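(* Let $\Omega=(0,1)$, $T>0$, $b\in\mathbb{R}$ and $\varepsilon\ge 0$. Let $u$ be an entropy solution of $\partial_t u+b\,\partial_x u=\varepsilon\,\partial_{xx}u$ on $(0,T)\times\Omega$ with respect to $\eta(u)=\tfrac12u^2$, $q(u)=\tfrac b2u^2$, such that: if $\varepsilon>0$, then $u\in L^2(0,T;H^1(\Omega))$, the initial data satisfies $u_0\in H^1(\Omega)$, and $u$ satisfies Dirichlet boundary data $g_D\in W^{1,\infty}((0,T)\times\partial\Omega)$; if $\varepsilon=0$, then $u\in L^\infty((0,T)\times\Omega)$, $u_0\in L^\infty(\Omega)$, and $u$ satisfies Lipschitz-continuous Dirichlet data $g_D$ on the inflow boundary ($x=0$ if $b>0$, $x=1$ if $b<0$). Let $\{u_h^i\}_{i=0}^N$, $u_h^i\in\mathbb{V}_q^s$, be a Runge-Kutta discontinuous Galerkin approximation with an (IMEX) Runge-Kutta temporal discretization of order at most $3$, with temporal reconstruction $\widehat u_h^t$ and space-time reconstruction $\widehat u^{ts}$, where $\widehat u^{ts}$ satisfies the same boundary data as $u$. Define the residuals $$r_1:=\partial_t\widehat u^{ts}+b\,\partial_x\widehat u^{ts}-\varepsilon\,\mathfrak{A}_h(\widehat u_h^t),\qquad r_2:=\mathfrak{A}_h(\widehat u_h^t)-\partial_{xx}\widehat u^{ts}.$$ Then for each $i=0,\dots,N$, $$\begin{aligned}\|u(t_i)-u_h^i\|_{L^2(\Omega)}^2&+2\varepsilon\,|||u-\widehat u_h^t|||_{L^2(0,t_i;\mathbb{V}_q)}^2\\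 \le\;& 8\Big(\|u(0)-\widehat u^{ts}(0)\|_{L^2(\Omega)}^2+4\|r_1\|_{L^1(0,t_i;L^2(\Omega))}^2+\varepsilon\|r_2\|_{L^2(0,t_i;H^{-1}(\Omega))}^2\Big)\\&+2\Big(\|\widehat u^{ts}(t_i)-u_h^i\|_{L^2(\Omega)}^2+2\varepsilon\,|||\widehat u^{ts}-\widehat u_h^t|||_{L^2(0,t_i;\mathbb{V}_q)}^2\Big).\end{aligned}$$
   Context: Entropy solution: $u\in L^\infty((0,T)\times\Omega)$ with $\varepsilon\partial_xu\in L^1$, such that $\int_0^T\!\int_\Omega \partial_t\phi\,u+\partial_x\phi\,(bu-\varepsilon\partial_xu)\,dx\,dt+\int_\Omega u_0\phi(0,\cdot)\,dx=0$ for all $\phi\in C_0^\infty([0,T)\times\Omega)$ and $\int_0^T\!\int_\Omega\partial_t\Phi\,\tfrac12u^2+\partial_x\Phi(\tfrac b2u^2-\varepsilon u\,\partial_xu)-\varepsilon\Phi(\partial_xu)^2\,dx\,dt+\int_\Omega\Phi(0,\cdot)\tfrac12u_0^2\,dx\ge0$ for all nonnegative $\Phi\in C_0^\infty([0,T)\times\Omega)$. Mesh and spaces: $0=x_0<\dots<x_M=1$, $I_j=(x_j,x_{j+1})$, $h_{k+1/2}=x_{k+1}-x_k$, $h_k=\tfrac12(h_{k+1/2}+h_{k-1/2})$, $h=\max_kh_{k+1/2}$; in the scheme the endpoints $x_0,x_M$ are identified, so the left limit at $x_0$ is the left limit at $x_M$. For $q\in\mathbb{N}$, $\mathbb{V}_q^s$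 is the space of functions on $[0,1]$ whose restriction to each $I_j$ is a polynomial of degree at most $q$. Write $[\![w]\!]_i=w(x_i^-)-w(x_i^+)$. Scheme, with flux $f(u)=bu$: $\mathfrak{f}_h:\mathbb{V}_q^s\to\mathbb{V}_q^s$ is defined by $\int\mathfrak{f}_h(\phi_h)\psi_h\,dx=-\int f(\phi_h)\partial_x\psi_h\,dx+\sum_{i=0}^{M-1}F(\phi_h(x_i^-),\phi_h(x_i^+))[\![\psi_h]\!]_i$ for all $\psi_h\in\mathbb{V}_q^s$ (derivatives elementwise). The numerical flux $F$ satisfies: there is a locally Lipschitz $w:\mathbb{R}\times\mathbb{R}\to\mathbb{R}$ such that for each compact $K$ there is $C_w(K)>0$ with $|w(a,b')-a|+|w(a,b')-b'|\le C_w(K)|b'-a|$ for $a,b'\in K$, and either $F(a,b')=f(w(a,b'))$ or $F(a,b')=f(w(a,b'))-\mu(a,b';h)h^\nu(b'-a)$ with $\nu\in\mathbb{N}_0$ and, for each compact $K$, $|\mu(a,b';h)|\le\mu_K(1+|a-b'|/h)$ on $K$ for $h$ small. $\mathfrak{A}_h:\mathbb{V}_q^s\to\mathbb{V}_q^s$ is a discrete approximation of $\partial_{xx}$; no structure is assumed beyond the Lipschitz constant of the semi-discrete ODE system being $O(h^{-1}+\varepsilon h^{-2})$. The semi-discrete scheme is $\partial_tu_h+\mathfrak{f}_h(u_h)=\varepsilon\mathfrak{A}_h(u_h)$, with $u_h(0)$ the $L^2$-projection of $u(0)$; a Runge-Kutta (explicit or implicit-explicit) method at times $0=t_0<\dots<t_N=T$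 yields $u_h^0,\dots,u_h^N\in\mathbb{V}_q^s$. Temporal reconstruction: $\widehat u_h^t$ is the function which on each $[t_n,t_{n+1}]$ is the polynomial of degree at most $3$ in time with values in $\mathbb{V}_q^s$ satisfying $\widehat u_h^t(t_j)=u_h^j$ and $\partial_t\widehat u_h^t(t_j)=-\mathfrak{f}_h(u_h^j)+\varepsilon\mathfrak{A}_h(u_h^j)$ for $j=n,n+1$ (one-sided derivatives from within the interval). Space-time reconstruction: for each $t$, $\widehat u^{ts}(t,\cdot)$ is the unique element of $\mathbb{V}_{q+1}^s$ with $\int_\Omega(\widehat u^{ts}-\widehat u_h^t)\psi_h\,dx=0$ for all $\psi_h\in\mathbb{V}_{q-1}^s$ and $\widehat u^{ts}(t,x_k^\pm)=w(\widehat u_h^t(t,x_k^-),\widehat u_h^t(t,x_k^+))$ for all $k$; it is Lipschitz continuous in space and time. Norms: $|||w|||_{L^2(0,t;\mathbb{V}_q)}^2:=\int_0^t\sum_{j=0}^{M-1}\big(\|\partial_xw(s)\|_{L^2(I_j)}^2+h_j^{-1}|[\![w(s)]\!]_j|^2\big)ds$. $\|g\|_{H^{-1}(\Omega)}=\sup_{0\ne\phi\in H_0^1(\Omega)}\langle g,\phi\rangle/\|\partial_x\phi\|_{L^2(\Omega)}$. *)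

theory Defs
  imports "HOL-Analysis.Analysis"
begin

text \<open>
  Space-time functions are curried, \<open>u t x\<close>, and \<open>\<Omega> = (0,1)\<close>. Elements of Lebesgue and Sobolev
  spaces are given by Borel representatives.
\<close>

abbreviation Omega :: "real set" where
  "Omega \<equiv> {0<..<1}"

abbreviation Cyl :: "real \<Rightarrow> (real \<times> real) set" where
  "Cyl T \<equiv> {0<..<T} \<times> Omega"


section \<open>Test functions\<close>

definition Dt :: "(real \<Rightarrow> real \<Rightarrow> real) \<Rightarrow> real \<Rightarrow> real \<Rightarrow> real" where
  "Dt f = (\<lambda>t x. deriv (\<lambda>s. f s x) t)"

definition Dx :: "(real \<Rightarrow> real \<Rightarrow> real) \<Rightarrow> real \<Rightarrow> real \<Rightarrow> real" where
  "Dx f = (\<lambda>t x. deriv (f t) x)"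

primrec C_times :: "nat \<Rightarrow> (real \<Rightarrow> real \<Rightarrow> real) \<Rightarrow> bool" where
  "C_times 0 f \<longleftrightarrow> continuous_on UNIV (\<lambda>(t, x). f t x)"
| "C_times (Suc k) f \<longleftrightarrow>
     (\<forall>t x. (\<lambda>s. f s x) differentiable (at t) \<and> f t differentiable (at x)) \<and>
     C_times k (Dt f) \<and> C_times k (Dx f)"

text \<open>
  \<open>test2 S\<close> is \<open>C_c^\<infinity>(S)\<close> for open \<open>S\<close>. The class \<open>C_0^\<infinity>([0,T) \<times> \<Omega>)\<close> consists of the restrictions
  to \<open>t \<ge> 0\<close> of the functions in \<open>C_c^\<infinity>((-\<infinity>,T) \<times> \<Omega>)\<close>.
\<close>

definition test2 :: "(real \<times> real) set \<Rightarrow> (real \<Rightarrow> real \<Rightarrow> real) \<Rightarrow> bool" where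
  "test2 S \<phi> \<longleftrightarrow> (\<forall>k. C_times k \<phi>) \<and>
     compact (closure {(t, x). \<phi> t x \<noteq> 0}) \<and> closure {(t, x). \<phi> t x \<noteq> 0} \<subseteq> S"

definition test1 :: "real set \<Rightarrow> (real \<Rightarrow> real) \<Rightarrow> bool" where
  "test1 S \<psi> \<longleftrightarrow> (\<forall>k x. (deriv ^^ k) \<psi> differentiable (at x)) \<and>
     compact (closure {x. \<psi> x \<noteq> 0}) \<and> closure {x. \<psi> x \<noteq> 0} \<subseteq> S"


section \<open>Weak derivatives, function spaces and norms\<close>

definition L1_loc :: "'a::euclidean_space set \<Rightarrow> ('a \<Rightarrow> real) \<Rightarrow> bool" where
  "L1_loc S f \<longleftrightarrow> (\<forall>K. compact K \<and> K \<subseteq> S \<longrightarrow> set_integrable lborel K f)"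

definition L2_on :: "'a::euclidean_space set \<Rightarrow> ('a \<Rightarrow> real) \<Rightarrow> bool" where
  "L2_on S f \<longleftrightarrow> set_borel_measurable lborel S f \<and> set_integrable lborel S (\<lambda>z. (f z)\<^sup>2)"

definition Linf_on :: "'a::euclidean_space set \<Rightarrow> ('a \<Rightarrow> real) \<Rightarrow> bool" where
  "Linf_on S f \<longleftrightarrow> set_borel_measurable lborel S f \<and>
     (\<exists>B. AE z in lborel. z \<in> S \<longrightarrow> \<bar>f z\<bar> \<le> B)"

definition has_weak_deriv :: "real \<Rightarrow> real \<Rightarrow> (real \<Rightarrow> real) \<Rightarrow> (real \<Rightarrow> real) \<Rightarrow> bool" where
  "has_weak_deriv a b f g \<longleftrightarrow> L1_loc {a<..<b} f \<and> L1_loc {a<..<b} g \<and>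
     (\<forall>\<psi>. test1 {a<..<b} \<psi> \<longrightarrow>
        (LINT x:{a<..<b}|lborel. f x * deriv \<psi> x) = - (LINT x:{a<..<b}|lborel. g x * \<psi> x))"

definition has_weak_dt ::
    "real \<Rightarrow> (real \<Rightarrow> real \<Rightarrow> real) \<Rightarrow> (real \<Rightarrow> real \<Rightarrow> real) \<Rightarrow> bool" where
  "has_weak_dt T v g \<longleftrightarrow> L1_loc (Cyl T) (\<lambda>(t, x). v t x) \<and> L1_loc (Cyl T) (\<lambda>(t, x). g t x) \<and>
     (\<forall>\<phi>. test2 (Cyl T) \<phi> \<longrightarrow>
        (LINT z:Cyl T|lborel. (case z of (t, x) \<Rightarrow> v t x * Dt \<phi> t x)) =
        - (LINT z:Cyl T|lborel. (case z of (t, x) \<Rightarrow> g t x * \<phi> t x)))"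

definition has_weak_dx ::
    "real \<Rightarrow> (real \<Rightarrow> real \<Rightarrow> real) \<Rightarrow> (real \<Rightarrow> real \<Rightarrow> real) \<Rightarrow> bool" where
  "has_weak_dx T v g \<longleftrightarrow> L1_loc (Cyl T) (\<lambda>(t, x). v t x) \<and> L1_loc (Cyl T) (\<lambda>(t, x). g t x) \<and>
     (\<forall>\<phi>. test2 (Cyl T) \<phi> \<longrightarrow>
        (LINT z:Cyl T|lborel. (case z of (t, x) \<Rightarrow> v t x * Dx \<phi> t x)) =
        - (LINT z:Cyl T|lborel. (case z of (t, x) \<Rightarrow> g t x * \<phi> t x)))"

text \<open>Representatives of the weak derivatives, which are unique almost everywhere.\<close>

definition wderiv :: "real \<Rightarrow> real \<Rightarrow> (real \<Rightarrow> real) \<Rightarrow> real \<Rightarrow> real" where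
  "wderiv a b f = (SOME g. has_weak_deriv a b f g)"

definition weak_dt :: "real \<Rightarrow> (real \<Rightarrow> real \<Rightarrow> real) \<Rightarrow> real \<Rightarrow> real \<Rightarrow> real" where
  "weak_dt T v = (SOME g. has_weak_dt T v g)"

definition H1 :: "(real \<Rightarrow> real) \<Rightarrow> bool" where
  "H1 f \<longleftrightarrow> L2_on Omega f \<and> (\<exists>g. has_weak_deriv 0 1 f g \<and> L2_on Omega g)"

text \<open>In one dimension every element of \<open>H\<^sup>1\<close> has a representative that is continuous on \<open>[0,1]\<close>;
  its end point values are the traces.\<close>

definition H10 :: "(real \<Rightarrow> real) \<Rightarrow> bool" where
  "H10 \<phi> \<longleftrightarrow> H1 \<phi> \<and> continuous_on {0..1} \<phi> \<and> \<phi> 0 = 0 \<and> \<phi> 1 = 0"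

definition W1inf :: "real \<Rightarrow> real \<Rightarrow> (real \<Rightarrow> real) \<Rightarrow> bool" where
  "W1inf a b f \<longleftrightarrow> Linf_on {a<..<b} f \<and> (\<exists>g. has_weak_deriv a b f g \<and> Linf_on {a<..<b} g)"

definition L2_H1 :: "real \<Rightarrow> (real \<Rightarrow> real \<Rightarrow> real) \<Rightarrow> bool" where
  "L2_H1 T u \<longleftrightarrow> L2_on (Cyl T) (\<lambda>(t, x). u t x) \<and>
     (\<exists>ux. L2_on (Cyl T) (\<lambda>(t, x). ux t x) \<and>
        (AE t in lborel. t \<in> {0<..<T} \<longrightarrow> has_weak_deriv 0 1 (u t) (ux t)))"

definition ennsqrt :: "ennreal \<Rightarrow> ennreal" where
  "ennsqrt a = (if a = \<infinity> then \<infinity> else ennreal (sqrt (enn2real a)))"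

definition L2_norm :: "(real \<Rightarrow> real) \<Rightarrow> ennreal" where
  "L2_norm f = ennsqrt (\<integral>\<^sup>+x\<in>Omega. ennreal ((f x)\<^sup>2) \<partial>lborel)"

definition Hm1_norm :: "((real \<Rightarrow> real) \<Rightarrow> real) \<Rightarrow> ennreal" where
  "Hm1_norm l = (SUP \<phi> \<in> {\<phi>. H10 \<phi> \<and> (\<exists>x\<in>Omega. \<phi> x \<noteq> 0)}.
     ennreal (l \<phi>) / L2_norm (wderiv 0 1 \<phi>))"

text \<open>
  Bochner norms are extended-valued: a function that is not measurable does not belong to the
  space and has norm \<open>\<infinity>\<close>. For \<open>H\<^sup>-\<^sup>1\<close>, which is separable, weak and strong measurability coincide.
\<close>

definition L1_L2_norm :: "real \<Rightarrow> (real \<Rightarrow> real \<Rightarrow> real) \<Rightarrow> ennreal" where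
  "L1_L2_norm t r =
     (if set_borel_measurable lebesgue (Cyl t) (\<lambda>(s, x). r s x)
      then \<integral>\<^sup>+s\<in>{0<..<t}. L2_norm (r s) \<partial>lborel else \<infinity>)"

definition L2_Hm1_norm :: "real \<Rightarrow> (real \<Rightarrow> (real \<Rightarrow> real) \<Rightarrow> real) \<Rightarrow> ennreal" where
  "L2_Hm1_norm t l =
     (if \<forall>\<phi>. H10 \<phi> \<longrightarrow> set_borel_measurable lebesgue {0<..<t} (\<lambda>s. l s \<phi>)
      then ennsqrt (\<integral>\<^sup>+s\<in>{0<..<t}. (Hm1_norm (l s))\<^sup>2 \<partial>lborel) else \<infinity>)"


section \<open>Entropy solutions, values in time, boundary data\<close>

text \<open>
  \<open>ux\<close> stands for \<open>\<partial>\<^sub>x u\<close>. All its occurrences carry a factor \<open>\<epsilon>\<close>, and it is unconstrained if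
  \<open>\<epsilon> = 0\<close>. The integrability of \<open>\<epsilon> \<Phi> ux\<^sup>2\<close> is demanded because otherwise the left-hand side of
  the entropy inequality is \<open>-\<infinity>\<close>, while the Bochner integral would default to \<open>0\<close>.
\<close>

definition entropy_solution ::
    "real \<Rightarrow> real \<Rightarrow> real \<Rightarrow> (real \<Rightarrow> real \<Rightarrow> real) \<Rightarrow> (real \<Rightarrow> real) \<Rightarrow> bool" where
  "entropy_solution T b \<epsilon> u u0 \<longleftrightarrow>
     Linf_on (Cyl T) (\<lambda>(t, x). u t x) \<and>
     (\<exists>ux. has_weak_dx T (\<lambda>t x. \<epsilon> * u t x) (\<lambda>t x. \<epsilon> * ux t x) \<and>
        set_integrable lborel (Cyl T) (\<lambda>(t, x). \<epsilon> * ux t x) \<and>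
        (\<forall>\<phi>. test2 ({..<T} \<times> Omega) \<phi> \<longrightarrow>
           (LINT z:Cyl T|lborel. (case z of (t, x) \<Rightarrow>
              Dt \<phi> t x * u t x + Dx \<phi> t x * (b * u t x - \<epsilon> * ux t x)))
           + (LINT x:Omega|lborel. u0 x * \<phi> 0 x) = 0) \<and>
        (\<forall>\<Phi>. test2 ({..<T} \<times> Omega) \<Phi> \<and> (\<forall>t x. 0 \<le> \<Phi> t x) \<longrightarrow>
           set_integrable lborel (Cyl T) (\<lambda>(t, x). \<epsilon> * \<Phi> t x * (ux t x)\<^sup>2) \<and>
           (LINT z:Cyl T|lborel. (case z of (t, x) \<Rightarrow>
              Dt \<Phi> t x * ((u t x)\<^sup>2 / 2)
              + Dx \<Phi> t x * (b / 2 * (u t x)\<^sup>2 - \<epsilon> * u t x * ux t x)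
              - \<epsilon> * \<Phi> t x * (ux t x)\<^sup>2))
           + (LINT x:Omega|lborel. \<Phi> 0 x * ((u0 x)\<^sup>2 / 2)) \<ge> 0))"

text \<open>
  An entropy solution is only an almost-everywhere class on \<open>(0,T) \<times> \<Omega>\<close>. By its weak formulation
  it has a unique representative that is weakly continuous from \<open>[0,T]\<close> to \<open>L\<^sup>2(\<Omega>)\<close>, and \<open>u(t)\<close>
  refers to this one.
\<close>

definition weakly_continuous_L2 :: "real \<Rightarrow> (real \<Rightarrow> real \<Rightarrow> real) \<Rightarrow> bool" where
  "weakly_continuous_L2 T u \<longleftrightarrow> (\<forall>t\<in>{0..T}. L2_on Omega (u t)) \<and>
     (\<forall>\<psi>. L2_on Omega \<psi> \<longrightarrow> continuous_on {0..T} (\<lambda>t. LINT x:Omega|lborel. u t x * \<psi> x))"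

text \<open>
  \<open>v\<close> has the trace \<open>g\<close> on \<open>(0,T) \<times> {c}\<close>, \<open>c \<in> {0,1}\<close>: the average of \<open>|v - g|\<close> over strips
  shrinking to that part of the boundary tends to \<open>0\<close>. For \<open>v \<in> L\<^sup>2(0,T;H\<^sup>1(\<Omega>))\<close> this is the Sobolev trace, and it is also
  meaningful for merely bounded solutions of the transport equation at the inflow boundary.
\<close>

definition has_trace ::
    "real \<Rightarrow> (real \<Rightarrow> real \<Rightarrow> real) \<Rightarrow> real \<Rightarrow> (real \<Rightarrow> real) \<Rightarrow> bool" where
  "has_trace T v c g \<longleftrightarrow>
     ((\<lambda>\<delta>. (\<integral>\<^sup>+z\<in>{0<..<T} \<times> ({c - \<delta><..<c + \<delta>} \<inter> Omega).
              (case z of (t, x) \<Rightarrow> ennreal \<bar>v t x - g t\<bar>) \<partial>lborel) / ennreal \<delta>)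
        \<longlongrightarrow> 0) (at_right 0)"

definition inflow_boundary :: "real \<Rightarrow> real set" where
  "inflow_boundary b = (if b > 0 then {0} else if b < 0 then {1} else {})"

definition dirichlet_boundary :: "real \<Rightarrow> real \<Rightarrow> real set" where
  "dirichlet_boundary b \<epsilon> = (if \<epsilon> > 0 then {0, 1} else inflow_boundary b)"


section \<open>Mesh and discontinuous Galerkin spaces\<close>

definition is_mesh :: "nat \<Rightarrow> (nat \<Rightarrow> real) \<Rightarrow> bool" where
  "is_mesh M x \<longleftrightarrow> x 0 = 0 \<and> x M = 1 \<and> (\<forall>k<M. x k < x (Suc k))"

definition mesh_size :: "nat \<Rightarrow> (nat \<Rightarrow> real) \<Rightarrow> real" where
  "mesh_size M x = Max ((\<lambda>k. x (Suc k) - x k) ` {..<M})"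

text \<open>\<open>h\<^sub>k\<close> for \<open>k < M\<close>; by the identification of \<open>x\<^sub>0\<close> and \<open>x\<^sub>M\<close>, the cell to the left of
  \<open>x\<^sub>0\<close> is the last one.\<close>

definition node_h :: "nat \<Rightarrow> (nat \<Rightarrow> real) \<Rightarrow> nat \<Rightarrow> real" where
  "node_h M x k =
     ((x (Suc k) - x k) + (if k = 0 then x M - x (M - 1) else x k - x (k - 1))) / 2"

text \<open>
  An element of \<open>\<V>\<^sub>q\<^sup>s\<close> is the family of its cell polynomials; \<open>dg_fun\<close> is the function on
  \<open>[0,1]\<close> it stands for. The value at the nodes is immaterial and set to \<open>0\<close>.
\<close>

type_synonym dg = "nat \<Rightarrow> real poly"

definition DG :: "nat \<Rightarrow> nat \<Rightarrow> dg set" where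
  "DG M q = {v. (\<forall>j<M. degree (v j) \<le> q) \<and> (\<forall>j\<ge>M. v j = 0)}"

definition dg_fun :: "nat \<Rightarrow> (nat \<Rightarrow> real) \<Rightarrow> dg \<Rightarrow> real \<Rightarrow> real" where
  "dg_fun M x v y = (\<Sum>j<M. indicator {x j<..<x (Suc j)} y * poly (v j) y)"

definition dg_deriv :: "dg \<Rightarrow> dg" where
  "dg_deriv v = (\<lambda>j. pderiv (v j))"

definition left_val :: "nat \<Rightarrow> (nat \<Rightarrow> real) \<Rightarrow> dg \<Rightarrow> nat \<Rightarrow> real" where
  "left_val M x v k = (if k = 0 then poly (v (M - 1)) (x M) else poly (v (k - 1)) (x k))"

definition right_val :: "(nat \<Rightarrow> real) \<Rightarrow> dg \<Rightarrow> nat \<Rightarrow> real" where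
  "right_val x v k = poly (v k) (x k)"

text \<open>
  One-sided limits of functions defined almost everywhere, as limits of averages. They agree with
  \<open>left_val\<close> and \<open>right_val\<close> on DG functions and with point values on continuous functions.
\<close>

definition left_trace :: "(real \<Rightarrow> real) \<Rightarrow> real \<Rightarrow> real" where
  "left_trace f a = Lim (at_right 0) (\<lambda>\<delta>. (LINT y:{a - \<delta><..<a}|lborel. f y) / \<delta>)"

definition right_trace :: "(real \<Rightarrow> real) \<Rightarrow> real \<Rightarrow> real" where
  "right_trace f a = Lim (at_right 0) (\<lambda>\<delta>. (LINT y:{a<..<a + \<delta>}|lborel. f y) / \<delta>)"

definition jump :: "nat \<Rightarrow> (nat \<Rightarrow> real) \<Rightarrow> (real \<Rightarrow> real) \<Rightarrow> nat \<Rightarrow> real" where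
  "jump M x f k = left_trace f (if k = 0 then x M else x k) - right_trace f (x k)"

text \<open>Square of the norm \<open>|||w|||\<close> in \<open>L\<^sup>2(0,t;\<V>\<^sub>q)\<close>.\<close>

definition dg_energy_sq ::
    "nat \<Rightarrow> (nat \<Rightarrow> real) \<Rightarrow> real \<Rightarrow> (real \<Rightarrow> real \<Rightarrow> real) \<Rightarrow> ennreal" where
  "dg_energy_sq M x t w =
     (\<integral>\<^sup>+s\<in>{0<..<t}.
        (\<Sum>j<M. (\<integral>\<^sup>+y\<in>{x j<..<x (Suc j)}. ennreal ((wderiv (x j) (x (Suc j)) (w s) y)\<^sup>2) \<partial>lborel)
               + ennreal ((jump M x (w s) j)\<^sup>2 / node_h M x j)) \<partial>lborel)"


section \<open>The semi-discrete scheme\<close>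

definition flux_base :: "(real \<Rightarrow> real \<Rightarrow> real) \<Rightarrow> bool" where
  "flux_base w \<longleftrightarrow>
     (\<forall>p. \<exists>\<delta>>0. \<exists>L. L-lipschitz_on (ball p \<delta>) (\<lambda>(a, c). w a c)) \<and>
     (\<forall>K. compact K \<longrightarrow>
        (\<exists>C>0. \<forall>a\<in>K. \<forall>c\<in>K. \<bar>w a c - a\<bar> + \<bar>w a c - c\<bar> \<le> C * \<bar>c - a\<bar>))"

definition numerical_flux ::
    "real \<Rightarrow> real \<Rightarrow> (real \<Rightarrow> real \<Rightarrow> real) \<Rightarrow> (real \<Rightarrow> real \<Rightarrow> real) \<Rightarrow> bool" where
  "numerical_flux b h w F \<longleftrightarrow> flux_base w \<and>
     ((\<forall>a c. F a c = b * w a c) \<or>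
      (\<exists>(\<mu> :: real \<Rightarrow> real \<Rightarrow> real \<Rightarrow> real) (\<nu> :: nat).
         (\<forall>K. compact K \<longrightarrow>
            (\<exists>\<mu>K. \<exists>h0>0. \<forall>h'. 0 < h' \<and> h' < h0 \<longrightarrow>
               (\<forall>a\<in>K. \<forall>c\<in>K. \<bar>\<mu> a c h'\<bar> \<le> \<mu>K * (1 + \<bar>a - c\<bar> / h')))) \<and>
         (\<forall>a c. F a c = b * w a c - \<mu> a c h * h ^ \<nu> * (c - a))))"

definition dg_flux ::
    "nat \<Rightarrow> (nat \<Rightarrow> real) \<Rightarrow> nat \<Rightarrow> real \<Rightarrow> (real \<Rightarrow> real \<Rightarrow> real) \<Rightarrow> dg \<Rightarrow> dg" where
  "dg_flux M x q b F \<phi> = (THE g. g \<in> DG M q \<and>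
     (\<forall>\<psi>\<in>DG M q.
        (LINT y:Omega|lborel. dg_fun M x g y * dg_fun M x \<psi> y) =
        - (LINT y:Omega|lborel. b * dg_fun M x \<phi> y * dg_fun M x (dg_deriv \<psi>) y)
        + (\<Sum>i<M. F (left_val M x \<phi> i) (right_val x \<phi> i) * (left_val M x \<psi> i - right_val x \<psi> i))))"

definition semi_rhs ::
    "nat \<Rightarrow> (nat \<Rightarrow> real) \<Rightarrow> nat \<Rightarrow> real \<Rightarrow> real \<Rightarrow> (real \<Rightarrow> real \<Rightarrow> real) \<Rightarrow> (dg \<Rightarrow> dg) \<Rightarrow> dg \<Rightarrow> dg" where
  "semi_rhs M x q b \<epsilon> F A v = (\<lambda>j. - dg_flux M x q b F v j + smult \<epsilon> (A v j))"

text \<open>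
  \<open>w\<close> is only locally Lipschitz, hence so is the right-hand side: \<open>C\<close> may depend on a bound for the
  discrete functions.
\<close>

definition discrete_laplacian ::
    "nat \<Rightarrow> (nat \<Rightarrow> real) \<Rightarrow> nat \<Rightarrow> real \<Rightarrow> real \<Rightarrow> (real \<Rightarrow> real \<Rightarrow> real) \<Rightarrow> (dg \<Rightarrow> dg) \<Rightarrow> bool" where
  "discrete_laplacian M x q b \<epsilon> F A \<longleftrightarrow>
     (\<forall>v\<in>DG M q. A v \<in> DG M q) \<and>
     (\<forall>R::real. \<exists>C\<ge>0. \<forall>v\<in>DG M q. \<forall>w\<in>DG M q.
        L2_norm (dg_fun M x v) \<le> ennreal R \<and> L2_norm (dg_fun M x w) \<le> ennreal R \<longrightarrow>
        L2_norm (\<lambda>y. dg_fun M x (semi_rhs M x q b \<epsilon> F A v) y - dg_fun M x (semi_rhs M x q b \<epsilon> F A w) y)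
        \<le> ennreal (C * (1 / mesh_size M x + \<epsilon> / (mesh_size M x)\<^sup>2))
          * L2_norm (\<lambda>y. dg_fun M x v y - dg_fun M x w y))"

definition is_L2_projection :: "nat \<Rightarrow> (nat \<Rightarrow> real) \<Rightarrow> nat \<Rightarrow> (real \<Rightarrow> real) \<Rightarrow> dg \<Rightarrow> bool" where
  "is_L2_projection M x q f v \<longleftrightarrow> v \<in> DG M q \<and>
     (\<forall>\<psi>\<in>DG M q. (LINT y:Omega|lborel. (f y - dg_fun M x v y) * dg_fun M x \<psi> y) = 0)"


section \<open>Runge-Kutta methods\<close>

text \<open>
  An additive Runge-Kutta method with \<open>s\<close> stages is given by two tableaux, selected by a Boolean:
  \<open>True\<close> for the explicit part and \<open>False\<close> for the implicit part. An explicit method is the case of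
  two equal tableaux. The order is the classical one, given by the order conditions over
  two-coloured rooted trees: elementary weight times density is 1.
\<close>

datatype rk_tree = Node bool "rk_tree list"

primrec tree_size :: "rk_tree \<Rightarrow> nat" where
  "tree_size (Node c ts) = Suc (sum_list (map tree_size ts))"

primrec tree_density :: "rk_tree \<Rightarrow> real" where
  "tree_density (Node c ts) =
     real (Suc (sum_list (map tree_size ts))) * prod_list (map tree_density ts)"

primrec stage_weight :: "nat \<Rightarrow> (bool \<Rightarrow> nat \<Rightarrow> nat \<Rightarrow> real) \<Rightarrow> rk_tree \<Rightarrow> nat \<Rightarrow> real" where
  "stage_weight s a (Node c ts) =
     (\<lambda>i. \<Sum>j<s. a c i j * prod_list (map (\<lambda>g. g j) (map (stage_weight s a) ts)))"

primrec tree_weight ::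
    "nat \<Rightarrow> (bool \<Rightarrow> nat \<Rightarrow> nat \<Rightarrow> real) \<Rightarrow> (bool \<Rightarrow> nat \<Rightarrow> real) \<Rightarrow> rk_tree \<Rightarrow> real" where
  "tree_weight s a \<beta> (Node c ts) =
     (\<Sum>j<s. \<beta> c j * prod_list (map (\<lambda>t. stage_weight s a t j) ts))"

definition rk_order_ge ::
    "nat \<Rightarrow> (bool \<Rightarrow> nat \<Rightarrow> nat \<Rightarrow> real) \<Rightarrow> (bool \<Rightarrow> nat \<Rightarrow> real) \<Rightarrow> nat \<Rightarrow> bool" where
  "rk_order_ge s a \<beta> p \<longleftrightarrow>
     (\<forall>t. tree_size t \<le> p \<longrightarrow> tree_weight s a \<beta> t * tree_density t = 1)"

definition rk_order ::
    "nat \<Rightarrow> (bool \<Rightarrow> nat \<Rightarrow> nat \<Rightarrow> real) \<Rightarrow> (bool \<Rightarrow> nat \<Rightarrow> real) \<Rightarrow> nat \<Rightarrow> bool" where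
  "rk_order s a \<beta> p \<longleftrightarrow> rk_order_ge s a \<beta> p \<and> \<not> rk_order_ge s a \<beta> (Suc p)"

definition imex_tableau :: "nat \<Rightarrow> (bool \<Rightarrow> nat \<Rightarrow> nat \<Rightarrow> real) \<Rightarrow> bool" where
  "imex_tableau s a \<longleftrightarrow> (\<forall>i<s. \<forall>j<s. i \<le> j \<longrightarrow> a True i j = 0)"

text \<open>One step of size \<open>\<tau>\<close> from \<open>v\<close> to \<open>v'\<close> for \<open>u' = G True u + G False u\<close>, with stages \<open>U i\<close>.\<close>

definition rk_step ::
    "nat \<Rightarrow> nat \<Rightarrow> nat \<Rightarrow> (bool \<Rightarrow> nat \<Rightarrow> nat \<Rightarrow> real) \<Rightarrow> (bool \<Rightarrow> nat \<Rightarrow> real) \<Rightarrow> (bool \<Rightarrow> dg \<Rightarrow> dg)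
      \<Rightarrow> real \<Rightarrow> dg \<Rightarrow> dg \<Rightarrow> bool" where
  "rk_step M q s a \<beta> G \<tau> v v' \<longleftrightarrow>
     (\<exists>U :: nat \<Rightarrow> dg.
        (\<forall>i<s. U i \<in> DG M q \<and>
           (\<forall>k. U i k = v k + (\<Sum>j<s. \<Sum>c\<in>UNIV. smult (\<tau> * a c i j) (G c (U j) k)))) \<and>
        (\<forall>k. v' k = v k + (\<Sum>j<s. \<Sum>c\<in>UNIV. smult (\<tau> * \<beta> c j) (G c (U j) k))))"

definition rkdg_approximation ::
    "nat \<Rightarrow> (nat \<Rightarrow> real) \<Rightarrow> nat \<Rightarrow> real \<Rightarrow> real \<Rightarrow> (real \<Rightarrow> real \<Rightarrow> real) \<Rightarrow> (dg \<Rightarrow> dg)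
      \<Rightarrow> nat \<Rightarrow> (bool \<Rightarrow> nat \<Rightarrow> nat \<Rightarrow> real) \<Rightarrow> (bool \<Rightarrow> nat \<Rightarrow> real)
      \<Rightarrow> nat \<Rightarrow> (nat \<Rightarrow> real) \<Rightarrow> (real \<Rightarrow> real) \<Rightarrow> (nat \<Rightarrow> dg) \<Rightarrow> bool" where
  "rkdg_approximation M x q b \<epsilon> F A s a \<beta> N tt uinit uh \<longleftrightarrow>
     imex_tableau s a \<and>
     is_L2_projection M x q uinit (uh 0) \<and>
     (\<forall>n\<le>N. uh n \<in> DG M q) \<and>
     (\<forall>n<N. rk_step M q s a \<beta>
        (\<lambda>c v. if c then (\<lambda>k. - dg_flux M x q b F v k) else (\<lambda>k. smult \<epsilon> (A v k)))
        (tt (Suc n) - tt n) (uh n) (uh (Suc n)))"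


section \<open>Reconstructions and residuals\<close>

definition temporal_reconstruction ::
    "nat \<Rightarrow> (nat \<Rightarrow> real) \<Rightarrow> nat \<Rightarrow> (dg \<Rightarrow> dg) \<Rightarrow> nat \<Rightarrow> (nat \<Rightarrow> real) \<Rightarrow> (nat \<Rightarrow> dg) \<Rightarrow> (real \<Rightarrow> dg) \<Rightarrow> bool"
  where
  "temporal_reconstruction M x q rhs N tt uh ut \<longleftrightarrow>
     (\<forall>n<N.
        (\<exists>c :: nat \<Rightarrow> dg. (\<forall>m\<le>3. c m \<in> DG M q) \<and>
           (\<forall>t\<in>{tt n..tt (Suc n)}. \<forall>j. ut t j = (\<Sum>m\<le>3. smult (t ^ m) (c m j)))) \<and>
        (\<forall>k\<in>{n, Suc n}. ut (tt k) = uh k \<and>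
           (\<forall>y. ((\<lambda>t. dg_fun M x (ut t) y) has_real_derivative dg_fun M x (rhs (uh k)) y)
                  (at (tt k) within {tt n..tt (Suc n)}))))"

definition space_time_reconstruction ::
    "nat \<Rightarrow> (nat \<Rightarrow> real) \<Rightarrow> nat \<Rightarrow> (real \<Rightarrow> real \<Rightarrow> real) \<Rightarrow> real \<Rightarrow> (real \<Rightarrow> dg) \<Rightarrow> (real \<Rightarrow> dg) \<Rightarrow> bool"
  where
  "space_time_reconstruction M x q w T ut uts \<longleftrightarrow>
     (\<forall>t\<in>{0..T}. uts t \<in> DG M (q + 1) \<and>
        (\<forall>\<psi>\<in>DG M (q - 1).
           (LINT y:Omega|lborel. (dg_fun M x (uts t) y - dg_fun M x (ut t) y) * dg_fun M x \<psi> y) = 0) \<and>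
        (\<forall>k<M. left_val M x (uts t) k = w (left_val M x (ut t) k) (right_val x (ut t) k) \<and>
               right_val x (uts t) k = w (left_val M x (ut t) k) (right_val x (ut t) k)))"

text \<open>The space-time reconstruction is Lipschitz in time, so its time derivative exists as a bounded
  function, in the weak sense and almost everywhere.\<close>

definition residual1 ::
    "nat \<Rightarrow> (nat \<Rightarrow> real) \<Rightarrow> real \<Rightarrow> real \<Rightarrow> (dg \<Rightarrow> dg) \<Rightarrow> real \<Rightarrow> (real \<Rightarrow> dg) \<Rightarrow> (real \<Rightarrow> dg)
      \<Rightarrow> real \<Rightarrow> real \<Rightarrow> real" where
  "residual1 M x b \<epsilon> A T ut uts t y =
     weak_dt T (\<lambda>s. dg_fun M x (uts s)) t y
     + b * dg_fun M x (dg_deriv (uts t)) y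
     - \<epsilon> * dg_fun M x (A (ut t)) y"

text \<open>
  The second residual at time \<open>t\<close> is a functional on \<open>H\<^sub>0\<^sup>1(\<Omega>)\<close>. Since \<open>uts t\<close> is continuous in
  space, its distributional derivative is the elementwise one, and the second derivative pairs
  with \<open>\<phi>\<close> as \<open>-\<integral> \<partial>\<^sub>x(uts t) \<partial>\<^sub>x\<phi>\<close>.
\<close>

definition residual2 ::
    "nat \<Rightarrow> (nat \<Rightarrow> real) \<Rightarrow> (dg \<Rightarrow> dg) \<Rightarrow> (real \<Rightarrow> dg) \<Rightarrow> (real \<Rightarrow> dg)
      \<Rightarrow> real \<Rightarrow> (real \<Rightarrow> real) \<Rightarrow> real" where
  "residual2 M x A ut uts t \<phi> =
     (LINT y:Omega|lborel. dg_fun M x (A (ut t)) y * \<phi> y)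
     - (- (LINT y:Omega|lborel. dg_fun M x (dg_deriv (uts t)) y * wderiv 0 1 \<phi> y))"

end

theory Submission
  imports Defs
begin

text \<open>
  The estimate is an instance of the relative entropy method. Let \<open>U\<close> denote the space-time reconstruction and
  \<open>e = u - U\<close>. Since \<open>U\<close> is Lipschitz continuous in space and time, it can be compared with the entropy solution:
  the entropy inequality for \<open>u\<close>, the weak form for \<open>u\<close> tested with \<open>\<Phi> U\<close>, and the chain rule for \<open>U\<^sup>2\<close> add up to
  an inequality for \<open>e\<^sup>2/2\<close> (\<open>rel_entropy_decompose\<close>, \<open>rel_entropy_approximable\<close>). With cutoffs in space and time
  removed it reads
  \<open>\<integral> e(\<tau>)\<^sup>2/2 + \<epsilon> \<integral>\<integral> (\<partial>\<^sub>x e)\<^sup>2 \<le> \<integral> e(0)\<^sup>2/2 - \<integral>\<integral> [e (\<partial>\<^sub>t U + b \<partial>\<^sub>x U) + \<epsilon> \<partial>\<^sub>x e \<partial>\<^sub>x U]\<close>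
  (\<open>energy_inequality\<close>). The last integral is \<open>\<integral>\<integral> e r\<^sub>1\<close> minus \<open>\<epsilon>\<close> times \<open>r\<^sub>2\<close> applied to \<open>-e\<close>. The first part is bounded by the
  supremum of \<open>\<parallel>e(t)\<parallel>\<close> times the \<open>L\<^sup>1(L\<^sup>2)\<close>-norm of \<open>r\<^sub>1\<close>, the second by half of the dissipation and the dual norm of
  \<open>r\<^sub>2\<close> (\<open>dual_norm_bound\<close>, \<open>energy_estimate\<close>).

  Three points need care. Boundary terms: for \<open>\<epsilon> > 0\<close> the error vanishes at the boundary and is small in mean square on
  thin strips (\<open>boundary_diffusion\<close>); for \<open>\<epsilon> = 0\<close> it vanishes at the inflow boundary, and at the outflow boundary the flux has
  the right sign (\<open>boundary_transport\<close>). Values at fixed times: weak continuity makes the energy lower semicontinuous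
  (\<open>weakly_continuous_lsc\<close>) and identifies \<open>u(0)\<close> with the initial datum (\<open>initial_value\<close>). Regularity of \<open>U\<close>: its
  coefficients depend on time through the locally Lipschitz function \<open>w\<close> (\<open>space_time_coefficients_Lip\<close>), so
  \<open>\<partial>\<^sub>t U\<close> exists as a bounded function, and \<open>U\<close> is a bounded limit of smooth functions together with its first
  derivatives (\<open>dg_fun_approximable\<close>).

  The elementwise norm of \<open>u - u_h\<close> splits in the same way, because \<open>e\<close> has a continuous representative that vanishes at
  both end points and hence no jumps (\<open>energy_of_difference\<close>).
\<close>

section \<open>Smooth functions of one variable\<close>

text \<open>The regularity is counted down along the derivatives, so closure properties of smooth functions are
  proved by induction on \<open>k\<close> with the function generalized.\<close>

primrec Ck :: "nat \<Rightarrow> (real \<Rightarrow> real) \<Rightarrow> bool" where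
  "Ck 0 f \<longleftrightarrow> True"
| "Ck (Suc k) f \<longleftrightarrow> (\<forall>x. f differentiable (at x)) \<and> Ck k (deriv f)"

definition smooth :: "(real \<Rightarrow> real) \<Rightarrow> bool" where
  "smooth f \<longleftrightarrow> (\<forall>k. Ck k f)"

lemma smooth_unfold: "smooth f \<longleftrightarrow> (\<forall>x. f differentiable (at x)) \<and> smooth (deriv f)"
proof -
  have "(\<forall>k. Ck k f) \<longleftrightarrow> (\<forall>k. Ck (Suc k) f)"
    by (metis Ck.simps(1) not0_implies_Suc)
  then show ?thesis by (auto simp: smooth_def)
qed

lemma smooth_deriv: "smooth f \<Longrightarrow> smooth (deriv f)"
  using smooth_unfold by blast

lemma smooth_DERIV: "smooth f \<Longrightarrow> (f has_real_derivative deriv f x) (at x)"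
  using smooth_unfold DERIV_deriv_iff_real_differentiable by blast

lemma smooth_continuous: "smooth f \<Longrightarrow> continuous_on A f"
  by (meson DERIV_isCont continuous_at_imp_continuous_on smooth_DERIV)

lemma smoothI: "\<lbrakk>\<And>x. (f has_real_derivative g x) (at x); smooth g\<rbrakk> \<Longrightarrow> smooth f"
  by (subst smooth_unfold)
     (metis DERIV_imp_deriv ext real_differentiable_def)

lemma smooth_iff_funpow: "smooth f \<longleftrightarrow> (\<forall>k x. (deriv ^^ k) f differentiable (at x))"
proof -
  have "Ck (Suc k) f \<longleftrightarrow> (\<forall>j\<le>k. \<forall>x. (deriv ^^ j) f differentiable (at x))" for k
  proof (induction k arbitrary: f)
    case (Suc k)
    have "(\<forall>j\<le>Suc k. \<forall>x. (deriv ^^ j) f differentiable (at x)) \<longleftrightarrow>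
        (\<forall>x. f differentiable (at x)) \<and> (\<forall>j\<le>k. \<forall>x. (deriv ^^ j) (deriv f) differentiable (at x))"
      (is "?L \<longleftrightarrow> ?R")
    proof
      assume L: ?L
      have "(deriv ^^ j) (deriv f) differentiable (at x)" if "j \<le> k" for j x
        using L[rule_format, of "Suc j" x] that by (simp add: funpow_Suc_right del: funpow.simps(2))
      then show ?R using L[rule_format, of 0] by auto
    next
      assume R: ?R
      have "(deriv ^^ j) f differentiable (at x)" if "j \<le> Suc k" for j x
        using R that by (cases j) (auto simp: funpow_Suc_right simp del: funpow.simps(2))
      then show ?L by blast
    qed
    then show ?case using Suc.IH[of "deriv f"] by simp
  qed auto
  then show ?thesis unfolding smooth_def
    by (metis Ck.simps(1) nat.exhaust order_refl)
qed

lemma Ck_add: "\<lbrakk>Ck k f; Ck k g\<rbrakk> \<Longrightarrow> Ck k (\<lambda>x. f x + g x)"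
proof (induction k arbitrary: f g)
  case (Suc k)
  have "deriv (\<lambda>x. f x + g x) = (\<lambda>x. deriv f x + deriv g x)"
    using Suc.prems
    by (auto intro!: ext DERIV_imp_deriv DERIV_add simp: DERIV_deriv_iff_real_differentiable)
  with Suc show ?case by (auto intro: differentiable_add)
qed auto

lemma smooth_add: "\<lbrakk>smooth f; smooth g\<rbrakk> \<Longrightarrow> smooth (\<lambda>x. f x + g x)"
  by (simp add: smooth_def Ck_add)

lemma smooth_const: "smooth (\<lambda>x. c)"
proof -
  have "Ck k (\<lambda>x. c)" for k c by (induction k arbitrary: c) auto
  then show ?thesis by (simp add: smooth_def)
qed

lemma smooth_ident: "smooth (\<lambda>x. x)"
  by (rule smoothI[where g = "\<lambda>_. 1"]) (auto intro: smooth_const)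

lemma smooth_mult:
  assumes "smooth f" "smooth g" shows "smooth (\<lambda>x. f x * g x)"
proof -
  have "Ck k (\<lambda>x. f x * g x)" if "smooth f" "smooth g" for k f g
    using that
  proof (induction k arbitrary: f g)
    case (Suc k)
    have d: "((\<lambda>x. f x * g x) has_real_derivative deriv f x * g x + f x * deriv g x) (at x)" for x
      by (rule derivative_eq_intros smooth_DERIV Suc.prems refl)+ (simp add: algebra_simps)
    then have "deriv (\<lambda>x. f x * g x) = (\<lambda>x. deriv f x * g x + f x * deriv g x)"
      by (auto intro: DERIV_imp_deriv)
    moreover have "(\<lambda>x. f x * g x) differentiable (at x)" for x
      using d real_differentiable_def by blast
    ultimately show ?case using Suc
      by (auto intro!: Ck_add simp: smooth_deriv)
  qed auto
  then show ?thesis using assms by (simp add: smooth_def)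
qed

lemma smooth_sum: "(\<And>i. i \<in> I \<Longrightarrow> smooth (f i)) \<Longrightarrow> smooth (\<lambda>x. \<Sum>i\<in>I. f i x)"
  by (induction I rule: infinite_finite_induct) (auto intro: smooth_const smooth_add)

lemma smooth_power: "smooth f \<Longrightarrow> smooth (\<lambda>x. f x ^ n)"
  by (induction n) (auto intro: smooth_const smooth_mult)

lemma smooth_affine:
  assumes "smooth f" shows "smooth (\<lambda>x. f (c * x + d))"
proof -
  have "Ck k (\<lambda>x. f (c * x + d))" if "smooth f" for k f
    using that
  proof (induction k arbitrary: f)
    case (Suc k)
    have d: "((\<lambda>x. f (c * x + d)) has_real_derivative c * deriv f (c * x + d)) (at x)" for x
    proof -
      have "((\<lambda>x. c * x + d) has_real_derivative c) (at x)" by (auto intro!: derivative_eq_intros)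
      from DERIV_chain2[OF smooth_DERIV[OF Suc.prems] this] show ?thesis by (simp add: mult.commute)
    qed
    then have e: "deriv (\<lambda>x. f (c * x + d)) = (\<lambda>x. c * deriv f (c * x + d))"
      by (auto intro: DERIV_imp_deriv)
    have "Ck k (\<lambda>x. c * g (c * x + d))" if "smooth g" for g
      using Suc.IH[of "\<lambda>x. c * g x"] that by (simp add: smooth_mult smooth_const)
    then show ?case using d e Suc.prems smooth_deriv real_differentiable_def by auto
  qed auto
  then show ?thesis using assms by (simp add: smooth_def)
qed

text \<open>The derivatives of \<open>exp (-1/x)\<close> have the form \<open>p (1/x) exp (-1/x)\<close>; all these functions
  decay faster than \<open>x\<close> at \<open>0\<close>, so that their extensions by \<open>0\<close> stay differentiable.\<close>

definition flat_exp :: "real poly \<Rightarrow> real \<Rightarrow> real" where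
  "flat_exp p x = (if x > 0 then poly p (1 / x) * exp (- (1 / x)) else 0)"

lemma poly_exp_decay: "((\<lambda>y::real. poly p y * exp (- y)) \<longlongrightarrow> 0) at_top"
proof -
  have "((\<lambda>y. \<Sum>i\<le>degree p. coeff p i * (y ^ i / exp y)) \<longlongrightarrow> (\<Sum>i\<le>degree p. coeff p i * 0)) at_top"
    by (intro tendsto_intros tendsto_power_div_exp_0)
  moreover have "(\<lambda>y. \<Sum>i\<le>degree p. coeff p i * (y ^ i / exp y)) = (\<lambda>y. poly p y * exp (- y))"
    by (auto simp: poly_altdef exp_minus sum_distrib_right divide_inverse mult.assoc)
  ultimately show ?thesis by simp
qed

lemma flat_exp_DERIV:
  "(flat_exp p has_real_derivative flat_exp ([:0, 0, 1:] * (p - pderiv p)) x) (at x)"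
proof -
  let ?q = "[:0, 0, 1:] * (p - pderiv p)"
  consider "x > 0" | "x < 0" | "x = 0" by linarith
  then show ?thesis
  proof cases
    case 1
    have "((\<lambda>x. poly p (1 / x) * exp (- (1 / x))) has_real_derivative
        poly ?q (1 / x) * exp (- (1 / x))) (at x)"
    proof -
      have i: "((\<lambda>x::real. 1 / x) has_real_derivative - (1 / x\<^sup>2)) (at x)"
        using 1 by (auto intro!: derivative_eq_intros simp: power2_eq_square field_simps)
      have p: "((\<lambda>x. poly p (1 / x)) has_real_derivative poly (pderiv p) (1 / x) * (- (1 / x\<^sup>2))) (at x)"
        by (rule DERIV_chain2[OF poly_DERIV i])
      have e: "((\<lambda>x. exp (- (1 / x))) has_real_derivative exp (- (1 / x)) * (1 / x\<^sup>2)) (at x)"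
        using DERIV_chain2[OF DERIV_exp DERIV_minus[OF i]] by simp
      show ?thesis
        by (rule DERIV_cong[OF DERIV_mult[OF p e]]) (simp add: field_simps power2_eq_square diff_divide_distrib)
    qed
    then have "(flat_exp p has_real_derivative poly ?q (1 / x) * exp (- (1 / x))) (at x)"
      by (rule has_field_derivative_transform_within_open[where S = "{0<..}"])
         (use 1 in \<open>auto simp: flat_exp_def\<close>)
    then show ?thesis using 1 by (simp add: flat_exp_def)
  next
    case 2
    have "((\<lambda>x. 0) has_real_derivative 0) (at x)" by simp
    then have "(flat_exp p has_real_derivative 0) (at x)"
      by (rule has_field_derivative_transform_within_open[where S = "{..<0}"])
         (use 2 in \<open>auto simp: flat_exp_def\<close>)
    then show ?thesis using 2 by (simp add: flat_exp_def)
  next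
    case 3
    have "((\<lambda>y. poly ([:0,1:] * p) y * exp (- y)) \<longlongrightarrow> 0) at_top" by (rule poly_exp_decay)
    then have "((\<lambda>h. poly ([:0,1:] * p) (inverse h) * exp (- inverse h)) \<longlongrightarrow> 0) (at_right (0::real))"
      by (rule filterlim_compose) (rule filterlim_inverse_at_top_right)
    then have R: "((\<lambda>h. (flat_exp p (0 + h) - flat_exp p 0) / h) \<longlongrightarrow> 0) (at_right 0)"
      by (rule Lim_transform_eventually)
         (auto simp: flat_exp_def eventually_at_filter field_simps)
    have L: "((\<lambda>h. (flat_exp p (0 + h) - flat_exp p 0) / h) \<longlongrightarrow> 0) (at_left 0)"
      by (rule Lim_transform_eventually[OF tendsto_const])
         (auto simp: flat_exp_def eventually_at_filter)
    have "(flat_exp p has_real_derivative 0) (at 0)"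
      unfolding DERIV_def by (rule filterlim_split_at_real[OF L R])
    then show ?thesis using 3 by (simp add: flat_exp_def)
  qed
qed

lemma smooth_flat_exp: "smooth (flat_exp p)"
proof -
  have "Ck k (flat_exp p)" for k p
  proof (induction k arbitrary: p)
    case (Suc k)
    have "deriv (flat_exp p) = flat_exp ([:0, 0, 1:] * (p - pderiv p))"
      using flat_exp_DERIV DERIV_imp_deriv by blast
    then show ?case using Suc flat_exp_DERIV real_differentiable_def by auto
  qed auto
  then show ?thesis by (simp add: smooth_def)
qed

text \<open>A smooth bump supported in \<open>[1,2]\<close> is integrated and normalized. The step is monotone, which later
  gives derivatives of cutoff functions a sign on each flank.\<close>

lemma smooth_step_exists:
  "\<exists>S. smooth S \<and> (\<forall>x\<le>1. S x = 0) \<and> (\<forall>x\<ge>2. S x = 1) \<and> (\<forall>x. 0 \<le> S x \<and> S x \<le> 1) \<and>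
     (\<forall>x. 0 \<le> deriv S x) \<and> (\<exists>C. \<forall>x. deriv S x \<le> C) \<and> (\<forall>x. x < 1 \<or> 2 < x \<longrightarrow> deriv S x = 0)"
proof -
  define f where "f = (\<lambda>x. flat_exp 1 (1 * x + (-1)) * flat_exp 1 ((-1) * x + 2))"
  have sf: "smooth f" unfolding f_def
    by (rule smooth_mult[OF smooth_affine[OF smooth_flat_exp] smooth_affine[OF smooth_flat_exp]])
  note cf = smooth_continuous[OF sf]
  have f0: "f x = 0" if "x \<le> 1 \<or> 2 \<le> x" for x using that by (auto simp: f_def flat_exp_def)
  have fp: "f x > 0" if "1 < x" "x < 2" for x using that by (auto simp: f_def flat_exp_def)
  have fn: "f x \<ge> 0" for x by (auto simp: f_def flat_exp_def)
  define G where "G = (\<lambda>x. integral {0..x} f)"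
  have dG: "(G has_real_derivative f x) (at x)" for x
  proof (cases "x > 0")
    case True
    have "(G has_real_derivative f x) (at x within {0..x+1})"
      unfolding G_def by (rule integral_has_real_derivative) (use cf True in auto)
    then show ?thesis using True by (simp add: at_within_Icc_at)
  next
    case False
    have z: "G y = 0" if "y < 1" for y
      unfolding G_def by (rule integral_unique, rule has_integral_is_0) (use that f0 in auto)
    have "((\<lambda>x. 0) has_real_derivative 0) (at x)" by simp
    then have "(G has_real_derivative 0) (at x)"
      by (rule has_field_derivative_transform_within_open[where S = "{..<1}"])
         (use False z in auto)
    then show ?thesis using False f0 by simp
  qed
  have sG: "smooth G" by (rule smoothI[OF dG sf])
  have mono: "G x \<le> G y" if "x \<le> y" for x y
    by (rule DERIV_nonneg_imp_nondecreasing[OF that]) (use dG fn in blast)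
  have G1: "G x = 0" if "x \<le> 1" for x
    unfolding G_def by (rule integral_unique, rule has_integral_is_0) (use that f0 in auto)
  have G2: "G x = G 2" if "x \<ge> 2" for x
  proof (cases "x = 2")
    case False
    then have "2 < x" using that by simp
    then obtain z where "2 < z" "z < x" "G x - G 2 = (x - 2) * f z"
      using MVT2[of 2 x G f] dG by blast
    then show ?thesis using f0 by simp
  qed simp
  obtain z where z: "1 < z" "z < 2" "G 2 - G 1 = (2 - 1) * f z"
    using MVT2[of 1 2 G f] dG by auto
  then have pos: "G 2 > 0" using fp[of z] G1[of 1] by simp
  define S where "S = (\<lambda>x. (1 / G 2) * G x)"
  have dS: "(S has_real_derivative (1 / G 2) * f x) (at x)" for x
    unfolding S_def by (rule DERIV_cmult[OF dG])
  then have dS': "deriv S x = (1 / G 2) * f x" for x using DERIV_imp_deriv by blast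
  have "bounded (f ` {0..3})"
    by (intro compact_imp_bounded compact_continuous_image cf) auto
  then obtain B where B: "\<And>x. x \<in> {0..3} \<Longrightarrow> \<bar>f x\<bar> \<le> B"
    by (metis bounded_iff imageI real_norm_def)
  have "f x \<le> \<bar>B\<bar>" for x
    using B[of x] f0[of x] by (cases "x \<in> {0..3}") auto
  then have "deriv S x \<le> (1 / G 2) * \<bar>B\<bar>" for x
    unfolding dS' using pos by (intro mult_left_mono) auto
  moreover have "smooth S" unfolding S_def by (rule smooth_mult[OF smooth_const sG])
  moreover have G01: "0 \<le> G x \<and> G x \<le> G 2" for x
  proof (cases "x \<le> 1")
    case True then show ?thesis using G1[OF True] pos by simp
  next
    case False
    then have "0 \<le> G x" using mono[of 1 x] G1[of 1] by simp
    moreover have "G x \<le> G 2"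
    proof (cases "x \<le> 2")
      case False then show ?thesis using G2[of x] by linarith
    qed (rule mono)
    ultimately show ?thesis by simp
  qed
  moreover have "S x = 0" if "x \<le> 1" for x using G1[OF that] by (simp add: S_def)
  moreover have "S x = 1" if "x \<ge> 2" for x unfolding S_def G2[OF that] using pos by simp
  moreover have "0 \<le> S x \<and> S x \<le> 1" for x using G01[of x] pos by (simp add: S_def)
  moreover have "0 \<le> deriv S x" for x unfolding dS' using pos fn[of x] by simp
  moreover have "deriv S x = 0" if "x < 1 \<or> 2 < x" for x
  proof -
    have "f x = 0" by (rule f0) (use that in auto)
    then show ?thesis unfolding dS' by simp
  qed
  ultimately show ?thesis by (intro exI[of _ S] conjI) blast+
qed

definition step :: "real \<Rightarrow> real" where
  "step = (SOME S. smooth S \<and> (\<forall>x\<le>1. S x = 0) \<and> (\<forall>x\<ge>2. S x = 1) \<and> (\<forall>x. 0 \<le> S x \<and> S x \<le> 1) \<and>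
     (\<forall>x. 0 \<le> deriv S x) \<and> (\<exists>C. \<forall>x. deriv S x \<le> C) \<and> (\<forall>x. x < 1 \<or> 2 < x \<longrightarrow> deriv S x = 0))"

lemma
  shows smooth_step: "smooth step"
    and step_0: "x \<le> 1 \<Longrightarrow> step x = 0" and step_1: "x \<ge> 2 \<Longrightarrow> step x = 1"
    and step_ge: "0 \<le> step x" and step_le: "step x \<le> 1"
    and step_deriv_ge: "0 \<le> deriv step x"
    and step_deriv_le: "\<exists>C. \<forall>x. deriv step x \<le> C"
    and step_deriv_0: "x < 1 \<or> 2 < x \<Longrightarrow> deriv step x = 0"
  using someI_ex[OF smooth_step_exists] unfolding step_def[symmetric] by auto

section \<open>Smooth functions of two variables and test functions\<close>

definition smooth2 :: "(real \<Rightarrow> real \<Rightarrow> real) \<Rightarrow> bool" where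
  "smooth2 f \<longleftrightarrow> (\<forall>k. C_times k f)"

lemma smooth2_D:
  assumes "smooth2 f"
  shows "smooth2 (Dt f)" "smooth2 (Dx f)" "continuous_on UNIV (\<lambda>(t, x). f t x)"
    "((\<lambda>s. f s x) has_real_derivative Dt f t x) (at t)"
    "(f t has_real_derivative Dx f t x) (at x)"
proof -
  have k: "C_times (Suc k) f" for k using assms by (simp add: smooth2_def)
  show "smooth2 (Dt f)" "smooth2 (Dx f)" using k by (auto simp: smooth2_def)
  show "continuous_on UNIV (\<lambda>(t, x). f t x)" using assms by (metis smooth2_def C_times.simps(1))
  show "((\<lambda>s. f s x) has_real_derivative Dt f t x) (at t)"
    "(f t has_real_derivative Dx f t x) (at x)"
    using k[of 0] by (auto simp: Dt_def Dx_def DERIV_deriv_iff_real_differentiable)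
qed

lemma Dt_eqI: "(\<And>t x. ((\<lambda>s. f s x) has_real_derivative g t x) (at t)) \<Longrightarrow> Dt f = g"
  unfolding Dt_def using DERIV_imp_deriv by blast

lemma Dx_eqI: "(\<And>t x. (f t has_real_derivative g t x) (at x)) \<Longrightarrow> Dx f = g"
  unfolding Dx_def using DERIV_imp_deriv by blast

lemma C_times_add: "\<lbrakk>C_times k f; C_times k g\<rbrakk> \<Longrightarrow> C_times k (\<lambda>t x. f t x + g t x)"
proof (induction k arbitrary: f g)
  case 0 then show ?case by (auto simp: case_prod_unfold intro!: continuous_intros)
next
  case (Suc k)
  have "Dt (\<lambda>t x. f t x + g t x) = (\<lambda>t x. Dt f t x + Dt g t x)"
    by (rule Dt_eqI) (use Suc.prems in \<open>auto simp: Dt_def DERIV_deriv_iff_real_differentiable intro!: DERIV_add\<close>)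
  moreover have "Dx (\<lambda>t x. f t x + g t x) = (\<lambda>t x. Dx f t x + Dx g t x)"
    by (rule Dx_eqI) (use Suc.prems in \<open>auto simp: Dx_def DERIV_deriv_iff_real_differentiable intro!: DERIV_add\<close>)
  ultimately show ?case using Suc by (auto intro: differentiable_add)
qed

lemma smooth2_add: "\<lbrakk>smooth2 f; smooth2 g\<rbrakk> \<Longrightarrow> smooth2 (\<lambda>t x. f t x + g t x)"
  by (simp add: smooth2_def C_times_add)

lemma
  assumes "smooth2 f" "smooth2 g"
  shows smooth2_mult: "smooth2 (\<lambda>t x. f t x * g t x)"
    and Dt_mult: "Dt (\<lambda>t x. f t x * g t x) = (\<lambda>t x. Dt f t x * g t x + f t x * Dt g t x)"
    and Dx_mult: "Dx (\<lambda>t x. f t x * g t x) = (\<lambda>t x. Dx f t x * g t x + f t x * Dx g t x)"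
proof -
  have t: "((\<lambda>s. f s x * g s x) has_real_derivative Dt f t x * g t x + f t x * Dt g t x) (at t)"
    if "smooth2 f" "smooth2 g" for f g t x
    by (rule derivative_eq_intros smooth2_D(4) that refl)+ simp
  have x: "((\<lambda>x. f t x * g t x) has_real_derivative Dx f t x * g t x + f t x * Dx g t x) (at x)"
    if "smooth2 f" "smooth2 g" for f g t x
    by (rule derivative_eq_intros smooth2_D(5) that refl)+ simp
  have "C_times k (\<lambda>t x. f t x * g t x)" if "smooth2 f" "smooth2 g" for k f g
    using that
  proof (induction k arbitrary: f g)
    case 0 then show ?case
      using smooth2_D(3)[OF 0(1)] smooth2_D(3)[OF 0(2)]
      by (auto simp: case_prod_unfold intro!: continuous_intros)
  next
    case (Suc k)
    have "(\<lambda>s. f s x * g s x) differentiable (at t)" "(\<lambda>x. f t x * g t x) differentiable (at x)" for t x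
      using t[OF Suc.prems] x[OF Suc.prems] real_differentiable_def by blast+
    moreover have "Dt (\<lambda>t x. f t x * g t x) = (\<lambda>t x. Dt f t x * g t x + f t x * Dt g t x)"
      "Dx (\<lambda>t x. f t x * g t x) = (\<lambda>t x. Dx f t x * g t x + f t x * Dx g t x)"
      by (rule Dt_eqI Dx_eqI, rule t x, rule Suc.prems, rule Suc.prems)+
    ultimately show ?case
      using Suc by (auto intro!: C_times_add simp: smooth2_D(1,2))
  qed
  then show "smooth2 (\<lambda>t x. f t x * g t x)" using assms by (simp add: smooth2_def)
  show "Dt (\<lambda>t x. f t x * g t x) = (\<lambda>t x. Dt f t x * g t x + f t x * Dt g t x)"
    by (rule Dt_eqI[OF t[OF assms]])
  show "Dx (\<lambda>t x. f t x * g t x) = (\<lambda>t x. Dx f t x * g t x + f t x * Dx g t x)"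
    by (rule Dx_eqI[OF x[OF assms]])
qed

lemma
  assumes "smooth r"
  shows smooth2_time: "smooth2 (\<lambda>t x. r t)"
    and Dt_time: "Dt (\<lambda>t x. r t) = (\<lambda>t x. deriv r t)"
    and Dx_time: "Dx (\<lambda>t x. r t) = (\<lambda>t x. 0)"
    and smooth2_space: "smooth2 (\<lambda>t x. r x)"
    and Dt_space: "Dt (\<lambda>t x. r x) = (\<lambda>t x. 0)"
    and Dx_space: "Dx (\<lambda>t x. r x) = (\<lambda>t x. deriv r x)"
proof -
  have c: "C_times k (\<lambda>t x. 0)" for k
    by (induction k) (auto simp: Dt_def Dx_def)
  have "C_times k (\<lambda>t x. r t) \<and> C_times k (\<lambda>t x. r x)" if "smooth r" for k r
    using that
  proof (induction k arbitrary: r)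
    case 0
    have "continuous_on UNIV (\<lambda>z::real \<times> real. r (fst z))" "continuous_on UNIV (\<lambda>z::real \<times> real. r (snd z))"
      by (rule continuous_on_compose2[OF smooth_continuous[OF 0, of UNIV]];
          simp add: continuous_on_fst continuous_on_snd)+
    then show ?case by (simp add: case_prod_unfold)
  next
    case (Suc k)
    have "r differentiable (at x)" for x using smooth_unfold Suc.prems by blast
    moreover note Suc.IH[OF smooth_deriv[OF Suc.prems]]
    ultimately show ?case using c by (auto simp: Dt_def Dx_def)
  qed
  then show "smooth2 (\<lambda>t x. r t)" "smooth2 (\<lambda>t x. r x)"
    using assms by (auto simp: smooth2_def)
qed (auto simp: Dt_def Dx_def)

lemma
  assumes "smooth r" "smooth c"
  shows smooth2_tensor: "smooth2 (\<lambda>t x. r t * c x)"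
    and Dt_tensor: "Dt (\<lambda>t x. r t * c x) = (\<lambda>t x. deriv r t * c x)"
    and Dx_tensor: "Dx (\<lambda>t x. r t * c x) = (\<lambda>t x. r t * deriv c x)"
  using assms by (auto simp: smooth2_mult smooth2_time smooth2_space Dt_mult Dx_mult Dt_time Dx_time Dt_space Dx_space)

lemma smooth2_sum: "(\<And>i. i \<in> I \<Longrightarrow> smooth2 (f i)) \<Longrightarrow> smooth2 (\<lambda>t x. \<Sum>i\<in>I. f i t x)"
  by (induction I rule: infinite_finite_induct) (auto intro: smooth2_time[OF smooth_const] smooth2_add)

lemma smooth2_polynomial:
  assumes "real_polynomial_function p" shows "smooth2 (\<lambda>t x. p (t, x))"
  using assms
proof (induction p rule: real_polynomial_function.induct)
  case (linear f)
  then interpret bounded_linear f .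
  have "f (t, x) = t * f (1, 0) + f (0, 1) * x" for t x
    using add[of "(t,0)" "(0,x)"] scaleR[of t "(1,0)"] scaleR[of x "(0,1)"] by simp
  then have e: "(\<lambda>t x. f (t, x)) = (\<lambda>t x. t * f (1, 0) + f (0, 1) * x)" by (intro ext)
  have "smooth2 (\<lambda>t x. t * f (1, 0) + f (0, 1) * x)"
    by (rule smooth2_add[OF smooth2_mult[OF smooth2_time[OF smooth_ident] smooth2_time[OF smooth_const]]
        smooth2_mult[OF smooth2_time[OF smooth_const] smooth2_space[OF smooth_ident]]])
  then show ?case by (simp only: e)
next
  case (const c) show ?case by (rule smooth2_time[OF smooth_const])
next
  case (add f g) show ?case by (rule smooth2_add[OF add.IH])
next
  case (mult f g) show ?case by (rule smooth2_mult[OF mult.IH])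
qed

lemma test1_smooth: "test1 S \<psi> \<Longrightarrow> smooth \<psi>"
  by (simp add: test1_def smooth_iff_funpow)

lemma test1I:
  assumes "smooth \<psi>" "\<And>x. \<psi> x \<noteq> 0 \<Longrightarrow> x \<in> {c..d}" "{c..d} \<subseteq> S"
  shows "test1 S \<psi>"
proof -
  have "closure {x. \<psi> x \<noteq> 0} \<subseteq> {c..d}"
    by (rule closure_minimal) (use assms(2) in auto)
  moreover from this have "compact (closure {x. \<psi> x \<noteq> 0})"
    using bounded_subset[OF compact_imp_bounded[OF compact_Icc]] by (auto simp: compact_eq_bounded_closed)
  ultimately show ?thesis using assms by (auto simp: test1_def smooth_iff_funpow)
qed

lemma test1_support:
  assumes "test1 {a<..<b} \<psi>" "a < b"
  obtains c d where "a < c" "c \<le> d" "d < b" "\<And>x. \<psi> x \<noteq> 0 \<Longrightarrow> x \<in> {c..d}"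
    "\<And>x. x \<notin> {c..d} \<Longrightarrow> deriv \<psi> x = 0"
proof -
  let ?K = "closure {x. \<psi> x \<noteq> 0}"
  have K: "compact ?K" "?K \<subseteq> {a<..<b}" using assms by (auto simp: test1_def)
  obtain c d where cd: "a < c" "c \<le> d" "d < b" "?K \<subseteq> {c..d}"
  proof (cases "?K = {}")
    case True
    then show thesis using that[of "(a+b)/2" "(a+b)/2"] assms(2) by auto
  next
    case False
    obtain c where c: "c \<in> ?K" "\<And>x. x \<in> ?K \<Longrightarrow> c \<le> x" using compact_attains_inf[OF K(1) False] by blast
    obtain d where d: "d \<in> ?K" "\<And>x. x \<in> ?K \<Longrightarrow> x \<le> d" using compact_attains_sup[OF K(1) False] by blast
    have ab: "a < c" "d < b" using subsetD[OF K(2) c(1)] subsetD[OF K(2) d(1)] by simp_all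
    have s: "?K \<subseteq> {c..d}"
    proof
      fix y assume y: "y \<in> ?K"
      show "y \<in> {c..d}" using c(2)[OF y] d(2)[OF y] by simp
    qed
    show thesis by (rule that[OF ab(1) c(2)[OF d(1)] ab(2) s])
  qed
  have z: "\<psi> x = 0" if "x \<notin> {c..d}" for x using subsetD[OF cd(4)] subsetD[OF closure_subset, of x "{x. \<psi> x \<noteq> 0}"] that by auto
  have "deriv \<psi> x = 0" if "x \<notin> {c..d}" for x
  proof -
    have "((\<lambda>x. 0) has_real_derivative 0) (at x)" by simp
    then have "(\<psi> has_real_derivative 0) (at x)"
      by (rule has_field_derivative_transform_within_open[where S = "- {c..d}"])
         (use that z in \<open>auto intro: open_Compl\<close>)
    then show ?thesis by (rule DERIV_imp_deriv)
  qed
  then show thesis using z by (intro that[OF cd(1-3)]) auto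
qed

lemma test2_smooth2: "test2 S \<phi> \<Longrightarrow> smooth2 \<phi>"
  by (simp add: test2_def smooth2_def)

lemma test2I:
  assumes "smooth2 \<phi>" "\<And>t x. \<phi> t x \<noteq> 0 \<Longrightarrow> t \<in> {a..b} \<and> x \<in> {c..d}" "{a..b} \<times> {c..d} \<subseteq> S"
  shows "test2 S \<phi>"
proof -
  have "closure {(t, x). \<phi> t x \<noteq> 0} \<subseteq> {a..b} \<times> {c..d}"
    by (rule closure_minimal) (use assms(2) in \<open>auto simp: closed_Times\<close>)
  moreover from this have "compact (closure {(t, x). \<phi> t x \<noteq> 0})"
    using bounded_subset[OF compact_imp_bounded[OF compact_Times[OF compact_Icc compact_Icc]]]
    by (auto simp: compact_eq_bounded_closed)
  ultimately show ?thesis using assms by (auto simp: test2_def smooth2_def)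
qed

text \<open>Plateau functions: 1 on \<open>[a+2\<delta>, b-2\<delta>]\<close>, supported in \<open>[a+\<delta>, b-\<delta>]\<close>.\<close>

definition plateau :: "real \<Rightarrow> real \<Rightarrow> real \<Rightarrow> real \<Rightarrow> real" where
  "plateau a b \<delta> x = step ((x - a) / \<delta>) * step ((b - x) / \<delta>)"

lemma smooth_step_affine:
  assumes "\<delta> \<noteq> 0"
  shows "smooth (\<lambda>x. step ((x - a) / \<delta>))" "smooth (\<lambda>x. step ((b - x) / \<delta>))"
    "deriv (\<lambda>x. step ((x - a) / \<delta>)) = (\<lambda>x. deriv step ((x - a) / \<delta>) / \<delta>)"
    "deriv (\<lambda>x. step ((b - x) / \<delta>)) = (\<lambda>x. - deriv step ((b - x) / \<delta>) / \<delta>)"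
proof -
  have e: "(\<lambda>x. step ((x - a) / \<delta>)) = (\<lambda>x. step ((1/\<delta>) * x + (- a/\<delta>)))"
    "(\<lambda>x. step ((b - x) / \<delta>)) = (\<lambda>x. step ((-1/\<delta>) * x + (b/\<delta>)))"
    using assms by (auto simp: field_simps)
  show "smooth (\<lambda>x. step ((x - a) / \<delta>))" "smooth (\<lambda>x. step ((b - x) / \<delta>))"
    unfolding e by (rule smooth_affine[OF smooth_step])+
  have "((\<lambda>x. (x - a) / \<delta>) has_real_derivative 1/\<delta>) (at x)" for x
    by (rule derivative_eq_intros refl)+ (use assms in simp_all)
  note DERIV_chain2[OF smooth_DERIV[OF smooth_step] this]
  then show "deriv (\<lambda>x. step ((x - a) / \<delta>)) = (\<lambda>x. deriv step ((x - a) / \<delta>) / \<delta>)"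
    by (intro ext) (simp add: DERIV_imp_deriv)
  have "((\<lambda>x. (b - x) / \<delta>) has_real_derivative -1/\<delta>) (at x)" for x
    by (rule derivative_eq_intros refl)+ (use assms in simp_all)
  note DERIV_chain2[OF smooth_DERIV[OF smooth_step] this]
  then show "deriv (\<lambda>x. step ((b - x) / \<delta>)) = (\<lambda>x. - deriv step ((b - x) / \<delta>) / \<delta>)"
    by (intro ext) (simp add: DERIV_imp_deriv)
qed

lemma smooth_plateau: "\<delta> > 0 \<Longrightarrow> smooth (plateau a b \<delta>)"
  unfolding plateau_def[abs_def] by (rule smooth_mult[OF smooth_step_affine(1) smooth_step_affine(2)]) auto

lemma plateau_ge: "0 \<le> plateau a b \<delta> x" and plateau_le: "plateau a b \<delta> x \<le> 1"
  unfolding plateau_def by (simp add: step_ge, rule mult_le_one) (simp_all add: step_ge step_le)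

lemma plateau_support: "\<lbrakk>plateau a b \<delta> x \<noteq> 0; \<delta> > 0\<rbrakk> \<Longrightarrow> x \<in> {a+\<delta>..b-\<delta>}"
proof -
  assume "plateau a b \<delta> x \<noteq> 0" and d: "\<delta> > 0"
  then have "\<not> (x - a) / \<delta> \<le> 1" "\<not> (b - x) / \<delta> \<le> 1"
    using step_0 by (auto simp: plateau_def)
  then show ?thesis using d by (simp add: not_le less_divide_eq)
qed

lemma plateau_eq_1: "\<lbrakk>x \<in> {a+2*\<delta>..b-2*\<delta>}; \<delta> > 0\<rbrakk> \<Longrightarrow> plateau a b \<delta> x = 1"
proof -
  assume "x \<in> {a+2*\<delta>..b-2*\<delta>}" "\<delta> > 0"
  then have "2 \<le> (x - a) / \<delta>" "2 \<le> (b - x) / \<delta>" by (simp_all add: le_divide_eq)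
  then show ?thesis by (simp add: plateau_def step_1)
qed

lemma plateau_deriv:
  assumes "\<delta> > 0"
  shows "deriv (plateau a b \<delta>) x = deriv step ((x - a) / \<delta>) / \<delta> * step ((b - x) / \<delta>)
    - step ((x - a) / \<delta>) * (deriv step ((b - x) / \<delta>) / \<delta>)"
proof -
  have d: "\<delta> \<noteq> 0" using assms by simp
  have "deriv (\<lambda>x. step ((x - a) / \<delta>) * step ((b - x) / \<delta>)) x =
     deriv (\<lambda>x. step ((x - a) / \<delta>)) x * step ((b - x) / \<delta>) +
     deriv (\<lambda>x. step ((b - x) / \<delta>)) x * step ((x - a) / \<delta>)"
    by (rule DERIV_imp_deriv, rule DERIV_mult)
       (rule smooth_DERIV[OF smooth_step_affine(1)[OF d]] smooth_DERIV[OF smooth_step_affine(2)[OF d]])+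
  then show ?thesis unfolding plateau_def[abs_def] smooth_step_affine(3,4)[OF d] by simp
qed

lemma test1_plateau: "\<delta> > 0 \<Longrightarrow> test1 {a<..<b} (plateau a b \<delta>)"
  by (rule test1I[where c = "a+\<delta>" and d = "b-\<delta>"]) (auto simp: smooth_plateau dest: plateau_support)

section \<open>Lebesgue measure on intervals and on the space-time cylinder\<close>

definition LI :: "real \<Rightarrow> real \<Rightarrow> real measure" where
  "LI a b = restrict_space lborel {a<..<b}"

definition LC :: "real \<Rightarrow> (real \<times> real) measure" where
  "LC T = LI 0 T \<Otimes>\<^sub>M LI 0 1"

lemma space_LI [simp]: "space (LI a b) = {a<..<b}"
  by (simp add: LI_def space_restrict_space)

lemma sets_LI [measurable_cong]: "sets (LI a b) = sets (restrict_space borel {a<..<b})"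
  by (simp add: LI_def sets_restrict_space)

lemma finite_measure_LI: "finite_measure (LI a b)"
  by (rule finite_measureI, cases "a \<le> b")
     (simp_all add: LI_def emeasure_restrict_space space_restrict_space)

interpretation LI: finite_measure "LI a b" for a b
  by (rule finite_measure_LI)

lemma pair_LI: "pair_sigma_finite (LI a b) (LI c d)"
  by (rule pair_sigma_finite.intro[OF LI.sigma_finite_measure_axioms LI.sigma_finite_measure_axioms])

lemma space_LC: "space (LC T) = Cyl T"
  by (simp add: LC_def space_pair_measure)

lemma finite_measure_LC: "finite_measure (LC T)"
  unfolding LC_def by (rule finite_measure_pair_measure[OF finite_measure_LI finite_measure_LI])

interpretation LC: finite_measure "LC T" for T
  by (rule finite_measure_LC)

lemma borel_LI: "f \<in> borel_measurable borel \<Longrightarrow> f \<in> borel_measurable (LI a b)"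
  unfolding LI_def by (rule measurable_restrict_space1) simp

lemma id_measurable_LC: "(\<lambda>z. z) \<in> measurable (LC T) borel"
proof -
  have "fst \<in> borel_measurable (LC T)"
    unfolding LC_def by (rule measurable_compose[OF measurable_fst borel_LI[OF measurable_ident_sets[OF refl]]])
  moreover have "snd \<in> borel_measurable (LC T)"
    unfolding LC_def by (rule measurable_compose[OF measurable_snd borel_LI[OF measurable_ident_sets[OF refl]]])
  ultimately have "(\<lambda>z. (fst z, snd z)) \<in> borel_measurable (LC T)"
    by (rule borel_measurable_Pair)
  then show ?thesis by simp
qed

lemma Cyl_borel [measurable, simp]: "Cyl T \<in> sets borel"
  by (simp add: borel_open open_Times)

text \<open>The measure on the cylinder is a product, for Fubini, and at the same time a restriction of
  Lebesgue measure, in which the norms and weak formulations are written.\<close>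

lemma LC_eq: "LC T = restrict_space lborel (Cyl T)"
  unfolding LC_def
proof (rule pair_measure_eqI)
  show "sigma_finite_measure (LI 0 T)" "sigma_finite_measure (LI 0 1)"
    by (rule LI.sigma_finite_measure_axioms)+
  show "sets (LI 0 T \<Otimes>\<^sub>M LI 0 1) = sets (restrict_space lborel (Cyl T))"
  proof (rule antisym)
    show "sets (LI 0 T \<Otimes>\<^sub>M LI 0 1) \<subseteq> sets (restrict_space lborel (Cyl T))"
      unfolding sets_pair_measure
    proof (rule sets.sigma_sets_subset')
      show "{A \<times> B |A B. A \<in> sets (LI 0 T) \<and> B \<in> sets (LI 0 1)} \<subseteq> sets (restrict_space lborel (Cyl T))"
      proof safe
        fix A B assume "A \<in> sets (LI 0 T)" "B \<in> sets (LI 0 1)"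
        then obtain A' B' where *: "A' \<in> sets borel" "B' \<in> sets borel"
          "A = {0<..<T} \<inter> A'" "B = Omega \<inter> B'"
          by (auto simp: LI_def sets_restrict_space)
        have "A' \<times> B' \<in> sets (borel \<Otimes>\<^sub>M borel)" using * by simp
        moreover have "A \<times> B = Cyl T \<inter> (A' \<times> B')" using * by auto
        ultimately show "A \<times> B \<in> sets (restrict_space lborel (Cyl T))"
          unfolding sets_restrict_space sets_lborel borel_prod by (rule image_eqI[rotated])
      qed
    qed (simp add: sets_restrict_space image_eqI[where x = UNIV])
    show "sets (restrict_space lborel (Cyl T)) \<subseteq> sets (LI 0 T \<Otimes>\<^sub>M LI 0 1)"
    proof
      fix Z assume "Z \<in> sets (restrict_space lborel (Cyl T))"
      then obtain Z' where Z': "Z' \<in> sets borel" "Z = Cyl T \<inter> Z'" by (auto simp: sets_restrict_space)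
      have "(\<lambda>z. z) -` Z' \<inter> space (LC T) \<in> sets (LC T)"
        by (rule measurable_sets[OF id_measurable_LC Z'(1)])
      then show "Z \<in> sets (LI 0 T \<Otimes>\<^sub>M LI 0 1)" using Z' unfolding LC_def[symmetric] by (simp add: space_LC Int_commute)
    qed
  qed
  fix A B assume A: "A \<in> sets (LI 0 T)" and B: "B \<in> sets (LI 0 1)"
  then have b: "A \<in> sets borel" "B \<in> sets borel" "A \<subseteq> {0<..<T}" "B \<subseteq> Omega"
    by (auto simp: LI_def sets_restrict_space)
  have "emeasure (restrict_space lborel (Cyl T)) (A \<times> B) = emeasure (lborel \<Otimes>\<^sub>M lborel) (A \<times> B)"
    using b by (subst emeasure_restrict_space) (auto simp: lborel_prod)
  also have "\<dots> = emeasure lborel A * emeasure lborel B"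
    using b by (intro lborel.emeasure_pair_measure_Times) auto
  also have "\<dots> = emeasure (LI 0 T) A * emeasure (LI 0 1) B"
    using b by (simp add: LI_def emeasure_restrict_space)
  finally show "emeasure (LI 0 T) A * emeasure (LI 0 1) B = emeasure (restrict_space lborel (Cyl T)) (A \<times> B)" ..
qed

lemma borel_LC: "f \<in> borel_measurable borel \<Longrightarrow> f \<in> borel_measurable (LC T)"
  unfolding LC_eq by (rule measurable_restrict_space1) simp

lemma
  fixes f :: "real \<Rightarrow> real"
  shows set_integrable_LI: "set_integrable lborel {a<..<b} f \<longleftrightarrow> integrable (LI a b) f"
    and set_integral_LI: "(LINT x:{a<..<b}|lborel. f x) = integral\<^sup>L (LI a b) f"
    and set_borel_LI: "set_borel_measurable lborel {a<..<b} f \<longleftrightarrow> f \<in> borel_measurable (LI a b)"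
  unfolding LI_def set_integrable_def set_lebesgue_integral_def set_borel_measurable_def
  by (auto simp: integrable_restrict_space integral_restrict_space borel_measurable_restrict_space_iff)

lemma AE_LI: "(AE x in LI a b. P x) \<longleftrightarrow> (AE x in lborel. x \<in> {a<..<b} \<longrightarrow> P x)"
  unfolding LI_def by (subst AE_restrict_space_iff) auto

lemma nn_integral_LI: "(\<integral>\<^sup>+x\<in>{a<..<b}. f x \<partial>lborel) = integral\<^sup>N (LI a b) f"
  unfolding LI_def by (subst nn_integral_restrict_space) auto

lemma
  fixes f :: "real \<times> real \<Rightarrow> real"
  shows set_integrable_LC: "set_integrable lborel (Cyl T) f \<longleftrightarrow> integrable (LC T) f"
    and set_integral_LC: "(LINT x:Cyl T|lborel. f x) = integral\<^sup>L (LC T) f"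
    and set_borel_LC: "set_borel_measurable lborel (Cyl T) f \<longleftrightarrow> f \<in> borel_measurable (LC T)"
  unfolding LC_eq set_integrable_def set_lebesgue_integral_def set_borel_measurable_def
  by (auto simp: integrable_restrict_space integral_restrict_space borel_measurable_restrict_space_iff)

lemma AE_LC: "(AE x in LC T. P x) \<longleftrightarrow> (AE x in lborel. x \<in> Cyl T \<longrightarrow> P x)"
  unfolding LC_eq by (subst AE_restrict_space_iff) auto

lemma L2_on_LI: "L2_on {a<..<b} f \<longleftrightarrow> f \<in> borel_measurable (LI a b) \<and> integrable (LI a b) (\<lambda>x. (f x)\<^sup>2)"
  by (simp add: L2_on_def set_integrable_LI set_borel_LI)

lemma L2_on_LC: "L2_on (Cyl T) f \<longleftrightarrow> f \<in> borel_measurable (LC T) \<and> integrable (LC T) (\<lambda>x. (f x)\<^sup>2)"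
  by (simp add: L2_on_def set_integrable_LC set_borel_LC)

definition sqint :: "'a measure \<Rightarrow> ('a \<Rightarrow> real) \<Rightarrow> bool" where
  "sqint M f \<longleftrightarrow> f \<in> borel_measurable M \<and> integrable M (\<lambda>x. (f x)\<^sup>2)"

lemma abs_mult_le: "\<bar>a * b\<bar> \<le> a\<^sup>2 + b\<^sup>2" for a b :: real
proof -
  have "2 * (\<bar>a\<bar> * \<bar>b\<bar>) \<le> a\<^sup>2 + b\<^sup>2"
    using sum_squares_bound[of "\<bar>a\<bar>" "\<bar>b\<bar>"] by (simp add: mult.assoc)
  moreover have "0 \<le> \<bar>a\<bar> * \<bar>b\<bar>" by simp
  ultimately show ?thesis unfolding abs_mult by linarith
qed

lemma sqint_mult:
  assumes "sqint M f" "sqint M g" shows "integrable M (\<lambda>x. f x * g x)"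
proof (rule Bochner_Integration.integrable_bound)
  show "integrable M (\<lambda>x. (f x)\<^sup>2 + (g x)\<^sup>2)" using assms by (simp add: sqint_def)
  show "(\<lambda>x. f x * g x) \<in> borel_measurable M" using assms by (intro borel_measurable_times) (auto simp: sqint_def)
  show "AE x in M. norm (f x * g x) \<le> norm ((f x)\<^sup>2 + (g x)\<^sup>2)" using abs_mult_le[of "f _" "g _"] by simp
qed

lemma sqint_bounded_mult:
  assumes "sqint M f" "g \<in> borel_measurable M" "AE x in M. \<bar>g x\<bar> \<le> C"
  shows "sqint M (\<lambda>x. g x * f x)"
  unfolding sqint_def
proof
  show "(\<lambda>x. g x * f x) \<in> borel_measurable M" using assms by (intro borel_measurable_times) (auto simp: sqint_def)
  show "integrable M (\<lambda>x. (g x * f x)\<^sup>2)"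
  proof (rule Bochner_Integration.integrable_bound)
    show "integrable M (\<lambda>x. C\<^sup>2 * (f x)\<^sup>2)" using assms by (simp add: sqint_def)
    show "(\<lambda>x. (g x * f x)\<^sup>2) \<in> borel_measurable M"
      using assms by (intro borel_measurable_power borel_measurable_times) (auto simp: sqint_def)
    show "AE x in M. norm ((g x * f x)\<^sup>2) \<le> norm (C\<^sup>2 * (f x)\<^sup>2)"
      using assms(3)
    proof eventually_elim
      case (elim x)
      then have "(g x)\<^sup>2 \<le> C\<^sup>2" by (metis abs_ge_zero power2_abs power_mono)
      then show ?case by (simp add: power_mult_distrib mult_right_mono)
    qed
  qed
qed

lemma sqint_add: "\<lbrakk>sqint M f; sqint M g\<rbrakk> \<Longrightarrow> sqint M (\<lambda>x. f x + g x)"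
  using sqint_mult[of M f g] by (auto simp: sqint_def power2_sum mult.assoc)

lemma sqint_diff: "\<lbrakk>sqint M f; sqint M g\<rbrakk> \<Longrightarrow> sqint M (\<lambda>x. f x - g x)"
  using sqint_mult[of M f g] by (auto simp: sqint_def power2_diff mult.assoc)

lemma (in finite_measure) sqint_bounded:
  assumes "f \<in> borel_measurable M" "AE x in M. \<bar>f x\<bar> \<le> C"
  shows "sqint M f"
  using sqint_bounded_mult[of M "\<lambda>_. 1" f C] assms by (simp add: sqint_def)

lemma (in finite_measure) sqint_integrable: "sqint M f \<Longrightarrow> integrable M f"
  using sqint_mult[of M f "\<lambda>_. 1"] by (simp add: sqint_def)

lemma sqint_CS:
  assumes "sqint M f" "sqint M g"
  shows "\<bar>integral\<^sup>L M (\<lambda>x. f x * g x)\<bar> \<le> sqrt (integral\<^sup>L M (\<lambda>x. (f x)\<^sup>2)) * sqrt (integral\<^sup>L M (\<lambda>x. (g x)\<^sup>2))"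
proof -
  define A B C where "A = integral\<^sup>L M (\<lambda>x. (f x)\<^sup>2)" "B = integral\<^sup>L M (\<lambda>x. (g x)\<^sup>2)"
    "C = integral\<^sup>L M (\<lambda>x. f x * g x)"
  have i: "integrable M (\<lambda>x. (f x)\<^sup>2)" "integrable M (\<lambda>x. (g x)\<^sup>2)" "integrable M (\<lambda>x. f x * g x)"
    using assms sqint_mult by (auto simp: sqint_def)
  have AB: "A \<ge> 0" "B \<ge> 0" by (auto simp: A_B_C_def)
  have q: "0 \<le> s\<^sup>2 * A + 2 * s * t * C + t\<^sup>2 * B" for s t
  proof -
    have "0 \<le> integral\<^sup>L M (\<lambda>x. (s * f x + t * g x)\<^sup>2)" by simp
    also have "(\<lambda>x. (s * f x + t * g x)\<^sup>2) = (\<lambda>x. s\<^sup>2 * (f x)\<^sup>2 + 2 * s * t * (f x * g x) + t\<^sup>2 * (g x)\<^sup>2)"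
      by (auto simp: power2_eq_square algebra_simps)
    also have "integral\<^sup>L M \<dots> = s\<^sup>2 * A + 2 * s * t * C + t\<^sup>2 * B"
      using i by (simp add: A_B_C_def)
    finally show ?thesis .
  qed
  have "C\<^sup>2 \<le> A * B"
  proof (cases "B = 0")
    case False
    then have "B > 0" using AB by simp
    moreover have "0 \<le> B * (A * B - C\<^sup>2)"
      using q[of B "-C"] by (simp add: power2_eq_square algebra_simps)
    ultimately show ?thesis by (simp add: zero_le_mult_iff)
  next
    case True
    have "C = 0"
    proof (rule ccontr)
      assume "C \<noteq> 0"
      with q[of 1 "- (A + 1) / (2 * C)"] True AB show False by (simp add: field_simps)
    qed
    then show ?thesis using AB by simp
  qed
  then have "\<bar>C\<bar> \<le> sqrt (A * B)" by (metis real_sqrt_abs real_sqrt_le_iff)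
  then show ?thesis by (simp add: real_sqrt_mult A_B_C_def)
qed

section \<open>Density of polynomials and the fundamental lemma\<close>

text \<open>Bounded Borel functions are limits of continuous functions almost everywhere, which are cut off at
  the bound and approximated uniformly by polynomials; the cutoff keeps all approximations bounded, so
  that dominated convergence applies to them.\<close>

lemma bounded_measurable_polynomial_limit:
  fixes h :: "'a::euclidean_space \<Rightarrow> real"
  assumes h: "h \<in> borel_measurable borel" and C: "\<And>z. \<bar>h z\<bar> \<le> C" and K: "compact K"
  shows "\<exists>p. (\<forall>n. real_polynomial_function (p n)) \<and> (\<forall>n. \<forall>z\<in>K. \<bar>p n z\<bar> \<le> C + 1) \<and>
    (AE z in lborel. z \<in> K \<longrightarrow> (\<lambda>n. p n z) \<longlonglongrightarrow> h z)"
proof -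
  have "h \<in> borel_measurable (lebesgue_on UNIV)"
    using h by (intro measurable_restrict_space1 measurable_completion) simp
  then have "h measurable_on UNIV" by (subst measurable_on_iff_borel_measurable) auto
  then obtain N g where N: "negligible N" and g: "\<And>n. continuous_on UNIV (g n)"
    and lim: "\<And>z. z \<notin> N \<Longrightarrow> (\<lambda>n. g n z) \<longlonglongrightarrow> h z"
    unfolding measurable_on_def by auto
  define g' where "g' = (\<lambda>n z. max (-C) (min C (g n z)))"
  have "\<exists>p. real_polynomial_function p \<and> (\<forall>z\<in>K. \<bar>g' n z - p z\<bar> < 1 / real (Suc n))" for n
  proof -
    have "continuous_on K (g' n)" unfolding g'_def
      by (intro continuous_intros continuous_on_subset[OF g]) auto
    from Stone_Weierstrass_real_polynomial_function[OF K this, of "1 / real (Suc n)"]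
    show ?thesis by (metis of_nat_0_less_iff zero_less_Suc zero_less_divide_1_iff)
  qed
  then obtain p where p: "\<And>n. real_polynomial_function (p n)"
    "\<And>n z. z \<in> K \<Longrightarrow> \<bar>g' n z - p n z\<bar> < 1 / real (Suc n)" by metis
  have C0: "C \<ge> 0" using C[of 0] by linarith
  have "\<bar>p n z\<bar> \<le> C + 1" if "z \<in> K" for n z
  proof -
    have "\<bar>g' n z\<bar> \<le> C" using C0 by (auto simp: g'_def)
    moreover have "1 / real (Suc n) \<le> 1" by simp
    ultimately show ?thesis using p(2)[OF that, of n] by linarith
  qed
  moreover have "(\<lambda>n. p n z) \<longlonglongrightarrow> h z" if "z \<in> K" "z \<notin> N" for z
  proof -
    have "(\<lambda>n. g' n z) \<longlonglongrightarrow> max (-C) (min C (h z))"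
      unfolding g'_def by (intro tendsto_intros lim that)
    also have "max (-C) (min C (h z)) = h z" using C[of z] by auto
    finally have 1: "(\<lambda>n. g' n z) \<longlonglongrightarrow> h z" .
    have "(\<lambda>n. g' n z - p n z) \<longlonglongrightarrow> 0"
    proof (rule Lim_null_comparison[OF _ LIMSEQ_inverse_real_of_nat])
      show "\<forall>\<^sub>F n in sequentially. norm (g' n z - p n z) \<le> inverse (real (Suc n))"
        by (intro always_eventually allI less_imp_le) (use p(2)[OF that(1)] in \<open>simp add: divide_inverse\<close>)
    qed
    from tendsto_diff[OF 1 this] show ?thesis by simp
  qed
  moreover have "AE z in lborel. z \<notin> N"
  proof -
    have "AE z in lebesgue. z \<notin> N"
      using N by (intro AE_not_in) (simp add: negligible_iff_null_sets)
    then show ?thesis by (simp add: AE_completion_iff)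
  qed
  ultimately show ?thesis using p(1) by (intro exI[of _ p]) (auto elim!: eventually_mono)
qed

text \<open>By the preceding approximation a function orthogonal to polynomials is orthogonal to its own sign.\<close>

lemma zero_if_orthogonal_to_polynomials:
  fixes f :: "'a::euclidean_space \<Rightarrow> real"
  assumes K: "compact K" and f: "set_integrable lborel K f"
    and orth: "\<And>p. real_polynomial_function p \<Longrightarrow> (LINT z:K|lborel. f z * p z) = 0"
  shows "AE z in lborel. z \<in> K \<longrightarrow> f z = 0"
proof -
  define F where "F = (\<lambda>z. indicator K z * f z)"
  have F: "integrable lborel F" using f by (simp add: F_def set_integrable_def)
  then have Fm[measurable]: "F \<in> borel_measurable borel" using borel_measurable_integrable by force
  define h where "h = (\<lambda>z. if 0 < F z then 1 else if F z < 0 then -1 else 0 :: real)"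
  have hm: "h \<in> borel_measurable borel" unfolding h_def by measurable
  have hb: "\<bar>h z\<bar> \<le> 1" for z by (simp add: h_def)
  obtain p where p: "\<forall>n. real_polynomial_function (p n)" "\<forall>n. \<forall>z\<in>K. \<bar>p n z\<bar> \<le> 1 + 1"
    "AE z in lborel. z \<in> K \<longrightarrow> (\<lambda>n. p n z) \<longlonglongrightarrow> h z"
    using bounded_measurable_polynomial_limit[OF hm hb K] by blast
  have pm: "p n \<in> borel_measurable borel" for n
    by (intro borel_measurable_continuous_onI continuous_on_polymonial_function)
       (use p(1) real_polynomial_function_eq in blast)
  have "(\<lambda>n. integral\<^sup>L lborel (\<lambda>z. F z * p n z)) \<longlonglongrightarrow> integral\<^sup>L lborel (\<lambda>z. F z * h z)"
  proof (rule integral_dominated_convergence)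
    show "integrable lborel (\<lambda>z. 2 * \<bar>F z\<bar>)" using F by simp
    show "AE z in lborel. (\<lambda>n. F z * p n z) \<longlonglongrightarrow> F z * h z"
      using p(3)
    proof eventually_elim
      case (elim z)
      then show ?case by (cases "z \<in> K") (auto simp: F_def intro!: tendsto_intros)
    qed
    show "AE z in lborel. norm (F z * p n z) \<le> 2 * \<bar>F z\<bar>" for n
    proof (rule AE_I2)
      fix z
      show "norm (F z * p n z) \<le> 2 * \<bar>F z\<bar>"
      proof (cases "z \<in> K")
        case True
        then have "\<bar>p n z\<bar> \<le> 2" using p(2) by simp
        then show ?thesis using mult_left_mono[of "\<bar>p n z\<bar>" 2 "\<bar>F z\<bar>"] by (simp add: abs_mult mult.commute)
      qed (simp add: F_def)
    qed
    show "(\<lambda>z. F z * h z) \<in> borel_measurable lborel" "(\<lambda>z. F z * p n z) \<in> borel_measurable lborel" for n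
      using Fm pm[of n] hm by (simp_all add: borel_measurable_times)
  qed
  moreover have "integral\<^sup>L lborel (\<lambda>z. F z * p n z) = 0" for n
    using orth[of "p n"] p(1) by (simp add: set_lebesgue_integral_def F_def mult.assoc)
  ultimately have "integral\<^sup>L lborel (\<lambda>z. F z * h z) = 0"
    by (simp only:) (rule LIMSEQ_unique[OF _ tendsto_const])
  moreover have "F z * h z = \<bar>F z\<bar>" for z by (simp add: h_def)
  ultimately have "AE z in lborel. \<bar>F z\<bar> = 0"
    using integral_nonneg_eq_0_iff_AE[of lborel "\<lambda>z. \<bar>F z\<bar>"] F by simp
  then show ?thesis by eventually_elim (auto simp: F_def)
qed

lemma smooth_real_polynomial:
  fixes p :: "real \<Rightarrow> real"
  assumes "real_polynomial_function p" shows "smooth p"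
proof -
  obtain a n where p: "p = (\<lambda>x. \<Sum>i\<le>n. a i * x ^ i)"
    using assms real_polynomial_function_iff_sum by blast
  have "smooth (\<lambda>x. a i * x ^ i)" for i
    by (rule smooth_mult[OF smooth_const smooth_power[OF smooth_ident]])
  then show ?thesis unfolding p by (rule smooth_sum)
qed

lemma smooth_primitive:
  assumes k: "smooth k" and z: "\<And>x. x \<le> m \<Longrightarrow> k x = 0"
  shows "\<exists>G. smooth G \<and> (\<forall>x. (G has_real_derivative k x) (at x)) \<and> (\<forall>x\<le>m. G x = 0)"
proof -
  define G where "G = (\<lambda>x. integral {m-1..x} k)"
  have z': "G y = 0" if "y \<le> m" for y
    unfolding G_def by (rule integral_unique, rule has_integral_is_0) (use that in \<open>simp add: z\<close>)
  have dG: "(G has_real_derivative k x) (at x)" for x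
  proof (cases "x > m - 1")
    case True
    have "(G has_real_derivative k x) (at x within {m-1..x+1})"
      unfolding G_def by (rule integral_has_real_derivative) (use smooth_continuous[OF k] True in auto)
    then show ?thesis using True by (simp add: at_within_Icc_at)
  next
    case False
    have "((\<lambda>x. 0) has_real_derivative 0) (at x)" by simp
    then have "(G has_real_derivative 0) (at x)"
      by (rule has_field_derivative_transform_within_open[where S = "{..<m}"])
         (use False z' in auto)
    then show ?thesis using False z[of x] by simp
  qed
  show ?thesis using smoothI[OF dG k] dG z' by blast
qed

lemma L1_loc_mult:
  fixes f :: "'a::euclidean_space \<Rightarrow> real"
  assumes f: "L1_loc S f" and K: "compact K" "K \<subseteq> S" and c: "continuous_on UNIV \<psi>"
    and z: "\<And>z. z \<notin> K \<Longrightarrow> \<psi> z = 0"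
  shows "set_integrable lborel K (\<lambda>z. f z * \<psi> z)" "set_integrable lborel S (\<lambda>z. f z * \<psi> z)"
    "(LINT z:S|lborel. f z * \<psi> z) = (LINT z:K|lborel. f z * \<psi> z)"
proof -
  have "bounded (\<psi> ` K)"
    by (intro compact_imp_bounded compact_continuous_image K continuous_on_subset[OF c]) auto
  then obtain B where B: "\<forall>z\<in>K. \<bar>\<psi> z\<bar> \<le> B" unfolding bounded_iff by (metis imageI real_norm_def)
  have fK: "integrable lborel (\<lambda>z. indicator K z * f z)"
    using f K by (simp add: L1_loc_def set_integrable_def)
  have "integrable lborel (\<lambda>z. (indicator K z * f z) * \<psi> z)"
  proof (rule Bochner_Integration.integrable_bound)
    show "integrable lborel (\<lambda>z. B * (indicator K z * f z))" using fK by simp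
    show "(\<lambda>z. indicator K z * f z * \<psi> z) \<in> borel_measurable lborel"
      by (rule borel_measurable_times)
         (use borel_measurable_integrable[OF fK] borel_measurable_continuous_onI[OF c] in auto)
    show "AE z in lborel. norm (indicator K z * f z * \<psi> z) \<le> norm (B * (indicator K z * f z))"
    proof (rule AE_I2)
      fix z show "norm (indicator K z * f z * \<psi> z) \<le> norm (B * (indicator K z * f z))"
      proof (cases "z \<in> K")
        case True
        then have "\<bar>\<psi> z\<bar> \<le> \<bar>B\<bar>" using B by force
        then have "\<bar>f z\<bar> * \<bar>\<psi> z\<bar> \<le> \<bar>f z\<bar> * \<bar>B\<bar>" by (rule mult_left_mono) simp
        then show ?thesis using True by (simp add: abs_mult mult.commute)
      qed simp
    qed
  qed
  then show 1: "set_integrable lborel K (\<lambda>z. f z * \<psi> z)" by (simp add: set_integrable_def mult.assoc)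
  have e: "(\<lambda>z. indicator S z *\<^sub>R (f z * \<psi> z)) = (\<lambda>z. indicator K z *\<^sub>R (f z * \<psi> z))"
  proof
    fix z show "indicator S z *\<^sub>R (f z * \<psi> z) = indicator K z *\<^sub>R (f z * \<psi> z)"
      using K(2) z[of z] by (cases "z \<in> K"; cases "z \<in> S") auto
  qed
  show "set_integrable lborel S (\<lambda>z. f z * \<psi> z)"
    using 1 unfolding set_integrable_def e .
  show "(LINT z:S|lborel. f z * \<psi> z) = (LINT z:K|lborel. f z * \<psi> z)"
    unfolding set_lebesgue_integral_def e ..
qed

text \<open>Polynomials times fixed cutoff functions are test functions, and already these force \<open>f\<close> to vanish;
  the fundamental lemma thus reduces to the density of polynomials instead of mollification.\<close>

lemma zero_if_orthogonal_locally:
  fixes f :: "'a::euclidean_space \<Rightarrow> real" and K :: "nat \<Rightarrow> 'a set"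
  assumes f: "L1_loc S f" and K: "\<And>n. compact (K n)" "\<And>n. K n \<subseteq> S"
    and c: "\<And>n. continuous_on UNIV (\<kappa> n)" and z: "\<And>n z. z \<notin> K n \<Longrightarrow> \<kappa> n z = 0"
    and ex: "\<And>z. z \<in> S \<Longrightarrow> \<exists>n. \<kappa> n z \<noteq> 0"
    and orth: "\<And>n p. real_polynomial_function p \<Longrightarrow> (LINT z:S|lborel. f z * (\<kappa> n z * p z)) = 0"
  shows "AE z in lborel. z \<in> S \<longrightarrow> f z = 0"
proof -
  have "AE z in lborel. z \<in> K n \<longrightarrow> f z * \<kappa> n z = 0" for n
  proof (rule zero_if_orthogonal_to_polynomials[OF K(1)])
    show "set_integrable lborel (K n) (\<lambda>z. f z * \<kappa> n z)"
      by (rule L1_loc_mult(1)[OF f K c z])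
    fix p :: "'a \<Rightarrow> real" assume p: "real_polynomial_function p"
    then have cp: "continuous_on UNIV p"
      by (intro continuous_on_polymonial_function) (simp add: real_polynomial_function_eq)
    have "(LINT z:S|lborel. f z * (\<kappa> n z * p z)) = (LINT z:K n|lborel. f z * (\<kappa> n z * p z))"
      by (rule L1_loc_mult(3)[OF f K continuous_on_mult[OF c cp]]) (simp add: z)
    then show "(LINT z:K n|lborel. f z * \<kappa> n z * p z) = 0" using orth[OF p, of n] by (simp add: mult.assoc)
  qed
  then have "AE z in lborel. \<forall>n. z \<in> K n \<longrightarrow> f z * \<kappa> n z = 0" by (simp add: AE_all_countable)
  then show ?thesis
  proof eventually_elim
    case (elim y)
    show ?case
    proof
      assume "y \<in> S"
      then obtain n where n: "\<kappa> n y \<noteq> 0" using ex by blast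
      then have "y \<in> K n" using z[of y n] by blast
      then show "f y = 0" using elim n mult_eq_0_iff by blast
    qed
  qed
qed

lemma plateau_exhausts:
  assumes "x \<in> {a<..<b}"
  shows "\<exists>n0. \<forall>n\<ge>n0. plateau a b (1 / real (Suc n)) x = 1"
proof -
  define m where "m = min (x - a) (b - x) / 2"
  have "m > 0" using assms by (simp add: m_def)
  then obtain n0 where n0: "1 / real (Suc n0) < m" using reals_Archimedean by (auto simp: inverse_eq_divide)
  have "plateau a b (1 / real (Suc n)) x = 1" if "n \<ge> n0" for n
  proof (rule plateau_eq_1)
    have "1 / real (Suc n) \<le> 1 / real (Suc n0)" using that by (intro divide_left_mono) auto
    then have "1 / real (Suc n) < m" using n0 by linarith
    then show "x \<in> {a + 2 * (1 / real (Suc n))..b - 2 * (1 / real (Suc n))}"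
      unfolding m_def by simp
  qed simp
  then show ?thesis by blast
qed

lemma fundamental_lemma_1d:
  assumes f: "L1_loc {a<..<b} f"
    and orth: "\<And>\<psi>. test1 {a<..<b} \<psi> \<Longrightarrow> (LINT x:{a<..<b}|lborel. f x * \<psi> x) = 0"
  shows "AE x in LI a b. f x = 0"
  unfolding AE_LI
proof (rule zero_if_orthogonal_locally[OF f, where \<kappa> = "\<lambda>n. plateau a b (1 / real (Suc n))"
      and K = "\<lambda>n. {a + 1 / real (Suc n)..b - 1 / real (Suc n)}"])
  fix n :: nat
  have d: "0 < 1 / real (Suc n)" by simp
  show "{a + 1 / real (Suc n)..b - 1 / real (Suc n)} \<subseteq> {a<..<b}"
  proof
    fix x assume "x \<in> {a + 1 / real (Suc n)..b - 1 / real (Suc n)}"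
    then show "x \<in> {a<..<b}" using d unfolding atLeastAtMost_iff greaterThanLessThan_iff by linarith
  qed
  show "continuous_on UNIV (plateau a b (1 / real (Suc n)))"
    by (rule smooth_continuous[OF smooth_plateau[OF d]])
  show "plateau a b (1 / real (Suc n)) z = 0" if "z \<notin> {a + 1 / real (Suc n)..b - 1 / real (Suc n)}" for z
    using plateau_support[OF _ d] that by blast
  fix p :: "real \<Rightarrow> real" assume p: "real_polynomial_function p"
  show "(LINT z:{a<..<b}|lborel. f z * (plateau a b (1 / real (Suc n)) z * p z)) = 0"
  proof (rule orth, rule test1I)
    show "smooth (\<lambda>x. plateau a b (1 / real (Suc n)) x * p x)"
      by (rule smooth_mult[OF smooth_plateau[OF d] smooth_real_polynomial[OF p]])
    show "x \<in> {a + 1 / real (Suc n)..b - 1 / real (Suc n)}" if "plateau a b (1 / real (Suc n)) x * p x \<noteq> 0" for x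
      by (rule plateau_support[OF _ d]) (use that in auto)
  qed fact
next
  show "\<exists>n. plateau a b (1 / real (Suc n)) z \<noteq> 0" if "z \<in> {a<..<b}" for z
    using plateau_exhausts[OF that] by (metis order_refl zero_neq_one)
qed simp

lemma fundamental_lemma_2d:
  assumes f: "L1_loc (Cyl T) f"
    and orth: "\<And>\<phi>. test2 (Cyl T) \<phi> \<Longrightarrow> (LINT z:Cyl T|lborel. f z * \<phi> (fst z) (snd z)) = 0"
  shows "AE z in LC T. f z = 0"
  unfolding AE_LC
proof (rule zero_if_orthogonal_locally[OF f,
      where \<kappa> = "\<lambda>n z. plateau 0 T (1 / real (Suc n)) (fst z) * plateau 0 1 (1 / real (Suc n)) (snd z)"
      and K = "\<lambda>n. {0 + 1 / real (Suc n)..T - 1 / real (Suc n)} \<times> {0 + 1 / real (Suc n)..1 - 1 / real (Suc n)}"])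
  fix n :: nat
  let ?d = "1 / real (Suc n)"
  let ?K = "{0 + ?d..T - ?d} \<times> {0 + ?d..1 - ?d}"
  let ?k = "\<lambda>t x. plateau 0 T ?d t * plateau 0 1 ?d x"
  have d: "0 < ?d" by simp
  show K: "?K \<subseteq> Cyl T"
  proof
    fix z assume "z \<in> ?K"
    then show "z \<in> Cyl T" using d unfolding mem_Times_iff atLeastAtMost_iff greaterThanLessThan_iff by linarith
  qed
  show "compact ?K" by (rule compact_Times[OF compact_Icc compact_Icc])
  have s: "smooth2 ?k" by (rule smooth2_tensor[OF smooth_plateau[OF d] smooth_plateau[OF d]])
  show "continuous_on UNIV (\<lambda>z. ?k (fst z) (snd z))"
    using smooth2_D(3)[OF s] by (simp add: case_prod_unfold)
  have z: "t \<in> {0 + ?d..T - ?d} \<and> x \<in> {0 + ?d..1 - ?d}" if "?k t x \<noteq> 0" for t x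
    using plateau_support[OF _ d, of 0 T t] plateau_support[OF _ d, of 0 1 x] that by simp
  show "?k (fst z) (snd z) = 0" if "z \<notin> ?K" for z
    using z[of "fst z" "snd z"] that by (metis mem_Times_iff)
  fix p :: "real \<times> real \<Rightarrow> real" assume p: "real_polynomial_function p"
  have "(LINT z:Cyl T|lborel. f z * (?k (fst z) (snd z) * p (fst z, snd z))) = 0"
  proof (rule orth, rule test2I)
    show "smooth2 (\<lambda>t x. ?k t x * p (t, x))" by (rule smooth2_mult[OF s smooth2_polynomial[OF p]])
    show "t \<in> {0 + ?d..T - ?d} \<and> x \<in> {0 + ?d..1 - ?d}" if "?k t x * p (t, x) \<noteq> 0" for t x
      by (rule z) (use that in auto)
  qed (rule K)
  then show "(LINT z:Cyl T|lborel. f z * (?k (fst z) (snd z) * p z)) = 0" by simp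
next
  fix z assume z: "z \<in> Cyl T"
  have "fst z \<in> {0<..<T}" "snd z \<in> {0<..<1}" using z by (auto simp: mem_Times_iff)
  note z = this
  obtain n1 where n1: "\<forall>n\<ge>n1. plateau 0 T (1 / real (Suc n)) (fst z) = 1"
    using plateau_exhausts[OF z(1)] by blast
  obtain n2 where n2: "\<forall>n\<ge>n2. plateau 0 1 (1 / real (Suc n)) (snd z) = 1"
    using plateau_exhausts[OF z(2)] by blast
  show "\<exists>n. plateau 0 T (1 / real (Suc n)) (fst z) * plateau 0 1 (1 / real (Suc n)) (snd z) \<noteq> 0"
    using n1[rule_format, of "max n1 n2"] n2[rule_format, of "max n1 n2"]
    by (intro exI[of _ "max n1 n2"]) simp
qed

section \<open>Weak derivatives in one variable\<close>

lemma integrable_L1_loc: "integrable (LI a b) f \<Longrightarrow> L1_loc {a<..<b} f"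
  unfolding L1_loc_def set_integrable_LI[symmetric]
  by (intro allI impI, elim conjE, rule set_integrable_subset) (auto intro: borel_compact)

lemma integrable_L1_loc2: "integrable (LC T) f \<Longrightarrow> L1_loc (Cyl T) f"
  unfolding L1_loc_def set_integrable_LC[symmetric]
  by (intro allI impI, elim conjE, rule set_integrable_subset) (auto intro: borel_compact)

lemma L1_loc_diff: "\<lbrakk>L1_loc S f; L1_loc S g\<rbrakk> \<Longrightarrow> L1_loc S (\<lambda>x. f x - g x)"
  unfolding L1_loc_def by (auto intro: set_integral_diff)

lemma L1_loc_test1:
  assumes f: "L1_loc {a<..<b} f" and \<psi>: "test1 {a<..<b} \<psi>" and ab: "a < b"
  shows "integrable (LI a b) (\<lambda>x. f x * \<psi> x)" "integrable (LI a b) (\<lambda>x. f x * deriv \<psi> x)"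
proof -
  obtain c d where cd: "a < c" "c \<le> d" "d < b" "\<And>x. \<psi> x \<noteq> 0 \<Longrightarrow> x \<in> {c..d}"
    "\<And>x. x \<notin> {c..d} \<Longrightarrow> deriv \<psi> x = 0" by (rule test1_support[OF \<psi> ab]) blast
  have K: "{c..d} \<subseteq> {a<..<b}" using cd by auto
  show "integrable (LI a b) (\<lambda>x. f x * \<psi> x)" "integrable (LI a b) (\<lambda>x. f x * deriv \<psi> x)"
    unfolding set_integrable_LI[symmetric]
    by (rule L1_loc_mult(2)[OF f compact_Icc K smooth_continuous[OF test1_smooth[OF \<psi>]]], use cd(4) in blast)
       (rule L1_loc_mult(2)[OF f compact_Icc K smooth_continuous[OF smooth_deriv[OF test1_smooth[OF \<psi>]]]], use cd(5) in blast)
qed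

lemma has_weak_deriv_LI:
  "has_weak_deriv a b f g \<longleftrightarrow> L1_loc {a<..<b} f \<and> L1_loc {a<..<b} g \<and>
     (\<forall>\<psi>. test1 {a<..<b} \<psi> \<longrightarrow> (LINT x|LI a b. f x * deriv \<psi> x) = - (LINT x|LI a b. g x * \<psi> x))"
  by (simp add: has_weak_deriv_def set_integral_LI)

lemma weak_deriv_diff:
  assumes 1: "has_weak_deriv a b f1 g1" and 2: "has_weak_deriv a b f2 g2" and ab: "a < b"
  shows "has_weak_deriv a b (\<lambda>x. f1 x - f2 x) (\<lambda>x. g1 x - g2 x)"
proof -
  have L: "L1_loc {a<..<b} f1" "L1_loc {a<..<b} g1" "L1_loc {a<..<b} f2" "L1_loc {a<..<b} g2"
    using 1 2 by (auto simp: has_weak_deriv_LI)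
  show ?thesis unfolding has_weak_deriv_LI
  proof (intro conjI allI impI)
    fix \<psi> assume \<psi>: "test1 {a<..<b} \<psi>"
    note i = L1_loc_test1[OF L(1) \<psi> ab] L1_loc_test1[OF L(2) \<psi> ab] L1_loc_test1[OF L(3) \<psi> ab] L1_loc_test1[OF L(4) \<psi> ab]
    have "(LINT x|LI a b. f1 x * deriv \<psi> x) = - (LINT x|LI a b. g1 x * \<psi> x)"
      "(LINT x|LI a b. f2 x * deriv \<psi> x) = - (LINT x|LI a b. g2 x * \<psi> x)"
      using 1 2 \<psi> by (auto simp: has_weak_deriv_LI)
    then show "(LINT x|LI a b. (f1 x - f2 x) * deriv \<psi> x) = - (LINT x|LI a b. (g1 x - g2 x) * \<psi> x)"
      using i by (simp add: left_diff_distrib)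
  qed (auto intro: L1_loc_diff L)
qed

lemma weak_deriv_unique:
  assumes 1: "has_weak_deriv a b f g" and 2: "has_weak_deriv a b f' g'" and ab: "a < b"
    and e: "AE x in LI a b. f x = f' x"
  shows "AE x in LI a b. g x = g' x"
proof -
  note d = weak_deriv_diff[OF 1 2 ab]
  have "AE x in LI a b. g x - g' x = 0"
  proof (rule fundamental_lemma_1d)
    show "L1_loc {a<..<b} (\<lambda>x. g x - g' x)" using d by (simp add: has_weak_deriv_LI)
    fix \<psi> assume \<psi>: "test1 {a<..<b} \<psi>"
    have "(LINT x|LI a b. (f x - f' x) * deriv \<psi> x) = 0"
      by (rule integral_eq_zero_AE) (use e in eventually_elim, simp)
    then show "(LINT x:{a<..<b}|lborel. (g x - g' x) * \<psi> x) = 0"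
      using d \<psi> by (simp add: has_weak_deriv_LI set_integral_LI)
  qed
  then show ?thesis by simp
qed

lemma wderiv_AE:
  assumes "has_weak_deriv a b f g" "a < b"
  shows "AE x in LI a b. wderiv a b f x = g x"
proof -
  have "has_weak_deriv a b f (wderiv a b f)" unfolding wderiv_def by (rule someI[of _ g]) (rule assms)
  from weak_deriv_unique[OF this assms] show ?thesis by simp
qed

lemma weak_deriv_subinterval:
  assumes w: "has_weak_deriv a b f g" and ac: "a \<le> c" "c < d" "d \<le> b"
  shows "has_weak_deriv c d f g"
proof -
  have L: "L1_loc {a<..<b} f" "L1_loc {a<..<b} g" using w by (auto simp: has_weak_deriv_def)
  have s: "{c<..<d} \<subseteq> {a<..<b}" using ac by auto
  have L': "L1_loc {c<..<d} f" "L1_loc {c<..<d} g"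
    using L s unfolding L1_loc_def by (meson order_trans)+
  show ?thesis unfolding has_weak_deriv_def
  proof (intro conjI allI impI L')
    fix \<psi> assume \<psi>: "test1 {c<..<d} \<psi>"
    obtain m n where mn: "c < m" "m \<le> n" "n < d" "\<And>x. \<psi> x \<noteq> 0 \<Longrightarrow> x \<in> {m..n}"
      "\<And>x. x \<notin> {m..n} \<Longrightarrow> deriv \<psi> x = 0" by (rule test1_support[OF \<psi> ac(2)]) blast
    have K: "{m..n} \<subseteq> {c<..<d}" "{m..n} \<subseteq> {a<..<b}" using mn s by auto
    have \<psi>': "test1 {a<..<b} \<psi>" using \<psi> s by (auto simp: test1_def)
    have z: "\<psi> x = 0" if "x \<notin> {m..n}" for x using mn(4) that by blast
    note c1 = smooth_continuous[OF test1_smooth[OF \<psi>]]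
    note c2 = smooth_continuous[OF smooth_deriv[OF test1_smooth[OF \<psi>]]]
    have "(LINT x:{c<..<d}|lborel. f x * deriv \<psi> x) = (LINT x:{m..n}|lborel. f x * deriv \<psi> x)"
      by (rule L1_loc_mult(3)[OF L'(1) compact_Icc K(1) c2 mn(5)])
    also have "\<dots> = (LINT x:{a<..<b}|lborel. f x * deriv \<psi> x)"
      by (rule L1_loc_mult(3)[OF L(1) compact_Icc K(2) c2 mn(5), symmetric])
    also have "\<dots> = - (LINT x:{a<..<b}|lborel. g x * \<psi> x)" using w \<psi>' by (simp add: has_weak_deriv_def)
    also have "(LINT x:{a<..<b}|lborel. g x * \<psi> x) = (LINT x:{m..n}|lborel. g x * \<psi> x)"
      by (rule L1_loc_mult(3)[OF L(2) compact_Icc K(2) c1 z])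
    also have "\<dots> = (LINT x:{c<..<d}|lborel. g x * \<psi> x)"
      by (rule L1_loc_mult(3)[OF L'(2) compact_Icc K(1) c1 z, symmetric])
    finally show "(LINT x:{c<..<d}|lborel. f x * deriv \<psi> x) = - (LINT x:{c<..<d}|lborel. g x * \<psi> x)" .
  qed
qed

lemma FTC_LI:
  assumes d: "\<And>x. (F has_real_derivative f x) (at x)" and c: "\<And>x. isCont f x" and ab: "a \<le> b"
  shows "integrable (LI a b) f" "integral\<^sup>L (LI a b) f = F b - F a"
proof -
  have h: "has_bochner_integral lborel (\<lambda>x. f x * indicator {a..b} x) (F b - F a)"
    by (rule has_bochner_integral_FTC_Icc_real[OF ab d c])
  have ae: "AE x in lborel. x \<noteq> a \<and> x \<noteq> b"
    using AE_lborel_singleton[of a] AE_lborel_singleton[of b] by eventually_elim simp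
  have fm: "f \<in> borel_measurable borel"
    by (intro borel_measurable_continuous_onI continuous_at_imp_continuous_on) (use c in simp)
  have "has_bochner_integral lborel (\<lambda>x. indicator {a<..<b} x *\<^sub>R f x) (F b - F a)"
  proof (rule has_bochner_integral_cong_AE[THEN iffD1, OF _ _ _ h])
    show "AE x in lborel. f x * indicator {a..b} x = indicator {a<..<b} x *\<^sub>R f x"
      using ae by eventually_elim (auto simp: indicator_def)
    show "(\<lambda>x. f x * indicator {a..b} x) \<in> borel_measurable lborel"
      using fm by measurable
    show "(\<lambda>x. indicator {a<..<b} x *\<^sub>R f x) \<in> borel_measurable lborel"
      using fm by measurable
  qed
  then show "integrable (LI a b) f" "integral\<^sup>L (LI a b) f = F b - F a"
    by (auto simp: LI_def integrable_restrict_space integral_restrict_space has_bochner_integral_iff)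
qed

text \<open>Antiderivatives are taken with respect to the Lebesgue integral over \<open>LI a b\<close>, so that they make sense
  on the whole line; this saves case distinctions at the end points.\<close>

definition primitive :: "real \<Rightarrow> real \<Rightarrow> real \<Rightarrow> (real \<Rightarrow> real) \<Rightarrow> real \<Rightarrow> real" where
  "primitive a b c g y = c + (LINT s|LI a b. (if s < y then g s else 0))"

lemma cut_measurable [measurable]:
  "g \<in> borel_measurable (LI a b) \<Longrightarrow> (\<lambda>s. if s < y then g s else 0 :: real) \<in> borel_measurable (LI a b)"
proof (rule measurable_If)
  have "(\<lambda>s. s) \<in> borel_measurable (LI a b)" by (rule borel_LI) simp
  then show "{s \<in> space (LI a b). s < y} \<in> sets (LI a b)" by measurable
qed simp_all

lemma cut_integrable:
  fixes g :: "real \<Rightarrow> real"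
  assumes "integrable (LI a b) g"
  shows "integrable (LI a b) (\<lambda>s. if s < y then g s else 0)"
  by (rule Bochner_Integration.integrable_bound[OF assms]) (use assms in \<open>auto intro: cut_measurable\<close>)

lemma primitive_left: "primitive a b c g a = c"
proof -
  have "(LINT s|LI a b. (if s < a then g s else 0)) = (LINT s|LI a b. 0)"
    by (rule Bochner_Integration.integral_cong) auto
  then show ?thesis by (simp add: primitive_def)
qed

lemma primitive_bound:
  assumes "integrable (LI a b) g"
  shows "\<bar>primitive a b c g y\<bar> \<le> \<bar>c\<bar> + (LINT s|LI a b. \<bar>g s\<bar>)"
proof -
  have "\<bar>LINT s|LI a b. (if s < y then g s else 0)\<bar> \<le> (LINT s|LI a b. \<bar>if s < y then g s else 0\<bar>)"
    by (rule integral_abs_bound)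
  also have "\<dots> \<le> (LINT s|LI a b. \<bar>g s\<bar>)"
    by (rule integral_mono) (use assms cut_integrable[OF assms] in auto)
  finally show ?thesis by (simp add: primitive_def)
qed

lemma primitive_continuous:
  assumes g: "integrable (LI a b) g"
  shows "continuous_on A (primitive a b c g)"
proof -
  have "isCont (primitive a b c g) y" for y
    unfolding continuous_at_sequentially
  proof (intro allI impI)
    fix Y assume Y: "Y \<longlonglongrightarrow> y"
    have "(\<lambda>n. LINT s|LI a b. (if s < Y n then g s else 0)) \<longlonglongrightarrow> (LINT s|LI a b. (if s < y then g s else 0))"
    proof (rule integral_dominated_convergence[where w = "\<lambda>s. \<bar>g s\<bar>"])
      show "AE s in LI a b. (\<lambda>n. if s < Y n then g s else 0) \<longlonglongrightarrow> (if s < y then g s else 0)"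
      proof -
        have "AE s in LI a b. s \<noteq> y" unfolding AE_LI
          using AE_lborel_singleton[of y] by eventually_elim simp
        then show ?thesis
        proof eventually_elim
          case (elim s)
          have "\<forall>\<^sub>F n in sequentially. (if s < Y n then g s else 0) = (if s < y then g s else 0)"
          proof (cases "s < y")
            case True
            show ?thesis using order_tendstoD(1)[OF Y True] by eventually_elim (simp add: True)
          next
            case False
            then have "y < s" using elim by simp
            show ?thesis using order_tendstoD(2)[OF Y \<open>y < s\<close>] by eventually_elim (use False in simp)
          qed
          then show ?case by (rule tendsto_eventually)
        qed
      qed
    qed (use g in \<open>auto intro: cut_measurable\<close>)
    then show "(primitive a b c g \<circ> Y) \<longlonglongrightarrow> primitive a b c g y"
      unfolding primitive_def comp_def by (rule tendsto_add[OF tendsto_const])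
  qed
  then show ?thesis by (intro continuous_at_imp_continuous_on) blast
qed

lemma primitive_diff:
  assumes "integrable (LI a b) g" "z \<le> y"
  shows "primitive a b c g y - primitive a b c g z = (LINT s|LI a b. indicator {z..<y} s * g s)"
proof -
  have "(LINT s|LI a b. (if s < y then g s else 0)) - (LINT s|LI a b. (if s < z then g s else 0))
    = (LINT s|LI a b. (if s < y then g s else 0) - (if s < z then g s else 0))"
    by (rule Bochner_Integration.integral_diff[symmetric]) (rule cut_integrable assms)+
  also have "\<dots> = (LINT s|LI a b. indicator {z..<y} s * g s)"
    by (rule Bochner_Integration.integral_cong) (use assms(2) in \<open>auto simp: indicator_def\<close>)
  finally show ?thesis by (simp add: primitive_def)
qed

text \<open>The product of the kernel \<open>1(s < y)\<close> with \<open>g(s) \<psi>'(y)\<close> is integrated in either order.\<close>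

lemma primitive_weak_deriv:
  assumes g: "integrable (LI a b) g" and ab: "a < b"
  shows "has_weak_deriv a b (primitive a b c g) g"
proof -
  have pm: "primitive a b c g \<in> borel_measurable borel"
    by (rule borel_measurable_continuous_onI[OF primitive_continuous[OF g]])
  have pint: "integrable (LI a b) (primitive a b c g)"
    by (rule LI.integrable_const_bound[where B = "\<bar>c\<bar> + (LINT s|LI a b. \<bar>g s\<bar>)"])
       (auto intro: borel_LI pm primitive_bound[OF g])
  show ?thesis unfolding has_weak_deriv_LI
  proof (intro conjI allI impI integrable_L1_loc pint g)
    fix \<psi> assume \<psi>: "test1 {a<..<b} \<psi>"
    note s = test1_smooth[OF \<psi>]
    obtain m n where mn: "a < m" "m \<le> n" "n < b" "\<And>x. \<psi> x \<noteq> 0 \<Longrightarrow> x \<in> {m..n}"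
      "\<And>x. x \<notin> {m..n} \<Longrightarrow> deriv \<psi> x = 0" by (rule test1_support[OF \<psi> ab]) blast
    have \<psi>ab: "\<psi> a = 0" "\<psi> b = 0" using mn(4)[of a] mn(4)[of b] mn(1-3) by (meson atLeastAtMost_iff not_le)+
    have cont: "isCont (deriv \<psi>) x" for x
      using smooth_continuous[OF smooth_deriv[OF s], of UNIV] by (simp add: continuous_on_eq_continuous_at)
    note F = FTC_LI[OF smooth_DERIV[OF s] cont]
    have dm: "deriv \<psi> \<in> borel_measurable (LI a b)"
      by (rule borel_LI[OF borel_measurable_continuous_onI[OF smooth_continuous[OF smooth_deriv[OF s]]]])
    have gm: "g \<in> borel_measurable (LI a b)" using g by simp
    have "bounded (deriv \<psi> ` {m..n})"
      by (intro compact_imp_bounded compact_continuous_image smooth_continuous smooth_deriv s) auto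
    then obtain B where B: "\<forall>x\<in>{m..n}. \<bar>deriv \<psi> x\<bar> \<le> B" unfolding bounded_iff by (metis imageI real_norm_def)
    have B': "\<bar>deriv \<psi> x\<bar> \<le> \<bar>B\<bar>" for x
    proof (cases "x \<in> {m..n}")
      case True then show ?thesis using B by force
    qed (simp add: mn(5))
    interpret P: pair_sigma_finite "LI a b" "LI a b" by (rule pair_LI)
    define k where "k = (\<lambda>y s. (if s < y then g s else 0) * deriv \<psi> y)"
    have km: "case_prod k \<in> borel_measurable (LI a b \<Otimes>\<^sub>M LI a b)"
      unfolding k_def case_prod_unfold
    proof (rule borel_measurable_times)
      show "(\<lambda>z. deriv \<psi> (fst z)) \<in> borel_measurable (LI a b \<Otimes>\<^sub>M LI a b)"
        by (rule measurable_compose[OF measurable_fst dm])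
      show "(\<lambda>z. if snd z < fst z then g (snd z) else 0) \<in> borel_measurable (LI a b \<Otimes>\<^sub>M LI a b)"
      proof (rule measurable_If)
        show "(\<lambda>z. g (snd z)) \<in> borel_measurable (LI a b \<Otimes>\<^sub>M LI a b)"
          by (rule measurable_compose[OF measurable_snd gm])
        have "fst \<in> borel_measurable (LI a b \<Otimes>\<^sub>M LI a b)" "snd \<in> borel_measurable (LI a b \<Otimes>\<^sub>M LI a b)"
          by (rule measurable_compose[OF measurable_fst borel_LI[OF measurable_ident_sets[OF refl]]]
              measurable_compose[OF measurable_snd borel_LI[OF measurable_ident_sets[OF refl]]])+
        then show "{z \<in> space (LI a b \<Otimes>\<^sub>M LI a b). snd z < fst z} \<in> sets (LI a b \<Otimes>\<^sub>M LI a b)"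
          by measurable
      qed simp
    qed
    have ks: "integrable (LI a b) (\<lambda>s. k y s)" for y
      unfolding k_def by (intro integrable_mult_left cut_integrable g)
    have kn: "(LINT s|LI a b. norm (k y s)) \<le> (LINT s|LI a b. \<bar>g s\<bar>) * \<bar>B\<bar>" for y
    proof -
      have "(LINT s|LI a b. norm (k y s)) \<le> (LINT s|LI a b. \<bar>g s\<bar> * \<bar>B\<bar>)"
      proof (rule integral_mono)
        show "integrable (LI a b) (\<lambda>s. norm (k y s))" using ks by simp
        show "integrable (LI a b) (\<lambda>s. \<bar>g s\<bar> * \<bar>B\<bar>)" using g by simp
        show "norm (k y s) \<le> \<bar>g s\<bar> * \<bar>B\<bar>" for s
          unfolding k_def real_norm_def abs_mult by (rule mult_mono) (auto simp: B')
      qed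
      then show ?thesis by simp
    qed
    have kint: "integrable (LI a b \<Otimes>\<^sub>M LI a b) (case_prod k)"
    proof (rule P.Fubini_integrable[OF km])
      show "integrable (LI a b) (\<lambda>y. LINT s|LI a b. norm (case_prod k (y, s)))"
      proof (rule LI.integrable_const_bound[where B = "(LINT s|LI a b. \<bar>g s\<bar>) * \<bar>B\<bar>"])
        show "AE y in LI a b. norm (LINT s|LI a b. norm (case_prod k (y, s))) \<le> (LINT s|LI a b. \<bar>g s\<bar>) * \<bar>B\<bar>"
          using kn by (simp add: integral_nonneg_AE)
        show "(\<lambda>y. LINT s|LI a b. norm (case_prod k (y, s))) \<in> borel_measurable (LI a b)"
          by (rule LI.borel_measurable_lebesgue_integral)
             (use km in \<open>simp add: case_prod_unfold\<close>)
      qed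
    qed (simp add: ks)
    have dint: "integrable (LI a b) (deriv \<psi>)" using F(1)[of a b] ab by simp
    have "(LINT y|LI a b. primitive a b c g y * deriv \<psi> y)
       = (LINT y|LI a b. c * deriv \<psi> y + (LINT s|LI a b. k y s))"
      by (simp add: primitive_def k_def distrib_right)
    also have "\<dots> = c * (LINT y|LI a b. deriv \<psi> y) + (LINT y|LI a b. (LINT s|LI a b. k y s))"
      using dint P.integrable_fst'[OF kint] by simp
    also have "(LINT y|LI a b. deriv \<psi> y) = 0" using F(2)[of a b] ab \<psi>ab by simp
    also have "(LINT y|LI a b. (LINT s|LI a b. k y s)) = (LINT s|LI a b. (LINT y|LI a b. k y s))"
      by (rule P.Fubini_integral[OF kint, symmetric])
    also have "\<dots> = (LINT s|LI a b. - (g s * \<psi> s))"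
    proof (rule Bochner_Integration.integral_cong[OF refl])
      fix s assume "s \<in> space (LI a b)"
      then have s: "a < s" "s < b" by auto
      have "(LINT y|LI a b. k y s) = (LINT y|LI a b. g s * (if s < y then deriv \<psi> y else 0))"
        unfolding k_def by (rule Bochner_Integration.integral_cong) auto
      also have "\<dots> = g s * (LINT y|LI a b. (if s < y then deriv \<psi> y else 0))" by simp
      also have "(LINT y|LI a b. (if s < y then deriv \<psi> y else 0)) = integral\<^sup>L (LI s b) (deriv \<psi>)"
        unfolding set_integral_LI[symmetric] set_lebesgue_integral_def
        by (rule Bochner_Integration.integral_cong) (use s in \<open>auto simp: indicator_def\<close>)
      also have "\<dots> = - \<psi> s" using F(2)[of s b] s \<psi>ab by simp
      finally show "(LINT y|LI a b. k y s) = - (g s * \<psi> s)" by simp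
    qed
    also have "\<dots> = - (LINT s|LI a b. g s * \<psi> s)" by simp
    finally show "(LINT x|LI a b. primitive a b c g x * deriv \<psi> x) = - (LINT x|LI a b. g x * \<psi> x)" by simp
  qed
qed

text \<open>A test function minus the multiple of a fixed plateau that has the same integral is the derivative of a
  test function, so it is annihilated by \<open>f\<close>; hence \<open>f\<close> is orthogonal to test functions up to a constant.\<close>

lemma weak_deriv_zero_const:
  assumes w: "has_weak_deriv a b f (\<lambda>_. 0)" and ab: "a < b"
  shows "\<exists>c. AE x in LI a b. f x = c"
proof -
  have L: "L1_loc {a<..<b} f" using w by (simp add: has_weak_deriv_LI)
  define \<delta> where "\<delta> = (b - a) / 8"
  have d: "\<delta> > 0" using ab by (simp add: \<delta>_def)
  define \<kappa> where "\<kappa> = plateau a b \<delta>"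
  have \<kappa>: "test1 {a<..<b} \<kappa>" unfolding \<kappa>_def by (rule test1_plateau[OF d])
  have one: "L1_loc {a<..<b} (\<lambda>_. 1)" by (rule integrable_L1_loc) simp
  have \<kappa>i: "integrable (LI a b) \<kappa>" using L1_loc_test1(1)[OF one \<kappa> ab] by simp
  define I where "I = integral\<^sup>L (LI a b) \<kappa>"
  have "I > 0"
  proof -
    have "\<not> (AE x in LI a b. \<kappa> x = 0)"
    proof
      assume "AE x in LI a b. \<kappa> x = 0"
      then have "AE x in lborel. x \<in> {a<..<b} \<longrightarrow> \<kappa> x = 0" by (simp add: AE_LI)
      then have "AE x in lborel. x \<notin> {a+2*\<delta>..b-2*\<delta>}"
      proof eventually_elim
        case (elim x)
        show ?case
        proof
          assume x: "x \<in> {a+2*\<delta>..b-2*\<delta>}"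
          then have "\<kappa> x = 1" unfolding \<kappa>_def by (rule plateau_eq_1[OF _ d])
          moreover have "x \<in> {a<..<b}" using x d by auto
          ultimately show False using elim by simp
        qed
      qed
      then have "emeasure lborel {a+2*\<delta>..b-2*\<delta>} = 0"
        by (subst (asm) AE_iff_null_sets[symmetric]) (auto simp: null_sets_def)
      then show False using ab by (simp add: \<delta>_def field_simps)
    qed
    moreover have "I \<ge> 0" unfolding I_def \<kappa>_def by (rule integral_nonneg_AE) (simp add: plateau_ge)
    moreover have "I = 0 \<longleftrightarrow> (AE x in LI a b. \<kappa> x = 0)"
      unfolding I_def by (rule integral_nonneg_eq_0_iff_AE[OF \<kappa>i]) (simp add: \<kappa>_def plateau_ge)
    ultimately show ?thesis by linarith
  qed
  define c where "c = (LINT x|LI a b. f x * \<kappa> x) / I"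
  have "AE x in LI a b. f x - c = 0"
  proof (rule fundamental_lemma_1d)
    show "L1_loc {a<..<b} (\<lambda>x. f x - c)"
      by (rule L1_loc_diff[OF L integrable_L1_loc]) simp
    fix \<phi> assume \<phi>: "test1 {a<..<b} \<phi>"
    have \<phi>i: "integrable (LI a b) \<phi>" using L1_loc_test1(1)[OF one \<phi> ab] by simp
    define J where "J = integral\<^sup>L (LI a b) \<phi> / I"
    define k where "k = (\<lambda>x. \<phi> x + (- J) * \<kappa> x)"
    have ks: "smooth k" unfolding k_def
      by (rule smooth_add[OF test1_smooth[OF \<phi>] smooth_mult[OF smooth_const test1_smooth[OF \<kappa>]]])
    obtain m n where mn: "a < m" "m \<le> n" "n < b" "\<And>x. \<phi> x \<noteq> 0 \<Longrightarrow> x \<in> {m..n}"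
      "\<And>x. x \<notin> {m..n} \<Longrightarrow> deriv \<phi> x = 0" by (rule test1_support[OF \<phi> ab]) blast
    obtain m' n' where mn': "a < m'" "m' \<le> n'" "n' < b" "\<And>x. \<kappa> x \<noteq> 0 \<Longrightarrow> x \<in> {m'..n'}"
      "\<And>x. x \<notin> {m'..n'} \<Longrightarrow> deriv \<kappa> x = 0" by (rule test1_support[OF \<kappa> ab]) blast
    define p q where "p = (a + min m m') / 2" and "q = max n n'"
    have pq: "a < p" "p < q" "q < b" "p < m" "p < m'" using mn(1-3) mn'(1-3) by (auto simp: p_def q_def)
    have \<phi>0: "\<phi> x = 0" if "x \<le> p \<or> q < x" for x
    proof (rule ccontr)
      assume "\<phi> x \<noteq> 0" from mn(4)[OF this] show False using that pq by (auto simp: q_def)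
    qed
    have \<kappa>0: "\<kappa> x = 0" if "x \<le> p \<or> q < x" for x
    proof (rule ccontr)
      assume "\<kappa> x \<noteq> 0" from mn'(4)[OF this] show False using that pq by (auto simp: q_def)
    qed
    have k0: "k x = 0" if "x \<le> p \<or> q < x" for x using \<phi>0[OF that] \<kappa>0[OF that] by (simp add: k_def)
    obtain G where G: "smooth G" "\<forall>x. (G has_real_derivative k x) (at x)" "\<forall>x\<le>p. G x = 0"
      using smooth_primitive[OF ks, of p] k0 by blast
    have kc: "isCont k x" for x
      using smooth_continuous[OF ks, of UNIV] by (simp add: continuous_on_eq_continuous_at)
    have "G b - G a = integral\<^sup>L (LI a b) k"
      using FTC_LI(2)[of G k a b] G(2) kc ab by simp
    also have "\<dots> = 0" using \<phi>i \<kappa>i \<open>I > 0\<close> by (simp add: k_def J_def I_def)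
    finally have Gb: "G b = 0" using G(3) pq by simp
    have G0: "G x = 0" if "q < x" for x
    proof -
      have "G y = G x" if xy: "q < x" "x < y" for x y
      proof -
        obtain z where "x < z" "z < y" "G y - G x = (y - x) * k z"
          using MVT2[OF xy(2), of G k] G(2) by blast
        then show ?thesis using k0[of z] xy by simp
      qed
      from this[of x b] this[of b x] show ?thesis using that pq Gb by (cases x b rule: linorder_cases) auto
    qed
    have Gt: "test1 {a<..<b} G"
    proof (rule test1I[OF G(1)])
      show "x \<in> {p..q}" if "G x \<noteq> 0" for x
        using that G(3) G0[of x] by (metis atLeastAtMost_iff linear not_le)
      show "{p..q} \<subseteq> {a<..<b}" using pq by auto
    qed
    have dG: "deriv G = k" using G(2) DERIV_imp_deriv by blast
    have i1: "integrable (LI a b) (\<lambda>x. f x * \<phi> x)" "integrable (LI a b) (\<lambda>x. f x * \<kappa> x)"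
      by (rule L1_loc_test1(1)[OF L \<phi> ab] L1_loc_test1(1)[OF L \<kappa> ab])+
    have "(LINT x|LI a b. f x * k x) = 0" using w Gt unfolding has_weak_deriv_LI dG[symmetric] by simp
    also have "(LINT x|LI a b. f x * k x) = (LINT x|LI a b. f x * \<phi> x - J * (f x * \<kappa> x))"
      by (rule Bochner_Integration.integral_cong) (auto simp: k_def algebra_simps)
    also have "\<dots> = (LINT x|LI a b. f x * \<phi> x) - J * (LINT x|LI a b. f x * \<kappa> x)" using i1 by simp
    finally have e: "(LINT x|LI a b. f x * \<phi> x) = c * integral\<^sup>L (LI a b) \<phi>" by (simp add: J_def c_def)
    have "(LINT x|LI a b. (f x - c) * \<phi> x) = (LINT x|LI a b. f x * \<phi> x - c * \<phi> x)"
      by (rule Bochner_Integration.integral_cong) (auto simp: algebra_simps)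
    also have "\<dots> = 0" using i1 \<phi>i e by simp
    finally show "(LINT x:{a<..<b}|lborel. (f x - c) * \<phi> x) = 0" by (simp add: set_integral_LI)
  qed
  then show ?thesis by (intro exI[of _ c]) simp
qed

lemma weak_deriv_primitive:
  assumes w: "has_weak_deriv a b f g" and g: "integrable (LI a b) g" and ab: "a < b"
  shows "\<exists>c. AE x in LI a b. f x = primitive a b c g x"
proof -
  have "has_weak_deriv a b (\<lambda>x. f x - primitive a b 0 g x) (\<lambda>x. g x - g x)"
    by (rule weak_deriv_diff[OF w primitive_weak_deriv[OF g ab] ab])
  then have "has_weak_deriv a b (\<lambda>x. f x - primitive a b 0 g x) (\<lambda>_. 0)" by simp
  from weak_deriv_zero_const[OF this ab] obtain c where "AE x in LI a b. f x - primitive a b 0 g x = c" by blast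
  then have "AE x in LI a b. f x = primitive a b c g x"
    by eventually_elim (simp add: primitive_def)
  then show ?thesis by blast
qed

section \<open>Lipschitz functions are primitives\<close>

lemma cut_integral:
  assumes "a \<le> y" "y \<le> b"
  shows "(LINT s|LI a b. (if s < y then g s else 0 :: real)) = integral\<^sup>L (LI a y) g"
  unfolding set_integral_LI[symmetric] set_lebesgue_integral_def
  by (rule Bochner_Integration.integral_cong) (use assms in \<open>auto simp: indicator_def\<close>)

text \<open>Rademacher's theorem on an interval, by way of Radon-Nikodym: adding a large linear function makes
  \<open>f\<close> and \<open>-f\<close> monotone, and the measures of the two sums add up to a multiple of Lebesgue measure.\<close>

lemma lipschitz_primitive:
  assumes lip: "L-lipschitz_on {0..T} f" and T: "0 \<le> T"
  shows "\<exists>g C. g \<in> borel_measurable borel \<and> (\<forall>s. \<bar>g s\<bar> \<le> C) \<and>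
    (\<forall>t\<in>{0..T}. f t = primitive 0 T (f 0) g t)"
proof -
  define cl where "cl = (\<lambda>t. max 0 (min T t))"
  have cl: "cl t \<in> {0..T}" for t using T by (auto simp: cl_def)
  have L0: "L \<ge> 0" using lip by (rule lipschitz_on_nonneg)
  define c where "c = L + 1"
  have c0: "c > 0" using L0 by (simp add: c_def)
  have lip': "\<bar>f (cl t) - f (cl s)\<bar> \<le> c * (t - s)" if "s \<le> t" for s t
  proof -
    have "\<bar>f (cl t) - f (cl s)\<bar> \<le> L * \<bar>cl t - cl s\<bar>"
      using lipschitz_onD[OF lip cl cl] by (simp add: dist_real_def)
    also have "\<dots> \<le> c * (t - s)"
      using that L0 by (intro mult_mono) (auto simp: cl_def c_def)
    finally show ?thesis .
  qed
  define F G where "F = (\<lambda>t. c * t + f (cl t))" and "G = (\<lambda>t. c * t - f (cl t))"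
  have mono: "F s \<le> F t" "G s \<le> G t" if "s \<le> t" for s t
    using lip'[OF that] by (auto simp: F_def G_def algebra_simps)
  have "continuous_on UNIV (\<lambda>t. f (cl t))"
    unfolding continuous_on_iff
  proof (intro ballI allI impI)
    fix s e :: real assume "e > 0"
    show "\<exists>d>0. \<forall>t\<in>UNIV. dist t s < d \<longrightarrow> dist (f (cl t)) (f (cl s)) < e"
    proof (intro exI[of _ "e / c"] conjI ballI impI)
      fix t assume "dist t s < e / c"
      then have "c * \<bar>t - s\<bar> < e" using c0 by (simp add: dist_real_def field_simps)
      then show "dist (f (cl t)) (f (cl s)) < e"
        using lip'[of s t] lip'[of t s] by (cases "s \<le> t") (auto simp: dist_real_def)
    qed (use \<open>e > 0\<close> c0 in auto)
  qed
  then have cont: "continuous_on UNIV F" "continuous_on UNIV G"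
    unfolding F_def G_def by (auto intro!: continuous_intros)
  have rc: "continuous (at_right a) F" "continuous (at_right a) G" for a
    using cont by (auto simp: continuous_on_eq_continuous_at intro: continuous_at_imp_continuous_within)
  define \<mu> \<nu> where "\<mu> = interval_measure F" and "\<nu> = interval_measure G"
  have sm: "sets \<mu> = sets borel" "sets \<nu> = sets borel" by (simp_all add: \<mu>_def \<nu>_def)
  have em: "emeasure \<mu> {s..t} = ennreal (F t - F s)" "emeasure \<nu> {s..t} = ennreal (G t - G s)" if "s \<le> t" for s t
    unfolding \<mu>_def \<nu>_def
    by (rule emeasure_interval_measure_Icc[OF that mono(1) cont(1)] emeasure_interval_measure_Icc[OF that mono(2) cont(2)]; assumption)+
  have eo: "emeasure \<mu> {s<..<t} = ennreal (F t - F s)" "emeasure \<nu> {s<..<t} = ennreal (G t - G s)" if "s \<le> t" for s t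
  proof -
    have p: "emeasure \<mu> {u} = 0" "emeasure \<nu> {u} = 0" for u using em[of u u] by auto
    have "emeasure \<mu> ({s..t} - ({s} \<union> {t})) = emeasure \<mu> {s..t}"
      "emeasure \<nu> ({s..t} - ({s} \<union> {t})) = emeasure \<nu> {s..t}"
      by (rule emeasure_Diff_null_set, rule null_sets.Un; simp add: sm null_sets_def p)+
    moreover have "{s..t} - ({s} \<union> {t}) = {s<..<t}" by auto
    ultimately show "emeasure \<mu> {s<..<t} = ennreal (F t - F s)" "emeasure \<nu> {s<..<t} = ennreal (G t - G s)"
      using em[OF that] by simp_all
  qed
  \<comment> \<open>Since \<open>F + G\<close> has constant slope \<open>2c\<close>, the sum of the two measures is \<open>2c\<close> times Lebesgue
    measure, so each of them has a density bounded by \<open>2c\<close>.\<close>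
  define S where "S = measure_of UNIV (sets borel) (\<lambda>A::real set. emeasure \<mu> A + emeasure \<nu> A)"
  have sS: "sets S = sets borel" unfolding S_def by (metis sets.sets_measure_of_eq space_borel)
  have eS: "emeasure S A = emeasure \<mu> A + emeasure \<nu> A" if "A \<in> sets borel" for A
  proof (rule emeasure_measure_of[OF S_def])
    show "sets borel \<subseteq> Pow (UNIV :: real set)" by simp
    show "A \<in> sets S" using that sS by simp
    show "positive (sets S) (\<lambda>A. emeasure \<mu> A + emeasure \<nu> A)" by (simp add: positive_def)
    show "countably_additive (sets S) (\<lambda>A. emeasure \<mu> A + emeasure \<nu> A)"
    proof (rule countably_additiveI)
      fix B :: "nat \<Rightarrow> real set" assume B: "range B \<subseteq> sets S" "disjoint_family B"
      have "(\<Sum>i. emeasure \<mu> (B i) + emeasure \<nu> (B i)) = (\<Sum>i. emeasure \<mu> (B i)) + (\<Sum>i. emeasure \<nu> (B i))"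
        by (rule suminf_add[symmetric]) auto
      also have "\<dots> = emeasure \<mu> (\<Union> (range B)) + emeasure \<nu> (\<Union> (range B))"
        using B suminf_emeasure[of B \<mu>] suminf_emeasure[of B \<nu>] by (simp add: sS sm)
      finally show "(\<Sum>i. emeasure \<mu> (B i) + emeasure \<nu> (B i)) = emeasure \<mu> (\<Union> (range B)) + emeasure \<nu> (\<Union> (range B))" .
    qed
  qed
  have "lborel = scale_measure (ennreal (1 / (2 * c))) S"
  proof (rule lborel_eqI)
    fix l u :: real assume "\<And>b. b \<in> Basis \<Longrightarrow> l \<bullet> b \<le> u \<bullet> b"
    then have lu: "l \<le> u" by simp
    have "emeasure S {l<..<u} = ennreal (F u - F l) + ennreal (G u - G l)" by (simp add: eS eo lu)
    also have "\<dots> = ennreal ((F u - F l) + (G u - G l))"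
      by (rule ennreal_plus[symmetric]) (simp_all add: mono lu)
    also have "(F u - F l) + (G u - G l) = 2 * c * (u - l)" by (simp add: F_def G_def algebra_simps)
    finally have "emeasure (scale_measure (ennreal (1 / (2 * c))) S) {l<..<u} = ennreal (1 / (2*c) * (2 * c * (u - l)))"
      using c0 lu by (subst ennreal_mult) auto
    then show "emeasure (scale_measure (ennreal (1 / (2 * c))) S) (box l u) = ennreal (\<Prod>b\<in>Basis. (u - l) \<bullet> b)"
      using c0 by (simp add: box_real)
  qed (simp add: sS)
  then have el: "emeasure lborel A = ennreal (1 / (2 * c)) * (emeasure \<mu> A + emeasure \<nu> A)" if "A \<in> sets borel" for A
    using eS[OF that] by (metis emeasure_scale_measure)
  have ac: "absolutely_continuous lborel \<mu>" "absolutely_continuous lborel \<nu>"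
    unfolding absolutely_continuous_def null_sets_def using el c0 by (auto simp: sm ennreal_zero_less_one)
  obtain d where d: "d \<in> borel_measurable lborel" "density lborel d = \<mu>"
    using sigma_finite_measure.Radon_Nikodym[OF sigma_finite_lborel ac(1)] sm by auto
  obtain d' where d': "d' \<in> borel_measurable lborel" "density lborel d' = \<nu>"
    using sigma_finite_measure.Radon_Nikodym[OF sigma_finite_lborel ac(2)] sm by auto
  have "density lborel (\<lambda>x. d x + d' x) = density lborel (\<lambda>_. ennreal (2 * c))"
  proof (rule measure_eqI)
    fix A assume "A \<in> sets (density lborel (\<lambda>x. d x + d' x))"
    then have A: "A \<in> sets borel" by simp
    have m: "(\<lambda>x. d x * indicator A x) \<in> borel_measurable lborel" "(\<lambda>x. d' x * indicator A x) \<in> borel_measurable lborel"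
      using d(1) d'(1) A by measurable
    have "emeasure (density lborel (\<lambda>x. d x + d' x)) A = (\<integral>\<^sup>+x. d x * indicator A x + d' x * indicator A x \<partial>lborel)"
      using d(1) d'(1) A by (subst emeasure_density) (auto simp: distrib_right)
    also have "\<dots> = emeasure \<mu> A + emeasure \<nu> A"
      using d d' A by (subst nn_integral_add[OF m]) (auto simp: emeasure_density[symmetric])
    also have "\<dots> = ennreal (2 * c) * (ennreal (1 / (2 * c)) * (emeasure \<mu> A + emeasure \<nu> A))"
      using c0 by (simp add: mult.assoc[symmetric] ennreal_mult[symmetric])
    also have "\<dots> = emeasure (density lborel (\<lambda>_. ennreal (2 * c))) A"
      using A by (simp add: el emeasure_density nn_integral_cmult_indicator)
    finally show "emeasure (density lborel (\<lambda>x. d x + d' x)) A = emeasure (density lborel (\<lambda>_. ennreal (2 * c))) A" .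
  qed simp
  then have dd: "AE x in lborel. d x + d' x = ennreal (2 * c)"
    using d(1) d'(1) by (intro sigma_finite_measure.density_unique[OF sigma_finite_lborel]) auto
  define r where "r = (\<lambda>s. enn2real (min (d s) (ennreal (2 * c))))"
  have rm: "r \<in> borel_measurable borel" using d(1) unfolding r_def by simp
  have r0: "0 \<le> r s" "r s \<le> 2 * c" for s
    using enn2real_mono[of "min (d s) (ennreal (2 * c))" "ennreal (2 * c)"] c0 by (auto simp: r_def)
  have rd: "AE s in lborel. ennreal (r s) = d s"
    using dd
  proof eventually_elim
    case (elim s)
    then have "d s \<le> ennreal (2 * c)" by (metis le_iff_add)
    moreover from this have "d s < top" by (metis ennreal_less_top le_less_trans)
    ultimately show ?case by (simp add: r_def min_def)
  qed
  have Fr: "F t - F 0 = integral\<^sup>L (LI 0 t) r" if "0 \<le> t" for t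
  proof -
    have "ennreal (F t - F 0) = (\<integral>\<^sup>+s. d s * indicator {0<..<t} s \<partial>lborel)"
      unfolding eo(1)[OF that, symmetric] d(2)[symmetric] by (rule emeasure_density[OF d(1)]) simp
    also have "\<dots> = (\<integral>\<^sup>+s. ennreal (r s) * indicator {0<..<t} s \<partial>lborel)"
      by (rule nn_integral_cong_AE) (use rd in eventually_elim, simp)
    also have "\<dots> = integral\<^sup>N (LI 0 t) (\<lambda>s. ennreal (r s))" by (rule nn_integral_LI)
    also have "\<dots> = ennreal (integral\<^sup>L (LI 0 t) r)"
      by (rule nn_integral_eq_integral)
         (auto simp: r0 intro!: LI.integrable_const_bound[where B = "2 * c"] borel_LI rm)
    finally show ?thesis using mono(1)[OF that] r0 by (simp add: integral_nonneg_AE)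
  qed
  define g where "g = (\<lambda>s. r s - c)"
  have "f t = primitive 0 T (f 0) g t" if "t \<in> {0..T}" for t
  proof -
    have t: "0 \<le> t" "t \<le> T" using that by auto
    have "primitive 0 T (f 0) g t = f 0 + integral\<^sup>L (LI 0 t) (\<lambda>s. r s - c)"
      using t by (simp add: primitive_def cut_integral g_def)
    also have "integral\<^sup>L (LI 0 t) (\<lambda>s. r s - c) = integral\<^sup>L (LI 0 t) r - integral\<^sup>L (LI 0 t) (\<lambda>s. c)"
      by (rule Bochner_Integration.integral_diff)
         (auto simp: r0 intro!: LI.integrable_const_bound[where B = "2 * c"] borel_LI rm)
    also have "integral\<^sup>L (LI 0 t) (\<lambda>s. c) = c * t"
      using FTC_LI(2)[of "\<lambda>s. c * s" "\<lambda>_. c" 0 t] t by (auto intro!: derivative_eq_intros)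
    also have "integral\<^sup>L (LI 0 t) r = F t - F 0" using Fr[OF t(1)] by simp
    also have "f 0 + (F t - F 0 - c * t) = f t" using t T by (simp add: F_def cl_def)
    finally show ?thesis by simp
  qed
  moreover have "g \<in> borel_measurable borel" unfolding g_def using rm by simp
  moreover have "\<bar>g s\<bar> \<le> c" for s using r0[of s] by (auto simp: g_def)
  ultimately show ?thesis by blast
qed

lemma real_polynomial_antiderivative:
  fixes p :: "real \<Rightarrow> real"
  assumes "real_polynomial_function p"
  shows "\<exists>P. smooth P \<and> (\<forall>x. (P has_real_derivative p x) (at x)) \<and> P 0 = c"
proof -
  obtain a n where p: "p = (\<lambda>x. \<Sum>i\<le>n. a i * x ^ i)"
    using assms real_polynomial_function_iff_sum by blast
  define P where "P = (\<lambda>x. c + (\<Sum>i\<le>n. a i / real (Suc i) * x ^ Suc i))"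
  have D: "(P has_real_derivative p x) (at x)" for x
  proof -
    have "((\<lambda>x. a i / real (Suc i) * x ^ Suc i) has_real_derivative a i * x ^ i) (at x)" for i
      using DERIV_cmult[OF DERIV_pow[of "Suc i" x UNIV], of "a i / real (Suc i)"] by simp
    then have "((\<lambda>x. c + (\<Sum>i\<le>n. a i / real (Suc i) * x ^ Suc i)) has_real_derivative 0 + (\<Sum>i\<le>n. a i * x ^ i)) (at x)"
      by (intro DERIV_add DERIV_const DERIV_sum)
    then show ?thesis unfolding P_def p by simp
  qed
  have "smooth P" by (rule smoothI[OF D smooth_real_polynomial[OF assms]])
  then show ?thesis using D by (intro exI[of _ P]) (simp add: P_def)
qed

text \<open>Polynomials that converge to the derivative boundedly and almost everywhere have antiderivatives
  that converge everywhere.\<close>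

lemma primitive_smooth_approximation:
  assumes g: "g \<in> borel_measurable borel" "\<forall>s. \<bar>g s\<bar> \<le> C" and T: "0 \<le> T"
  shows "\<exists>P p B. (\<forall>n. smooth (P n)) \<and> (\<forall>n x. (P n has_real_derivative p n x) (at x)) \<and>
    (\<forall>n. \<forall>t\<in>{0..T}. \<bar>P n t\<bar> \<le> B \<and> \<bar>p n t\<bar> \<le> B) \<and> (\<forall>n. P n 0 = c) \<and>
    (AE t in LI 0 T. (\<lambda>n. p n t) \<longlonglongrightarrow> g t) \<and> (\<forall>t\<in>{0..T}. (\<lambda>n. P n t) \<longlonglongrightarrow> primitive 0 T c g t)"
proof -
  obtain p where p: "\<forall>n. real_polynomial_function (p n)" "\<forall>n. \<forall>z\<in>{0..T}. \<bar>p n z\<bar> \<le> C + 1"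
    "AE z in lborel. z \<in> {0..T} \<longrightarrow> (\<lambda>n. p n z) \<longlonglongrightarrow> g z"
    using bounded_measurable_polynomial_limit[OF g(1) _ compact_Icc, of C 0 T] g(2) by blast
  have "\<forall>n. \<exists>P. smooth P \<and> (\<forall>x. (P has_real_derivative p n x) (at x)) \<and> P 0 = c"
    using real_polynomial_antiderivative p(1) by blast
  then obtain P where P: "\<forall>n. smooth (P n) \<and> (\<forall>x. (P n has_real_derivative p n x) (at x)) \<and> P n 0 = c"
    by metis
  have C0: "C \<ge> 0" using g(2)[rule_format, of 0] by linarith
  have ps: "smooth (p n)" for n using p(1) smooth_real_polynomial by blast
  have pc: "isCont (p n) x" for n x
    using smooth_continuous[OF ps, of UNIV n] by (simp add: continuous_on_eq_continuous_at)
  have pm: "p n \<in> borel_measurable (LI a b)" for n a b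
    by (rule borel_LI[OF borel_measurable_continuous_onI[OF smooth_continuous[OF ps]]])
  have Pe: "P n t = c + integral\<^sup>L (LI 0 t) (p n)" if "t \<in> {0..T}" for n t
    using FTC_LI(2)[of "P n" "p n" 0 t] P pc that by simp
  have ae: "AE t in LI 0 T. (\<lambda>n. p n t) \<longlonglongrightarrow> g t"
    unfolding AE_LI using p(3) by eventually_elim auto
  have lim: "(\<lambda>n. P n t) \<longlonglongrightarrow> primitive 0 T c g t" if t: "t \<in> {0..T}" for t
  proof -
    have "(\<lambda>n. integral\<^sup>L (LI 0 t) (p n)) \<longlonglongrightarrow> integral\<^sup>L (LI 0 t) g"
    proof (rule integral_dominated_convergence[where w = "\<lambda>_. C + 1"])
      show "AE s in LI 0 t. (\<lambda>n. p n s) \<longlonglongrightarrow> g s"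
        unfolding AE_LI using p(3) by eventually_elim (use t in auto)
      show "AE s in LI 0 t. norm (p n s) \<le> C + 1" for n
        unfolding AE_LI by (rule AE_I2) (use t p(2) in auto)
    qed (auto intro: pm borel_LI g)
    then have "(\<lambda>n. c + integral\<^sup>L (LI 0 t) (p n)) \<longlonglongrightarrow> c + integral\<^sup>L (LI 0 t) g"
      by (rule tendsto_add[OF tendsto_const])
    moreover have "primitive 0 T c g t = c + integral\<^sup>L (LI 0 t) g"
      using t by (simp add: primitive_def cut_integral)
    ultimately show ?thesis using Pe[OF t] by simp
  qed
  define B where "B = \<bar>c\<bar> + (C + 1) * T + (C + 1)"
  have "\<bar>P n t\<bar> \<le> B \<and> \<bar>p n t\<bar> \<le> B" if t: "t \<in> {0..T}" for n t
  proof
    have T0: "0 \<le> (C + 1) * T" using C0 T by simp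
    have "\<bar>p n t\<bar> \<le> C + 1" using p(2) t by blast
    then show "\<bar>p n t\<bar> \<le> B" using T0 abs_ge_zero[of c] unfolding B_def by linarith
    have "\<bar>P n t - P n 0\<bar> \<le> (C + 1) * t"
    proof (cases "t = 0")
      case False
      then have "0 < t" using t by simp
      then obtain z where z: "0 < z" "z < t" "P n t - P n 0 = (t - 0) * p n z"
        using MVT2[of 0 t "P n" "p n"] P by blast
      then have "\<bar>p n z\<bar> \<le> C + 1" using p(2) t by simp
      then have "\<bar>t * p n z\<bar> \<le> t * (C + 1)" unfolding abs_mult using \<open>0 < t\<close> by simp
      then show ?thesis using z(3) by (simp add: mult.commute)
    qed simp
    also have "\<dots> \<le> (C + 1) * T" using t C0 by (intro mult_left_mono) auto
    finally have "\<bar>P n t - c\<bar> \<le> (C + 1) * T" using P by simp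
    then show "\<bar>P n t\<bar> \<le> B" using C0 unfolding B_def by linarith
  qed
  then show ?thesis using P ae lim by (intro exI[of _ P] exI[of _ p] exI[of _ B]) blast
qed

section \<open>Integrals over the space-time cylinder\<close>

abbreviation Cmeas :: "real \<Rightarrow> (real \<Rightarrow> real \<Rightarrow> real) \<Rightarrow> bool" where
  "Cmeas T f \<equiv> (\<lambda>z. f (fst z) (snd z)) \<in> borel_measurable (LC T)"

abbreviation Cint :: "real \<Rightarrow> (real \<Rightarrow> real \<Rightarrow> real) \<Rightarrow> bool" where
  "Cint T f \<equiv> integrable (LC T) (\<lambda>z. f (fst z) (snd z))"

abbreviation CI :: "real \<Rightarrow> (real \<Rightarrow> real \<Rightarrow> real) \<Rightarrow> real" where
  "CI T f \<equiv> (LINT z|LC T. f (fst z) (snd z))"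

lemma AE_LC_I: "(\<And>t x. \<lbrakk>0 < t; t < T; 0 < x; x < 1\<rbrakk> \<Longrightarrow> P (t, x)) \<Longrightarrow> AE z in LC T. P z"
  by (rule AE_I2) (auto simp: space_LC)

lemma AE_LI_I: "(\<And>x. \<lbrakk>a < x; x < b\<rbrakk> \<Longrightarrow> P x) \<Longrightarrow> AE x in LI a b. P x"
  by (rule AE_I2) auto

lemma fst_LC_LI: "fst \<in> measurable (LC T) (LI 0 T)" and snd_LC_LI: "snd \<in> measurable (LC T) (LI 0 1)"
  unfolding LC_def by (rule measurable_fst measurable_snd)+

lemma fst_LC: "fst \<in> borel_measurable (LC T)" and snd_LC: "snd \<in> borel_measurable (LC T)"
  by (rule measurable_compose[OF fst_LC_LI borel_LI[OF measurable_ident_sets[OF refl]]]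
      measurable_compose[OF snd_LC_LI borel_LI[OF measurable_ident_sets[OF refl]]])+

lemma Cmeas_time: "f \<in> borel_measurable (LI 0 T) \<Longrightarrow> Cmeas T (\<lambda>t x. f t)"
  by (rule measurable_compose[OF fst_LC_LI])

lemma Cmeas_space: "f \<in> borel_measurable (LI 0 1) \<Longrightarrow> Cmeas T (\<lambda>t x. f x)"
  by (rule measurable_compose[OF snd_LC_LI])

lemma AE_LC_sections:
  assumes "AE z in LC T. P z"
  shows "AE t in LI 0 T. AE x in LI 0 1. P (t, x)"
  using pair_sigma_finite.AE_pair[OF pair_LI] assms unfolding LC_def by blast

lemma AE_LC_time:
  assumes "AE t in LI 0 T. P t" shows "AE z in LC T. P (fst z)"
proof -
  obtain N where N: "{t \<in> space (LI 0 T). \<not> P t} \<subseteq> N" "emeasure (LI 0 T) N = 0" "N \<in> sets (LI 0 T)"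
    using assms by (auto elim: AE_E)
  have "emeasure (LC T) (N \<times> space (LI 0 1)) = 0"
    unfolding LC_def by (rule trans[OF LI.emeasure_pair_measure_Times[OF N(3) sets.top]]) (simp add: N(2))
  then show ?thesis
    by (intro AE_I[where N = "N \<times> space (LI 0 1)"])
       (use N sets.top[of "LI 0 1"] in \<open>auto simp: LC_def space_pair_measure intro!: pair_measureI\<close>)
qed

lemma AE_LC_space:
  assumes "AE x in LI 0 1. P x" shows "AE z in LC T. P (snd z)"
proof -
  obtain N where N: "{x \<in> space (LI 0 1). \<not> P x} \<subseteq> N" "emeasure (LI 0 1) N = 0" "N \<in> sets (LI 0 1)"
    using assms by (auto elim: AE_E)
  have "emeasure (LC T) (space (LI 0 T) \<times> N) = 0"
    unfolding LC_def by (rule trans[OF LI.emeasure_pair_measure_Times[OF sets.top N(3)]]) (simp add: N(2))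
  then show ?thesis
    by (intro AE_I[where N = "space (LI 0 T) \<times> N"])
       (use N sets.top[of "LI 0 T"] in \<open>auto simp: LC_def space_pair_measure intro!: pair_measureI\<close>)
qed

lemma CI_iterated:
  assumes "Cint T f"
  shows "CI T f = (LINT t|LI 0 T. LINT x|LI 0 1. f t x)"
    "CI T f = (LINT x|LI 0 1. LINT t|LI 0 T. f t x)"
    "integrable (LI 0 T) (\<lambda>t. LINT x|LI 0 1. f t x)"
    "AE t in LI 0 T. integrable (LI 0 1) (f t)"
proof -
  interpret P: pair_sigma_finite "LI 0 T" "LI 0 1" by (rule pair_LI)
  have i: "integrable (LI 0 T \<Otimes>\<^sub>M LI 0 1) (\<lambda>z. f (fst z) (snd z))" using assms by (simp add: LC_def)
  then have i': "integrable (LI 0 T \<Otimes>\<^sub>M LI 0 1) (case_prod f)" by (simp add: case_prod_unfold)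
  show 1: "CI T f = (LINT t|LI 0 T. LINT x|LI 0 1. f t x)"
    using P.integral_fst'[OF i] by (simp add: LC_def)
  show "CI T f = (LINT x|LI 0 1. LINT t|LI 0 T. f t x)"
    unfolding 1 by (rule P.Fubini_integral[OF i', symmetric])
  show "integrable (LI 0 T) (\<lambda>t. LINT x|LI 0 1. f t x)" using P.integrable_fst'[OF i] by simp
  show "AE t in LI 0 T. integrable (LI 0 1) (f t)" using P.AE_integrable_fst'[OF i] by simp
qed

lemma integrable_bounded_mult:
  fixes f g :: "'a \<Rightarrow> real"
  assumes g: "integrable M g" and f: "f \<in> borel_measurable M" "AE x in M. \<bar>f x\<bar> \<le> C"
  shows "integrable M (\<lambda>x. f x * g x)"
proof (rule Bochner_Integration.integrable_bound)
  show "integrable M (\<lambda>x. C * g x)" using g by simp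
  show "(\<lambda>x. f x * g x) \<in> borel_measurable M" using borel_measurable_times[OF f(1)] g by simp
  show "AE x in M. norm (f x * g x) \<le> norm (C * g x)"
    using f(2)
  proof eventually_elim
    case (elim x)
    then have "\<bar>f x\<bar> * \<bar>g x\<bar> \<le> \<bar>C\<bar> * \<bar>g x\<bar>" by (intro mult_right_mono) auto
    then show ?case by (simp add: abs_mult)
  qed
qed

lemma smooth2_meas: "smooth2 f \<Longrightarrow> Cmeas T f"
  using borel_LC[OF borel_measurable_continuous_onI[OF smooth2_D(3)]] by (simp add: case_prod_unfold)

lemma smooth2_bounded:
  assumes "smooth2 f" shows "\<exists>C. \<forall>t\<in>{0..T}. \<forall>x\<in>{0..1}. \<bar>f t x\<bar> \<le> C"
proof -
  have "bounded ((\<lambda>(t, x). f t x) ` ({0..T} \<times> {0..1}))"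
    by (intro compact_imp_bounded compact_continuous_image compact_Times compact_Icc
        continuous_on_subset[OF smooth2_D(3)[OF assms]]) auto
  then obtain C where C: "\<forall>y\<in>(\<lambda>(t, x). f t x) ` ({0..T} \<times> {0..1}). norm y \<le> C"
    unfolding bounded_iff by blast
  have "\<bar>f t x\<bar> \<le> C" if "t \<in> {0..T}" "x \<in> {0..1}" for t x
  proof -
    have "f t x \<in> (\<lambda>(t, x). f t x) ` ({0..T} \<times> {0..1})" using that by force
    then show ?thesis using C by force
  qed
  then show ?thesis by blast
qed

lemma smooth2_Cint:
  assumes "smooth2 f" shows "Cint T f"
proof -
  obtain C where "\<forall>t\<in>{0..T}. \<forall>x\<in>{0..1}. \<bar>f t x\<bar> \<le> C" using smooth2_bounded[OF assms] by blast
  then show ?thesis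
    by (intro LC.integrable_const_bound[where B = C] smooth2_meas assms AE_LC_I) auto
qed

lemma smooth2_isCont: "smooth2 f \<Longrightarrow> isCont (\<lambda>s. f s x) t" "smooth2 f \<Longrightarrow> isCont (f t) x"
  by (rule DERIV_isCont[OF smooth2_D(4)] DERIV_isCont[OF smooth2_D(5)]; assumption)+

lemma CI_Dx:
  assumes F: "smooth2 F" and z: "\<And>t. F t 0 = 0" "\<And>t. F t 1 = 0"
  shows "CI T (Dx F) = 0"
proof -
  have "(LINT x|LI 0 1. Dx F t x) = 0" for t
    using FTC_LI(2)[of "F t" "Dx F t" 0 1] smooth2_D(5)[OF F] smooth2_isCont(2)[OF smooth2_D(2)[OF F]] z
    by simp
  then show ?thesis by (simp add: CI_iterated(1)[OF smooth2_Cint[OF smooth2_D(2)[OF F]]])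
qed

lemma CI_Dt:
  assumes F: "smooth2 F" and z: "\<And>x. F T x = 0" and T: "0 \<le> T"
  shows "CI T (Dt F) = - (LINT x|LI 0 1. F 0 x)"
proof -
  have "(LINT t|LI 0 T. Dt F t x) = - F 0 x" for x
    using FTC_LI(2)[of "\<lambda>t. F t x" "\<lambda>t. Dt F t x" 0 T] smooth2_D(4)[OF F]
      smooth2_isCont(1)[OF smooth2_D(1)[OF F]] z T
    by simp
  then show ?thesis by (simp add: CI_iterated(2)[OF smooth2_Cint[OF smooth2_D(1)[OF F]]])
qed

section \<open>Lipschitz reference functions\<close>

text \<open>Reference functions \<open>V\<close> with which an entropy solution can be compared. They are merely Lipschitz,
  whereas \<open>V\<close> enters the weak formulation as a factor of the test function, which has to be smooth; the
  sequence \<open>W\<close> allows passage to the limit by dominated convergence.\<close>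

definition approximable ::
    "real \<Rightarrow> (real \<Rightarrow> real \<Rightarrow> real) \<Rightarrow> (real \<Rightarrow> real \<Rightarrow> real) \<Rightarrow> (real \<Rightarrow> real \<Rightarrow> real) \<Rightarrow> bool" where
  "approximable T V Vt Vx \<longleftrightarrow> Cmeas T V \<and> Cmeas T Vt \<and> Cmeas T Vx \<and> V 0 \<in> borel_measurable (LI 0 1) \<and>
     (\<exists>W C. (\<forall>n. smooth2 (W n)) \<and>
        (\<forall>n. \<forall>t\<in>{0..T}. \<forall>x\<in>{0..1}. \<bar>W n t x\<bar> \<le> C \<and> \<bar>Dt (W n) t x\<bar> \<le> C \<and> \<bar>Dx (W n) t x\<bar> \<le> C) \<and>
        (AE z in LC T. (\<lambda>n. W n (fst z) (snd z)) \<longlonglongrightarrow> V (fst z) (snd z)) \<and>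
        (AE z in LC T. (\<lambda>n. Dt (W n) (fst z) (snd z)) \<longlonglongrightarrow> Vt (fst z) (snd z)) \<and>
        (AE z in LC T. (\<lambda>n. Dx (W n) (fst z) (snd z)) \<longlonglongrightarrow> Vx (fst z) (snd z)) \<and>
        (AE x in LI 0 1. (\<lambda>n. W n 0 x) \<longlonglongrightarrow> V 0 x))"

lemma AE_limit_bound:
  fixes f :: "nat \<Rightarrow> 'a \<Rightarrow> real"
  assumes "AE z in M. (\<lambda>n. f n z) \<longlonglongrightarrow> g z" "AE z in M. \<forall>n. \<bar>f n z\<bar> \<le> C"
  shows "AE z in M. \<bar>g z\<bar> \<le> C"
  using assms
proof eventually_elim
  case (elim z)
  show ?case by (rule LIMSEQ_le_const2[OF tendsto_rabs[OF elim(1)]]) (use elim(2) in blast)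
qed

lemma approximable_bounds:
  assumes "approximable T V Vt Vx" and T: "0 < T"
  shows "\<exists>C. (AE z in LC T. \<bar>V (fst z) (snd z)\<bar> \<le> C) \<and> (AE z in LC T. \<bar>Vt (fst z) (snd z)\<bar> \<le> C) \<and>
    (AE z in LC T. \<bar>Vx (fst z) (snd z)\<bar> \<le> C) \<and> (AE x in LI 0 1. \<bar>V 0 x\<bar> \<le> C)"
proof -
  obtain W C where W: "\<forall>n. smooth2 (W n)"
    "\<forall>n. \<forall>t\<in>{0..T}. \<forall>x\<in>{0..1}. \<bar>W n t x\<bar> \<le> C \<and> \<bar>Dt (W n) t x\<bar> \<le> C \<and> \<bar>Dx (W n) t x\<bar> \<le> C"
    "AE z in LC T. (\<lambda>n. W n (fst z) (snd z)) \<longlonglongrightarrow> V (fst z) (snd z)"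
    "AE z in LC T. (\<lambda>n. Dt (W n) (fst z) (snd z)) \<longlonglongrightarrow> Vt (fst z) (snd z)"
    "AE z in LC T. (\<lambda>n. Dx (W n) (fst z) (snd z)) \<longlonglongrightarrow> Vx (fst z) (snd z)"
    "AE x in LI 0 1. (\<lambda>n. W n 0 x) \<longlonglongrightarrow> V 0 x"
    using assms(1) unfolding approximable_def by blast
  show ?thesis
  proof (intro exI[of _ C] conjI)
    show "AE z in LC T. \<bar>V (fst z) (snd z)\<bar> \<le> C"
      by (rule AE_limit_bound[OF W(3)], rule AE_LC_I) (use W(2) in simp)
    show "AE z in LC T. \<bar>Vt (fst z) (snd z)\<bar> \<le> C"
      by (rule AE_limit_bound[OF W(4)], rule AE_LC_I) (use W(2) in simp)
    show "AE z in LC T. \<bar>Vx (fst z) (snd z)\<bar> \<le> C"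
      by (rule AE_limit_bound[OF W(5)], rule AE_LC_I) (use W(2) in simp)
    show "AE x in LI 0 1. \<bar>V 0 x\<bar> \<le> C"
      by (rule AE_limit_bound[OF W(6)], rule AE_LI_I) (use W(2) T in simp)
  qed
qed

lemma has_weak_dt_CI:
  "has_weak_dt T v g \<longleftrightarrow> L1_loc (Cyl T) (\<lambda>(t, x). v t x) \<and> L1_loc (Cyl T) (\<lambda>(t, x). g t x) \<and>
     (\<forall>\<phi>. test2 (Cyl T) \<phi> \<longrightarrow> CI T (\<lambda>t x. v t x * Dt \<phi> t x) = - CI T (\<lambda>t x. g t x * \<phi> t x))"
  by (simp add: has_weak_dt_def set_integral_LC case_prod_unfold)

lemma test2_Cyl_zero:
  assumes "test2 (Cyl T) \<phi>" "t \<le> 0 \<or> T \<le> t \<or> x \<le> 0 \<or> 1 \<le> x"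
  shows "\<phi> t x = 0"
proof (rule ccontr)
  assume "\<phi> t x \<noteq> 0"
  then have "(t, x) \<in> {(t, x). \<phi> t x \<noteq> 0}" by simp
  then have "(t, x) \<in> closure {(t, x). \<phi> t x \<noteq> 0}" by (rule subsetD[OF closure_subset])
  moreover have "closure {(t, x). \<phi> t x \<noteq> 0} \<subseteq> Cyl T" using assms(1) unfolding test2_def by (elim conjE)
  ultimately have "(t, x) \<in> Cyl T" by (rule rev_subsetD)
  then show False using assms(2) by auto
qed

lemma approximable_weak_dt:
  assumes V: "approximable T V Vt Vx" and T: "0 < T"
  shows "has_weak_dt T V Vt"
proof -
  obtain W C where W: "\<forall>n. smooth2 (W n)"
    "\<forall>n. \<forall>t\<in>{0..T}. \<forall>x\<in>{0..1}. \<bar>W n t x\<bar> \<le> C \<and> \<bar>Dt (W n) t x\<bar> \<le> C \<and> \<bar>Dx (W n) t x\<bar> \<le> C"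
    "AE z in LC T. (\<lambda>n. W n (fst z) (snd z)) \<longlonglongrightarrow> V (fst z) (snd z)"
    "AE z in LC T. (\<lambda>n. Dt (W n) (fst z) (snd z)) \<longlonglongrightarrow> Vt (fst z) (snd z)"
    "AE z in LC T. (\<lambda>n. Dx (W n) (fst z) (snd z)) \<longlonglongrightarrow> Vx (fst z) (snd z)"
    "AE x in LI 0 1. (\<lambda>n. W n 0 x) \<longlonglongrightarrow> V 0 x"
    using V unfolding approximable_def by blast
  have m: "Cmeas T V" "Cmeas T Vt" using V by (auto simp: approximable_def)
  obtain C' where C': "AE z in LC T. \<bar>V (fst z) (snd z)\<bar> \<le> C'" "AE z in LC T. \<bar>Vt (fst z) (snd z)\<bar> \<le> C'"
    using approximable_bounds[OF V T] by blast
  have i: "Cint T V" "Cint T Vt"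
    by (rule LC.integrable_const_bound[where B = C']; use m C' in simp)+
  show ?thesis unfolding has_weak_dt_CI
  proof (intro conjI allI impI)
    show "L1_loc (Cyl T) (\<lambda>(t, x). V t x)" "L1_loc (Cyl T) (\<lambda>(t, x). Vt t x)"
      using i integrable_L1_loc2 by (simp_all add: case_prod_unfold)
    fix \<phi> assume \<phi>: "test2 (Cyl T) \<phi>"
    note s = test2_smooth2[OF \<phi>]
    obtain B1 where B1: "\<forall>t\<in>{0..T}. \<forall>x\<in>{0..1}. \<bar>\<phi> t x\<bar> \<le> B1" using smooth2_bounded[OF s] by blast
    obtain B2 where B2: "\<forall>t\<in>{0..T}. \<forall>x\<in>{0..1}. \<bar>Dt \<phi> t x\<bar> \<le> B2" using smooth2_bounded[OF smooth2_D(1)[OF s]] by blast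
    have z: "CI T (\<lambda>t x. W n t x * Dt \<phi> t x) + CI T (\<lambda>t x. Dt (W n) t x * \<phi> t x) = 0" for n
    proof -
      have sn: "smooth2 (W n)" using W(1) by blast
      have "CI T (\<lambda>t x. W n t x * Dt \<phi> t x) + CI T (\<lambda>t x. Dt (W n) t x * \<phi> t x) =
        CI T (Dt (\<lambda>t x. W n t x * \<phi> t x))"
        unfolding Dt_mult[OF sn s]
        using Bochner_Integration.integral_add[OF smooth2_Cint[OF smooth2_mult[OF smooth2_D(1)[OF sn] s], of T]
            smooth2_Cint[OF smooth2_mult[OF sn smooth2_D(1)[OF s]], of T]] by simp
      also have "\<dots> = - (LINT x|LI 0 1. W n 0 x * \<phi> 0 x)"
        by (rule CI_Dt[OF smooth2_mult[OF sn s]]) (use T test2_Cyl_zero[OF \<phi>] in auto)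
      finally show ?thesis using test2_Cyl_zero[OF \<phi>, of 0] by simp
    qed
    have l1: "(\<lambda>n. CI T (\<lambda>t x. W n t x * Dt \<phi> t x)) \<longlonglongrightarrow> CI T (\<lambda>t x. V t x * Dt \<phi> t x)"
    proof (rule integral_dominated_convergence[where w = "\<lambda>_. C * B2"])
      show "AE z in LC T. (\<lambda>n. W n (fst z) (snd z) * Dt \<phi> (fst z) (snd z)) \<longlonglongrightarrow> V (fst z) (snd z) * Dt \<phi> (fst z) (snd z)"
        using W(3) by eventually_elim (intro tendsto_intros)
      show "AE z in LC T. norm (W n (fst z) (snd z) * Dt \<phi> (fst z) (snd z)) \<le> C * B2" for n
      proof (rule AE_LC_I)
        fix t x :: real assume "0 < t" "t < T" "0 < x" "x < 1"
        then have "\<bar>W n t x\<bar> \<le> C" "\<bar>Dt \<phi> t x\<bar> \<le> B2" using W(2) B2 by auto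
        then show "norm (W n (fst (t, x)) (snd (t, x)) * Dt \<phi> (fst (t, x)) (snd (t, x))) \<le> C * B2"
          unfolding real_norm_def abs_mult fst_conv snd_conv by (intro mult_mono) linarith+
      qed
    qed (rule borel_measurable_times; simp add: m smooth2_meas smooth2_D(1) s W(1); fail | simp)+
    have l2: "(\<lambda>n. CI T (\<lambda>t x. Dt (W n) t x * \<phi> t x)) \<longlonglongrightarrow> CI T (\<lambda>t x. Vt t x * \<phi> t x)"
    proof (rule integral_dominated_convergence[where w = "\<lambda>_. C * B1"])
      show "AE z in LC T. (\<lambda>n. Dt (W n) (fst z) (snd z) * \<phi> (fst z) (snd z)) \<longlonglongrightarrow> Vt (fst z) (snd z) * \<phi> (fst z) (snd z)"
        using W(4) by eventually_elim (intro tendsto_intros)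
      show "AE z in LC T. norm (Dt (W n) (fst z) (snd z) * \<phi> (fst z) (snd z)) \<le> C * B1" for n
      proof (rule AE_LC_I)
        fix t x :: real assume "0 < t" "t < T" "0 < x" "x < 1"
        then have "\<bar>Dt (W n) t x\<bar> \<le> C" "\<bar>\<phi> t x\<bar> \<le> B1" using W(2) B1 by auto
        then show "norm (Dt (W n) (fst (t, x)) (snd (t, x)) * \<phi> (fst (t, x)) (snd (t, x))) \<le> C * B1"
          unfolding real_norm_def abs_mult fst_conv snd_conv by (intro mult_mono) linarith+
      qed
    qed (rule borel_measurable_times; simp add: m smooth2_meas smooth2_D(1) s W(1); fail | simp)+
    have "(\<lambda>n. 0) \<longlonglongrightarrow> CI T (\<lambda>t x. V t x * Dt \<phi> t x) + CI T (\<lambda>t x. Vt t x * \<phi> t x)"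
      using tendsto_add[OF l1 l2] unfolding z .
    from LIMSEQ_unique[OF this tendsto_const]
    show "CI T (\<lambda>t x. V t x * Dt \<phi> t x) = - CI T (\<lambda>t x. Vt t x * \<phi> t x)" by simp
  qed
qed

lemma L1_loc_unique_2d:
  assumes L: "L1_loc (Cyl T) (\<lambda>z. f (fst z) (snd z))" "L1_loc (Cyl T) (\<lambda>z. g (fst z) (snd z))"
    and e: "\<And>\<phi>. test2 (Cyl T) \<phi> \<Longrightarrow> CI T (\<lambda>t x. f t x * \<phi> t x) = CI T (\<lambda>t x. g t x * \<phi> t x)"
  shows "AE z in LC T. f (fst z) (snd z) = g (fst z) (snd z)"
proof -
  have "AE z in LC T. f (fst z) (snd z) - g (fst z) (snd z) = 0"
  proof (rule fundamental_lemma_2d)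
    show "L1_loc (Cyl T) (\<lambda>z. f (fst z) (snd z) - g (fst z) (snd z))" using L by (rule L1_loc_diff)
    fix \<phi> assume \<phi>: "test2 (Cyl T) \<phi>"
    let ?K = "closure {(t, x). \<phi> t x \<noteq> 0}"
    have K: "compact ?K" "?K \<subseteq> Cyl T" using \<phi> unfolding test2_def by simp_all
    have c: "continuous_on UNIV (\<lambda>z. \<phi> (fst z) (snd z))"
      using smooth2_D(3)[OF test2_smooth2[OF \<phi>]] by (simp add: case_prod_unfold)
    have z: "\<phi> (fst z) (snd z) = 0" if "z \<notin> ?K" for z
    proof (rule ccontr)
      assume "\<phi> (fst z) (snd z) \<noteq> 0"
      then have "z \<in> {(t, x). \<phi> t x \<noteq> 0}" by (simp add: case_prod_unfold)
      then have "z \<in> ?K" by (rule subsetD[OF closure_subset])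
      with that show False by (rule notE)
    qed
    have i: "Cint T (\<lambda>t x. f t x * \<phi> t x)" "Cint T (\<lambda>t x. g t x * \<phi> t x)"
      using L1_loc_mult(2)[OF L(1) K c z] L1_loc_mult(2)[OF L(2) K c z] by (simp_all add: set_integrable_LC)
    then show "(LINT z:Cyl T|lborel. (f (fst z) (snd z) - g (fst z) (snd z)) * \<phi> (fst z) (snd z)) = 0"
      using e[OF \<phi>] by (simp add: set_integral_LC left_diff_distrib)
  qed
  then show ?thesis by simp
qed

lemma weak_dt_AE:
  assumes g: "has_weak_dt T v g"
  shows "AE z in LC T. weak_dt T v (fst z) (snd z) = g (fst z) (snd z)"
proof -
  have g': "has_weak_dt T v (weak_dt T v)" unfolding weak_dt_def by (rule someI[of _ g]) (rule g)
  show ?thesis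
  proof (rule L1_loc_unique_2d)
    show "L1_loc (Cyl T) (\<lambda>z. weak_dt T v (fst z) (snd z))" "L1_loc (Cyl T) (\<lambda>z. g (fst z) (snd z))"
      using g g' by (auto simp: has_weak_dt_def case_prod_unfold)
    fix \<phi> assume \<phi>: "test2 (Cyl T) \<phi>"
    have "CI T (\<lambda>t x. v t x * Dt \<phi> t x) = - CI T (\<lambda>t x. g t x * \<phi> t x)"
      "CI T (\<lambda>t x. v t x * Dt \<phi> t x) = - CI T (\<lambda>t x. weak_dt T v t x * \<phi> t x)"
      using g g' \<phi> unfolding has_weak_dt_CI by simp_all
    then show "CI T (\<lambda>t x. weak_dt T v t x * \<phi> t x) = CI T (\<lambda>t x. g t x * \<phi> t x)" by simp
  qed
qed

section \<open>The relative entropy inequality\<close>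

text \<open>The integrand of the relative entropy inequality for the entropy \<open>u\<^sup>2/2\<close>, as a function of the point
  values of the test function, the solution, the reference function and their derivatives.\<close>

definition rel_entropy :: "real \<Rightarrow> real \<Rightarrow> real \<Rightarrow> real \<Rightarrow> real \<Rightarrow> real \<Rightarrow> real \<Rightarrow> real \<Rightarrow> real \<Rightarrow> real \<Rightarrow> real" where
  "rel_entropy b \<epsilon> pt px p u ux v vt vx =
     pt * ((u - v)\<^sup>2 / 2) + px * (b / 2 * (u - v)\<^sup>2 - \<epsilon> * (u - v) * ux)
     - p * ((u - v) * (vt + b * vx) + \<epsilon> * (ux - vx) * ux)"

lemma rel_entropy_bound:
  assumes c: "\<bar>pt\<bar> \<le> c" "\<bar>px\<bar> \<le> c" "\<bar>p\<bar> \<le> c" and C: "\<bar>v\<bar> \<le> C" "\<bar>vt\<bar> \<le> C" "\<bar>vx\<bar> \<le> C" and e: "0 \<le> \<epsilon>"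
  shows "\<bar>rel_entropy b \<epsilon> pt px p u ux v vt vx\<bar> \<le>
    c * ((2 + \<bar>b\<bar> + \<epsilon>) * (2 * u\<^sup>2 + 2 * C\<^sup>2) + 3 * \<epsilon> * ux\<^sup>2 + (C + \<bar>b\<bar> * C)\<^sup>2 + \<epsilon> * C\<^sup>2)"
proof -
  define d where "d = u - v"
  have C2: "v\<^sup>2 \<le> C\<^sup>2" "vx\<^sup>2 \<le> C\<^sup>2"
    using C power_mono[of "\<bar>v\<bar>" C 2] power_mono[of "\<bar>vx\<bar>" C 2] by auto
  have d2: "d\<^sup>2 \<le> 2 * u\<^sup>2 + 2 * C\<^sup>2"
  proof -
    have "d\<^sup>2 + (u + v)\<^sup>2 = 2 * u\<^sup>2 + 2 * v\<^sup>2" by (simp add: d_def power2_eq_square algebra_simps)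
    then show ?thesis using C2 zero_le_power2[of "u + v"] by linarith
  qed
  have t1: "\<bar>d\<^sup>2 / 2\<bar> \<le> d\<^sup>2" by simp
  have t2: "\<bar>b / 2 * d\<^sup>2 - \<epsilon> * d * ux\<bar> \<le> \<bar>b\<bar> * d\<^sup>2 + \<epsilon> * (d\<^sup>2 + ux\<^sup>2)"
  proof -
    have "\<bar>b / 2 * d\<^sup>2\<bar> \<le> \<bar>b\<bar> * d\<^sup>2" by (simp add: abs_mult)
    moreover have "\<bar>\<epsilon> * d * ux\<bar> \<le> \<epsilon> * (d\<^sup>2 + ux\<^sup>2)"
      using mult_left_mono[OF abs_mult_le[of d ux] e] e by (simp add: abs_mult mult.assoc)
    ultimately show ?thesis by linarith
  qed
  have t3: "\<bar>d * (vt + b * vx) + \<epsilon> * (ux - vx) * ux\<bar> \<le> d\<^sup>2 + (C + \<bar>b\<bar> * C)\<^sup>2 + \<epsilon> * (2 * ux\<^sup>2 + C\<^sup>2)"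
  proof -
    have "\<bar>vt + b * vx\<bar> \<le> C + \<bar>b\<bar> * C"
      using C mult_left_mono[OF C(3) abs_ge_zero[of b]] abs_mult[of b vx] by linarith
    then have "(vt + b * vx)\<^sup>2 \<le> (C + \<bar>b\<bar> * C)\<^sup>2" using power_mono[of "\<bar>vt + b * vx\<bar>" _ 2] by auto
    then have 1: "\<bar>d * (vt + b * vx)\<bar> \<le> d\<^sup>2 + (C + \<bar>b\<bar> * C)\<^sup>2" using abs_mult_le[of d "vt + b * vx"] by linarith
    have "(ux - vx) * ux = ux\<^sup>2 - vx * ux" by (simp add: algebra_simps power2_eq_square)
    then have "\<bar>(ux - vx) * ux\<bar> \<le> ux\<^sup>2 + (vx\<^sup>2 + ux\<^sup>2)"
      using abs_mult_le[of vx ux] zero_le_power2[of ux] by linarith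
    then have "\<bar>(ux - vx) * ux\<bar> \<le> 2 * ux\<^sup>2 + C\<^sup>2" using C2 by linarith
    then have "\<epsilon> * \<bar>(ux - vx) * ux\<bar> \<le> \<epsilon> * (2 * ux\<^sup>2 + C\<^sup>2)" using e by (rule mult_left_mono)
    then have "\<bar>\<epsilon> * (ux - vx) * ux\<bar> \<le> \<epsilon> * (2 * ux\<^sup>2 + C\<^sup>2)" using e by (simp add: abs_mult mult.assoc)
    with 1 show ?thesis by linarith
  qed
  have c0: "0 \<le> c" using c(1) by linarith
  have m: "\<bar>a * y\<bar> \<le> c * z" if "\<bar>a\<bar> \<le> c" "\<bar>y\<bar> \<le> z" for a y z
    unfolding abs_mult by (rule mult_mono) (use that c0 in auto)
  have "\<bar>rel_entropy b \<epsilon> pt px p u ux v vt vx\<bar> \<le> c * d\<^sup>2 + c * (\<bar>b\<bar> * d\<^sup>2 + \<epsilon> * (d\<^sup>2 + ux\<^sup>2))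
      + c * (d\<^sup>2 + (C + \<bar>b\<bar> * C)\<^sup>2 + \<epsilon> * (2 * ux\<^sup>2 + C\<^sup>2))"
    unfolding rel_entropy_def d_def[symmetric]
  proof -
    have "\<bar>x + y - z\<bar> \<le> x' + y' + z'" if "\<bar>x\<bar> \<le> x'" "\<bar>y\<bar> \<le> y'" "\<bar>z\<bar> \<le> z'" for x y z x' y' z' :: real
      using that by linarith
    from this[OF m[OF c(1) t1] m[OF c(2) t2] m[OF c(3) t3]]
    show "\<bar>pt * (d\<^sup>2 / 2) + px * (b / 2 * d\<^sup>2 - \<epsilon> * d * ux) - p * (d * (vt + b * vx) + \<epsilon> * (ux - vx) * ux)\<bar>
      \<le> c * d\<^sup>2 + c * (\<bar>b\<bar> * d\<^sup>2 + \<epsilon> * (d\<^sup>2 + ux\<^sup>2)) + c * (d\<^sup>2 + (C + \<bar>b\<bar> * C)\<^sup>2 + \<epsilon> * (2 * ux\<^sup>2 + C\<^sup>2))" .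
  qed
  also have "\<dots> = c * ((2 + \<bar>b\<bar> + \<epsilon>) * d\<^sup>2 + 3 * \<epsilon> * ux\<^sup>2 + (C + \<bar>b\<bar> * C)\<^sup>2 + \<epsilon> * C\<^sup>2)"
  proof -
    have "c * D + c * (B * D + e * (D + X)) + c * (D + K + e * (2 * X + L)) =
      c * ((2 + B + e) * D + 3 * e * X + K + e * L)" for B D e X K L :: real
      by (simp add: algebra_simps)
    then show ?thesis .
  qed
  also have "\<dots> \<le> c * ((2 + \<bar>b\<bar> + \<epsilon>) * (2 * u\<^sup>2 + 2 * C\<^sup>2) + 3 * \<epsilon> * ux\<^sup>2 + (C + \<bar>b\<bar> * C)\<^sup>2 + \<epsilon> * C\<^sup>2)"
    using d2 e c0 by (intro mult_left_mono add_right_mono) simp_all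
  finally show ?thesis .
qed

lemma test2_mult:
  assumes P: "test2 S \<Phi>" and W: "smooth2 W"
  shows "test2 S (\<lambda>t x. \<Phi> t x * W t x)"
proof -
  have s: "closure {(t, x). \<Phi> t x * W t x \<noteq> 0} \<subseteq> closure {(t, x). \<Phi> t x \<noteq> 0}"
    by (rule closure_mono) auto
  have K: "compact (closure {(t, x). \<Phi> t x \<noteq> 0})" "closure {(t, x). \<Phi> t x \<noteq> 0} \<subseteq> S"
    using P unfolding test2_def by simp_all
  have "compact (closure {(t, x). \<Phi> t x * W t x \<noteq> 0})"
    using bounded_subset[OF compact_imp_bounded[OF K(1)] s] by (simp add: compact_eq_bounded_closed)
  moreover have "closure {(t, x). \<Phi> t x * W t x \<noteq> 0} \<subseteq> S" by (rule order_trans[OF s K(2)])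
  moreover have "smooth2 (\<lambda>t x. \<Phi> t x * W t x)" by (rule smooth2_mult[OF test2_smooth2[OF P] W])
  ultimately show ?thesis unfolding test2_def smooth2_def by simp
qed

lemma test2_zero:
  assumes "test2 S \<phi>" "(t, x) \<notin> S"
  shows "\<phi> t x = 0"
proof (rule ccontr)
  assume "\<phi> t x \<noteq> 0"
  then have "(t, x) \<in> {(t, x). \<phi> t x \<noteq> 0}" by simp
  then have "(t, x) \<in> closure {(t, x). \<phi> t x \<noteq> 0}" by (rule subsetD[OF closure_subset])
  moreover have "closure {(t, x). \<phi> t x \<noteq> 0} \<subseteq> S" using assms(1) unfolding test2_def by simp
  ultimately have "(t, x) \<in> S" by (rule rev_subsetD)
  with assms(2) show False by (rule notE)
qed

text \<open>The algebra of the relative entropy method: the entropy integrand with test function \<open>\<Phi>\<close>, minus the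
  weak form with test function \<open>\<Phi> w\<close>, plus terms that form a total derivative and integrate to boundary values.\<close>

lemma rel_entropy_decompose:
  "rel_entropy b \<epsilon> pt px p u ux w wt wx = rel_entropy b \<epsilon> pt px p u ux 0 0 0
     - ((pt * w + p * wt) * u + (px * w + p * wx) * (b * u - \<epsilon> * ux))
     + (1 / 2 * (pt * (w * w) + p * (wt * w + w * wt)) + b / 2 * (px * (w * w) + p * (wx * w + w * wx)))"
  by (simp add: rel_entropy_def field_simps power2_eq_square)

text \<open>What the estimate uses of an entropy solution: square integrability, the weak form and the entropy
  inequality. If \<open>\<epsilon> = 0\<close> every occurrence of \<open>ux\<close> is multiplied by \<open>0\<close>, so one formulation covers both cases.\<close>

locale viscous_solution =
  fixes T b \<epsilon> :: real and u ux :: "real \<Rightarrow> real \<Rightarrow> real" and u0 :: "real \<Rightarrow> real"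
  assumes T: "0 < T" and eps: "0 \<le> \<epsilon>"
    and um: "Cmeas T u" and uxm: "Cmeas T ux"
    and u2: "Cint T (\<lambda>t x. (u t x)\<^sup>2)" and ux2: "Cint T (\<lambda>t x. (ux t x)\<^sup>2)"
    and u0: "sqint (LI 0 1) u0"
    and weak: "test2 ({..<T} \<times> Omega) \<phi> \<Longrightarrow>
      CI T (\<lambda>t x. Dt \<phi> t x * u t x + Dx \<phi> t x * (b * u t x - \<epsilon> * ux t x)) + (LINT x|LI 0 1. u0 x * \<phi> 0 x) = 0"
    and entropy: "\<lbrakk>test2 ({..<T} \<times> Omega) \<Phi>; \<forall>t x. 0 \<le> \<Phi> t x\<rbrakk> \<Longrightarrow>
      0 \<le> CI T (\<lambda>t x. Dt \<Phi> t x * ((u t x)\<^sup>2 / 2) + Dx \<Phi> t x * (b / 2 * (u t x)\<^sup>2 - \<epsilon> * u t x * ux t x)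
            - \<epsilon> * \<Phi> t x * (ux t x)\<^sup>2) + (LINT x|LI 0 1. \<Phi> 0 x * ((u0 x)\<^sup>2 / 2))"
begin

definition RE where
  "RE \<Phi> V Vt Vx = (\<lambda>t x. rel_entropy b \<epsilon> (Dt \<Phi> t x) (Dx \<Phi> t x) (\<Phi> t x) (u t x) (ux t x) (V t x) (Vt t x) (Vx t x))"

text \<open>An integrable majorant of the relative entropy integrand, uniform in the reference function as long as
  that function and its first derivatives are bounded by \<open>C\<close>.\<close>

definition dom where
  "dom c C = (\<lambda>t x. c * ((2 + \<bar>b\<bar> + \<epsilon>) * (2 * (u t x)\<^sup>2 + 2 * C\<^sup>2) + 3 * \<epsilon> * (ux t x)\<^sup>2 + (C + \<bar>b\<bar> * C)\<^sup>2 + \<epsilon> * C\<^sup>2))"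

lemma dom_integrable: "Cint T (dom c C)"
  unfolding dom_def using u2 ux2 by simp

lemma RE_measurable:
  assumes "smooth2 \<Phi>" "Cmeas T V" "Cmeas T Vt" "Cmeas T Vx"
  shows "Cmeas T (RE \<Phi> V Vt Vx)"
proof -
  note [measurable] = um uxm assms(2-4) smooth2_meas[OF assms(1)]
    smooth2_meas[OF smooth2_D(1)[OF assms(1)]] smooth2_meas[OF smooth2_D(2)[OF assms(1)]]
  show ?thesis unfolding RE_def rel_entropy_def by measurable
qed

lemma test_bound:
  assumes "smooth2 \<Phi>"
  shows "\<exists>c. \<forall>t\<in>{0..T}. \<forall>x\<in>{0..1}. \<bar>\<Phi> t x\<bar> \<le> c \<and> \<bar>Dt \<Phi> t x\<bar> \<le> c \<and> \<bar>Dx \<Phi> t x\<bar> \<le> c"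
proof -
  obtain c1 where c1: "\<forall>t\<in>{0..T}. \<forall>x\<in>{0..1}. \<bar>\<Phi> t x\<bar> \<le> c1" using smooth2_bounded[OF assms] by blast
  obtain c2 where c2: "\<forall>t\<in>{0..T}. \<forall>x\<in>{0..1}. \<bar>Dt \<Phi> t x\<bar> \<le> c2" using smooth2_bounded[OF smooth2_D(1)[OF assms]] by blast
  obtain c3 where c3: "\<forall>t\<in>{0..T}. \<forall>x\<in>{0..1}. \<bar>Dx \<Phi> t x\<bar> \<le> c3" using smooth2_bounded[OF smooth2_D(2)[OF assms]] by blast
  have "\<forall>t\<in>{0..T}. \<forall>x\<in>{0..1}. \<bar>\<Phi> t x\<bar> \<le> max c1 (max c2 c3) \<and> \<bar>Dt \<Phi> t x\<bar> \<le> max c1 (max c2 c3) \<and> \<bar>Dx \<Phi> t x\<bar> \<le> max c1 (max c2 c3)"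
    using c1 c2 c3 by (auto simp: le_max_iff_disj)
  then show ?thesis by blast
qed

lemma RE_le_dom:
  assumes c: "\<forall>t\<in>{0..T}. \<forall>x\<in>{0..1}. \<bar>\<Phi> t x\<bar> \<le> c \<and> \<bar>Dt \<Phi> t x\<bar> \<le> c \<and> \<bar>Dx \<Phi> t x\<bar> \<le> c"
    and C: "AE z in LC T. \<bar>V (fst z) (snd z)\<bar> \<le> C" "AE z in LC T. \<bar>Vt (fst z) (snd z)\<bar> \<le> C"
      "AE z in LC T. \<bar>Vx (fst z) (snd z)\<bar> \<le> C"
  shows "AE z in LC T. \<bar>RE \<Phi> V Vt Vx (fst z) (snd z)\<bar> \<le> dom c C (fst z) (snd z)"
proof -
  have "AE z in LC T. z \<in> space (LC T)" by (rule AE_space)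
  then show ?thesis using C
  proof eventually_elim
    case (elim z)
    then have "fst z \<in> {0..T}" "snd z \<in> {0..1}" by (auto simp: space_LC)
    then show ?case using c elim eps unfolding RE_def dom_def
      by (intro rel_entropy_bound) auto
  qed
qed

lemma RE_integrable:
  assumes P: "smooth2 \<Phi>" and m: "Cmeas T V" "Cmeas T Vt" "Cmeas T Vx"
    and C: "AE z in LC T. \<bar>V (fst z) (snd z)\<bar> \<le> C" "AE z in LC T. \<bar>Vt (fst z) (snd z)\<bar> \<le> C"
      "AE z in LC T. \<bar>Vx (fst z) (snd z)\<bar> \<le> C"
  shows "Cint T (RE \<Phi> V Vt Vx)"
proof -
  obtain c where c: "\<forall>t\<in>{0..T}. \<forall>x\<in>{0..1}. \<bar>\<Phi> t x\<bar> \<le> c \<and> \<bar>Dt \<Phi> t x\<bar> \<le> c \<and> \<bar>Dx \<Phi> t x\<bar> \<le> c"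
    using test_bound[OF P] by blast
  show ?thesis
  proof (rule Bochner_Integration.integrable_bound[OF dom_integrable[of c C] RE_measurable[OF P m]])
    show "AE z in LC T. norm (RE \<Phi> V Vt Vx (fst z) (snd z)) \<le> norm (dom c C (fst z) (snd z))"
      using RE_le_dom[OF c C] by eventually_elim simp
  qed
qed

text \<open>For smooth \<open>W\<close> the terms of the decomposition can be integrated one by one: entropy inequality, weak form
  with test function \<open>\<Phi> W\<close>, and integration by parts for \<open>\<Phi> W\<^sup>2\<close>.\<close>

lemma rel_entropy_smooth:
  assumes P: "test2 ({..<T} \<times> Omega) \<Phi>" "\<forall>t x. 0 \<le> \<Phi> t x" and W: "smooth2 W"
  shows "0 \<le> CI T (RE \<Phi> W (Dt W) (Dx W)) + (LINT x|LI 0 1. \<Phi> 0 x * ((u0 x - W 0 x)\<^sup>2 / 2))"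
proof -
  note s = test2_smooth2[OF P(1)]
  let ?Z = "\<lambda>t x. 0 :: real"
  define wk where "wk = (\<lambda>t x. Dt (\<lambda>t x. \<Phi> t x * W t x) t x * u t x
     + Dx (\<lambda>t x. \<Phi> t x * W t x) t x * (b * u t x - \<epsilon> * ux t x))"
  define F where "F = (\<lambda>t x. \<Phi> t x * (W t x * W t x))"
  have sF: "smooth2 F" unfolding F_def by (rule smooth2_mult[OF s smooth2_mult[OF W W]])
  obtain C where C: "\<forall>t\<in>{0..T}. \<forall>x\<in>{0..1}. \<bar>W t x\<bar> \<le> C \<and> \<bar>Dt W t x\<bar> \<le> C \<and> \<bar>Dx W t x\<bar> \<le> C"
    using test_bound[OF W] by blast
  have e: "RE \<Phi> W (Dt W) (Dx W) t x = RE \<Phi> ?Z ?Z ?Z t x - wk t x + (1 / 2 * Dt F t x + b / 2 * Dx F t x)" for t x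
    unfolding RE_def wk_def F_def Dt_mult[OF s W] Dx_mult[OF s W] Dt_mult[OF s smooth2_mult[OF W W]]
      Dx_mult[OF s smooth2_mult[OF W W]] Dt_mult[OF W W] Dx_mult[OF W W]
    by (rule rel_entropy_decompose)
  have i1: "Cint T (RE \<Phi> W (Dt W) (Dx W))"
    by (rule RE_integrable[OF s, of _ _ _ C]; (intro smooth2_meas smooth2_D W | rule AE_LC_I, use C in simp))
  have i2: "Cint T (RE \<Phi> ?Z ?Z ?Z)" by (rule RE_integrable[OF s, of _ _ _ 0]) simp_all
  have i3: "Cint T (Dt F)" "Cint T (Dx F)" by (intro smooth2_Cint smooth2_D sF)+
  have wke: "wk t x = RE \<Phi> ?Z ?Z ?Z t x - RE \<Phi> W (Dt W) (Dx W) t x + (1 / 2 * Dt F t x + b / 2 * Dx F t x)" for t x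
    using e[of t x] by linarith
  have i4: "Cint T wk" unfolding wke using i1 i2 i3 by simp
  have "CI T (RE \<Phi> W (Dt W) (Dx W)) = CI T (RE \<Phi> ?Z ?Z ?Z) - CI T wk + (1 / 2 * CI T (Dt F) + b / 2 * CI T (Dx F))"
    unfolding e using i2 i3 i4 by simp
  moreover have "b / 2 * CI T (Dx F) = 0"
    using CI_Dx[OF sF] by (simp add: F_def test2_zero[OF P(1)])
  moreover have "CI T (Dt F) = - (LINT x|LI 0 1. F 0 x)"
    by (rule CI_Dt[OF sF]) (simp_all add: F_def test2_zero[OF P(1)] T less_imp_le)
  moreover have "CI T wk = - (LINT x|LI 0 1. u0 x * (\<Phi> 0 x * W 0 x))"
    using weak[OF test2_mult[OF P(1) W]] unfolding wk_def by linarith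
  moreover have "0 \<le> CI T (RE \<Phi> ?Z ?Z ?Z) + (LINT x|LI 0 1. \<Phi> 0 x * ((u0 x)\<^sup>2 / 2))"
  proof -
    have "RE \<Phi> ?Z ?Z ?Z = (\<lambda>t x. Dt \<Phi> t x * ((u t x)\<^sup>2 / 2) + Dx \<Phi> t x * (b / 2 * (u t x)\<^sup>2 - \<epsilon> * u t x * ux t x)
            - \<epsilon> * \<Phi> t x * (ux t x)\<^sup>2)"
      by (simp add: RE_def rel_entropy_def power2_eq_square algebra_simps)
    then show ?thesis using entropy[OF P] by simp
  qed
  moreover have "(LINT x|LI 0 1. \<Phi> 0 x * ((u0 x - W 0 x)\<^sup>2 / 2)) = (LINT x|LI 0 1. \<Phi> 0 x * ((u0 x)\<^sup>2 / 2))
     - (LINT x|LI 0 1. u0 x * (\<Phi> 0 x * W 0 x)) + 1 / 2 * (LINT x|LI 0 1. F 0 x)"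
  proof -
    have m: "(\<lambda>x. \<Phi> 0 x) \<in> borel_measurable (LI 0 1)" "(\<lambda>x. W 0 x) \<in> borel_measurable (LI 0 1)"
      by (rule borel_LI[OF borel_measurable_continuous_onI], rule continuous_at_imp_continuous_on,
          use smooth2_isCont(2) s W in blast)+
    obtain c where c: "\<forall>t\<in>{0..T}. \<forall>x\<in>{0..1}. \<bar>\<Phi> t x\<bar> \<le> c \<and> \<bar>Dt \<Phi> t x\<bar> \<le> c \<and> \<bar>Dx \<Phi> t x\<bar> \<le> c"
      using test_bound[OF s] by blast
    have b\<Phi>: "AE x in LI 0 1. \<bar>\<Phi> 0 x\<bar> \<le> c" by (rule AE_LI_I) (use c T in simp)
    have bW: "AE x in LI 0 1. \<bar>W 0 x\<bar> \<le> C" by (rule AE_LI_I) (use C T in simp)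
    have sW: "sqint (LI 0 1) (W 0)" by (rule LI.sqint_bounded[OF m(2) bW])
    have j1: "integrable (LI 0 1) (\<lambda>x. \<Phi> 0 x * ((u0 x)\<^sup>2 / 2))"
      by (rule integrable_bounded_mult[OF _ m(1) b\<Phi>]) (use u0 in \<open>simp add: sqint_def\<close>)
    have j2: "integrable (LI 0 1) (\<lambda>x. \<Phi> 0 x * (u0 x * W 0 x))"
      by (rule integrable_bounded_mult[OF sqint_mult[OF u0 sW] m(1) b\<Phi>])
    have j3: "integrable (LI 0 1) (\<lambda>x. \<Phi> 0 x * (W 0 x * W 0 x))"
      by (rule integrable_bounded_mult[OF sqint_mult[OF sW sW] m(1) b\<Phi>])
    have "(LINT x|LI 0 1. \<Phi> 0 x * ((u0 x - W 0 x)\<^sup>2 / 2)) =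
      (LINT x|LI 0 1. \<Phi> 0 x * ((u0 x)\<^sup>2 / 2) - \<Phi> 0 x * (u0 x * W 0 x) + 1 / 2 * (\<Phi> 0 x * (W 0 x * W 0 x)))"
      by (rule Bochner_Integration.integral_cong) (simp_all add: power2_eq_square field_simps)
    also have "\<dots> = (LINT x|LI 0 1. \<Phi> 0 x * ((u0 x)\<^sup>2 / 2)) - (LINT x|LI 0 1. \<Phi> 0 x * (u0 x * W 0 x))
       + 1 / 2 * (LINT x|LI 0 1. \<Phi> 0 x * (W 0 x * W 0 x))"
      using j1 j2 j3 by simp
    also have "(\<lambda>x. \<Phi> 0 x * (u0 x * W 0 x)) = (\<lambda>x. u0 x * (\<Phi> 0 x * W 0 x))" by (simp add: mult_ac)
    finally show ?thesis by (simp add: F_def)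
  qed
  ultimately show ?thesis by linarith
qed

lemma rel_entropy_approximable:
  assumes P: "test2 ({..<T} \<times> Omega) \<Phi>" "\<forall>t x. 0 \<le> \<Phi> t x" and V: "approximable T V Vt Vx"
  shows "0 \<le> CI T (RE \<Phi> V Vt Vx) + (LINT x|LI 0 1. \<Phi> 0 x * ((u0 x - V 0 x)\<^sup>2 / 2))"
proof -
  note s = test2_smooth2[OF P(1)]
  obtain W C where W: "\<forall>n. smooth2 (W n)"
    "\<forall>n. \<forall>t\<in>{0..T}. \<forall>x\<in>{0..1}. \<bar>W n t x\<bar> \<le> C \<and> \<bar>Dt (W n) t x\<bar> \<le> C \<and> \<bar>Dx (W n) t x\<bar> \<le> C"
    "AE z in LC T. (\<lambda>n. W n (fst z) (snd z)) \<longlonglongrightarrow> V (fst z) (snd z)"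
    "AE z in LC T. (\<lambda>n. Dt (W n) (fst z) (snd z)) \<longlonglongrightarrow> Vt (fst z) (snd z)"
    "AE z in LC T. (\<lambda>n. Dx (W n) (fst z) (snd z)) \<longlonglongrightarrow> Vx (fst z) (snd z)"
    "AE x in LI 0 1. (\<lambda>n. W n 0 x) \<longlonglongrightarrow> V 0 x"
    using V unfolding approximable_def by blast
  have m: "Cmeas T V" "Cmeas T Vt" "Cmeas T Vx" "V 0 \<in> borel_measurable (LI 0 1)"
    using V by (auto simp: approximable_def)
  obtain c where c: "\<forall>t\<in>{0..T}. \<forall>x\<in>{0..1}. \<bar>\<Phi> t x\<bar> \<le> c \<and> \<bar>Dt \<Phi> t x\<bar> \<le> c \<and> \<bar>Dx \<Phi> t x\<bar> \<le> c"
    using test_bound[OF s] by blast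
  have Wm: "Cmeas T (W n)" "Cmeas T (Dt (W n))" "Cmeas T (Dx (W n))" for n
    using W(1) by (auto intro: smooth2_meas smooth2_D)
  have "(\<lambda>n. CI T (RE \<Phi> (W n) (Dt (W n)) (Dx (W n)))) \<longlonglongrightarrow> CI T (RE \<Phi> V Vt Vx)"
  proof (rule integral_dominated_convergence[where w = "\<lambda>z. dom c C (fst z) (snd z)"])
    show "Cmeas T (RE \<Phi> V Vt Vx)" by (rule RE_measurable[OF s m(1-3)])
    show "Cmeas T (RE \<Phi> (W n) (Dt (W n)) (Dx (W n)))" for n by (rule RE_measurable[OF s Wm])
    show "Cint T (dom c C)" by (rule dom_integrable)
    show "AE z in LC T. norm (RE \<Phi> (W n) (Dt (W n)) (Dx (W n)) (fst z) (snd z)) \<le> dom c C (fst z) (snd z)" for n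
      unfolding real_norm_def by (rule RE_le_dom[OF c]; rule AE_LC_I; use W(2) in simp)
    show "AE z in LC T. (\<lambda>n. RE \<Phi> (W n) (Dt (W n)) (Dx (W n)) (fst z) (snd z)) \<longlonglongrightarrow> RE \<Phi> V Vt Vx (fst z) (snd z)"
      using W(3-5) by eventually_elim (unfold RE_def rel_entropy_def, intro tendsto_intros; simp)
  qed
  moreover have "(\<lambda>n. LINT x|LI 0 1. \<Phi> 0 x * ((u0 x - W n 0 x)\<^sup>2 / 2)) \<longlonglongrightarrow> (LINT x|LI 0 1. \<Phi> 0 x * ((u0 x - V 0 x)\<^sup>2 / 2))"
  proof (rule integral_dominated_convergence[where w = "\<lambda>x. c * ((u0 x)\<^sup>2 + C\<^sup>2)"])
    have [measurable]: "(\<lambda>x. \<Phi> 0 x) \<in> borel_measurable (LI 0 1)" "(\<lambda>x. W n 0 x) \<in> borel_measurable (LI 0 1)" for n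
      by (rule borel_LI[OF borel_measurable_continuous_onI], rule continuous_at_imp_continuous_on,
          use smooth2_isCont(2) s W(1) in blast)+
    have [measurable]: "u0 \<in> borel_measurable (LI 0 1)" using u0 by (simp add: sqint_def)
    note [measurable] = m(4)
    show "(\<lambda>x. \<Phi> 0 x * ((u0 x - V 0 x)\<^sup>2 / 2)) \<in> borel_measurable (LI 0 1)" by measurable
    show "(\<lambda>x. \<Phi> 0 x * ((u0 x - W n 0 x)\<^sup>2 / 2)) \<in> borel_measurable (LI 0 1)" for n by measurable
    show "integrable (LI 0 1) (\<lambda>x. c * ((u0 x)\<^sup>2 + C\<^sup>2))" using u0 by (simp add: sqint_def)
    show "AE x in LI 0 1. (\<lambda>n. \<Phi> 0 x * ((u0 x - W n 0 x)\<^sup>2 / 2)) \<longlonglongrightarrow> \<Phi> 0 x * ((u0 x - V 0 x)\<^sup>2 / 2)"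
      using W(6) by eventually_elim (intro tendsto_intros; simp)
    show "AE x in LI 0 1. norm (\<Phi> 0 x * ((u0 x - W n 0 x)\<^sup>2 / 2)) \<le> c * ((u0 x)\<^sup>2 + C\<^sup>2)" for n
    proof (rule AE_LI_I)
      fix x :: real assume x: "0 < x" "x < 1"
      then have "\<bar>W n 0 x\<bar> \<le> C" "\<bar>\<Phi> 0 x\<bar> \<le> c" using W(2) c T by auto
      then have w: "(W n 0 x)\<^sup>2 \<le> C\<^sup>2" using power_mono[of "\<bar>W n 0 x\<bar>" C 2] by auto
      have "(u0 x - W n 0 x)\<^sup>2 + (u0 x + W n 0 x)\<^sup>2 = 2 * (u0 x)\<^sup>2 + 2 * (W n 0 x)\<^sup>2"
        by (simp add: power2_eq_square algebra_simps)
      then have "(u0 x - W n 0 x)\<^sup>2 / 2 \<le> (u0 x)\<^sup>2 + C\<^sup>2" using w zero_le_power2[of "u0 x + W n 0 x"] by linarith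
      then show "norm (\<Phi> 0 x * ((u0 x - W n 0 x)\<^sup>2 / 2)) \<le> c * ((u0 x)\<^sup>2 + C\<^sup>2)"
        unfolding real_norm_def abs_mult using \<open>\<bar>\<Phi> 0 x\<bar> \<le> c\<close> by (intro mult_mono) auto
    qed
  qed
  ultimately have "(\<lambda>n. CI T (RE \<Phi> (W n) (Dt (W n)) (Dx (W n))) + (LINT x|LI 0 1. \<Phi> 0 x * ((u0 x - W n 0 x)\<^sup>2 / 2)))
    \<longlonglongrightarrow> CI T (RE \<Phi> V Vt Vx) + (LINT x|LI 0 1. \<Phi> 0 x * ((u0 x - V 0 x)\<^sup>2 / 2))"
    by (rule tendsto_add)
  then show ?thesis
    by (rule LIMSEQ_le_const) (use rel_entropy_smooth[OF P] W(1) in blast)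
qed

lemma u_sq: "sqint (LC T) (\<lambda>z. u (fst z) (snd z))" and ux_sq: "sqint (LC T) (\<lambda>z. ux (fst z) (snd z))"
  using um uxm u2 ux2 by (auto simp: sqint_def)

text \<open>The interior production term of the relative entropy and the flux of the relative entropy.\<close>

definition dissip where
  "dissip V Vt Vx = (\<lambda>t x. (u t x - V t x) * (Vt t x + b * Vx t x) + \<epsilon> * (ux t x - Vx t x) * ux t x)"

definition bflux where
  "bflux V = (\<lambda>t x. b / 2 * (u t x - V t x)\<^sup>2 - \<epsilon> * (u t x - V t x) * ux t x)"

text \<open>The part of the entropy flux of the error that enters through the lateral boundary, seen by
  plateau functions that exhaust \<open>\<Omega>\<close>, is asymptotically nonpositive.\<close>

abbreviation no_boundary_gain where
  "no_boundary_gain V \<theta> \<equiv> \<exists>r. r \<longlonglongrightarrow> 0 \<and>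
     (\<forall>\<^sub>F n in sequentially. CI T (\<lambda>t x. \<theta> t * deriv (plateau 0 1 (1 / real (Suc n))) x * bflux V t x) \<le> r n)"

lemma
  assumes V: "approximable T V Vt Vx"
  shows err_sq: "sqint (LC T) (\<lambda>z. u (fst z) (snd z) - V (fst z) (snd z))"
    and err2_int: "Cint T (\<lambda>t x. (u t x - V t x)\<^sup>2)"
    and dissip_int: "Cint T (dissip V Vt Vx)"
    and bflux_int: "Cint T (bflux V)"
    and err_dx_sq: "sqint (LC T) (\<lambda>z. ux (fst z) (snd z) - Vx (fst z) (snd z))"
proof -
  have m: "Cmeas T V" "Cmeas T Vt" "Cmeas T Vx" using V by (auto simp: approximable_def)
  obtain C where C: "AE z in LC T. \<bar>V (fst z) (snd z)\<bar> \<le> C" "AE z in LC T. \<bar>Vt (fst z) (snd z)\<bar> \<le> C"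
    "AE z in LC T. \<bar>Vx (fst z) (snd z)\<bar> \<le> C" using approximable_bounds[OF V T] by blast
  note V2 = LC.sqint_bounded[OF m(1) C(1)] and Vt2 = LC.sqint_bounded[OF m(2) C(2)] and Vx2 = LC.sqint_bounded[OF m(3) C(3)]
  show e: "sqint (LC T) (\<lambda>z. u (fst z) (snd z) - V (fst z) (snd z))" by (rule sqint_diff[OF u_sq V2])
  then show e2: "Cint T (\<lambda>t x. (u t x - V t x)\<^sup>2)" by (simp add: sqint_def)
  show d: "sqint (LC T) (\<lambda>z. ux (fst z) (snd z) - Vx (fst z) (snd z))" by (rule sqint_diff[OF ux_sq Vx2])
  have "integrable (LC T) (\<lambda>z. b * ((u (fst z) (snd z) - V (fst z) (snd z)) * Vx (fst z) (snd z)))"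
    using sqint_mult[OF e Vx2] by simp
  moreover have "integrable (LC T) (\<lambda>z. \<epsilon> * ((ux (fst z) (snd z) - Vx (fst z) (snd z)) * ux (fst z) (snd z)))"
    using sqint_mult[OF d ux_sq] by simp
  ultimately have "integrable (LC T) (\<lambda>z. (u (fst z) (snd z) - V (fst z) (snd z)) * Vt (fst z) (snd z)
      + b * ((u (fst z) (snd z) - V (fst z) (snd z)) * Vx (fst z) (snd z))
      + \<epsilon> * ((ux (fst z) (snd z) - Vx (fst z) (snd z)) * ux (fst z) (snd z)))"
    using sqint_mult[OF e Vt2] by simp
  then show "Cint T (dissip V Vt Vx)"
    by (simp add: dissip_def algebra_simps)
  have "integrable (LC T) (\<lambda>z. b / 2 * (u (fst z) (snd z) - V (fst z) (snd z))\<^sup>2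
      - \<epsilon> * ((u (fst z) (snd z) - V (fst z) (snd z)) * ux (fst z) (snd z)))"
    using sqint_mult[OF e ux_sq] e2 by simp
  then show "Cint T (bflux V)" by (simp add: bflux_def mult.assoc)
qed

lemma smooth_time_bounded:
  assumes "smooth r" shows "\<exists>c. \<forall>t\<in>{0..T}. \<bar>r t\<bar> \<le> c"
  using smooth2_bounded[OF smooth2_time[OF assms], of T] by force

lemma smooth_borel: "smooth r \<Longrightarrow> r \<in> borel_measurable (LI 0 S)"
  by (rule borel_LI[OF borel_measurable_continuous_onI[OF smooth_continuous]])

text \<open>The left flank of the plateau lies in \<open>[-3, -1]\<close>, before the initial time, so for positive times only the
  descending flank at \<open>\<tau>\<close> is visible.\<close>

lemma time_cutoff_deriv:
  assumes d: "0 < \<delta>" "\<delta> \<le> 1" and t: "0 < t"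
  shows "deriv (plateau (-3) \<tau> \<delta>) t \<le> 0 \<and> (deriv (plateau (-3) \<tau> \<delta>) t \<noteq> 0 \<longrightarrow> \<tau> - 2 * \<delta> \<le> t \<and> t \<le> \<tau>)"
proof -
  have "2 < (t - (-3)) / \<delta>" using t d by (simp add: less_divide_eq)
  then have z: "deriv step ((t - (-3)) / \<delta>) = 0" by (intro step_deriv_0) simp
  have e: "deriv (plateau (-3) \<tau> \<delta>) t = - (step ((t - (-3)) / \<delta>) * (deriv step ((\<tau> - t) / \<delta>) / \<delta>))"
    unfolding plateau_deriv[OF d(1)] z by simp
  have "0 \<le> step ((t - (-3)) / \<delta>) * (deriv step ((\<tau> - t) / \<delta>) / \<delta>)"
    using d(1) step_ge step_deriv_ge by simp
  moreover have "\<tau> - 2 * \<delta> \<le> t \<and> t \<le> \<tau>" if "deriv (plateau (-3) \<tau> \<delta>) t \<noteq> 0"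
  proof -
    have "deriv step ((\<tau> - t) / \<delta>) \<noteq> 0" using that unfolding e by auto
    then have "\<not> ((\<tau> - t) / \<delta> < 1 \<or> 2 < (\<tau> - t) / \<delta>)" using step_deriv_0 by blast
    then have "1 \<le> (\<tau> - t) / \<delta>" "(\<tau> - t) / \<delta> \<le> 2" by auto
    then show ?thesis using d(1) by (simp add: divide_le_eq le_divide_eq)
  qed
  ultimately show ?thesis unfolding e by simp
qed

text \<open>The plateau functions exhaust \<open>\<Omega>\<close>, so the cutoff in space can be removed; its derivative
  concentrates at the lateral boundary and leaves the boundary flux, which \<open>r\<close> controls.\<close>

lemma rel_entropy_in_time:
  assumes V: "approximable T V Vt Vx"
    and \<theta>: "smooth \<theta>" "\<forall>t. 0 \<le> \<theta> t" "\<forall>t. \<theta> t \<noteq> 0 \<longrightarrow> t \<in> {A..B}" "B < T"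
    and r: "r \<longlonglongrightarrow> 0"
      "\<forall>\<^sub>F n in sequentially. CI T (\<lambda>t x. \<theta> t * deriv (plateau 0 1 (1 / real (Suc n))) x * bflux V t x) \<le> r n"
  shows "0 \<le> CI T (\<lambda>t x. deriv \<theta> t * ((u t x - V t x)\<^sup>2 / 2)) - CI T (\<lambda>t x. \<theta> t * dissip V Vt Vx t x)
     + \<theta> 0 * (LINT x|LI 0 1. (u0 x - V 0 x)\<^sup>2 / 2)"
proof -
  define \<kappa> where "\<kappa> = (\<lambda>n. plateau 0 1 (1 / real (Suc n)))"
  have d: "0 < 1 / real (Suc n)" for n by simp
  have \<kappa>s: "smooth (\<kappa> n)" for n unfolding \<kappa>_def by (rule smooth_plateau[OF d])
  have \<kappa>b: "0 \<le> \<kappa> n x" "\<kappa> n x \<le> 1" for n x unfolding \<kappa>_def by (rule plateau_ge plateau_le)+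
  have \<kappa>lim: "(\<lambda>n. \<kappa> n x) \<longlonglongrightarrow> 1" if "0 < x" "x < 1" for x
  proof -
    have "x \<in> {0<..<1}" using that by simp
    from plateau_exhausts[OF this] obtain n0 where n0: "\<forall>n\<ge>n0. plateau 0 1 (1 / real (Suc n)) x = 1" by blast
    have "\<forall>\<^sub>F n in sequentially. \<kappa> n x = 1"
      unfolding \<kappa>_def by (rule eventually_sequentiallyI[of n0]) (use n0 in blast)
    then show ?thesis by (rule tendsto_eventually)
  qed
  have \<kappa>ae: "AE z in LC T. (\<lambda>n. \<kappa> n (snd z)) \<longlonglongrightarrow> 1"
    by (rule AE_LC_I) (use \<kappa>lim in simp)
  obtain c where c: "\<forall>t\<in>{0..T}. \<bar>\<theta> t\<bar> \<le> c" using smooth_time_bounded[OF \<theta>(1)] by blast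
  obtain c' where c': "\<forall>t\<in>{0..T}. \<bar>deriv \<theta> t\<bar> \<le> c'" using smooth_time_bounded[OF smooth_deriv[OF \<theta>(1)]] by blast
  have \<theta>m: "Cmeas T (\<lambda>t x. \<theta> t)" "Cmeas T (\<lambda>t x. deriv \<theta> t)"
    by (intro Cmeas_time smooth_borel \<theta>(1) smooth_deriv)+
  have \<theta>b: "AE z in LC T. \<bar>\<theta> (fst z)\<bar> \<le> c" "AE z in LC T. \<bar>deriv \<theta> (fst z)\<bar> \<le> c'"
    by (rule AE_LC_I, use c c' in simp)+
  have \<kappa>m: "Cmeas T (\<lambda>t x. \<kappa> n x)" for n by (rule Cmeas_space[OF smooth_borel[OF \<kappa>s]])
  have i1: "Cint T (\<lambda>t x. deriv \<theta> t * ((u t x - V t x)\<^sup>2 / 2))"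
    by (rule integrable_bounded_mult[OF _ \<theta>m(2) \<theta>b(2)]) (use err2_int[OF V] in simp)
  have i2: "Cint T (\<lambda>t x. \<theta> t * dissip V Vt Vx t x)"
    by (rule integrable_bounded_mult[OF dissip_int[OF V] \<theta>m(1) \<theta>b(1)])
  have i3: "Cint T (\<lambda>t x. \<theta> t * bflux V t x)"
    by (rule integrable_bounded_mult[OF bflux_int[OF V] \<theta>m(1) \<theta>b(1)])
  have \<kappa>mult: "Cint T (\<lambda>t x. \<kappa> n x * f t x)" if "Cint T f" for f n
    by (rule integrable_bounded_mult[OF that \<kappa>m, where C = 1]) (use \<kappa>b in simp)
  have lim: "(\<lambda>n. CI T (\<lambda>t x. \<kappa> n x * f t x)) \<longlonglongrightarrow> CI T f" if f: "Cint T f" for f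
  proof (rule integral_dominated_convergence[where w = "\<lambda>z. \<bar>f (fst z) (snd z)\<bar>"])
    show "AE z in LC T. (\<lambda>n. \<kappa> n (snd z) * f (fst z) (snd z)) \<longlonglongrightarrow> f (fst z) (snd z)"
      using \<kappa>ae
    proof eventually_elim
      case (elim z)
      from tendsto_mult[OF elim tendsto_const[of "f (fst z) (snd z)"]] show ?case by simp
    qed
    show "AE z in LC T. norm (\<kappa> n (snd z) * f (fst z) (snd z)) \<le> \<bar>f (fst z) (snd z)\<bar>" for n
      by (rule AE_I2) (simp add: abs_mult \<kappa>b mult_left_le_one_le)
  qed (use f \<kappa>mult[OF f] in auto)
  have ineq: "0 \<le> CI T (\<lambda>t x. \<kappa> n x * (deriv \<theta> t * ((u t x - V t x)\<^sup>2 / 2)))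
      + CI T (\<lambda>t x. \<theta> t * deriv (\<kappa> n) x * bflux V t x)
      - CI T (\<lambda>t x. \<kappa> n x * (\<theta> t * dissip V Vt Vx t x))
      + \<theta> 0 * (LINT x|LI 0 1. \<kappa> n x * ((u0 x - V 0 x)\<^sup>2 / 2))" for n
  proof -
    define \<Phi> where "\<Phi> = (\<lambda>t x. \<theta> t * \<kappa> n x)"
    have P: "test2 ({..<T} \<times> Omega) \<Phi>"
    proof (rule test2I)
      show "smooth2 \<Phi>" unfolding \<Phi>_def by (rule smooth2_tensor[OF \<theta>(1) \<kappa>s])
      show "t \<in> {A..B} \<and> x \<in> {0 + 1 / real (Suc n)..1 - 1 / real (Suc n)}" if "\<Phi> t x \<noteq> 0" for t x
        using that \<theta>(3) plateau_support[OF _ d] unfolding \<Phi>_def \<kappa>_def by (metis mult_eq_0_iff)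
      show "{A..B} \<times> {0 + 1 / real (Suc n)..1 - 1 / real (Suc n)} \<subseteq> {..<T} \<times> Omega"
      proof (rule Sigma_mono)
        show "{A..B} \<subseteq> {..<T}" using \<theta>(4) by auto
        show "{0 + 1 / real (Suc n)..1 - 1 / real (Suc n)} \<subseteq> Omega"
        proof
          fix x assume "x \<in> {0 + 1 / real (Suc n)..1 - 1 / real (Suc n)}"
          then show "x \<in> Omega" using d[of n] unfolding atLeastAtMost_iff greaterThanLessThan_iff by linarith
        qed
      qed
    qed
    have pos: "\<forall>t x. 0 \<le> \<Phi> t x" unfolding \<Phi>_def using \<theta>(2) \<kappa>b by simp
    obtain cc where cc: "\<forall>x\<in>{0..1}. \<bar>deriv (\<kappa> n) x\<bar> \<le> cc"
      using smooth2_bounded[OF smooth2_space[OF smooth_deriv[OF \<kappa>s]], of T n] T by force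
    have j: "Cint T (\<lambda>t x. \<theta> t * deriv (\<kappa> n) x * bflux V t x)"
    proof -
      have "Cint T (\<lambda>t x. deriv (\<kappa> n) x * (\<theta> t * bflux V t x))"
        by (rule integrable_bounded_mult[OF i3 Cmeas_space[OF smooth_borel[OF smooth_deriv[OF \<kappa>s]]], where C = cc],
            rule AE_LC_I) (use cc in simp)
      then show ?thesis by (simp add: mult_ac)
    qed
    have e: "RE \<Phi> V Vt Vx t x = \<kappa> n x * (deriv \<theta> t * ((u t x - V t x)\<^sup>2 / 2)) + \<theta> t * deriv (\<kappa> n) x * bflux V t x
       - \<kappa> n x * (\<theta> t * dissip V Vt Vx t x)" for t x
      unfolding RE_def \<Phi>_def Dt_tensor[OF \<theta>(1) \<kappa>s] Dx_tensor[OF \<theta>(1) \<kappa>s] rel_entropy_def bflux_def dissip_def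
      by (simp add: mult_ac)
    have "CI T (RE \<Phi> V Vt Vx) = CI T (\<lambda>t x. \<kappa> n x * (deriv \<theta> t * ((u t x - V t x)\<^sup>2 / 2)))
      + CI T (\<lambda>t x. \<theta> t * deriv (\<kappa> n) x * bflux V t x)
      - CI T (\<lambda>t x. \<kappa> n x * (\<theta> t * dissip V Vt Vx t x))"
      unfolding e using \<kappa>mult[OF i1, of n] \<kappa>mult[OF i2, of n] j by simp
    moreover have "(LINT x|LI 0 1. \<Phi> 0 x * ((u0 x - V 0 x)\<^sup>2 / 2)) = \<theta> 0 * (LINT x|LI 0 1. \<kappa> n x * ((u0 x - V 0 x)\<^sup>2 / 2))"
      by (simp add: \<Phi>_def mult.assoc)
    ultimately show ?thesis using rel_entropy_approximable[OF P pos V] by simp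
  qed
  have l3: "(\<lambda>n. LINT x|LI 0 1. \<kappa> n x * ((u0 x - V 0 x)\<^sup>2 / 2)) \<longlonglongrightarrow> (LINT x|LI 0 1. (u0 x - V 0 x)\<^sup>2 / 2)"
  proof (rule integral_dominated_convergence[where w = "\<lambda>x. (u0 x - V 0 x)\<^sup>2 / 2"])
    obtain C where C: "AE x in LI 0 1. \<bar>V 0 x\<bar> \<le> C" using approximable_bounds[OF V T] by blast
    have "V 0 \<in> borel_measurable (LI 0 1)" using V by (simp add: approximable_def)
    from sqint_diff[OF u0 LI.sqint_bounded[OF this C]]
    have q: "integrable (LI 0 1) (\<lambda>x. (u0 x - V 0 x)\<^sup>2)" by (simp add: sqint_def)
    then show qi: "integrable (LI 0 1) (\<lambda>x. (u0 x - V 0 x)\<^sup>2 / 2)" by simp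
    then show "(\<lambda>x. (u0 x - V 0 x)\<^sup>2 / 2) \<in> borel_measurable (LI 0 1)" by simp
    show "(\<lambda>x. \<kappa> n x * ((u0 x - V 0 x)\<^sup>2 / 2)) \<in> borel_measurable (LI 0 1)" for n
      by (rule borel_measurable_times[OF smooth_borel[OF \<kappa>s]]) (use qi in simp)
    show "AE x in LI 0 1. (\<lambda>n. \<kappa> n x * ((u0 x - V 0 x)\<^sup>2 / 2)) \<longlonglongrightarrow> (u0 x - V 0 x)\<^sup>2 / 2"
    proof (rule AE_LI_I)
      fix x :: real assume "0 < x" "x < 1"
      from tendsto_mult[OF \<kappa>lim[OF this] tendsto_const[of "(u0 x - V 0 x)\<^sup>2 / 2"]]
      show "(\<lambda>n. \<kappa> n x * ((u0 x - V 0 x)\<^sup>2 / 2)) \<longlonglongrightarrow> (u0 x - V 0 x)\<^sup>2 / 2" by simp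
    qed
    show "AE x in LI 0 1. norm (\<kappa> n x * ((u0 x - V 0 x)\<^sup>2 / 2)) \<le> (u0 x - V 0 x)\<^sup>2 / 2" for n
      by (rule AE_I2) (simp add: abs_mult \<kappa>b mult_left_le_one_le)
  qed
  have lims: "(\<lambda>n. CI T (\<lambda>t x. \<kappa> n x * (deriv \<theta> t * ((u t x - V t x)\<^sup>2 / 2))) + r n
      - CI T (\<lambda>t x. \<kappa> n x * (\<theta> t * dissip V Vt Vx t x))
      + \<theta> 0 * (LINT x|LI 0 1. \<kappa> n x * ((u0 x - V 0 x)\<^sup>2 / 2)))
    \<longlonglongrightarrow> CI T (\<lambda>t x. deriv \<theta> t * ((u t x - V t x)\<^sup>2 / 2)) + 0 - CI T (\<lambda>t x. \<theta> t * dissip V Vt Vx t x)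
     + \<theta> 0 * (LINT x|LI 0 1. (u0 x - V 0 x)\<^sup>2 / 2)"
    by (intro tendsto_add tendsto_diff tendsto_mult tendsto_const lim[OF i1] lim[OF i2] r(1) l3)
  have "0 \<le> CI T (\<lambda>t x. deriv \<theta> t * ((u t x - V t x)\<^sup>2 / 2)) + 0 - CI T (\<lambda>t x. \<theta> t * dissip V Vt Vx t x)
     + \<theta> 0 * (LINT x|LI 0 1. (u0 x - V 0 x)\<^sup>2 / 2)"
  proof (rule tendsto_lowerbound[OF lims])
    show "\<forall>\<^sub>F n in sequentially. 0 \<le> CI T (\<lambda>t x. \<kappa> n x * (deriv \<theta> t * ((u t x - V t x)\<^sup>2 / 2))) + r n
      - CI T (\<lambda>t x. \<kappa> n x * (\<theta> t * dissip V Vt Vx t x))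
      + \<theta> 0 * (LINT x|LI 0 1. \<kappa> n x * ((u0 x - V 0 x)\<^sup>2 / 2))"
      using r(2)
    proof eventually_elim
      case (elim n) then show ?case using ineq[of n] unfolding \<kappa>_def by linarith
    qed
  qed simp
  then show ?thesis by simp
qed

text \<open>Letting the cutoff in time tend to the indicator of \<open>t < \<tau>\<close>. The energy need only be lower
  semicontinuous from the left at \<open>\<tau>\<close>, which weak continuity provides.\<close>

lemma energy_inequality:
  assumes V: "approximable T V Vt Vx" and \<tau>: "0 < \<tau>" "\<tau> \<le> T"
    and bc: "\<And>\<theta>. \<lbrakk>smooth \<theta>; \<forall>t. 0 \<le> \<theta> t \<and> \<theta> t \<le> 1\<rbrakk> \<Longrightarrow> no_boundary_gain V \<theta>"
    and lsc: "\<forall>\<eta>>0. \<exists>\<rho>>0. \<forall>t\<in>{0..T}. \<tau> - \<rho> \<le> t \<and> t \<le> \<tau> \<longrightarrow>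
      (LINT x|LI 0 1. (u \<tau> x - V \<tau> x)\<^sup>2) - \<eta> \<le> (LINT x|LI 0 1. (u t x - V t x)\<^sup>2)"
  shows "(LINT x|LI 0 1. (u \<tau> x - V \<tau> x)\<^sup>2) / 2 \<le> (LINT x|LI 0 1. (u0 x - V 0 x)\<^sup>2) / 2
     - CI T (\<lambda>t x. if t < \<tau> then dissip V Vt Vx t x else 0)"
proof (rule field_le_epsilon)
  fix \<eta> :: real assume \<eta>: "0 < \<eta>"
  define E where "E = (\<lambda>t. LINT x|LI 0 1. (u t x - V t x)\<^sup>2)"
  define E0 where "E0 = (LINT x|LI 0 1. (u0 x - V 0 x)\<^sup>2)"
  obtain \<rho> where \<rho>: "\<rho> > 0" "\<forall>t\<in>{0..T}. \<tau> - \<rho> \<le> t \<and> t \<le> \<tau> \<longrightarrow> E \<tau> - \<eta> \<le> E t"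
    using lsc \<eta> unfolding E_def by blast
  define \<delta> where "\<delta> = (\<lambda>n. 1 / real (Suc n))"
  define \<theta> where "\<theta> = (\<lambda>n. plateau (-3) \<tau> (\<delta> n))"
  have d: "0 < \<delta> n" "\<delta> n \<le> 1" for n by (simp_all add: \<delta>_def)
  have \<theta>s: "smooth (\<theta> n)" for n unfolding \<theta>_def by (rule smooth_plateau[OF d(1)])
  have \<theta>b: "0 \<le> \<theta> n t" "\<theta> n t \<le> 1" for n t unfolding \<theta>_def by (rule plateau_ge plateau_le)+
  have \<theta>0: "\<theta> n t = 0" if "\<tau> \<le> t" for n t
  proof (rule ccontr)
    assume "\<theta> n t \<noteq> 0"
    from plateau_support[OF this[unfolded \<theta>_def] d(1)] show False using that d(1)[of n] by simp
  qed
  have \<theta>1: "\<theta> n t = 1" if "0 \<le> t" "t \<le> \<tau> - 2 * \<delta> n" for n t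
    unfolding \<theta>_def by (rule plateau_eq_1[OF _ d(1)]) (use that d(2)[of n] in simp)
  have d\<theta>: "deriv (\<theta> n) t \<le> 0 \<and> (deriv (\<theta> n) t \<noteq> 0 \<longrightarrow> \<tau> - 2 * \<delta> n \<le> t \<and> t \<le> \<tau>)" if "0 < t" for n t
    unfolding \<theta>_def by (rule time_cutoff_deriv[OF d that])
  have \<delta>lim: "\<delta> \<longlonglongrightarrow> 0" unfolding \<delta>_def using LIMSEQ_inverse_real_of_nat by (simp add: inverse_eq_divide)
  have small: "\<forall>\<^sub>F n in sequentially. 2 * \<delta> n < \<rho> \<and> 2 * \<delta> n < \<tau>"
  proof -
    have "\<forall>\<^sub>F n in sequentially. \<delta> n < min \<rho> \<tau> / 2"
      by (rule order_tendstoD(2)[OF \<delta>lim]) (use \<rho>(1) \<tau> in simp)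
    then show ?thesis by eventually_elim auto
  qed
  have fe: "E \<tau> - \<eta> \<le> E0 - 2 * CI T (\<lambda>t x. \<theta> n t * dissip V Vt Vx t x)"
    if n: "2 * \<delta> n < \<rho>" "2 * \<delta> n < \<tau>" for n
  proof -
    obtain r where r: "r \<longlonglongrightarrow> 0"
      "\<forall>\<^sub>F m in sequentially. CI T (\<lambda>t x. \<theta> n t * deriv (plateau 0 1 (1 / real (Suc m))) x * bflux V t x) \<le> r m"
      using bc[OF \<theta>s] \<theta>b by blast
    have sup: "\<forall>t. \<theta> n t \<noteq> 0 \<longrightarrow> t \<in> {-3 + \<delta> n..\<tau> - \<delta> n}"
      unfolding \<theta>_def using plateau_support[OF _ d(1)] by blast
    have "\<tau> - \<delta> n < T" using \<tau> d(1)[of n] by simp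
    from rel_entropy_in_time[OF V \<theta>s _ sup this r] \<theta>b
    have I: "0 \<le> CI T (\<lambda>t x. deriv (\<theta> n) t * ((u t x - V t x)\<^sup>2 / 2)) - CI T (\<lambda>t x. \<theta> n t * dissip V Vt Vx t x)
      + \<theta> n 0 * (LINT x|LI 0 1. (u0 x - V 0 x)\<^sup>2 / 2)" by blast
    obtain c' where c': "\<forall>t\<in>{0..T}. \<bar>deriv (\<theta> n) t\<bar> \<le> c'" using smooth_time_bounded[OF smooth_deriv[OF \<theta>s]] by blast
    have i: "Cint T (\<lambda>t x. deriv (\<theta> n) t * ((u t x - V t x)\<^sup>2 / 2))"
      by (rule integrable_bounded_mult[OF _ Cmeas_time[OF smooth_borel[OF smooth_deriv[OF \<theta>s]]], where C = c'], use err2_int[OF V] in simp,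
          rule AE_LC_I) (use c' in simp)
    have "CI T (\<lambda>t x. deriv (\<theta> n) t * ((u t x - V t x)\<^sup>2 / 2)) = (LINT t|LI 0 T. deriv (\<theta> n) t * (E t / 2))"
      unfolding CI_iterated(1)[OF i] by (simp add: E_def)
    also have "\<dots> \<le> (LINT t|LI 0 T. deriv (\<theta> n) t * ((E \<tau> - \<eta>) / 2))"
    proof (rule integral_mono_AE)
      show "integrable (LI 0 T) (\<lambda>t. deriv (\<theta> n) t * (E t / 2))"
        using CI_iterated(3)[OF i] by (simp add: E_def)
      have "isCont (deriv (\<theta> n)) t" for t
        using smooth_continuous[OF smooth_deriv[OF \<theta>s], of UNIV] by (simp add: continuous_on_eq_continuous_at)
      note FTC_LI[OF smooth_DERIV[OF \<theta>s] this, where a = 0 and b = T]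
      then show "integrable (LI 0 T) (\<lambda>t. deriv (\<theta> n) t * ((E \<tau> - \<eta>) / 2))" using T by simp
      show "AE t in LI 0 T. deriv (\<theta> n) t * (E t / 2) \<le> deriv (\<theta> n) t * ((E \<tau> - \<eta>) / 2)"
      proof (rule AE_LI_I)
        fix t :: real assume t: "0 < t" "t < T"
        show "deriv (\<theta> n) t * (E t / 2) \<le> deriv (\<theta> n) t * ((E \<tau> - \<eta>) / 2)"
        proof (cases "deriv (\<theta> n) t = 0")
          case False
          then have "\<tau> - 2 * \<delta> n \<le> t" "t \<le> \<tau>" "deriv (\<theta> n) t \<le> 0" using d\<theta>[OF t(1), of n] by auto
          then have "E \<tau> - \<eta> \<le> E t" using \<rho>(2) n t by simp
          then show ?thesis using \<open>deriv (\<theta> n) t \<le> 0\<close> by (intro mult_left_mono_neg) auto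
        qed simp
      qed
    qed
    also have "\<dots> = (LINT t|LI 0 T. deriv (\<theta> n) t) * ((E \<tau> - \<eta>) / 2)" by simp
    also have "(LINT t|LI 0 T. deriv (\<theta> n) t) = -1"
    proof -
      have c: "isCont (deriv (\<theta> n)) t" for t
        using smooth_continuous[OF smooth_deriv[OF \<theta>s], of UNIV] by (simp add: continuous_on_eq_continuous_at)
      show ?thesis using FTC_LI(2)[OF smooth_DERIV[OF \<theta>s] c, where a = 0 and b = T] T \<theta>0[of T n] \<theta>1[of 0 n] \<tau> n by simp
    qed
    finally have "CI T (\<lambda>t x. deriv (\<theta> n) t * ((u t x - V t x)\<^sup>2 / 2)) \<le> - ((E \<tau> - \<eta>) / 2)"
      by linarith
    note D = this
    have z: "\<theta> n 0 * (LINT x|LI 0 1. (u0 x - V 0 x)\<^sup>2 / 2) = E0 / 2" using \<theta>1[of 0 n] n by (simp add: E0_def)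
    have "a - e \<le> E' - 2 * k" if "d \<le> - ((a - e) / 2)" "0 \<le> d - k + E' / 2" for a e E' k d :: real
    proof -
      have "2 * d \<le> e - a" using that(1) by (simp add: field_simps)
      moreover have "2 * k \<le> 2 * d + E'" using that(2) by (simp add: field_simps)
      ultimately show ?thesis by simp
    qed
    from this[OF D I[unfolded z]] show ?thesis .
  qed
  have lim: "(\<lambda>n. CI T (\<lambda>t x. \<theta> n t * dissip V Vt Vx t x)) \<longlonglongrightarrow> CI T (\<lambda>t x. if t < \<tau> then dissip V Vt Vx t x else 0)"
  proof (rule integral_dominated_convergence[where w = "\<lambda>z. \<bar>dissip V Vt Vx (fst z) (snd z)\<bar>"])
    have dm: "Cmeas T (dissip V Vt Vx)" using dissip_int[OF V] by simp
    have tm: "Cmeas T (\<lambda>t x. t)" by (rule fst_LC)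
    show "Cmeas T (\<lambda>t x. if t < \<tau> then dissip V Vt Vx t x else 0)"
      using dm tm by measurable
    show "Cmeas T (\<lambda>t x. \<theta> n t * dissip V Vt Vx t x)" for n
      by (rule borel_measurable_times[OF Cmeas_time[OF smooth_borel[OF \<theta>s]] dm])
    show "integrable (LC T) (\<lambda>z. \<bar>dissip V Vt Vx (fst z) (snd z)\<bar>)" using dissip_int[OF V] by simp
    show "AE z in LC T. norm (\<theta> n (fst z) * dissip V Vt Vx (fst z) (snd z)) \<le> \<bar>dissip V Vt Vx (fst z) (snd z)\<bar>" for n
      by (rule AE_I2) (simp add: abs_mult \<theta>b mult_left_le_one_le)
    show "AE z in LC T. (\<lambda>n. \<theta> n (fst z) * dissip V Vt Vx (fst z) (snd z)) \<longlonglongrightarrow> (if fst z < \<tau> then dissip V Vt Vx (fst z) (snd z) else 0)"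
    proof (rule AE_LC_I)
      fix t x :: real assume t: "0 < t" "t < T" "0 < x" "x < 1"
      have "\<forall>\<^sub>F n in sequentially. \<theta> n t * dissip V Vt Vx t x = (if t < \<tau> then dissip V Vt Vx t x else 0)"
      proof (cases "t < \<tau>")
        case True
        have "\<forall>\<^sub>F n in sequentially. \<delta> n < (\<tau> - t) / 2"
          by (rule order_tendstoD(2)[OF \<delta>lim]) (use True in simp)
        then show ?thesis
        proof eventually_elim
          case (elim n) then show ?case using \<theta>1[of t n] True t by simp
        qed
      qed (simp add: \<theta>0)
      then show "(\<lambda>n. \<theta> n (fst (t, x)) * dissip V Vt Vx (fst (t, x)) (snd (t, x))) \<longlonglongrightarrow>
        (if fst (t, x) < \<tau> then dissip V Vt Vx (fst (t, x)) (snd (t, x)) else 0)"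
        unfolding fst_conv snd_conv by (rule tendsto_eventually)
    qed
  qed
  have "E \<tau> - \<eta> \<le> E0 - 2 * CI T (\<lambda>t x. if t < \<tau> then dissip V Vt Vx t x else 0)"
  proof (rule tendsto_lowerbound)
    show "(\<lambda>n. E0 - 2 * CI T (\<lambda>t x. \<theta> n t * dissip V Vt Vx t x))
      \<longlonglongrightarrow> E0 - 2 * CI T (\<lambda>t x. if t < \<tau> then dissip V Vt Vx t x else 0)"
      by (intro tendsto_diff tendsto_mult tendsto_const lim)
    show "\<forall>\<^sub>F n in sequentially. E \<tau> - \<eta> \<le> E0 - 2 * CI T (\<lambda>t x. \<theta> n t * dissip V Vt Vx t x)"
      using small by eventually_elim (use fe in blast)
  qed simp
  then show "(LINT x|LI 0 1. (u \<tau> x - V \<tau> x)\<^sup>2) / 2 \<le> (LINT x|LI 0 1. (u0 x - V 0 x)\<^sup>2) / 2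
     - CI T (\<lambda>t x. if t < \<tau> then dissip V Vt Vx t x else 0) + \<eta>"
    using \<eta> unfolding E_def E0_def by linarith
qed

end

section \<open>Traces and strips along the lateral boundary\<close>

definition strip :: "real \<Rightarrow> real \<Rightarrow> real set" where
  "strip c \<delta> = {c - \<delta><..<c + \<delta>}"

lemma strip_borel [measurable]: "strip c \<delta> \<in> sets borel"
  by (simp add: strip_def)

lemma strip_Cmeas: "Cmeas T (\<lambda>t x. indicator (strip c \<delta>) x)"
  by (rule Cmeas_space[OF borel_LI]) simp

lemma strip_nn_integral:
  "(\<integral>\<^sup>+z\<in>{0<..<T} \<times> ({c - \<delta><..<c + \<delta>} \<inter> Omega). f z \<partial>lborel) = (\<integral>\<^sup>+z. f z * indicator (strip c \<delta>) (snd z) \<partial>LC T)"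
proof -
  have "(\<integral>\<^sup>+z. f z * indicator (strip c \<delta>) (snd z) \<partial>LC T) =
     (\<integral>\<^sup>+z. f z * indicator (strip c \<delta>) (snd z) * indicator (Cyl T) z \<partial>lborel)"
    unfolding LC_eq by (subst nn_integral_restrict_space) auto
  also have "\<dots> = (\<integral>\<^sup>+z\<in>{0<..<T} \<times> ({c - \<delta><..<c + \<delta>} \<inter> Omega). f z \<partial>lborel)"
    by (rule nn_integral_cong) (auto simp: indicator_def strip_def)
  finally show ?thesis ..
qed

text \<open>Common boundary data cancel by the triangle inequality, so that the boundary values of the error vanish.\<close>

lemma trace_difference:
  assumes tr: "has_trace T u c g" "has_trace T v c g"
    and m: "Cmeas T u" "Cmeas T v" "g \<in> borel_measurable (LI 0 T)"
    and d: "\<And>n. 0 < \<delta> n" "\<delta> \<longlonglongrightarrow> 0"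
  shows "(\<lambda>n. (\<integral>\<^sup>+z. ennreal \<bar>u (fst z) (snd z) - v (fst z) (snd z)\<bar> * indicator (strip c (\<delta> n)) (snd z) \<partial>LC T) / ennreal (\<delta> n))
    \<longlonglongrightarrow> 0"
proof -
  define N where "N = (\<lambda>v \<delta>. (\<integral>\<^sup>+z. ennreal \<bar>v (fst z) (snd z) - g (fst z)\<bar> * indicator (strip c \<delta>) (snd z) \<partial>LC T))"
  have fl: "filterlim \<delta> (at_right 0) sequentially"
    by (rule filterlim_atI[where F = sequentially, OF _ _] tendsto_imp_filterlim_at_right)+ (use d in auto)
  have lim: "(\<lambda>n. N v (\<delta> n) / ennreal (\<delta> n)) \<longlonglongrightarrow> 0" if "has_trace T v c g" for v
  proof -
    have "((\<lambda>\<delta>. N v \<delta> / ennreal \<delta>) \<longlongrightarrow> 0) (at_right 0)"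
      using that unfolding has_trace_def strip_nn_integral N_def by (simp add: case_prod_unfold)
    then show ?thesis by (rule filterlim_compose[OF _ fl])
  qed
  have gm: "Cmeas T (\<lambda>t x. g t)" by (rule Cmeas_time[OF m(3)])
  show ?thesis
  proof (rule tendsto_sandwich[OF always_eventually always_eventually tendsto_const])
    show "(\<lambda>n. N u (\<delta> n) / ennreal (\<delta> n) + N v (\<delta> n) / ennreal (\<delta> n)) \<longlonglongrightarrow> 0"
      using tendsto_add[OF lim[OF tr(1)] lim[OF tr(2)]] by simp
    show "\<forall>n. (\<integral>\<^sup>+z. ennreal \<bar>u (fst z) (snd z) - v (fst z) (snd z)\<bar> * indicator (strip c (\<delta> n)) (snd z) \<partial>LC T) / ennreal (\<delta> n)
      \<le> N u (\<delta> n) / ennreal (\<delta> n) + N v (\<delta> n) / ennreal (\<delta> n)"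
    proof
      fix n
      have "(\<integral>\<^sup>+z. ennreal \<bar>u (fst z) (snd z) - v (fst z) (snd z)\<bar> * indicator (strip c (\<delta> n)) (snd z) \<partial>LC T)
        \<le> (\<integral>\<^sup>+z. ennreal \<bar>u (fst z) (snd z) - g (fst z)\<bar> * indicator (strip c (\<delta> n)) (snd z)
            + ennreal \<bar>v (fst z) (snd z) - g (fst z)\<bar> * indicator (strip c (\<delta> n)) (snd z) \<partial>LC T)"
      proof (rule nn_integral_mono)
        fix z
        have "ennreal \<bar>u (fst z) (snd z) - v (fst z) (snd z)\<bar> \<le> ennreal (\<bar>u (fst z) (snd z) - g (fst z)\<bar> + \<bar>v (fst z) (snd z) - g (fst z)\<bar>)"
          by (rule ennreal_leI) linarith
        also have "\<dots> = ennreal \<bar>u (fst z) (snd z) - g (fst z)\<bar> + ennreal \<bar>v (fst z) (snd z) - g (fst z)\<bar>"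
          by (rule ennreal_plus) simp_all
        finally show "ennreal \<bar>u (fst z) (snd z) - v (fst z) (snd z)\<bar> * indicator (strip c (\<delta> n)) (snd z)
          \<le> ennreal \<bar>u (fst z) (snd z) - g (fst z)\<bar> * indicator (strip c (\<delta> n)) (snd z)
            + ennreal \<bar>v (fst z) (snd z) - g (fst z)\<bar> * indicator (strip c (\<delta> n)) (snd z)"
          by (simp add: indicator_def)
      qed
      also have "\<dots> = N u (\<delta> n) + N v (\<delta> n)"
        unfolding N_def
      proof (rule nn_integral_add)
        have [measurable]: "(\<lambda>z. indicator (strip c (\<delta> n)) (snd z) :: ennreal) \<in> borel_measurable (LC T)"
          by (rule measurable_compose[OF snd_LC]) simp
        note [measurable] = m(1,2) gm
        show "(\<lambda>z. ennreal \<bar>u (fst z) (snd z) - g (fst z)\<bar> * indicator (strip c (\<delta> n)) (snd z)) \<in> borel_measurable (LC T)"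
          "(\<lambda>z. ennreal \<bar>v (fst z) (snd z) - g (fst z)\<bar> * indicator (strip c (\<delta> n)) (snd z)) \<in> borel_measurable (LC T)"
          by measurable
      qed
      finally show "(\<integral>\<^sup>+z. ennreal \<bar>u (fst z) (snd z) - v (fst z) (snd z)\<bar> * indicator (strip c (\<delta> n)) (snd z) \<partial>LC T) / ennreal (\<delta> n)
        \<le> N u (\<delta> n) / ennreal (\<delta> n) + N v (\<delta> n) / ennreal (\<delta> n)"
        unfolding add_divide_distrib_ennreal[symmetric] by (rule divide_right_mono_ennreal)
    qed
  qed simp
qed

lemma plateau_deriv_bounds:
  "\<exists>C\<ge>0. \<forall>\<delta>>0. \<forall>x. deriv (plateau 0 1 \<delta>) x \<le> C / \<delta> * indicator (strip 0 (3 * \<delta>)) x \<and>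
      - deriv (plateau 0 1 \<delta>) x \<le> C / \<delta> * indicator (strip 1 (3 * \<delta>)) x"
proof -
  obtain C where C: "\<forall>x. deriv step x \<le> C" using step_deriv_le by blast
  have C0: "0 \<le> C" using C step_deriv_ge order_trans by blast
  have b: "deriv step y / \<delta> * s \<le> C / \<delta> * indicator A x" "0 \<le> deriv step y / \<delta> * s"
    if "0 < \<delta>" "0 \<le> s" "s \<le> 1" "\<And>y'. y' = y \<Longrightarrow> 1 \<le> y \<and> y \<le> 2 \<longrightarrow> x \<in> A" for \<delta> y s x :: real and A
  proof -
    show p: "0 \<le> deriv step y / \<delta> * s" using that step_deriv_ge[of y] by simp
    show "deriv step y / \<delta> * s \<le> C / \<delta> * indicator A x"
    proof (cases "1 \<le> y \<and> y \<le> 2")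
      case True
      then have "x \<in> A" using that(4) by blast
      have "deriv step y / \<delta> * s \<le> C / \<delta> * 1"
        by (rule mult_mono) (use that C C0 in \<open>auto simp: divide_right_mono\<close>)
      then show ?thesis using \<open>x \<in> A\<close> by simp
    next
      case False
      then have "deriv step y = 0" by (intro step_deriv_0) linarith
      then show ?thesis using C0 that by simp
    qed
  qed
  show ?thesis
  proof (intro exI[of _ C] conjI allI impI C0)
    fix \<delta> x :: real assume d: "0 < \<delta>"
    define p1 p2 where "p1 = deriv step ((x - 0) / \<delta>) / \<delta> * step ((1 - x) / \<delta>)"
      and "p2 = deriv step ((1 - x) / \<delta>) / \<delta> * step ((x - 0) / \<delta>)"
    have e: "deriv (plateau 0 1 \<delta>) x = p1 - p2" unfolding plateau_deriv[OF d] p1_def p2_def by (simp add: mult.commute)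
    have s1: "1 \<le> (x - 0) / \<delta> \<and> (x - 0) / \<delta> \<le> 2 \<longrightarrow> x \<in> strip 0 (3 * \<delta>)"
    proof
      assume "1 \<le> (x - 0) / \<delta> \<and> (x - 0) / \<delta> \<le> 2"
      then have "\<delta> \<le> x" "x \<le> 2 * \<delta>" using d by (simp_all add: le_divide_eq divide_le_eq)
      then show "x \<in> strip 0 (3 * \<delta>)" using d by (simp add: strip_def)
    qed
    have s2: "1 \<le> (1 - x) / \<delta> \<and> (1 - x) / \<delta> \<le> 2 \<longrightarrow> x \<in> strip 1 (3 * \<delta>)"
    proof
      assume "1 \<le> (1 - x) / \<delta> \<and> (1 - x) / \<delta> \<le> 2"
      then have "\<delta> \<le> 1 - x" "1 - x \<le> 2 * \<delta>" using d by (simp_all add: le_divide_eq divide_le_eq)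
      then show "x \<in> strip 1 (3 * \<delta>)" using d by (simp add: strip_def)
    qed
    have p1: "p1 \<le> C / \<delta> * indicator (strip 0 (3 * \<delta>)) x" "0 \<le> p1"
      unfolding p1_def by (rule b[OF d step_ge step_le s1])+
    have p2: "p2 \<le> C / \<delta> * indicator (strip 1 (3 * \<delta>)) x" "0 \<le> p2"
      unfolding p2_def by (rule b[OF d step_ge step_le s2])+
    show "deriv (plateau 0 1 \<delta>) x \<le> C / \<delta> * indicator (strip 0 (3 * \<delta>)) x"
      "- deriv (plateau 0 1 \<delta>) x \<le> C / \<delta> * indicator (strip 1 (3 * \<delta>)) x"
      unfolding e using p1 p2 by linarith+
  qed
qed

lemma inv_Suc_lim: "(\<lambda>n. a * (1 / real (Suc n))) \<longlonglongrightarrow> 0"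
  using tendsto_mult[OF tendsto_const[of a] LIMSEQ_inverse_real_of_nat] by (simp add: inverse_eq_divide)

lemma strip_measure:
  assumes "c \<in> {0, 1}" "0 < \<delta>" "\<delta> \<le> 1"
  shows "(\<integral>\<^sup>+x. indicator (strip c \<delta>) x \<partial>LI 0 1) = ennreal \<delta>" "(LINT x|LI 0 1. indicator (strip c \<delta>) x) = \<delta>"
proof -
  have "(\<integral>\<^sup>+x. indicator (strip c \<delta>) x \<partial>LI 0 1) = (\<integral>\<^sup>+x. indicator (strip c \<delta> \<inter> Omega) x \<partial>lborel)"
    unfolding nn_integral_LI[symmetric] by (rule nn_integral_cong) (simp add: indicator_def)
  also have "\<dots> = emeasure lborel (strip c \<delta> \<inter> Omega)" by (rule nn_integral_indicator) simp
  also have "strip c \<delta> \<inter> Omega = (if c = 0 then {0<..<\<delta>} else {1 - \<delta><..<1})"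
    using assms by (auto simp: strip_def)
  also have "emeasure lborel (if c = 0 then {0<..<\<delta>} else {1 - \<delta><..<1}) = ennreal \<delta>"
    using assms by simp
  finally show n: "(\<integral>\<^sup>+x. indicator (strip c \<delta>) x \<partial>LI 0 1) = ennreal \<delta>" .
  have i: "integrable (LI 0 1) (\<lambda>x. indicator (strip c \<delta>) x :: real)"
    by (rule LI.integrable_const_bound[where B = 1]) (auto intro: borel_LI)
  have "ennreal (LINT x|LI 0 1. indicator (strip c \<delta>) x) = (\<integral>\<^sup>+x. ennreal (indicator (strip c \<delta>) x) \<partial>LI 0 1)"
    by (rule nn_integral_eq_integral[symmetric, OF i]) simp
  also have "\<dots> = ennreal \<delta>" unfolding ennreal_indicator by (rule n)
  finally show "(LINT x|LI 0 1. indicator (strip c \<delta>) x) = \<delta>"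
    using assms by (simp add: integral_nonneg_AE)
qed

lemma Cmeas_section: "Cmeas T f \<Longrightarrow> t \<in> {0<..<T} \<Longrightarrow> f t \<in> borel_measurable (LI 0 1)"
proof -
  assume m: "Cmeas T f" and t: "t \<in> {0<..<T}"
  have "Pair t \<in> measurable (LI 0 1) (LC T)" unfolding LC_def by (rule measurable_Pair1') (use t in simp)
  from measurable_compose[OF this m] show ?thesis by simp
qed

lemma sqint_sections:
  assumes "sqint (LC T) (\<lambda>z. f (fst z) (snd z))"
  shows "AE t in LI 0 T. sqint (LI 0 1) (f t)"
proof -
  have i: "Cint T (\<lambda>t x. (f t x)\<^sup>2)" and m: "Cmeas T f" using assms by (simp_all add: sqint_def)
  have "AE t in LI 0 T. t \<in> {0<..<T}" using AE_space[of "LI 0 T"] by simp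
  then show ?thesis using CI_iterated(4)[OF i]
    by eventually_elim (simp add: sqint_def Cmeas_section[OF m])
qed

text \<open>A continuous representative whose averages over the boundary strips vanish in the limit
  vanishes at the boundary; by Fatou's lemma, convergence of the averages in the mean over time is enough.\<close>

lemma zero_trace_sections:
  assumes m: "Cmeas T e" and c: "c \<in> {0, 1}"
    and P: "AE t in LI 0 T. continuous_on UNIV (P t) \<and> (AE x in LI 0 1. e t x = P t x)"
    and tr: "(\<lambda>n. (\<integral>\<^sup>+z. ennreal \<bar>e (fst z) (snd z)\<bar> * indicator (strip c (1 / real (Suc n))) (snd z) \<partial>LC T) / ennreal (1 / real (Suc n)))
      \<longlonglongrightarrow> 0"
  shows "AE t in LI 0 T. P t c = (0 :: real)"
proof -
  define \<delta> where "\<delta> = (\<lambda>n. 1 / real (Suc n))"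
  have d: "0 < \<delta> n" "\<delta> n \<le> 1" for n by (simp_all add: \<delta>_def)
  define F where "F = (\<lambda>n t. (\<integral>\<^sup>+x. ennreal \<bar>e t x\<bar> * indicator (strip c (\<delta> n)) x \<partial>LI 0 1) / ennreal (\<delta> n))"
  have f2: "(\<lambda>z. ennreal \<bar>e (fst z) (snd z)\<bar> * indicator (strip c (\<delta> n)) (snd z)) \<in> borel_measurable (LI 0 T \<Otimes>\<^sub>M LI 0 1)" for n
  proof -
    have [measurable]: "(\<lambda>z. indicator (strip c (\<delta> n)) (snd z) :: ennreal) \<in> borel_measurable (LC T)"
      by (rule measurable_compose[OF snd_LC]) simp
    note [measurable] = m
    show ?thesis unfolding LC_def[symmetric] by measurable
  qed
  have Fm: "F n \<in> borel_measurable (LI 0 T)" for n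
    using LI.borel_measurable_nn_integral_fst[OF f2, of n] unfolding F_def by simp
  have "(\<integral>\<^sup>+t. F n t \<partial>LI 0 T) = (\<integral>\<^sup>+z. ennreal \<bar>e (fst z) (snd z)\<bar> * indicator (strip c (\<delta> n)) (snd z) \<partial>LC T) / ennreal (\<delta> n)" for n
  proof -
    have "(\<integral>\<^sup>+t. F n t \<partial>LI 0 T) = (\<integral>\<^sup>+t. (\<integral>\<^sup>+x. ennreal \<bar>e t x\<bar> * indicator (strip c (\<delta> n)) x \<partial>LI 0 1) \<partial>LI 0 T) / ennreal (\<delta> n)"
      unfolding F_def by (rule nn_integral_divide) (use LI.borel_measurable_nn_integral_fst[OF f2, of n] in simp)
    then show ?thesis using LI.nn_integral_fst[OF f2, of n] by (simp add: LC_def)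
  qed
  then have lim: "(\<lambda>n. \<integral>\<^sup>+t. F n t \<partial>LI 0 T) \<longlonglongrightarrow> 0" using tr by (simp add: \<delta>_def)
  have "(\<integral>\<^sup>+t. liminf (\<lambda>n. F n t) \<partial>LI 0 T) \<le> liminf (\<lambda>n. \<integral>\<^sup>+t. F n t \<partial>LI 0 T)"
    by (rule nn_integral_liminf) (rule Fm)
  also have "\<dots> = 0" by (rule lim_imp_Liminf[OF _ lim]) simp
  finally have "(\<integral>\<^sup>+t. liminf (\<lambda>n. F n t) \<partial>LI 0 T) = 0" by simp
  then have "AE t in LI 0 T. liminf (\<lambda>n. F n t) = 0"
    by (subst (asm) nn_integral_0_iff_AE) (auto intro: borel_measurable_liminf Fm)
  then show ?thesis using P
  proof eventually_elim
    case (elim t)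
    show ?case
    proof (rule ccontr)
      assume nz: "P t c \<noteq> 0"
      define h where "h = \<bar>P t c\<bar> / 2"
      have h: "0 < h" "h < \<bar>P t c\<bar>" using nz by (simp_all add: h_def)
      have "isCont (P t) c" using elim(2) by (simp add: continuous_on_eq_continuous_at)
      then have "isCont (\<lambda>x. \<bar>P t x\<bar>) c" by (intro continuous_intros)
      then have "((\<lambda>x. \<bar>P t x\<bar>) \<longlongrightarrow> \<bar>P t c\<bar>) (at c)" by (simp add: isCont_def)
      then have "\<forall>\<^sub>F x in at c. h < \<bar>P t x\<bar>" by (rule order_tendstoD(1)) (rule h(2))
      then obtain \<rho> where \<rho>: "\<rho> > 0" "\<forall>x. x \<noteq> c \<and> dist x c < \<rho> \<longrightarrow> h < \<bar>P t x\<bar>"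
        unfolding eventually_at by blast
      have "\<forall>\<^sub>F n in sequentially. \<delta> n < \<rho>"
        using order_tendstoD(2)[OF inv_Suc_lim[of 1] \<rho>(1)] by (simp add: \<delta>_def)
      then have "\<forall>\<^sub>F n in sequentially. ennreal h \<le> F n t"
      proof eventually_elim
        case (elim n)
        have "ennreal h * ennreal (\<delta> n) = (\<integral>\<^sup>+x. ennreal h * indicator (strip c (\<delta> n)) x \<partial>LI 0 1)"
          using strip_measure(1)[OF c d(1) d(2), of n] by (subst nn_integral_cmult) (auto intro: borel_LI)
        also have "\<dots> \<le> (\<integral>\<^sup>+x. ennreal \<bar>e t x\<bar> * indicator (strip c (\<delta> n)) x \<partial>LI 0 1)"
        proof (rule nn_integral_mono_AE)
          have "AE x in LI 0 1. e t x = P t x" using \<open>continuous_on UNIV (P t) \<and> (AE x in LI 0 1. e t x = P t x)\<close> by blast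
          moreover have "AE x in LI 0 1. 0 < x \<and> x < 1" by (rule AE_LI_I) simp
          ultimately show "AE x in LI 0 1. ennreal h * indicator (strip c (\<delta> n)) x \<le> ennreal \<bar>e t x\<bar> * indicator (strip c (\<delta> n)) x"
          proof eventually_elim
            case (elim x)
            show ?case
            proof (cases "x \<in> strip c (\<delta> n)")
              case True
              then have "dist x c < \<rho>" "x \<noteq> c" using \<open>\<delta> n < \<rho>\<close> elim c by (auto simp: strip_def dist_real_def)
              then have "h \<le> \<bar>e t x\<bar>" using \<rho>(2) elim by (simp add: less_imp_le)
              then show ?thesis using True by (simp add: ennreal_leI)
            qed simp
          qed
        qed
        finally have "ennreal h * ennreal (\<delta> n) / ennreal (\<delta> n) \<le> F n t"
          unfolding F_def by (rule divide_right_mono_ennreal)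
        also have "ennreal h * ennreal (\<delta> n) / ennreal (\<delta> n) = ennreal h"
          using d(1)[of n] h by (simp add: ennreal_mult[symmetric] divide_ennreal)
        finally show ?case .
      qed
      then have "ennreal h \<le> liminf (\<lambda>n. F n t)" by (rule Liminf_bounded)
      then show False using elim(1) h by simp
    qed
  qed
qed

text \<open>The fundamental theorem of calculus from the boundary point, with the Cauchy-Schwarz inequality.\<close>

lemma primitive_near_boundary:
  assumes g: "sqint (LI 0 1) g" and z: "primitive 0 1 0 g 1 = 0" and c: "c \<in> {0, 1}"
    and x: "0 < x" "x < 1" "x \<in> strip c \<delta>"
  shows "(primitive 0 1 0 g x)\<^sup>2 \<le> \<delta> * (LINT s|LI 0 1. (g s)\<^sup>2)"
proof -
  define G where "G = (LINT s|LI 0 1. (g s)\<^sup>2)"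
  have G0: "0 \<le> G" by (simp add: G_def)
  have gi: "integrable (LI 0 1) g" by (rule LI.sqint_integrable[OF g])
  have key: "(LINT s|LI 0 1. indicator A s * g s)\<^sup>2 \<le> measure (LI 0 1) A * G" if "A \<in> sets (LI 0 1)" for A
  proof -
    have q: "sqint (LI 0 1) (indicator A)"
      by (rule LI.sqint_bounded[where C = 1]) (use that in auto)
    have "(\<lambda>s. (indicator A s :: real)\<^sup>2) = indicator A" by (auto simp: indicator_def)
    then have "(LINT s|LI 0 1. (indicator A s :: real)\<^sup>2) = measure (LI 0 1) A"
      using that sets.sets_into_space[OF that] by (simp add: Int_absorb2)
    then have "\<bar>LINT s|LI 0 1. indicator A s * g s\<bar> \<le> sqrt (measure (LI 0 1) A) * sqrt G"
      using sqint_CS[OF q g] by (simp add: G_def)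
    then have "\<bar>LINT s|LI 0 1. indicator A s * g s\<bar> \<le> sqrt (measure (LI 0 1) A * G)" by (simp add: real_sqrt_mult)
    then have "\<bar>LINT s|LI 0 1. indicator A s * g s\<bar>\<^sup>2 \<le> (sqrt (measure (LI 0 1) A * G))\<^sup>2"
      by (rule power_mono) simp
    then show ?thesis using G0 by simp
  qed
  have ms: "{p..<r} \<in> sets (LI 0 1) \<and> measure (LI 0 1) {p..<r} = r - p" if "0 < p" "p \<le> r" "r \<le> 1" for p r
  proof -
    have "{p..<r} = {0<..<1} \<inter> {p..<r}" using that by auto
    then have "{p..<r} \<in> sets (LI 0 1)" unfolding sets_LI sets_restrict_space by (metis atLeastLessThan_borel image_eqI)
    moreover have "measure (LI 0 1) {p..<r} = measure lborel {p..<r}"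
      unfolding LI_def by (rule measure_restrict_space) (use that in auto)
    ultimately show ?thesis using that by simp
  qed
  show ?thesis
  proof (cases "c = 0")
    case True
    have ms': "{0<..<x} \<in> sets (LI 0 1)" "measure (LI 0 1) {0<..<x} = x"
    proof -
      have "{0<..<x} = {0<..<1} \<inter> {0<..<x}" using x by auto
      then show "{0<..<x} \<in> sets (LI 0 1)" unfolding sets_LI sets_restrict_space by (metis borel_open image_eqI open_greaterThanLessThan)
      have "measure (LI 0 1) {0<..<x} = measure lborel {0<..<x}"
        unfolding LI_def by (rule measure_restrict_space) (use x in auto)
      then show "measure (LI 0 1) {0<..<x} = x" using x by simp
    qed
    have "primitive 0 1 0 g x = (LINT s|LI 0 1. indicator {0<..<x} s * g s)"
      unfolding primitive_def by (simp, rule Bochner_Integration.integral_cong) (auto simp: indicator_def)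
    then have "(primitive 0 1 0 g x)\<^sup>2 \<le> x * G" using key[OF ms'(1)] ms'(2) by simp
    also have "\<dots> \<le> \<delta> * G" using x True G0 by (intro mult_right_mono) (auto simp: strip_def)
    finally show ?thesis by (simp add: G_def)
  next
    case False
    then have c1: "c = 1" using c by simp
    have "primitive 0 1 0 g 1 - primitive 0 1 0 g x = (LINT s|LI 0 1. indicator {x..<1} s * g s)"
      by (rule primitive_diff[OF gi]) (use x in simp)
    then have "primitive 0 1 0 g x = - (LINT s|LI 0 1. indicator {x..<1} s * g s)" using z by linarith
    then have "(primitive 0 1 0 g x)\<^sup>2 = (LINT s|LI 0 1. indicator {x..<1} s * g s)\<^sup>2" by simp
    also have "\<dots> \<le> (1 - x) * G" using key[of "{x..<1}"] ms[of x 1] x by simp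
    also have "\<dots> \<le> \<delta> * G" using x c1 G0 by (intro mult_right_mono) (auto simp: strip_def)
    finally show ?thesis by (simp add: G_def)
  qed
qed

text \<open>Almost every section has a continuous representative, the primitive of its weak derivative; the vanishing
  trace at \<open>0\<close> fixes the constant and the vanishing trace at \<open>1\<close> fixes the mean of the derivative.\<close>

lemma zero_trace_representative:
  assumes m: "Cmeas T e" and ex: "sqint (LC T) (\<lambda>z. ex (fst z) (snd z))"
    and w: "AE t in LI 0 T. has_weak_deriv 0 1 (e t) (ex t)"
    and tr: "\<And>c. c \<in> {0, 1} \<Longrightarrow> (\<lambda>n. (\<integral>\<^sup>+z. ennreal \<bar>e (fst z) (snd z)\<bar> * indicator (strip c (1 / real (Suc n))) (snd z) \<partial>LC T) / ennreal (1 / real (Suc n)))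
      \<longlonglongrightarrow> 0"
  shows "AE t in LI 0 T. sqint (LI 0 1) (ex t) \<and> primitive 0 1 0 (ex t) 1 = 0 \<and>
    (AE x in LI 0 1. e t x = primitive 0 1 0 (ex t) x)"
proof -
  define cc where "cc = (\<lambda>t. SOME c. AE x in LI 0 1. e t x = primitive 0 1 c (ex t) x)"
  define P where "P = (\<lambda>t. primitive 0 1 (cc t) (ex t))"
  have sq: "AE t in LI 0 T. sqint (LI 0 1) (ex t)" by (rule sqint_sections[OF ex])
  then have P: "AE t in LI 0 T. continuous_on UNIV (P t) \<and> (AE x in LI 0 1. e t x = P t x)"
    using w
  proof eventually_elim
    case (elim t)
    have i: "integrable (LI 0 1) (ex t)" by (rule LI.sqint_integrable[OF elim(1)])
    have "\<exists>c. AE x in LI 0 1. e t x = primitive 0 1 c (ex t) x"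
      by (rule weak_deriv_primitive[OF elim(2) i]) simp
    then have "AE x in LI 0 1. e t x = P t x" unfolding P_def cc_def by (rule someI_ex)
    moreover have "continuous_on UNIV (P t)" unfolding P_def by (rule primitive_continuous[OF i])
    ultimately show ?case by blast
  qed
  have "AE t in LI 0 T. P t 0 = 0" "AE t in LI 0 T. P t 1 = 0"
    by (rule zero_trace_sections[OF m _ P tr]; simp)+
  then show ?thesis using P sq
  proof eventually_elim
    case (elim t)
    have "cc t = 0" using elim(1) by (simp add: P_def primitive_left)
    then show ?case using elim by (simp add: P_def)
  qed
qed

context viscous_solution
begin

text \<open>Pure transport: at the inflow boundary the trace of the error vanishes, at the outflow
  boundary the flux of the error leaves the domain.\<close>

lemma boundary_transport:
  assumes V: "approximable T V Vt Vx" and e0: "\<epsilon> = 0"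
    and ub: "AE z in LC T. \<bar>u (fst z) (snd z)\<bar> \<le> B"
    and tr: "\<forall>c\<in>inflow_boundary b. has_trace T u c (g c) \<and> has_trace T V c (g c) \<and> g c \<in> borel_measurable (LI 0 T)"
    and \<theta>: "smooth \<theta>" "\<forall>t. 0 \<le> \<theta> t \<and> \<theta> t \<le> 1"
  shows "no_boundary_gain V \<theta>"
proof (cases "b = 0")
  case True
  have "bflux V = (\<lambda>t x. 0)" unfolding bflux_def by (simp add: True e0)
  then show ?thesis by (intro exI[of _ "\<lambda>_. 0"]) simp
next
  case False
  define c where "c = (if b > 0 then 0 else 1 :: real)"
  have cin: "c \<in> inflow_boundary b" using False by (auto simp: c_def inflow_boundary_def)
  obtain C where C: "0 \<le> C" "\<forall>\<delta>>0. \<forall>x. deriv (plateau 0 1 \<delta>) x \<le> C / \<delta> * indicator (strip 0 (3 * \<delta>)) x \<and>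
      - deriv (plateau 0 1 \<delta>) x \<le> C / \<delta> * indicator (strip 1 (3 * \<delta>)) x" using plateau_deriv_bounds by blast
  have Vm: "Cmeas T V" using V by (simp add: approximable_def)
  obtain CV where CV: "AE z in LC T. \<bar>V (fst z) (snd z)\<bar> \<le> CV" using approximable_bounds[OF V T] by blast
  define Be where "Be = \<bar>B\<bar> + \<bar>CV\<bar>"
  define e where "e = (\<lambda>t x. u t x - V t x)"
  have eb: "AE z in LC T. \<bar>e (fst z) (snd z)\<bar> \<le> Be"
    using ub CV by eventually_elim (simp add: e_def Be_def)
  have ei: "Cint T (\<lambda>t x. \<bar>e t x\<bar>)"
    using LC.sqint_integrable[OF err_sq[OF V]] unfolding e_def by simp
  define \<delta> where "\<delta> = (\<lambda>n. 3 * (1 / real (Suc n)))"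
  have d: "0 < \<delta> n" for n by (simp add: \<delta>_def)
  have dl: "\<delta> \<longlonglongrightarrow> 0" unfolding \<delta>_def by (rule inv_Suc_lim)
  define I where "I = (\<lambda>n. CI T (\<lambda>t x. indicator (strip c (\<delta> n)) x * \<bar>e t x\<bar>))"
  have Ii: "Cint T (\<lambda>t x. indicator (strip c (\<delta> n)) x * \<bar>e t x\<bar>)" for n
    by (rule integrable_bounded_mult[OF ei strip_Cmeas, where C = 1]) simp
  have I0: "0 \<le> I n" for n unfolding I_def by (rule integral_nonneg_AE) simp
  have "(\<lambda>n. ennreal (I n / \<delta> n)) \<longlonglongrightarrow> ennreal 0"
  proof -
    have "ennreal (I n / \<delta> n) = (\<integral>\<^sup>+z. ennreal \<bar>u (fst z) (snd z) - V (fst z) (snd z)\<bar> * indicator (strip c (\<delta> n)) (snd z) \<partial>LC T) / ennreal (\<delta> n)" for n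
    proof -
      have "ennreal (I n) = (\<integral>\<^sup>+z. ennreal (indicator (strip c (\<delta> n)) (snd z) * \<bar>e (fst z) (snd z)\<bar>) \<partial>LC T)"
        unfolding I_def by (rule nn_integral_eq_integral[symmetric, OF Ii]) simp
      also have "\<dots> = (\<integral>\<^sup>+z. ennreal \<bar>u (fst z) (snd z) - V (fst z) (snd z)\<bar> * indicator (strip c (\<delta> n)) (snd z) \<partial>LC T)"
        by (rule nn_integral_cong) (simp add: e_def indicator_def)
      finally show ?thesis using divide_ennreal[OF I0 d, of n n] by simp
    qed
    then show ?thesis
      using trace_difference[OF _ _ um Vm _ d dl, of c "g c"] tr cin by simp
  qed
  then have Il: "(\<lambda>n. I n / \<delta> n) \<longlonglongrightarrow> 0"
    by (rule tendsto_ennrealD) (use I0 d in \<open>auto intro!: always_eventually divide_nonneg_pos\<close>)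
  define r where "r = (\<lambda>n. \<bar>b\<bar> / 2 * C * Be * 3 * (I n / \<delta> n))"
  have "r \<longlonglongrightarrow> \<bar>b\<bar> / 2 * C * Be * 3 * 0" unfolding r_def by (intro tendsto_mult tendsto_const Il)
  then have "r \<longlonglongrightarrow> 0" by simp
  moreover have "CI T (\<lambda>t x. \<theta> t * deriv (plateau 0 1 (1 / real (Suc n))) x * bflux V t x) \<le> r n" for n
  proof -
    define \<kappa>' where "\<kappa>' = deriv (plateau 0 1 (1 / real (Suc n)))"
    define K where "K = C / (1 / real (Suc n))"
    have K0: "0 \<le> K" using C by (simp add: K_def)
    have s: "smooth \<kappa>'" unfolding \<kappa>'_def by (intro smooth_deriv smooth_plateau) simp
    obtain c1 where c1: "\<forall>x\<in>{0..1}. \<bar>\<kappa>' x\<bar> \<le> c1" using smooth2_bounded[OF smooth2_space[OF s], of T] T by force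
    have bk: "b * \<kappa>' x \<le> \<bar>b\<bar> * (K * indicator (strip c (\<delta> n)) x)" for x
    proof -
      have 1: "\<kappa>' x \<le> K * indicator (strip 0 (\<delta> n)) x" "- \<kappa>' x \<le> K * indicator (strip 1 (\<delta> n)) x"
        unfolding \<kappa>'_def K_def \<delta>_def using C(2)[rule_format, of "1 / real (Suc n)" x] by simp_all
      show ?thesis
      proof (cases "b > 0")
        case True
        then show ?thesis using mult_left_mono[OF 1(1), of b] by (simp add: c_def)
      next
        case False
        then show ?thesis using mult_left_mono[OF 1(2), of "-b"] by (simp add: c_def)
      qed
    qed
    have "CI T (\<lambda>t x. \<theta> t * \<kappa>' x * bflux V t x) \<le> CI T (\<lambda>t x. \<bar>b\<bar> / 2 * K * Be * (indicator (strip c (\<delta> n)) x * \<bar>e t x\<bar>))"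
    proof (rule integral_mono_AE)
      have "Cint T (\<lambda>t x. (\<theta> t * \<kappa>' x) * bflux V t x)"
      proof (rule integrable_bounded_mult[OF bflux_int[OF V], where C = c1])
        show "Cmeas T (\<lambda>t x. \<theta> t * \<kappa>' x)" by (rule smooth2_meas[OF smooth2_tensor[OF \<theta>(1) s]])
        show "AE z in LC T. \<bar>\<theta> (fst z) * \<kappa>' (snd z)\<bar> \<le> c1"
        proof (rule AE_LC_I)
          fix t x :: real assume "0 < x" "x < 1"
          then have "\<bar>\<theta> t\<bar> * \<bar>\<kappa>' x\<bar> \<le> 1 * c1" using \<theta>(2) c1 by (intro mult_mono) auto
          then show "\<bar>\<theta> (fst (t, x)) * \<kappa>' (snd (t, x))\<bar> \<le> c1" by (simp add: abs_mult)
        qed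
      qed
      then show "Cint T (\<lambda>t x. \<theta> t * \<kappa>' x * bflux V t x)" .
      show "Cint T (\<lambda>t x. \<bar>b\<bar> / 2 * K * Be * (indicator (strip c (\<delta> n)) x * \<bar>e t x\<bar>))" using Ii by simp
      show "AE z in LC T. \<theta> (fst z) * \<kappa>' (snd z) * bflux V (fst z) (snd z)
         \<le> \<bar>b\<bar> / 2 * K * Be * (indicator (strip c (\<delta> n)) (snd z) * \<bar>e (fst z) (snd z)\<bar>)"
        using eb
      proof eventually_elim
        case (elim z)
        let ?e = "e (fst z) (snd z)" and ?i = "indicator (strip c (\<delta> n)) (snd z) :: real"
        have "\<theta> (fst z) * \<kappa>' (snd z) * bflux V (fst z) (snd z) = (\<theta> (fst z) * (?e\<^sup>2 / 2)) * (b * \<kappa>' (snd z))"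
        proof -
          have "bflux V (fst z) (snd z) = b / 2 * ?e\<^sup>2" unfolding bflux_def e_def by (simp add: e0)
          then show ?thesis by simp
        qed
        also have "\<dots> \<le> (\<theta> (fst z) * (?e\<^sup>2 / 2)) * (\<bar>b\<bar> * (K * ?i))"
          by (rule mult_left_mono[OF bk]) (use \<theta>(2) in simp)
        also have "\<dots> \<le> (1 * (Be * \<bar>?e\<bar> / 2)) * (\<bar>b\<bar> * (K * ?i))"
        proof (rule mult_right_mono)
          have "?e\<^sup>2 \<le> Be * \<bar>?e\<bar>" using mult_right_mono[OF elim, of "\<bar>?e\<bar>"] by (simp add: power2_eq_square)
          then show "\<theta> (fst z) * (?e\<^sup>2 / 2) \<le> 1 * (Be * \<bar>?e\<bar> / 2)" using \<theta>(2) by (intro mult_mono) auto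
        qed (use K0 in simp)
        also have "\<dots> = \<bar>b\<bar> / 2 * K * Be * (?i * \<bar>?e\<bar>)" by simp
        finally show ?case .
      qed
    qed
    also have "\<dots> = \<bar>b\<bar> / 2 * K * Be * I n" by (simp add: I_def)
    also have "\<dots> = r n" by (simp add: r_def K_def \<delta>_def)
    finally show ?thesis by (simp add: \<kappa>'_def)
  qed
  ultimately show ?thesis by (intro exI[of _ r]) simp
qed

text \<open>Diffusive case: the error vanishes at the boundary, hence is of order \<open>\<delta>\<close> in mean square on a
  strip of width \<open>\<delta>\<close>, which compensates the slope \<open>1/\<delta>\<close> of the cutoff.\<close>

lemma boundary_diffusion:
  assumes V: "approximable T V Vt Vx"
    and rep: "AE t in LI 0 T. sqint (LI 0 1) (\<lambda>x. ux t x - Vx t x) \<and> primitive 0 1 0 (\<lambda>x. ux t x - Vx t x) 1 = 0 \<and>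
      (AE x in LI 0 1. u t x - V t x = primitive 0 1 0 (\<lambda>x. ux t x - Vx t x) x)"
    and \<theta>: "smooth \<theta>" "\<forall>t. 0 \<le> \<theta> t \<and> \<theta> t \<le> 1"
  shows "no_boundary_gain V \<theta>"
proof -
  obtain C where C: "0 \<le> C" "\<forall>\<delta>>0. \<forall>x. deriv (plateau 0 1 \<delta>) x \<le> C / \<delta> * indicator (strip 0 (3 * \<delta>)) x \<and>
      - deriv (plateau 0 1 \<delta>) x \<le> C / \<delta> * indicator (strip 1 (3 * \<delta>)) x" using plateau_deriv_bounds by blast
  define e where "e = (\<lambda>t x. u t x - V t x)"
  define ex where "ex = (\<lambda>t x. ux t x - Vx t x)"
  have es: "sqint (LC T) (\<lambda>z. e (fst z) (snd z))" using err_sq[OF V] by (simp add: e_def)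
  have exs: "sqint (LC T) (\<lambda>z. ex (fst z) (snd z))" using err_dx_sq[OF V] by (simp add: ex_def)
  define K where "K = CI T (\<lambda>t x. (ex t x)\<^sup>2)"
  have K0: "0 \<le> K" by (simp add: K_def)
  have exi: "Cint T (\<lambda>t x. (ex t x)\<^sup>2)" using exs by (simp add: sqint_def)
  define \<delta> where "\<delta> = (\<lambda>n. 3 * (1 / real (Suc n)))"
  have d: "0 < \<delta> n" for n by (simp add: \<delta>_def)
  have dl: "\<delta> \<longlonglongrightarrow> 0" unfolding \<delta>_def by (rule inv_Suc_lim)
  have ind: "sqint (LC T) (\<lambda>z. indicator (strip c s) (snd z) * f (fst z) (snd z))"
    if "sqint (LC T) (\<lambda>z. f (fst z) (snd z))" for c s f
    by (rule sqint_bounded_mult[OF that strip_Cmeas, where C = 1]) simp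
  have ind2: "(indicator A x * y :: real)\<^sup>2 = indicator A x * y\<^sup>2" for A and x y :: real by (simp add: indicator_def)
  define E2 where "E2 = (\<lambda>c n. CI T (\<lambda>t x. indicator (strip c (\<delta> n)) x * (e t x)\<^sup>2))"
  define U2 where "U2 = (\<lambda>c n. CI T (\<lambda>t x. indicator (strip c (\<delta> n)) x * (ux t x)\<^sup>2))"
  define EU where "EU = (\<lambda>c n. CI T (\<lambda>t x. indicator (strip c (\<delta> n)) x * \<bar>e t x * ux t x\<bar>))"
  have iE: "Cint T (\<lambda>t x. indicator (strip c s) x * (e t x)\<^sup>2)" for c s
    using ind[OF es, of c s] by (simp add: sqint_def ind2)
  have iU: "Cint T (\<lambda>t x. indicator (strip c s) x * (ux t x)\<^sup>2)" for c s
    using ind[OF ux_sq, of c s] by (simp add: sqint_def ind2)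
  have iEU: "Cint T (\<lambda>t x. indicator (strip c s) x * \<bar>e t x * ux t x\<bar>)" for c s
    by (rule integrable_bounded_mult[OF _ strip_Cmeas, where C = 1]) (use sqint_mult[OF es ux_sq] in simp_all)
  have E2: "E2 c n \<le> (\<delta> n)\<^sup>2 * K" if c: "c \<in> {0, 1}" and n: "\<delta> n \<le> 1" for c n
  proof -
    have "E2 c n = (LINT t|LI 0 T. LINT x|LI 0 1. indicator (strip c (\<delta> n)) x * (e t x)\<^sup>2)"
      unfolding E2_def by (rule CI_iterated(1)[OF iE])
    also have "\<dots> \<le> (LINT t|LI 0 T. (\<delta> n)\<^sup>2 * (LINT x|LI 0 1. (ex t x)\<^sup>2))"
    proof (rule integral_mono_AE)
      show "integrable (LI 0 T) (\<lambda>t. LINT x|LI 0 1. indicator (strip c (\<delta> n)) x * (e t x)\<^sup>2)"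
        by (rule CI_iterated(3)[OF iE])
      show "integrable (LI 0 T) (\<lambda>t. (\<delta> n)\<^sup>2 * (LINT x|LI 0 1. (ex t x)\<^sup>2))"
        using CI_iterated(3)[OF exi] by simp
      show "AE t in LI 0 T. (LINT x|LI 0 1. indicator (strip c (\<delta> n)) x * (e t x)\<^sup>2) \<le> (\<delta> n)\<^sup>2 * (LINT x|LI 0 1. (ex t x)\<^sup>2)"
        using rep CI_iterated(4)[OF iE[of c "\<delta> n"]]
      proof eventually_elim
        case (elim t)
        define k where "k = (LINT x|LI 0 1. (ex t x)\<^sup>2)"
        have "(LINT x|LI 0 1. indicator (strip c (\<delta> n)) x * (e t x)\<^sup>2) \<le> (LINT x|LI 0 1. indicator (strip c (\<delta> n)) x * (\<delta> n * k))"
        proof (rule integral_mono_AE[OF elim(2)])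
          show "integrable (LI 0 1) (\<lambda>x. indicator (strip c (\<delta> n)) x * (\<delta> n * k))"
            by (rule integrable_mult_left, rule LI.integrable_const_bound[where B = 1]) (auto intro: borel_LI)
          have "AE x in LI 0 1. 0 < x \<and> x < 1" by (rule AE_LI_I) simp
          moreover have "AE x in LI 0 1. e t x = primitive 0 1 0 (ex t) x" using elim(1) by (simp add: e_def ex_def)
          ultimately show "AE x in LI 0 1. indicator (strip c (\<delta> n)) x * (e t x)\<^sup>2 \<le> indicator (strip c (\<delta> n)) x * (\<delta> n * k)"
          proof eventually_elim
            case (elim x)
            show ?case
            proof (cases "x \<in> strip c (\<delta> n)")
              case True
              have "(primitive 0 1 0 (ex t) x)\<^sup>2 \<le> \<delta> n * k" unfolding k_def
                by (rule primitive_near_boundary[OF _ _ c _ _ True])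
                   (use elim \<open>sqint (LI 0 1) (\<lambda>x. ux t x - Vx t x) \<and> _ \<and> _\<close> in \<open>simp_all add: ex_def\<close>)
              then show ?thesis using True elim by simp
            qed simp
          qed
        qed
        also have "\<dots> = (LINT x|LI 0 1. indicator (strip c (\<delta> n)) x) * (\<delta> n * k)" by simp
        also have "(LINT x|LI 0 1. indicator (strip c (\<delta> n)) x) = \<delta> n" by (rule strip_measure(2)[OF c d n])
        finally show ?case by (simp add: k_def power2_eq_square)
      qed
    qed
    also have "\<dots> = (\<delta> n)\<^sup>2 * K" unfolding K_def CI_iterated(1)[OF exi] by simp
    finally show ?thesis .
  qed
  have EU: "EU c n \<le> \<delta> n * sqrt K * sqrt (U2 c n)" if c: "c \<in> {0, 1}" and n: "\<delta> n \<le> 1" for c n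
  proof -
    have "EU c n = CI T (\<lambda>t x. (indicator (strip c (\<delta> n)) x * \<bar>e t x\<bar>) * (indicator (strip c (\<delta> n)) x * \<bar>ux t x\<bar>))"
      unfolding EU_def by (rule Bochner_Integration.integral_cong) (auto simp: indicator_def abs_mult)
    also have "\<dots> \<le> sqrt (CI T (\<lambda>t x. (indicator (strip c (\<delta> n)) x * \<bar>e t x\<bar>)\<^sup>2)) * sqrt (CI T (\<lambda>t x. (indicator (strip c (\<delta> n)) x * \<bar>ux t x\<bar>)\<^sup>2))"
    proof (rule order_trans[OF abs_ge_self sqint_CS])
      have "sqint (LC T) (\<lambda>z. \<bar>e (fst z) (snd z)\<bar>)" "sqint (LC T) (\<lambda>z. \<bar>ux (fst z) (snd z)\<bar>)"
        using es ux_sq borel_measurable_abs by (auto simp: sqint_def)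
      then show "sqint (LC T) (\<lambda>z. indicator (strip c (\<delta> n)) (snd z) * \<bar>e (fst z) (snd z)\<bar>)"
        "sqint (LC T) (\<lambda>z. indicator (strip c (\<delta> n)) (snd z) * \<bar>ux (fst z) (snd z)\<bar>)"
        using ind[of "\<lambda>t x. \<bar>e t x\<bar>"] ind[of "\<lambda>t x. \<bar>ux t x\<bar>"] by blast+
    qed
    also have "\<dots> = sqrt (E2 c n) * sqrt (U2 c n)" by (simp add: ind2 E2_def U2_def)
    also have "\<dots> \<le> sqrt ((\<delta> n)\<^sup>2 * K) * sqrt (U2 c n)"
      by (intro mult_right_mono real_sqrt_le_mono E2[OF c n]) (simp add: U2_def integral_nonneg_AE)
    also have "\<dots> = \<delta> n * sqrt K * sqrt (U2 c n)" using d[of n] by (simp add: real_sqrt_mult)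
    finally show ?thesis .
  qed
  have U2l: "(\<lambda>n. U2 c n) \<longlonglongrightarrow> 0" if c: "c \<in> {0, 1}" for c
  proof -
    have "(\<lambda>n. U2 c n) \<longlonglongrightarrow> CI T (\<lambda>t x. 0)"
      unfolding U2_def
    proof (rule integral_dominated_convergence[where w = "\<lambda>z. (ux (fst z) (snd z))\<^sup>2"])
      show "Cint T (\<lambda>t x. (ux t x)\<^sup>2)" by (rule ux2)
      show "Cmeas T (\<lambda>t x. indicator (strip c (\<delta> n)) x * (ux t x)\<^sup>2)" for n using iU by simp
      show "AE z in LC T. norm (indicator (strip c (\<delta> n)) (snd z) * (ux (fst z) (snd z))\<^sup>2) \<le> (ux (fst z) (snd z))\<^sup>2" for n
        by (rule AE_I2) (simp add: indicator_def)
      show "AE z in LC T. (\<lambda>n. indicator (strip c (\<delta> n)) (snd z) * (ux (fst z) (snd z))\<^sup>2) \<longlonglongrightarrow> 0"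
      proof (rule AE_LC_I)
        fix t x :: real assume x: "0 < x" "x < 1"
        have "\<forall>\<^sub>F n in sequentially. \<delta> n < min x (1 - x)" by (rule order_tendstoD(2)[OF dl]) (use x in simp)
        then have "\<forall>\<^sub>F n in sequentially. indicator (strip c (\<delta> n)) x * (ux t x)\<^sup>2 = 0"
          by eventually_elim (use c in \<open>auto simp: strip_def indicator_def\<close>)
        then show "(\<lambda>n. indicator (strip c (\<delta> n)) (snd (t, x)) * (ux (fst (t, x)) (snd (t, x)))\<^sup>2) \<longlonglongrightarrow> 0"
          unfolding fst_conv snd_conv by (rule tendsto_eventually)
      qed
    qed simp
    then show ?thesis by simp
  qed
  define r1 where "r1 = (\<lambda>c n. 3 * C * (\<bar>b\<bar> / 2 * \<delta> n * K + \<epsilon> * (sqrt K * sqrt (U2 c n))))"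
  have r1l: "r1 c \<longlonglongrightarrow> 0" if "c \<in> {0, 1}" for c
  proof -
    have "r1 c \<longlonglongrightarrow> 3 * C * (\<bar>b\<bar> / 2 * 0 * K + \<epsilon> * (sqrt K * sqrt 0))"
      unfolding r1_def by (intro tendsto_intros dl U2l[OF that])
    then show ?thesis by simp
  qed
  have "(\<lambda>n. r1 0 n + r1 1 n) \<longlonglongrightarrow> 0" using tendsto_add[OF r1l[of 0] r1l[of 1]] by simp
  moreover have "\<forall>\<^sub>F n in sequentially. CI T (\<lambda>t x. \<theta> t * deriv (plateau 0 1 (1 / real (Suc n))) x * bflux V t x) \<le> r1 0 n + r1 1 n"
  proof -
    have "\<forall>\<^sub>F n in sequentially. \<delta> n < 1" by (rule order_tendstoD(2)[OF dl]) simp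
    then show ?thesis
    proof eventually_elim
      case (elim n)
      then have n: "\<delta> n \<le> 1" by simp
      define \<kappa>' where "\<kappa>' = deriv (plateau 0 1 (1 / real (Suc n)))"
      define L where "L = C / (1 / real (Suc n))"
      have L0: "0 \<le> L" using C by (simp add: L_def)
      have s: "smooth \<kappa>'" unfolding \<kappa>'_def by (intro smooth_deriv smooth_plateau) simp
      obtain c1 where c1: "\<forall>x\<in>{0..1}. \<bar>\<kappa>' x\<bar> \<le> c1" using smooth2_bounded[OF smooth2_space[OF s], of T] T by force
      have bk: "\<bar>\<kappa>' x\<bar> \<le> L * indicator (strip 0 (\<delta> n)) x + L * indicator (strip 1 (\<delta> n)) x" for x
      proof -
        have "\<kappa>' x \<le> L * indicator (strip 0 (\<delta> n)) x" "- \<kappa>' x \<le> L * indicator (strip 1 (\<delta> n)) x"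
          unfolding \<kappa>'_def L_def \<delta>_def using C(2)[rule_format, of "1 / real (Suc n)" x] by simp_all
        moreover have "0 \<le> L * indicator (strip 0 (\<delta> n)) x" "0 \<le> L * indicator (strip 1 (\<delta> n)) x" using L0 by simp_all
        ultimately show ?thesis by linarith
      qed
      define f where "f = (\<lambda>c t x. L * (\<bar>b\<bar> / 2 * (indicator (strip c (\<delta> n)) x * (e t x)\<^sup>2) + \<epsilon> * (indicator (strip c (\<delta> n)) x * \<bar>e t x * ux t x\<bar>)))"
      have fi: "Cint T (f c)" for c unfolding f_def using iE[of c "\<delta> n"] iEU[of c "\<delta> n"] by simp
      have fI: "CI T (f c) \<le> r1 c n" if c: "c \<in> {0, 1}" for c
      proof -
        have "CI T (f c) = L * (\<bar>b\<bar> / 2 * E2 c n + \<epsilon> * EU c n)"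
          unfolding f_def E2_def EU_def using iE[of c "\<delta> n"] iEU[of c "\<delta> n"] by simp
        also have "\<dots> \<le> L * (\<bar>b\<bar> / 2 * ((\<delta> n)\<^sup>2 * K) + \<epsilon> * (\<delta> n * sqrt K * sqrt (U2 c n)))"
          by (intro mult_left_mono add_mono E2[OF c n] EU[OF c n] L0 eps) simp
        also have "\<dots> = L * \<delta> n * (\<bar>b\<bar> / 2 * \<delta> n * K + \<epsilon> * (sqrt K * sqrt (U2 c n)))"
          by (simp add: power2_eq_square algebra_simps)
        also have "L * \<delta> n = 3 * C" by (simp add: L_def \<delta>_def)
        finally show ?thesis by (simp add: r1_def)
      qed
      have "CI T (\<lambda>t x. \<theta> t * \<kappa>' x * bflux V t x) \<le> CI T (\<lambda>t x. f 0 t x + f 1 t x)"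
      proof (rule integral_mono_AE)
        have "Cint T (\<lambda>t x. (\<theta> t * \<kappa>' x) * bflux V t x)"
        proof (rule integrable_bounded_mult[OF bflux_int[OF V], where C = c1])
          show "Cmeas T (\<lambda>t x. \<theta> t * \<kappa>' x)" by (rule smooth2_meas[OF smooth2_tensor[OF \<theta>(1) s]])
          show "AE z in LC T. \<bar>\<theta> (fst z) * \<kappa>' (snd z)\<bar> \<le> c1"
          proof (rule AE_LC_I)
            fix t x :: real assume "0 < x" "x < 1"
            then have "\<bar>\<theta> t\<bar> * \<bar>\<kappa>' x\<bar> \<le> 1 * c1" using \<theta>(2) c1 by (intro mult_mono) auto
            then show "\<bar>\<theta> (fst (t, x)) * \<kappa>' (snd (t, x))\<bar> \<le> c1" by (simp add: abs_mult)
          qed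
        qed
        then show "Cint T (\<lambda>t x. \<theta> t * \<kappa>' x * bflux V t x)" .
        show "Cint T (\<lambda>t x. f 0 t x + f 1 t x)" using fi[of 0] fi[of 1] by simp
        show "AE z in LC T. \<theta> (fst z) * \<kappa>' (snd z) * bflux V (fst z) (snd z) \<le> f 0 (fst z) (snd z) + f 1 (fst z) (snd z)"
        proof (rule AE_I2)
          fix z
          let ?e = "e (fst z) (snd z)" and ?x = "ux (fst z) (snd z)"
          let ?m = "\<bar>b\<bar> / 2 * ?e\<^sup>2 + \<epsilon> * \<bar>?e * ?x\<bar>"
          have m0: "0 \<le> ?m" using eps by simp
          have bf: "\<bar>bflux V (fst z) (snd z)\<bar> \<le> ?m"
          proof -
            have "bflux V (fst z) (snd z) = b / 2 * ?e\<^sup>2 - \<epsilon> * (?e * ?x)" by (simp add: bflux_def e_def)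
            moreover have "\<bar>b / 2 * ?e\<^sup>2\<bar> = \<bar>b\<bar> / 2 * ?e\<^sup>2" "\<bar>\<epsilon> * (?e * ?x)\<bar> = \<epsilon> * \<bar>?e * ?x\<bar>" using eps by (simp_all add: abs_mult)
            ultimately show ?thesis by linarith
          qed
          have "\<theta> (fst z) * \<kappa>' (snd z) * bflux V (fst z) (snd z) \<le> \<bar>\<theta> (fst z)\<bar> * \<bar>\<kappa>' (snd z)\<bar> * \<bar>bflux V (fst z) (snd z)\<bar>"
            by (metis abs_ge_self abs_mult)
          also have "\<dots> \<le> 1 * \<bar>\<kappa>' (snd z)\<bar> * ?m"
            using \<theta>(2) bf by (intro mult_mono) auto
          also have "\<dots> \<le> 1 * (L * indicator (strip 0 (\<delta> n)) (snd z) + L * indicator (strip 1 (\<delta> n)) (snd z)) * ?m"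
            using bk[of "snd z"] m0 by (intro mult_right_mono mult_left_mono) auto
          also have "\<dots> = f 0 (fst z) (snd z) + f 1 (fst z) (snd z)" by (simp add: f_def algebra_simps)
          finally show "\<theta> (fst z) * \<kappa>' (snd z) * bflux V (fst z) (snd z) \<le> f 0 (fst z) (snd z) + f 1 (fst z) (snd z)" .
        qed
      qed
      also have "\<dots> = CI T (f 0) + CI T (f 1)" using fi[of 0] fi[of 1] by simp
      also have "\<dots> \<le> r1 0 n + r1 1 n" by (intro add_mono fI) simp_all
      finally show ?case by (simp add: \<kappa>'_def)
    qed
  qed
  ultimately show ?thesis by blast
qed

text \<open>
  The weak formulation is tested with \<open>\<theta>\<^sub>n(t) \<psi>(x)\<close>, where \<open>\<theta>\<^sub>n(0) = 1\<close> and \<open>\<theta>\<^sub>n\<close> falls to \<open>0\<close> on a shrinking time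
  interval. All terms but two vanish in the limit, and weak continuity identifies the average of
  \<open>\<integral> u(t) \<psi>\<close> over that interval with its value at \<open>0\<close>.
\<close>

lemma initial_value:
  assumes wc: "weakly_continuous_L2 T u"
  shows "AE x in LI 0 1. u0 x = u 0 x"
proof -
  have q0: "sqint (LI 0 1) (u 0)" using wc T by (auto simp: weakly_continuous_L2_def L2_on_LI sqint_def)
  have le: "(LINT x|LI 0 1. u 0 x * \<psi> x) \<le> (LINT x|LI 0 1. u0 x * \<psi> x)" if \<psi>: "test1 Omega \<psi>" for \<psi>
  proof (rule field_le_epsilon)
    fix \<eta> :: real assume \<eta>: "0 < \<eta>"
    note s = test1_smooth[OF \<psi>]
    obtain c where c: "\<forall>x\<in>{0..1}. \<bar>\<psi> x\<bar> \<le> c" using smooth2_bounded[OF smooth2_space[OF s], of T] T by force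
    obtain c1 where c1: "\<forall>x\<in>{0..1}. \<bar>deriv \<psi> x\<bar> \<le> c1" using smooth2_bounded[OF smooth2_space[OF smooth_deriv[OF s]], of T] T by force
    define m where "m = (\<lambda>t. LINT x|LI 0 1. u t x * \<psi> x)"
    have "sqint (LI 0 1) \<psi>" by (rule LI.sqint_bounded[OF smooth_borel[OF s], where C = c], rule AE_LI_I) (use c in simp)
    then have "L2_on Omega \<psi>" by (simp add: L2_on_LI sqint_def)
    then have mc: "continuous_on {0..T} m"
      using wc unfolding weakly_continuous_L2_def m_def set_integral_LI by blast
    obtain \<rho> where \<rho>: "\<rho> > 0" "\<forall>t\<in>{0..T}. dist t 0 < \<rho> \<longrightarrow> dist (m t) (m 0) < \<eta>"
      using mc T \<eta> unfolding continuous_on_iff by (metis atLeastAtMost_iff less_imp_le order_refl)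
    define \<delta> where "\<delta> = (\<lambda>n. 1 / real (Suc n))"
    \<comment> \<open>Equal to \<open>1\<close> at time \<open>0\<close>; the ascending flank lies before the initial time.\<close>
    define \<theta> where "\<theta> = (\<lambda>n. plateau (-3) (3 * \<delta> n) (\<delta> n))"
    have d: "0 < \<delta> n" "\<delta> n \<le> 1" for n by (simp_all add: \<delta>_def)
    have \<theta>s: "smooth (\<theta> n)" for n unfolding \<theta>_def by (rule smooth_plateau[OF d(1)])
    have \<theta>b: "0 \<le> \<theta> n t" "\<theta> n t \<le> 1" for n t unfolding \<theta>_def by (rule plateau_ge plateau_le)+
    have sup: "t \<in> {-3 + \<delta> n..3 * \<delta> n - \<delta> n}" if "\<theta> n t \<noteq> 0" for n t
      using plateau_support[OF that[unfolded \<theta>_def] d(1)] .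
    have \<theta>0: "\<theta> n 0 = 1" for n unfolding \<theta>_def by (rule plateau_eq_1[OF _ d(1)]) (use d[of n] in simp)
    have \<delta>l: "(\<lambda>n. 3 * \<delta> n) \<longlonglongrightarrow> 0" unfolding \<delta>_def by (rule inv_Suc_lim)
    define f where "f = (\<lambda>t x. deriv \<psi> x * (b * u t x - \<epsilon> * ux t x))"
    have fi: "Cint T f" unfolding f_def
      by (rule integrable_bounded_mult[OF _ Cmeas_space[OF smooth_borel[OF smooth_deriv[OF s]]], where C = c1],
          use LC.sqint_integrable[OF u_sq] LC.sqint_integrable[OF ux_sq] in simp, rule AE_LC_I) (use c1 in simp)
    have gi: "Cint T (\<lambda>t x. \<psi> x * u t x)"
      by (rule integrable_bounded_mult[OF LC.sqint_integrable[OF u_sq] Cmeas_space[OF smooth_borel[OF s]], where C = c], rule AE_LC_I) (use c in simp)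
    have step: "m 0 - \<eta> \<le> CI T (\<lambda>t x. \<theta> n t * f t x) + (LINT x|LI 0 1. u0 x * \<psi> x)" if n: "3 * \<delta> n < min \<rho> T" for n
    proof -
      define \<phi> where "\<phi> = (\<lambda>t x. \<theta> n t * \<psi> x)"
      obtain p q where pq: "0 < p" "p \<le> q" "q < 1" "\<And>x. \<psi> x \<noteq> 0 \<Longrightarrow> x \<in> {p..q}"
        "\<And>x. x \<notin> {p..q} \<Longrightarrow> deriv \<psi> x = 0" by (rule test1_support[OF \<psi>]) simp_all
      have \<phi>: "test2 ({..<T} \<times> Omega) \<phi>"
      proof (rule test2I)
        show "smooth2 \<phi>" unfolding \<phi>_def by (rule smooth2_tensor[OF \<theta>s s])
        show "t \<in> {-3 + \<delta> n..3 * \<delta> n - \<delta> n} \<and> x \<in> {p..q}" if "\<phi> t x \<noteq> 0" for t x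
        proof
          show "t \<in> {-3 + \<delta> n..3 * \<delta> n - \<delta> n}" by (rule sup) (use that in \<open>auto simp: \<phi>_def\<close>)
          show "x \<in> {p..q}" by (rule pq(4)) (use that in \<open>auto simp: \<phi>_def\<close>)
        qed
        show "{-3 + \<delta> n..3 * \<delta> n - \<delta> n} \<times> {p..q} \<subseteq> {..<T} \<times> Omega"
          by (rule Sigma_mono) (use n d(1)[of n] pq in auto)
      qed
      obtain c' where c': "\<forall>t\<in>{0..T}. \<bar>deriv (\<theta> n) t\<bar> \<le> c'" using smooth_time_bounded[OF smooth_deriv[OF \<theta>s]] by blast
      have i1: "Cint T (\<lambda>t x. deriv (\<theta> n) t * (\<psi> x * u t x))"
        by (rule integrable_bounded_mult[OF gi Cmeas_time[OF smooth_borel[OF smooth_deriv[OF \<theta>s]]], where C = c'],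
            rule AE_LC_I) (use c' in simp)
      have i2: "Cint T (\<lambda>t x. \<theta> n t * f t x)"
        by (rule integrable_bounded_mult[OF fi Cmeas_time[OF smooth_borel[OF \<theta>s]], where C = 1], rule AE_I2) (use \<theta>b in simp)
      have "CI T (\<lambda>t x. deriv (\<theta> n) t * (\<psi> x * u t x)) = (LINT t|LI 0 T. deriv (\<theta> n) t * m t)"
        unfolding CI_iterated(1)[OF i1] m_def by (simp add: mult.commute)
      also have "\<dots> \<le> (LINT t|LI 0 T. deriv (\<theta> n) t * (m 0 - \<eta>))"
      proof (rule integral_mono_AE)
        show "integrable (LI 0 T) (\<lambda>t. deriv (\<theta> n) t * m t)"
          using CI_iterated(3)[OF i1] by (simp add: m_def mult.commute)
        show "integrable (LI 0 T) (\<lambda>t. deriv (\<theta> n) t * (m 0 - \<eta>))"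
          by (rule integrable_mult_left, rule LI.integrable_const_bound[where B = c'], rule AE_LI_I)
             (use c' smooth_borel[OF smooth_deriv[OF \<theta>s]] in auto)
        show "AE t in LI 0 T. deriv (\<theta> n) t * m t \<le> deriv (\<theta> n) t * (m 0 - \<eta>)"
        proof (rule AE_LI_I)
          fix t :: real assume t: "0 < t" "t < T"
          show "deriv (\<theta> n) t * m t \<le> deriv (\<theta> n) t * (m 0 - \<eta>)"
          proof (cases "deriv (\<theta> n) t = 0")
            case False
            then have t3: "t \<le> 3 * \<delta> n" "deriv (\<theta> n) t \<le> 0"
              using time_cutoff_deriv[OF d t(1), of "3 * \<delta> n" n] unfolding \<theta>_def by auto
            then have "dist (m t) (m 0) < \<eta>" using \<rho>(2) t n by (simp add: dist_real_def)
            then have "m 0 - \<eta> \<le> m t" by (simp add: dist_real_def)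
            then show ?thesis using t3(2) by (intro mult_left_mono_neg)
          qed simp
        qed
      qed
      also have "\<dots> = (LINT t|LI 0 T. deriv (\<theta> n) t) * (m 0 - \<eta>)" by simp
      also have "(LINT t|LI 0 T. deriv (\<theta> n) t) = -1"
      proof -
        have cn: "isCont (deriv (\<theta> n)) t" for t
          using smooth_continuous[OF smooth_deriv[OF \<theta>s], of UNIV] by (simp add: continuous_on_eq_continuous_at)
        have "\<theta> n T = 0"
        proof (rule ccontr)
          assume "\<theta> n T \<noteq> 0" from sup[OF this] show False using n d(1)[of n] by simp
        qed
        then show ?thesis using FTC_LI(2)[OF smooth_DERIV[OF \<theta>s] cn, where a = 0 and b = T] T \<theta>0[of n] by simp
      qed
      finally have 1: "CI T (\<lambda>t x. deriv (\<theta> n) t * (\<psi> x * u t x)) \<le> - (m 0 - \<eta>)" by simp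
      have "Dt \<phi> t x * u t x + Dx \<phi> t x * (b * u t x - \<epsilon> * ux t x) = deriv (\<theta> n) t * (\<psi> x * u t x) + \<theta> n t * f t x" for t x
        unfolding \<phi>_def Dt_tensor[OF \<theta>s s] Dx_tensor[OF \<theta>s s] f_def by simp
      then have "CI T (\<lambda>t x. deriv (\<theta> n) t * (\<psi> x * u t x)) + CI T (\<lambda>t x. \<theta> n t * f t x) + (LINT x|LI 0 1. u0 x * \<psi> x) = 0"
        using weak[OF \<phi>] i1 i2 by (simp add: \<phi>_def \<theta>0)
      then show ?thesis using 1 by linarith
    qed
    have "(\<lambda>n. CI T (\<lambda>t x. \<theta> n t * f t x)) \<longlonglongrightarrow> CI T (\<lambda>t x. 0)"
    proof (rule integral_dominated_convergence[where w = "\<lambda>z. \<bar>f (fst z) (snd z)\<bar>"])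
      show "Cmeas T (\<lambda>t x. \<theta> n t * f t x)" for n
        by (rule borel_measurable_times[OF Cmeas_time[OF smooth_borel[OF \<theta>s]]]) (use fi in simp)
      show "integrable (LC T) (\<lambda>z. \<bar>f (fst z) (snd z)\<bar>)" using fi by simp
      show "AE z in LC T. norm (\<theta> n (fst z) * f (fst z) (snd z)) \<le> \<bar>f (fst z) (snd z)\<bar>" for n
        by (rule AE_I2) (simp add: abs_mult \<theta>b mult_left_le_one_le)
      show "AE z in LC T. (\<lambda>n. \<theta> n (fst z) * f (fst z) (snd z)) \<longlonglongrightarrow> 0"
      proof (rule AE_LC_I)
        fix t x :: real assume t: "0 < t"
        have "\<forall>\<^sub>F n in sequentially. 3 * \<delta> n < t" by (rule order_tendstoD(2)[OF \<delta>l t])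
        then have "\<forall>\<^sub>F n in sequentially. \<theta> n t * f t x = 0"
        proof eventually_elim
          case (elim n)
          have "\<theta> n t = 0"
          proof (rule ccontr)
            assume "\<theta> n t \<noteq> 0" from sup[OF this] show False using elim d(1)[of n] by simp
          qed
          then show ?case by simp
        qed
        then show "(\<lambda>n. \<theta> n (fst (t, x)) * f (fst (t, x)) (snd (t, x))) \<longlonglongrightarrow> 0"
          unfolding fst_conv snd_conv by (rule tendsto_eventually)
      qed
    qed simp
    then have "(\<lambda>n. CI T (\<lambda>t x. \<theta> n t * f t x) + (LINT x|LI 0 1. u0 x * \<psi> x)) \<longlonglongrightarrow> CI T (\<lambda>t x. 0) + (LINT x|LI 0 1. u0 x * \<psi> x)"
      by (rule tendsto_add[OF _ tendsto_const])
    then have "m 0 - \<eta> \<le> CI T (\<lambda>t x. 0) + (LINT x|LI 0 1. u0 x * \<psi> x)"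
    proof (rule tendsto_lowerbound)
      have "\<forall>\<^sub>F n in sequentially. 3 * \<delta> n < min \<rho> T" by (rule order_tendstoD(2)[OF \<delta>l]) (use \<rho>(1) T in simp)
      then show "\<forall>\<^sub>F n in sequentially. m 0 - \<eta> \<le> CI T (\<lambda>t x. \<theta> n t * f t x) + (LINT x|LI 0 1. u0 x * \<psi> x)"
        by eventually_elim (rule step)
    qed simp
    then show "(LINT x|LI 0 1. u 0 x * \<psi> x) \<le> (LINT x|LI 0 1. u0 x * \<psi> x) + \<eta>" by (simp add: m_def)
  qed
  have "AE x in LI 0 1. u0 x - u 0 x = 0"
  proof (rule fundamental_lemma_1d)
    have i: "integrable (LI 0 1) u0" "integrable (LI 0 1) (u 0)" by (rule LI.sqint_integrable[OF u0] LI.sqint_integrable[OF q0])+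
    then have L: "L1_loc Omega u0" "L1_loc Omega (u 0)" by (auto intro: integrable_L1_loc)
    then show "L1_loc Omega (\<lambda>x. u0 x - u 0 x)" by (rule L1_loc_diff)
    fix \<psi> assume \<psi>: "test1 Omega \<psi>"
    have "smooth (\<lambda>x. (-1) * \<psi> x)" by (rule smooth_mult[OF smooth_const test1_smooth[OF \<psi>]])
    then have n: "test1 Omega (\<lambda>x. - \<psi> x)" using \<psi> by (simp add: test1_def smooth_iff_funpow)
    have "(LINT x|LI 0 1. u 0 x * \<psi> x) = (LINT x|LI 0 1. u0 x * \<psi> x)"
      using le[OF \<psi>] le[OF n] by simp
    then show "(LINT x:Omega|lborel. (u0 x - u 0 x) * \<psi> x) = 0"
      using L1_loc_test1(1)[OF L(1) \<psi>] L1_loc_test1(1)[OF L(2) \<psi>] by (simp add: set_integral_LI left_diff_distrib)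
  qed
  then show ?thesis by simp
qed

end

text \<open>The norm is weakly lower semicontinuous: \<open>e(\<tau>)\<close> itself serves as the test function.\<close>

lemma weakly_continuous_lsc:
  assumes e: "weakly_continuous_L2 T e" and \<tau>: "\<tau> \<in> {0..T}"
  shows "\<forall>\<eta>>0. \<exists>\<rho>>0. \<forall>t\<in>{0..T}. \<tau> - \<rho> \<le> t \<and> t \<le> \<tau> \<longrightarrow>
      (LINT x|LI 0 1. (e \<tau> x)\<^sup>2) - \<eta> \<le> (LINT x|LI 0 1. (e t x)\<^sup>2)"
proof (intro allI impI)
  fix \<eta> :: real assume \<eta>: "0 < \<eta>"
  have q: "sqint (LI 0 1) (e t)" if "t \<in> {0..T}" for t
    using e that by (auto simp: weakly_continuous_L2_def L2_on_LI sqint_def)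
  define h where "h = (\<lambda>t. LINT x|LI 0 1. e t x * e \<tau> x)"
  have "continuous_on {0..T} h"
    using e \<tau> unfolding weakly_continuous_L2_def h_def set_integral_LI by blast
  then have "\<exists>\<rho>>0. \<forall>t\<in>{0..T}. dist t \<tau> < \<rho> \<longrightarrow> dist (h t) (h \<tau>) < \<eta> / 2"
    using \<tau> half_gt_zero[OF \<eta>] unfolding continuous_on_iff by blast
  then obtain \<rho> where \<rho>: "\<rho> > 0" "\<forall>t\<in>{0..T}. dist t \<tau> < \<rho> \<longrightarrow> dist (h t) (h \<tau>) < \<eta> / 2" by blast
  have "(LINT x|LI 0 1. (e \<tau> x)\<^sup>2) - \<eta> \<le> (LINT x|LI 0 1. (e t x)\<^sup>2)"
    if t: "t \<in> {0..T}" "\<tau> - \<rho> / 2 \<le> t" "t \<le> \<tau>" for t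
  proof -
    have "dist t \<tau> < \<rho>" using t \<rho>(1) by (simp add: dist_real_def)
    then have hd: "\<bar>h t - h \<tau>\<bar> < \<eta> / 2" using \<rho>(2) t(1) by (simp add: dist_real_def)
    have "0 \<le> (LINT x|LI 0 1. (e t x - e \<tau> x)\<^sup>2)" by simp
    also have "\<dots> = (LINT x|LI 0 1. (e t x)\<^sup>2 - 2 * (e t x * e \<tau> x) + (e \<tau> x)\<^sup>2)"
      by (rule Bochner_Integration.integral_cong) (simp_all add: power2_diff)
    also have "\<dots> = (LINT x|LI 0 1. (e t x)\<^sup>2) - 2 * h t + (LINT x|LI 0 1. (e \<tau> x)\<^sup>2)"
      using q[OF t(1)] q[OF \<tau>] sqint_mult[OF q[OF t(1)] q[OF \<tau>]] by (simp add: sqint_def h_def)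
    finally have "0 \<le> (LINT x|LI 0 1. (e t x)\<^sup>2) - 2 * h t + (LINT x|LI 0 1. (e \<tau> x)\<^sup>2)" .
    moreover have "h \<tau> = (LINT x|LI 0 1. (e \<tau> x)\<^sup>2)" by (simp add: h_def power2_eq_square)
    ultimately show ?thesis using hd by linarith
  qed
  then show "\<exists>\<rho>>0. \<forall>t\<in>{0..T}. \<tau> - \<rho> \<le> t \<and> t \<le> \<tau> \<longrightarrow>
      (LINT x|LI 0 1. (e \<tau> x)\<^sup>2) - \<eta> \<le> (LINT x|LI 0 1. (e t x)\<^sup>2)"
    using \<rho>(1) by (intro exI[of _ "\<rho> / 2"]) auto
qed

section \<open>Entropy solutions as viscous solutions\<close>

lemma smooth2_section: "smooth2 f \<Longrightarrow> smooth (f t)"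
proof -
  have "Ck k (f t)" if "smooth2 f" for k f
    using that
  proof (induction k arbitrary: f)
    case (Suc k)
    have "deriv (f t) = Dx f t" by (simp add: Dx_def)
    then show ?case using Suc.IH[OF smooth2_D(2)[OF Suc.prems]] smooth2_D(5)[OF Suc.prems, of t] real_differentiable_def by auto
  qed simp
  then show "smooth2 f \<Longrightarrow> smooth (f t)" by (simp add: smooth_def)
qed

lemma test2_section:
  assumes \<phi>: "test2 (Cyl T) \<phi>" shows "test1 Omega (\<phi> t)"
proof -
  let ?K = "closure {(t, x). \<phi> t x \<noteq> 0}"
  have K: "compact ?K" "?K \<subseteq> Cyl T" using \<phi> unfolding test2_def by simp_all
  have kc: "compact (snd ` ?K)" by (rule compact_continuous_image[OF _ K(1)]) (intro continuous_intros)
  have ko: "snd ` ?K \<subseteq> Omega"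
  proof
    fix y assume "y \<in> snd ` ?K"
    then obtain z where "z \<in> ?K" "y = snd z" by blast
    then show "y \<in> Omega" using subsetD[OF K(2)] by (auto simp: mem_Times_iff)
  qed
  have "{x. \<phi> t x \<noteq> 0} \<subseteq> snd ` ?K"
  proof
    fix x assume "x \<in> {x. \<phi> t x \<noteq> 0}"
    then have "(t, x) \<in> {(t, x). \<phi> t x \<noteq> 0}" by simp
    then have "(t, x) \<in> ?K" by (rule subsetD[OF closure_subset])
    then show "x \<in> snd ` ?K" by (rule image_eqI[rotated]) simp
  qed
  then have c: "closure {x. \<phi> t x \<noteq> 0} \<subseteq> snd ` ?K" by (rule closure_minimal) (rule compact_imp_closed[OF kc])
  then have "compact (closure {x. \<phi> t x \<noteq> 0})"
    using bounded_subset[OF compact_imp_bounded[OF kc] c] by (simp add: compact_eq_bounded_closed)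
  then show ?thesis using smooth2_section[OF test2_smooth2[OF \<phi>], of t] c ko
    by (simp add: test1_def smooth_iff_funpow)
qed

lemma weak_dx_of_sections:
  assumes i: "Cint T u" "Cint T ux" and w: "AE t in LI 0 T. has_weak_deriv 0 1 (u t) (ux t)"
    and \<phi>: "test2 (Cyl T) \<phi>"
  shows "CI T (\<lambda>t x. u t x * Dx \<phi> t x) = - CI T (\<lambda>t x. ux t x * \<phi> t x)"
proof -
  note s = test2_smooth2[OF \<phi>]
  obtain c1 where c1: "\<forall>t\<in>{0..T}. \<forall>x\<in>{0..1}. \<bar>\<phi> t x\<bar> \<le> c1" using smooth2_bounded[OF s] by blast
  obtain c2 where c2: "\<forall>t\<in>{0..T}. \<forall>x\<in>{0..1}. \<bar>Dx \<phi> t x\<bar> \<le> c2" using smooth2_bounded[OF smooth2_D(2)[OF s]] by blast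
  have "Cint T (\<lambda>t x. Dx \<phi> t x * u t x)"
    by (rule integrable_bounded_mult[OF i(1) smooth2_meas[OF smooth2_D(2)[OF s]], where C = c2], rule AE_LC_I) (use c2 in simp)
  then have j1: "Cint T (\<lambda>t x. u t x * Dx \<phi> t x)" by (simp add: mult.commute)
  have "Cint T (\<lambda>t x. \<phi> t x * ux t x)"
    by (rule integrable_bounded_mult[OF i(2) smooth2_meas[OF s], where C = c1], rule AE_LC_I) (use c1 in simp)
  then have j2: "Cint T (\<lambda>t x. ux t x * \<phi> t x)" by (simp add: mult.commute)
  have "CI T (\<lambda>t x. u t x * Dx \<phi> t x) = (LINT t|LI 0 T. - (LINT x|LI 0 1. ux t x * \<phi> t x))"
    unfolding CI_iterated(1)[OF j1]
  proof (rule integral_cong_AE)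
    show "(\<lambda>t. LINT x|LI 0 1. u t x * Dx \<phi> t x) \<in> borel_measurable (LI 0 T)"
      "(\<lambda>t. - (LINT x|LI 0 1. ux t x * \<phi> t x)) \<in> borel_measurable (LI 0 T)"
      using CI_iterated(3)[OF j1] CI_iterated(3)[OF j2] by auto
    show "AE t in LI 0 T. (LINT x|LI 0 1. u t x * Dx \<phi> t x) = - (LINT x|LI 0 1. ux t x * \<phi> t x)"
      using w
    proof eventually_elim
      case (elim t)
      have "deriv (\<phi> t) = Dx \<phi> t" by (simp add: Dx_def)
      then show ?case using elim test2_section[OF \<phi>, of t] unfolding has_weak_deriv_LI by metis
    qed
  qed
  also have "\<dots> = - CI T (\<lambda>t x. ux t x * \<phi> t x)" unfolding CI_iterated(1)[OF j2] by simp
  finally show ?thesis .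
qed

text \<open>For \<open>\<epsilon> > 0\<close> two candidates for \<open>\<partial>\<^sub>x u\<close> are at hand, one from the definition of an entropy solution and one
  from the regularity \<open>L\<^sup>2(0,T;H\<^sup>1)\<close>. They agree almost everywhere by uniqueness of weak derivatives, so
  the second, which is square integrable and a weak derivative at almost every time, satisfies the weak form.\<close>

lemma entropy_solution_viscous:
  assumes T: "0 < T" and eps: "0 \<le> \<epsilon>" and es: "entropy_solution T b \<epsilon> u u0" and u0: "L2_on Omega u0"
    and h1: "0 < \<epsilon> \<Longrightarrow> L2_H1 T u"
  shows "\<exists>ux. viscous_solution T b \<epsilon> u ux u0 \<and> (0 < \<epsilon> \<longrightarrow> (AE t in LI 0 T. has_weak_deriv 0 1 (u t) (ux t)))"
proof -
  have um: "Cmeas T u" using es by (simp add: entropy_solution_def Linf_on_def set_borel_LC case_prod_unfold)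
  obtain B where B: "AE z in LC T. \<bar>u (fst z) (snd z)\<bar> \<le> B"
    using es by (auto simp: entropy_solution_def Linf_on_def AE_LC case_prod_unfold)
  have uq: "sqint (LC T) (\<lambda>z. u (fst z) (snd z))" by (rule LC.sqint_bounded[OF um B])
  have u0q: "sqint (LI 0 1) u0" using u0 by (simp add: L2_on_LI sqint_def)
  obtain ux1 where wdx: "has_weak_dx T (\<lambda>t x. \<epsilon> * u t x) (\<lambda>t x. \<epsilon> * ux1 t x)"
    and int1: "Cint T (\<lambda>t x. \<epsilon> * ux1 t x)"
    and weak1: "\<And>\<phi>. test2 ({..<T} \<times> Omega) \<phi> \<Longrightarrow>
        CI T (\<lambda>t x. Dt \<phi> t x * u t x + Dx \<phi> t x * (b * u t x - \<epsilon> * ux1 t x)) + (LINT x|LI 0 1. u0 x * \<phi> 0 x) = 0"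
    and ent1: "\<And>\<Phi>. \<lbrakk>test2 ({..<T} \<times> Omega) \<Phi>; \<forall>t x. 0 \<le> \<Phi> t x\<rbrakk> \<Longrightarrow>
      0 \<le> CI T (\<lambda>t x. Dt \<Phi> t x * ((u t x)\<^sup>2 / 2) + Dx \<Phi> t x * (b / 2 * (u t x)\<^sup>2 - \<epsilon> * u t x * ux1 t x)
            - \<epsilon> * \<Phi> t x * (ux1 t x)\<^sup>2) + (LINT x|LI 0 1. \<Phi> 0 x * ((u0 x)\<^sup>2 / 2))"
    using es unfolding entropy_solution_def set_integral_LC set_integral_LI set_integrable_LC case_prod_unfold by blast
  show ?thesis
  proof (cases "\<epsilon> = 0")
    case True
    have "viscous_solution T b \<epsilon> u (\<lambda>t x. 0) u0"
      by unfold_locales (use T eps um uq u0q weak1 ent1 True in \<open>simp_all add: sqint_def\<close>)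
    then show ?thesis using True by blast
  next
    case False
    then have ep: "0 < \<epsilon>" using eps by simp
    obtain ux2 where ux2: "L2_on (Cyl T) (\<lambda>(t, x). ux2 t x)" "AE t in LI 0 T. has_weak_deriv 0 1 (u t) (ux2 t)"
      using h1[OF ep] by (auto simp: L2_H1_def AE_LI)
    have q2: "sqint (LC T) (\<lambda>z. ux2 (fst z) (snd z))" using ux2(1) by (simp add: L2_on_LC sqint_def case_prod_unfold)
    have i2: "Cint T ux2" by (rule LC.sqint_integrable[OF q2])
    have iu: "Cint T u" by (rule LC.sqint_integrable[OF uq])
    have "Cint T (\<lambda>t x. 1 / \<epsilon> * (\<epsilon> * ux1 t x))" by (rule integrable_mult_right) (rule int1)
    then have i1: "Cint T ux1" using False by simp
    have ae: "AE z in LC T. ux1 (fst z) (snd z) = ux2 (fst z) (snd z)"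
    proof (rule L1_loc_unique_2d)
      show "L1_loc (Cyl T) (\<lambda>z. ux1 (fst z) (snd z))" "L1_loc (Cyl T) (\<lambda>z. ux2 (fst z) (snd z))"
        by (rule integrable_L1_loc2[OF i1] integrable_L1_loc2[OF i2])+
      fix \<phi> assume \<phi>: "test2 (Cyl T) \<phi>"
      have "CI T (\<lambda>t x. \<epsilon> * u t x * Dx \<phi> t x) = - CI T (\<lambda>t x. \<epsilon> * ux1 t x * \<phi> t x)"
        using wdx \<phi> by (simp add: has_weak_dx_def set_integral_LC case_prod_unfold)
      then have "\<epsilon> * CI T (\<lambda>t x. u t x * Dx \<phi> t x) = - (\<epsilon> * CI T (\<lambda>t x. ux1 t x * \<phi> t x))" by (simp add: mult.assoc)
      then show "CI T (\<lambda>t x. ux1 t x * \<phi> t x) = CI T (\<lambda>t x. ux2 t x * \<phi> t x)"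
        using weak_dx_of_sections[OF iu i2 ux2(2) \<phi>] ep by simp
    qed
    have m1: "Cmeas T ux1" and m2: "Cmeas T ux2" using i1 i2 by simp_all
    have "viscous_solution T b \<epsilon> u ux2 u0"
    proof unfold_locales
      show "Cint T (\<lambda>t x. (u t x)\<^sup>2)" "Cint T (\<lambda>t x. (ux2 t x)\<^sup>2)" using uq q2 by (simp_all add: sqint_def)
      fix \<phi> assume \<phi>: "test2 ({..<T} \<times> Omega) \<phi>"
      note s = test2_smooth2[OF \<phi>]
      note [measurable] = um m1 m2 smooth2_meas[OF s] smooth2_meas[OF smooth2_D(1)[OF s]] smooth2_meas[OF smooth2_D(2)[OF s]]
      have "CI T (\<lambda>t x. Dt \<phi> t x * u t x + Dx \<phi> t x * (b * u t x - \<epsilon> * ux2 t x)) =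
        CI T (\<lambda>t x. Dt \<phi> t x * u t x + Dx \<phi> t x * (b * u t x - \<epsilon> * ux1 t x))"
        by (rule integral_cong_AE, measurable) (use ae in eventually_elim, simp)
      then show "CI T (\<lambda>t x. Dt \<phi> t x * u t x + Dx \<phi> t x * (b * u t x - \<epsilon> * ux2 t x)) + (LINT x|LI 0 1. u0 x * \<phi> 0 x) = 0"
        using weak1[OF \<phi>] by simp
      assume pos: "\<forall>t x. 0 \<le> \<phi> t x"
      have "CI T (\<lambda>t x. Dt \<phi> t x * ((u t x)\<^sup>2 / 2) + Dx \<phi> t x * (b / 2 * (u t x)\<^sup>2 - \<epsilon> * u t x * ux2 t x)
            - \<epsilon> * \<phi> t x * (ux2 t x)\<^sup>2) = CI T (\<lambda>t x. Dt \<phi> t x * ((u t x)\<^sup>2 / 2) + Dx \<phi> t x * (b / 2 * (u t x)\<^sup>2 - \<epsilon> * u t x * ux1 t x)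
            - \<epsilon> * \<phi> t x * (ux1 t x)\<^sup>2)"
        by (rule integral_cong_AE, measurable) (use ae in eventually_elim, simp)
      then show "0 \<le> CI T (\<lambda>t x. Dt \<phi> t x * ((u t x)\<^sup>2 / 2) + Dx \<phi> t x * (b / 2 * (u t x)\<^sup>2 - \<epsilon> * u t x * ux2 t x)
            - \<epsilon> * \<phi> t x * (ux2 t x)\<^sup>2) + (LINT x|LI 0 1. \<phi> 0 x * ((u0 x)\<^sup>2 / 2))"
        using ent1[OF \<phi> pos] by simp
    qed (use T eps um m2 u0q in simp_all)
    then show ?thesis using ux2(2) by blast
  qed
qed

section \<open>Lipschitz functions of time\<close>

definition Lip :: "real \<Rightarrow> (real \<Rightarrow> real) \<Rightarrow> bool" where
  "Lip T f \<longleftrightarrow> (\<exists>L. L-lipschitz_on {0..T} f)"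

lemma Lip_const: "Lip T (\<lambda>t. c)"
  unfolding Lip_def using lipschitz_on_constant by blast

lemma Lip_add: "\<lbrakk>Lip T f; Lip T g\<rbrakk> \<Longrightarrow> Lip T (\<lambda>t. f t + g t)"
  unfolding Lip_def using lipschitz_on_add by blast

lemma Lip_cmult: "Lip T f \<Longrightarrow> Lip T (\<lambda>t. c * f t)"
  unfolding Lip_def using lipschitz_on_cmult_real by blast

lemma Lip_mult_const: "Lip T f \<Longrightarrow> Lip T (\<lambda>t. f t * c)"
  using Lip_cmult[of T f c] by (simp add: mult.commute)

lemma Lip_diff: "\<lbrakk>Lip T f; Lip T g\<rbrakk> \<Longrightarrow> Lip T (\<lambda>t. f t - g t)"
  using Lip_add[of T f "\<lambda>t. (-1) * g t"] Lip_cmult[of T g "-1"] by simp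

lemma Lip_sum: "(\<And>i. i \<in> I \<Longrightarrow> Lip T (f i)) \<Longrightarrow> Lip T (\<lambda>t. \<Sum>i\<in>I. f i t)"
  by (induction I rule: infinite_finite_induct) (simp_all add: Lip_const Lip_add)

lemma Lip_cong: "\<lbrakk>Lip T f; \<And>t. t \<in> {0..T} \<Longrightarrow> g t = f t\<rbrakk> \<Longrightarrow> Lip T g"
  unfolding Lip_def lipschitz_on_def by (metis (no_types, lifting))

lemma Lip_continuous: "Lip T f \<Longrightarrow> continuous_on {0..T} f"
  unfolding Lip_def using lipschitz_on_continuous_on by blast

lemma Lip_measurable: "Lip T f \<Longrightarrow> f \<in> borel_measurable (LI 0 T)"
proof -
  assume "Lip T f"
  then have "continuous_on {0<..<T} f" by (intro continuous_on_subset[OF Lip_continuous]) auto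
  then have "f \<in> borel_measurable (restrict_space borel {0<..<T})" by (rule borel_measurable_continuous_on_restrict)
  then show ?thesis by (simp add: measurable_cong_sets[OF sets_LI refl])
qed

lemma poly_lipschitz:
  fixes p :: "real poly" shows "\<exists>L. L-lipschitz_on {a..b} (poly p)"
proof -
  have "bounded (poly (pderiv p) ` {a..b})"
    by (intro compact_imp_bounded compact_continuous_image) (auto intro: continuous_intros)
  then obtain L where L: "\<forall>y\<in>poly (pderiv p) ` {a..b}. norm y \<le> L" unfolding bounded_iff by blast
  have "\<bar>L\<bar>-lipschitz_on {a..b} (poly p)"
  proof (rule lipschitz_onI)
    fix s t assume st: "s \<in> {a..b}" "t \<in> {a..b}"
    show "dist (poly p s) (poly p t) \<le> \<bar>L\<bar> * dist s t"
      unfolding dist_norm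
    proof (rule field_differentiable_bound[of "{a..b}" "poly p" "poly (pderiv p)"])
      show "(poly p has_field_derivative poly (pderiv p) z) (at z within {a..b})" for z
        using poly_DERIV has_field_derivative_at_within by blast
      show "norm (poly (pderiv p) z) \<le> \<bar>L\<bar>" if "z \<in> {a..b}" for z
        using L that by (metis abs_ge_self imageI order_trans)
    qed (use st in auto)
  qed simp
  then show ?thesis by blast
qed

lemma piecewise_poly_Lip:
  assumes tt: "tt 0 = 0" "\<forall>n<N. tt n < tt (Suc n)"
    and p: "\<forall>n<N. \<exists>p. \<forall>t\<in>{tt n..tt (Suc n)}. f t = poly p t"
  shows "Lip (tt N) f"
proof -
  have "n \<le> N \<Longrightarrow> 0 \<le> tt n \<and> Lip (tt n) f" for n
  proof (induction n)
    case 0 then show ?case by (auto simp: Lip_def lipschitz_on_def tt intro!: exI[of _ 0])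
  next
    case (Suc n)
    then obtain L where L: "L-lipschitz_on {0..tt n} f" and t0: "0 \<le> tt n" unfolding Lip_def by auto
    have lt: "tt n < tt (Suc n)" using tt(2) Suc.prems by simp
    obtain P where P: "\<forall>t\<in>{tt n..tt (Suc n)}. f t = poly P t" using p Suc.prems by fastforce
    obtain K where "K-lipschitz_on {tt n..tt (Suc n)} (poly P)" using poly_lipschitz by blast
    then have K: "K-lipschitz_on {tt n..tt (Suc n)} f" using P unfolding lipschitz_on_def by simp
    have "(max L K)-lipschitz_on {0..tt (Suc n)} (\<lambda>t. if t \<le> tt n then f t else f t)"
      by (rule lipschitz_on_concat_max[OF L K refl])
    then have "Lip (tt (Suc n)) f" unfolding Lip_def by auto
    then show ?case using t0 lt by simp
  qed
  then show ?thesis by simp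
qed

text \<open>The curve \<open>t \<mapsto> (a t, c t)\<close> is compact, so the local Lipschitz bounds of \<open>w\<close> along it are uniform.\<close>

lemma Lip_compose2:
  assumes w: "\<forall>p. \<exists>\<delta>>0. \<exists>L. L-lipschitz_on (ball p \<delta>) (\<lambda>(a, c). w a c)"
    and a: "Lip T a" and c: "Lip T c"
  shows "Lip T (\<lambda>t. w (a t) (c t) :: real)"
proof -
  obtain A where A: "A-lipschitz_on {0..T} a" using a by (auto simp: Lip_def)
  obtain C where C: "C-lipschitz_on {0..T} c" using c by (auto simp: Lip_def)
  define h where "h = (\<lambda>t. (a t, c t))"
  define K where "K = sqrt (A\<^sup>2 + C\<^sup>2)"
  have K: "K-lipschitz_on {0..T} h" unfolding h_def K_def by (rule lipschitz_on_Pair[OF A C])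
  have K0: "0 \<le> K" by (rule lipschitz_on_nonneg[OF K])
  have ll: "local_lipschitz {0::real} {0..T} (\<lambda>_ t. w (a t) (c t))"
  proof (rule local_lipschitzI)
    fix s t0 :: real assume s: "s \<in> {0}" and t0: "t0 \<in> {0..T}"
    obtain \<delta> L where d: "\<delta> > 0" and L: "L-lipschitz_on (ball (h t0) \<delta>) (\<lambda>(a, c). w a c)" using w by blast
    define u where "u = \<delta> / (2 * (K + 1))"
    have u: "u > 0" using d K0 by (simp add: u_def)
    have hb: "h ` (cball t0 u \<inter> {0..T}) \<subseteq> ball (h t0) \<delta>"
    proof (rule image_subsetI)
      fix t assume "t \<in> cball t0 u \<inter> {0..T}"
      then have t: "t \<in> cball t0 u" "t \<in> {0..T}" by simp_all
      have "dist (h t0) (h t) \<le> K * dist t0 t" by (rule lipschitz_onD[OF K t0 t(2)])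
      also have "\<dots> \<le> (K + 1) * u" using t K0 by (intro mult_mono) auto
      also have "(K + 1) * u = \<delta> / 2"
      proof -
        have "K + 1 \<noteq> 0" using K0 by simp
        then show ?thesis unfolding u_def by (simp add: divide_simps)
      qed
      also have "\<dots> < \<delta>" using d by simp
      finally show "h t \<in> ball (h t0) \<delta>" by simp
    qed
    have "K-lipschitz_on (cball t0 u \<inter> {0..T}) h" by (rule lipschitz_on_subset[OF K]) simp
    moreover have "L-lipschitz_on (h ` (cball t0 u \<inter> {0..T})) (\<lambda>(a, c). w a c)" by (rule lipschitz_on_subset[OF L hb])
    ultimately have "(L * K)-lipschitz_on (cball t0 u \<inter> {0..T}) ((\<lambda>(a, c). w a c) \<circ> h)"
      by (rule lipschitz_on_compose)
    then have "(L * K)-lipschitz_on (cball t0 u \<inter> {0..T}) (\<lambda>t. w (a t) (c t))" by (simp add: h_def comp_def)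
    then show "\<exists>u>0. \<exists>L. \<forall>s\<in>cball s u \<inter> {0}. L-lipschitz_on (cball t0 u \<inter> {0..T}) (\<lambda>t. w (a t) (c t))"
      by (intro exI[of _ u] conjI u exI[of _ "L * K"] ballI)
  qed
  show ?thesis unfolding Lip_def
  proof (rule local_lipschitz_compact_implies_lipschitz[OF ll compact_Icc])
    fix L assume L: "\<And>s. s \<in> {0::real} \<Longrightarrow> L-lipschitz_on {0..T} (\<lambda>t. w (a t) (c t))"
    show "\<exists>L. L-lipschitz_on {0..T} (\<lambda>t. w (a t) (c t))" by (rule exI[of _ L], rule L[of 0]) simp
  qed (simp_all add: continuous_on_const)
qed

section \<open>Polynomials of bounded degree\<close>

definition pspace :: "nat \<Rightarrow> real poly set" where
  "pspace n = {p. \<forall>i\<ge>n. coeff p i = 0}"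

lemma pspace_degree: "p \<in> pspace (Suc n) \<longleftrightarrow> degree p \<le> n"
  unfolding pspace_def
proof safe
  assume "\<forall>i\<ge>Suc n. coeff p i = 0" then show "degree p \<le> n" by (intro degree_le) auto
next
  fix i assume "degree p \<le> n" "Suc n \<le> i" then show "coeff p i = 0" by (intro coeff_eq_0) simp
qed

lemma pspace_poly: "p \<in> pspace n \<Longrightarrow> poly p y = (\<Sum>i<n. coeff p i * y ^ i)"
proof (cases n)
  case 0
  assume "p \<in> pspace n"
  then have "p = 0" using 0 by (simp add: pspace_def poly_eq_iff)
  then show ?thesis using 0 by simp
next
  case (Suc m)
  assume "p \<in> pspace n"
  then have "degree p \<le> m" using Suc pspace_degree by blast
  then have "(\<Sum>i\<le>m. coeff p i * y ^ i) = (\<Sum>i\<le>degree p. coeff p i * y ^ i)"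
    by (intro sum.mono_neutral_right) (auto simp: coeff_eq_0)
  then show ?thesis unfolding Suc lessThan_Suc_atMost poly_altdef by simp
qed

text \<open>For a positive definite form, polynomials of bounded degree are determined linearly by
  finitely many of their moments. This is the Gram-Schmidt process; the expansion itself forces the
  \<open>Q i\<close> to be orthonormal.\<close>

lemma gram_schmidt:
  fixes B :: "real poly \<Rightarrow> real poly \<Rightarrow> real"
  assumes add: "\<And>p r s. B (p + r) s = B p s + B r s" and scale: "\<And>c p s. B (smult c p) s = c * B p s"
    and sym: "\<And>p s. B p s = B s p" and pos: "\<And>p. p \<noteq> 0 \<Longrightarrow> 0 < B p p"
  shows "\<exists>Q. (\<forall>i<n. Q i \<in> pspace n) \<and> (\<forall>r\<in>pspace n. r = (\<Sum>i<n. smult (B r (Q i)) (Q i)))"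
proof (induction n)
  case 0
  have "p = 0" if "p \<in> pspace 0" for p using that by (simp add: pspace_def poly_eq_iff)
  then show ?case by auto
next
  case (Suc n)
  then obtain Q where Q: "\<forall>i<n. Q i \<in> pspace n" "\<forall>r\<in>pspace n. r = (\<Sum>i<n. smult (B r (Q i)) (Q i))" by blast
  have zero: "B 0 s = 0" for s using scale[of 0 0 s] by simp
  have Bsum: "B (\<Sum>i\<in>I. f i) s = (\<Sum>i\<in>I. B (f i) s)" for I :: "nat set" and f s
    by (induction I rule: infinite_finite_induct) (simp_all add: add zero)
  define m where "m = (monom 1 n :: real poly)"
  define P where "P = (\<Sum>i<n. smult (B m (Q i)) (Q i))"
  define v where "v = m - P"
  have Pn: "P \<in> pspace n" using Q(1) unfolding P_def pspace_def by (auto simp: coeff_sum)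
  have vc: "coeff v n = 1" "v \<in> pspace (Suc n)" using Pn by (auto simp: v_def m_def pspace_def)
  have v0: "v \<noteq> 0" using vc(1) by auto
  have orth: "B v s = 0" if s: "s \<in> pspace n" for s
  proof -
    have "B m s = B s m" by (rule sym)
    also have "\<dots> = B (\<Sum>i<n. smult (B s (Q i)) (Q i)) m" using Q(2) s by simp
    also have "\<dots> = (\<Sum>i<n. B s (Q i) * B (Q i) m)" by (simp add: Bsum scale)
    also have "\<dots> = (\<Sum>i<n. B m (Q i) * B (Q i) s)" by (simp add: sym mult.commute)
    also have "\<dots> = B P s" unfolding P_def by (simp add: Bsum scale)
    finally have "B m s = B P s" .
    moreover have "B m s = B v s + B P s" using add[of v P s] by (simp add: v_def)
    ultimately show ?thesis by simp
  qed
  define k where "k = sqrt (B v v)"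
  have k: "k > 0" "k * k = B v v" using pos[OF v0] by (simp_all add: k_def)
  define Q' where "Q' = Q(n := smult (1 / k) v)"
  have "\<forall>i<Suc n. Q' i \<in> pspace (Suc n)"
    using Q(1) vc(2) unfolding Q'_def pspace_def by (auto simp: less_Suc_eq)
  moreover have "r = (\<Sum>i<Suc n. smult (B r (Q' i)) (Q' i))" if r: "r \<in> pspace (Suc n)" for r
  proof -
    define c where "c = coeff r n"
    define s where "s = r - smult c v"
    have s: "s \<in> pspace n"
      unfolding pspace_def
    proof safe
      fix i assume i: "n \<le> i"
      show "coeff s i = 0"
      proof (cases "i = n")
        case True then show ?thesis by (simp add: s_def c_def vc)
      next
        case False
        then show ?thesis using i r vc(2) by (simp add: s_def pspace_def)
      qed
    qed
    have rs: "r = smult c v + s" by (simp add: s_def)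
    have "B r (Q i) = B s (Q i)" if "i < n" for i
      unfolding rs add scale using orth[of "Q i"] Q(1) that by simp
    then have "(\<Sum>i<n. smult (B r (Q' i)) (Q' i)) = (\<Sum>i<n. smult (B s (Q i)) (Q i))"
      by (intro sum.cong) (auto simp: Q'_def)
    also have "\<dots> = s" using Q(2) s by simp
    finally have 1: "(\<Sum>i<n. smult (B r (Q' i)) (Q' i)) = s" .
    have "B r (Q' n) = (1 / k) * B v r" unfolding Q'_def fun_upd_same sym[of r "smult (1 / k) v"] scale ..
    also have "B v r = c * (k * k)"
    proof -
      have "B v r = B r v" by (rule sym)
      also have "\<dots> = B (smult c v + s) v" by (rule arg_cong[OF rs])
      also have "\<dots> = c * B v v + B v s" unfolding add scale sym[of s v] ..
      finally show ?thesis by (simp add: k(2) orth[OF s])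
    qed
    finally have "B r (Q' n) = c * k" using k(1) by simp
    then have "smult (B r (Q' n)) (Q' n) = smult c v" using k(1) by (simp add: Q'_def)
    with 1 have "(\<Sum>i<Suc n. smult (B r (Q' i)) (Q' i)) = smult c v + s" by (simp add: add.commute)
    then show ?thesis unfolding rs[symmetric] by (rule HOL.sym)
  qed
  ultimately show ?case by (intro exI[of _ Q']) simp
qed

lemma poly_LI: "integrable (LI a b) (poly p)" for p :: "real poly"
proof -
  have "bounded (poly p ` {a..b})"
    by (intro compact_imp_bounded compact_continuous_image) (auto intro: continuous_intros)
  then obtain L where L: "\<forall>y\<in>poly p ` {a..b}. norm y \<le> L" unfolding bounded_iff by blast
  show ?thesis
    by (rule LI.integrable_const_bound[where B = L], rule AE_LI_I)
       (use L in \<open>auto intro!: borel_LI borel_measurable_continuous_onI continuous_intros\<close>)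
qed

lemma poly_mult_LI: "integrable (LI a b) (\<lambda>y. poly p y * poly r y)" for p r :: "real poly"
  unfolding poly_mult[symmetric] by (rule poly_LI)

text \<open>The value at both ends and the moments against polynomials of degree less than \<open>q\<close> determine a
  polynomial of degree \<open>q + 1\<close>, and linearly so: subtracting the linear interpolant leaves
  \<open>\<omega> r\<close> with \<open>\<omega> = (y - a)(b - y)\<close>, and \<open>r\<close> is recovered from its moments with respect to the weight \<open>\<omega>\<close>.\<close>

lemma endpoint_moment_representation:
  fixes a b :: real
  assumes ab: "a < b"
  shows "\<exists>la lb G Q. (\<forall>i<q. Q i \<in> pspace q) \<and>
    (\<forall>p. degree p \<le> Suc q \<longrightarrow> p = smult (poly p a) la + smult (poly p b) lb +
       (\<Sum>i<q. smult ((LINT y|LI a b. poly p y * poly (Q i) y) - poly p a * (LINT y|LI a b. poly la y * poly (Q i) y)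
           - poly p b * (LINT y|LI a b. poly lb y * poly (Q i) y)) (G i)))"
proof -
  define W where "W = [:-a, 1:] * [:b, -1:]"
  have Wv: "poly W y = (y - a) * (b - y)" for y by (simp add: W_def algebra_simps)
  have Wd: "degree W = 2" unfolding W_def by (subst degree_mult_eq) auto
  define B where "B = (\<lambda>p r. LINT y|LI a b. poly (W * p * r) y)"
  have Badd: "B (p + r) s = B p s + B r s" for p r s
  proof -
    have "B (p + r) s = (LINT y|LI a b. poly (W * p * s) y + poly (W * r * s) y)"
      unfolding B_def by (rule Bochner_Integration.integral_cong) (simp_all add: algebra_simps)
    also have "\<dots> = B p s + B r s" unfolding B_def by (rule Bochner_Integration.integral_add) (rule poly_LI)+
    finally show ?thesis .
  qed
  have Bscale: "B (smult c p) s = c * B p s" for c p s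
  proof -
    have "B (smult c p) s = (LINT y|LI a b. c * poly (W * p * s) y)"
      unfolding B_def by (rule Bochner_Integration.integral_cong) simp_all
    then show ?thesis by (simp add: B_def)
  qed
  have Bsym: "B p s = B s p" for p s unfolding B_def by (simp add: mult_ac)
  have Bpos: "0 < B p p" if "p \<noteq> 0" for p
  proof -
    have nn: "AE y in LI a b. 0 \<le> poly (W * p * p) y"
      by (rule AE_LI_I) (auto simp: Wv mult.assoc intro!: mult_nonneg_nonneg)
    then have "0 \<le> B p p" unfolding B_def by (rule integral_nonneg_AE)
    moreover have "B p p \<noteq> 0"
    proof
      assume "B p p = 0"
      then have "AE y in LI a b. poly (W * p * p) y = 0"
        unfolding B_def using integral_nonneg_eq_0_iff_AE[OF poly_LI nn] by blast
      then have "AE y in lborel. y \<in> {a<..<b} \<longrightarrow> poly (W * p * p) y = 0" by (simp add: AE_LI)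
      moreover have "AE y in lborel. y \<notin> {y. poly (W * p * p) y = 0}"
      proof (rule AE_not_in)
        have "W * p * p \<noteq> 0" using that Wd by auto
        then have "finite {y. poly (W * p * p) y = 0}" by (rule poly_roots_finite)
        then show "{y. poly (W * p * p) y = 0} \<in> null_sets lborel" by (rule finite_imp_null_set_lborel)
      qed
      ultimately have "AE y in lborel. y \<notin> {a<..<b}" by eventually_elim auto
      then have "emeasure lborel {a<..<b} = 0"
        by (subst (asm) AE_iff_null_sets[symmetric]) (auto simp: null_sets_def)
      then show False using ab by simp
    qed
    ultimately show ?thesis by simp
  qed
  obtain Q where Q: "\<forall>i<q. Q i \<in> pspace q" "\<forall>r\<in>pspace q. r = (\<Sum>i<q. smult (B r (Q i)) (Q i))"
    using gram_schmidt[of B q, OF Badd Bscale Bsym Bpos] by blast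
  define la where "la = smult (1 / (b - a)) [:b, -1:]"
  define lb where "lb = smult (1 / (b - a)) [:-a, 1:]"
  have lv: "poly la a = 1" "poly la b = 0" "poly lb a = 0" "poly lb b = 1"
  proof -
    have "poly la y = (b - y) / (b - a)" "poly lb y = (y - a) / (b - a)" for y by (simp_all add: la_def lb_def diff_divide_distrib)
    then show "poly la a = 1" "poly la b = 0" "poly lb a = 0" "poly lb b = 1" using ab by simp_all
  qed
  have ld: "degree la \<le> 1" "degree lb \<le> 1" unfolding la_def lb_def by (auto intro: order_trans[OF degree_smult_le])
  show ?thesis
  proof (rule exI[of _ la], rule exI[of _ lb], rule exI[of _ "\<lambda>i. W * Q i"], rule exI[of _ Q],
      intro conjI[OF Q(1)] allI impI)
    fix p :: "real poly" assume p: "degree p \<le> Suc q"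
    define l where "l = smult (poly p a) la + smult (poly p b) lb"
    define d where "d = p - l"
    have "poly d a = 0" "poly d b = 0" by (simp_all add: d_def l_def lv)
    then have "[:-a, 1:] dvd d" by (simp add: poly_eq_0_iff_dvd)
    then obtain d1 where d1: "d = [:-a, 1:] * d1" by (rule dvdE)
    have "poly d1 b = 0" using \<open>poly d b = 0\<close> ab by (simp add: d1)
    then have "[:-b, 1:] dvd d1" by (simp add: poly_eq_0_iff_dvd)
    then obtain d2 where d2: "d1 = [:-b, 1:] * d2" by (rule dvdE)
    define r where "r = - d2"
    have e: "[:b, -1:] = - [:-b, 1:]" by simp
    have dr: "d = W * r" unfolding d1 d2 W_def r_def e
      by (simp only: mult_minus_left mult_minus_right minus_minus mult.assoc)
    have "r \<in> pspace q"
    proof (cases "r = 0")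
      case True then show ?thesis by (simp add: pspace_def)
    next
      case False
      have "degree d \<le> max (Suc q) 1" unfolding d_def l_def
        by (intro degree_diff_le degree_add_le order_trans[OF degree_smult_le]) (use p ld in auto)
      moreover have "degree d = 2 + degree r"
        unfolding dr using False Wd by (subst degree_mult_eq) auto
      ultimately have "Suc (degree r) \<le> q" by simp
      then obtain q' where "q = Suc q'" "degree r \<le> q'" by (cases q) auto
      then show ?thesis using pspace_degree by blast
    qed
    then have re: "r = (\<Sum>i<q. smult (B r (Q i)) (Q i))" using Q(2) by blast
    have Br: "B r (Q i) = (LINT y|LI a b. poly p y * poly (Q i) y) - poly p a * (LINT y|LI a b. poly la y * poly (Q i) y)
           - poly p b * (LINT y|LI a b. poly lb y * poly (Q i) y)" for i
    proof -
      have "B r (Q i) = (LINT y|LI a b. poly p y * poly (Q i) y - poly p a * (poly la y * poly (Q i) y) - poly p b * (poly lb y * poly (Q i) y))"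
        unfolding B_def dr[symmetric] d_def l_def
        by (rule Bochner_Integration.integral_cong) (simp_all add: algebra_simps)
      then show ?thesis
        using poly_mult_LI[of a b p "Q i"] poly_mult_LI[of a b la "Q i"] poly_mult_LI[of a b lb "Q i"] by simp
    qed
    have "p = l + W * r" using dr by (simp add: d_def)
    also have "W * r = W * (\<Sum>i<q. smult (B r (Q i)) (Q i))" using re by simp
    also have "\<dots> = (\<Sum>i<q. smult (B r (Q i)) (W * Q i))" by (simp add: sum_distrib_left)
    finally show "p = smult (poly p a) la + smult (poly p b) lb +
       (\<Sum>i<q. smult ((LINT y|LI a b. poly p y * poly (Q i) y) - poly p a * (LINT y|LI a b. poly la y * poly (Q i) y)
           - poly p b * (LINT y|LI a b. poly lb y * poly (Q i) y)) (W * Q i))"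
      unfolding l_def Br .
  qed
qed

section \<open>Discontinuous Galerkin functions\<close>

lemma mesh_facts:
  assumes "is_mesh M x"
  shows "0 < M" "x 0 = 0" "x M = 1" "\<And>j. j < M \<Longrightarrow> x j < x (Suc j)"
    "\<And>i j. \<lbrakk>i \<le> j; j \<le> M\<rbrakk> \<Longrightarrow> x i \<le> x j" "\<And>j. j \<le> M \<Longrightarrow> 0 \<le> x j \<and> x j \<le> 1"
proof -
  show "0 < M" using assms by (cases M) (auto simp: is_mesh_def)
  show x: "x 0 = 0" "x M = 1" "\<And>j. j < M \<Longrightarrow> x j < x (Suc j)" using assms by (auto simp: is_mesh_def)
  show m: "x i \<le> x j" if "i \<le> j" "j \<le> M" for i j
    using that
  proof (induction j rule: dec_induct)
    case (step n) then show ?case using x(3)[of n] by simp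
  qed simp
  show "0 \<le> x j \<and> x j \<le> 1" if "j \<le> M" for j using m[of 0 j] m[of j M] that x by simp
qed

lemma dg_fun_cell:
  assumes m: "is_mesh M x" and j: "j < M" and y: "y \<in> {x j<..<x (Suc j)}"
  shows "dg_fun M x v y = poly (v j) y"
proof -
  have "indicator {x i<..<x (Suc i)} y * poly (v i) y = (if i = j then poly (v j) y else 0)" if "i < M" for i
  proof (cases i j rule: linorder_cases)
    case less
    then have "x (Suc i) \<le> x j" using mesh_facts(5)[OF m, of "Suc i" j] j by simp
    then show ?thesis using y less by (simp add: indicator_def)
  next
    case greater
    then have "x (Suc j) \<le> x i" using mesh_facts(5)[OF m, of "Suc j" i] that by simp
    then show ?thesis using y greater by (simp add: indicator_def)
  qed (use y in simp)
  then have "dg_fun M x v y = (\<Sum>i<M. if i = j then poly (v j) y else 0)"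
    unfolding dg_fun_def by (intro sum.cong) auto
  then show ?thesis using j by simp
qed

lemma AE_in_cell:
  assumes m: "is_mesh M x"
  shows "AE y in LI 0 1. \<exists>j<M. y \<in> {x j<..<x (Suc j)}"
  unfolding AE_LI
proof -
  have "AE y in lborel. y \<notin> x ` {..M}"
    by (intro AE_not_in finite_imp_null_set_lborel) simp
  then show "AE y in lborel. y \<in> Omega \<longrightarrow> (\<exists>j<M. y \<in> {x j<..<x (Suc j)})"
  proof eventually_elim
    case (elim y)
    show ?case
    proof
      assume y: "y \<in> Omega"
      define j where "j = (GREATEST j. j \<le> M \<and> x j \<le> y)"
      have j: "j \<le> M \<and> x j \<le> y"
        unfolding j_def by (rule GreatestI_nat[where k = 0 and b = M]) (use y mesh_facts(2)[OF m] in auto)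
      have jM: "j < M" using j y mesh_facts(3)[OF m] by (cases "j = M") auto
      have "\<not> x (Suc j) \<le> y"
      proof
        assume "x (Suc j) \<le> y"
        then have "Suc j \<le> j" unfolding j_def by (intro Greatest_le_nat[where b = M]) (use jM j_def in auto)
        then show False by simp
      qed
      moreover have "x j \<noteq> y" using elim jM by auto
      ultimately show "\<exists>j<M. y \<in> {x j<..<x (Suc j)}" using jM j by (intro exI[of _ j]) auto
    qed
  qed
qed

lemma dg_fun_borel: "dg_fun M x v \<in> borel_measurable borel"
  unfolding dg_fun_def[abs_def]
  by (intro borel_measurable_sum borel_measurable_times borel_measurable_indicator borel_measurable_continuous_onI continuous_intros) auto

lemma dg_fun_bounded: "\<exists>C. \<forall>y. \<bar>dg_fun M x v y\<bar> \<le> C"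
proof -
  have "\<exists>C. \<forall>y. \<bar>indicator {x j<..<x (Suc j)} y * poly (v j) y\<bar> \<le> C" for j
  proof -
    have "bounded (poly (v j) ` {x j..x (Suc j)})"
      by (intro compact_imp_bounded compact_continuous_image) (auto intro: continuous_intros)
    then obtain L where L: "\<forall>y\<in>poly (v j) ` {x j..x (Suc j)}. norm y \<le> L" unfolding bounded_iff by blast
    have "\<bar>indicator {x j<..<x (Suc j)} y * poly (v j) y\<bar> \<le> \<bar>L\<bar>" for y
    proof (cases "y \<in> {x j<..<x (Suc j)}")
      case True
      then have "y \<in> {x j..x (Suc j)}" by simp
      then have "norm (poly (v j) y) \<le> L" using L by blast
      then show ?thesis using True by simp
    qed simp
    then show ?thesis by blast
  qed
  then obtain C where C: "\<And>j y. \<bar>indicator {x j<..<x (Suc j)} y * poly (v j) y\<bar> \<le> C j" by metis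
  have "\<bar>dg_fun M x v y\<bar> \<le> (\<Sum>j<M. C j)" for y
    unfolding dg_fun_def by (rule order_trans[OF sum_abs sum_mono]) (rule C)
  then show ?thesis by blast
qed

lemma dg_fun_sqint: "sqint (LI a b) (dg_fun M x v)"
proof -
  obtain C where "\<forall>y. \<bar>dg_fun M x v y\<bar> \<le> C" using dg_fun_bounded by blast
  then show ?thesis by (intro LI.sqint_bounded[where C = C] borel_LI dg_fun_borel) simp
qed

lemma cell_integral:
  assumes m: "is_mesh M x" and j: "j < M"
    and f: "\<And>y. y \<in> Omega \<Longrightarrow> y \<notin> {x j<..<x (Suc j)} \<Longrightarrow> f y = 0"
  shows "(LINT y|LI 0 1. f y) = (LINT y|LI (x j) (x (Suc j)). f y :: real)"
  unfolding set_integral_LI[symmetric] set_lebesgue_integral_def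
proof (rule Bochner_Integration.integral_cong[OF refl])
  fix y
  have "{x j<..<x (Suc j)} \<subseteq> Omega" using mesh_facts(6)[OF m, of j] mesh_facts(6)[OF m, of "Suc j"] j by auto
  then show "indicator Omega y *\<^sub>R f y = indicator {x j<..<x (Suc j)} y *\<^sub>R f y"
    using f[of y] by (cases "y \<in> {x j<..<x (Suc j)}"; cases "y \<in> Omega") auto
qed

text \<open>On each cell the space-time reconstruction is determined by its end point values, which are values of
  \<open>w\<close> on traces of the temporal reconstruction, and by moments of the latter. The representation is linear,
  so Lipschitz continuity in time carries over to the coefficients.\<close>

lemma space_time_coefficients_Lip:
  assumes m: "is_mesh M x" and q: "1 \<le> q"
    and w: "\<forall>p. \<exists>\<delta>>0. \<exists>L. L-lipschitz_on (ball p \<delta>) (\<lambda>(a, c). w a c)"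
    and st: "space_time_reconstruction M x q w T ut uts"
    and ut: "\<And>j i. j < M \<Longrightarrow> Lip T (\<lambda>t. coeff (ut t j) i)" "\<And>j t. \<lbrakk>j < M; t \<in> {0..T}\<rbrakk> \<Longrightarrow> degree (ut t j) \<le> q"
    and j: "j < M"
  shows "Lip T (\<lambda>t. coeff (uts t j) i)"
proof -
  note mf = mesh_facts[OF m]
  have evL: "Lip T (\<lambda>t. poly (ut t k) y)" if "k < M" for k y
  proof (rule Lip_cong)
    show "Lip T (\<lambda>t. \<Sum>i<Suc q. coeff (ut t k) i * y ^ i)"
      by (intro Lip_sum Lip_mult_const ut(1) that)
    show "poly (ut t k) y = (\<Sum>i<Suc q. coeff (ut t k) i * y ^ i)" if "t \<in> {0..T}" for t
      using ut(2)[OF \<open>k < M\<close> that] by (intro pspace_poly) (simp add: pspace_degree)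
  qed
  define wn where "wn = (\<lambda>k t. w (left_val M x (ut t) k) (right_val x (ut t) k))"
  have wL: "Lip T (wn k)" if "k < M" for k
    unfolding wn_def
  proof (rule Lip_compose2[OF w])
    show "Lip T (\<lambda>t. left_val M x (ut t) k)" using evL[of "M - 1" "x M"] evL[of "k - 1" "x k"] mf(1) that
      by (cases "k = 0") (simp_all add: left_val_def)
    show "Lip T (\<lambda>t. right_val x (ut t) k)" using evL that by (simp add: right_val_def)
  qed
  have S: "uts t \<in> DG M (q + 1)"
    "\<forall>\<psi>\<in>DG M (q - 1). (LINT y:Omega|lborel. (dg_fun M x (uts t) y - dg_fun M x (ut t) y) * dg_fun M x \<psi> y) = 0"
    "\<forall>k<M. left_val M x (uts t) k = wn k t \<and> right_val x (uts t) k = wn k t" if "t \<in> {0..T}" for t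
    using st that unfolding space_time_reconstruction_def wn_def by blast+
  define r where "r = (if Suc j = M then 0 else Suc j)"
  have rM: "r < M" using j mf(1) by (auto simp: r_def)
  have ends: "poly (uts t j) (x j) = wn j t" "poly (uts t j) (x (Suc j)) = wn r t" if "t \<in> {0..T}" for t
  proof -
    show "poly (uts t j) (x j) = wn j t" using S(3)[OF that] j by (simp add: right_val_def)
    have "left_val M x (uts t) r = wn r t" using S(3)[OF that] rM by blast
    moreover have "left_val M x (uts t) r = poly (uts t j) (x (Suc j))"
      using j by (auto simp: left_val_def r_def)
    ultimately show "poly (uts t j) (x (Suc j)) = wn r t" by simp
  qed
  obtain la lb G Q where Q: "\<forall>i<q. Q i \<in> pspace q" and rep: "\<forall>p. degree p \<le> Suc q \<longrightarrow> p = smult (poly p (x j)) la + smult (poly p (x (Suc j))) lb +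
       (\<Sum>i<q. smult ((LINT y|LI (x j) (x (Suc j)). poly p y * poly (Q i) y) - poly p (x j) * (LINT y|LI (x j) (x (Suc j)). poly la y * poly (Q i) y)
           - poly p (x (Suc j)) * (LINT y|LI (x j) (x (Suc j)). poly lb y * poly (Q i) y)) (G i))"
    using endpoint_moment_representation[OF mf(4)[OF j], of q] by blast
  have mom: "(LINT y|LI (x j) (x (Suc j)). poly (uts t j) y * poly (Q i) y) =
      (\<Sum>k<Suc q. coeff (ut t j) k * (LINT y|LI (x j) (x (Suc j)). y ^ k * poly (Q i) y))"
    if t: "t \<in> {0..T}" and i: "i < q" for t i
  proof -
    define \<psi> where "\<psi> = (\<lambda>k. if k = j then Q i else (0 :: real poly))"
    have "Q i \<in> pspace (Suc (q - 1))" using Q i by simp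
    then have "\<psi> \<in> DG M (q - 1)" using j by (auto simp: DG_def \<psi>_def pspace_degree)
    then have "0 = (LINT y|LI 0 1. (dg_fun M x (uts t) y - dg_fun M x (ut t) y) * dg_fun M x \<psi> y)"
      using S(2)[OF t] by (simp add: set_integral_LI)
    also have "\<dots> = (LINT y|LI (x j) (x (Suc j)). (dg_fun M x (uts t) y - dg_fun M x (ut t) y) * dg_fun M x \<psi> y)"
    proof (rule cell_integral[OF m j])
      fix y assume y: "y \<notin> {x j<..<x (Suc j)}"
      have "dg_fun M x \<psi> y = 0" unfolding dg_fun_def \<psi>_def
        by (rule sum.neutral) (use y in \<open>auto simp: indicator_def\<close>)
      then show "(dg_fun M x (uts t) y - dg_fun M x (ut t) y) * dg_fun M x \<psi> y = 0" by simp
    qed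
    also have "\<dots> = (LINT y|LI (x j) (x (Suc j)). poly (uts t j * Q i) y - poly (ut t j * Q i) y)"
      by (rule Bochner_Integration.integral_cong) (auto simp: dg_fun_cell[OF m j] \<psi>_def algebra_simps)
    also have "\<dots> = (LINT y|LI (x j) (x (Suc j)). poly (uts t j * Q i) y) - (LINT y|LI (x j) (x (Suc j)). poly (ut t j * Q i) y)"
      by (rule Bochner_Integration.integral_diff) (rule poly_LI)+
    finally have "(LINT y|LI (x j) (x (Suc j)). poly (uts t j) y * poly (Q i) y) = (LINT y|LI (x j) (x (Suc j)). poly (ut t j) y * poly (Q i) y)"
      by simp
    also have "\<dots> = (LINT y|LI (x j) (x (Suc j)). (\<Sum>k<Suc q. coeff (ut t j) k * (y ^ k * poly (Q i) y)))"
    proof (rule Bochner_Integration.integral_cong[OF refl])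
      fix y
      have "poly (ut t j) y = (\<Sum>k<Suc q. coeff (ut t j) k * y ^ k)"
        using ut(2)[OF j t] by (intro pspace_poly) (simp add: pspace_degree)
      then show "poly (ut t j) y * poly (Q i) y = (\<Sum>k<Suc q. coeff (ut t j) k * (y ^ k * poly (Q i) y))"
        by (simp only: sum_distrib_right mult.assoc)
    qed
    also have "\<dots> = (\<Sum>k<Suc q. LINT y|LI (x j) (x (Suc j)). coeff (ut t j) k * (y ^ k * poly (Q i) y))"
    proof (rule Bochner_Integration.integral_sum)
      fix k
      have "integrable (LI (x j) (x (Suc j))) (\<lambda>y. poly (monom 1 k * Q i) y)" by (rule poly_LI)
      then have "integrable (LI (x j) (x (Suc j))) (\<lambda>y. y ^ k * poly (Q i) y)" by (simp add: poly_monom)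
      then show "integrable (LI (x j) (x (Suc j))) (\<lambda>y. coeff (ut t j) k * (y ^ k * poly (Q i) y))"
        by (rule integrable_mult_right)
    qed
    finally show ?thesis by simp
  qed
  show ?thesis
  proof (rule Lip_cong)
    show "Lip T (\<lambda>t. wn j t * coeff la i + wn r t * coeff lb i +
       (\<Sum>l<q. ((\<Sum>k<Suc q. coeff (ut t j) k * (LINT y|LI (x j) (x (Suc j)). y ^ k * poly (Q l) y)) - wn j t * (LINT y|LI (x j) (x (Suc j)). poly la y * poly (Q l) y)
           - wn r t * (LINT y|LI (x j) (x (Suc j)). poly lb y * poly (Q l) y)) * coeff (G l) i))"
      by (intro Lip_add Lip_sum Lip_diff Lip_mult_const wL j rM ut(1))
    fix t assume t: "t \<in> {0..T}"
    have "degree (uts t j) \<le> Suc q" using S(1)[OF t] j by (simp add: DG_def)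
    then have "coeff (uts t j) i = coeff (smult (poly (uts t j) (x j)) la + smult (poly (uts t j) (x (Suc j))) lb +
       (\<Sum>i<q. smult ((LINT y|LI (x j) (x (Suc j)). poly (uts t j) y * poly (Q i) y) - poly (uts t j) (x j) * (LINT y|LI (x j) (x (Suc j)). poly la y * poly (Q i) y)
           - poly (uts t j) (x (Suc j)) * (LINT y|LI (x j) (x (Suc j)). poly lb y * poly (Q i) y)) (G i))) i"
      by (intro arg_cong[where f = "\<lambda>p. coeff p i"]) (rule rep[rule_format])
    also have "\<dots> = wn j t * coeff la i + wn r t * coeff lb i +
       (\<Sum>l<q. ((LINT y|LI (x j) (x (Suc j)). poly (uts t j) y * poly (Q l) y) - wn j t * (LINT y|LI (x j) (x (Suc j)). poly la y * poly (Q l) y)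
           - wn r t * (LINT y|LI (x j) (x (Suc j)). poly lb y * poly (Q l) y)) * coeff (G l) i)"
      by (simp add: coeff_sum ends[OF t])
    also have "\<dots> = wn j t * coeff la i + wn r t * coeff lb i +
       (\<Sum>l<q. ((\<Sum>k<Suc q. coeff (ut t j) k * (LINT y|LI (x j) (x (Suc j)). y ^ k * poly (Q l) y)) - wn j t * (LINT y|LI (x j) (x (Suc j)). poly la y * poly (Q l) y)
           - wn r t * (LINT y|LI (x j) (x (Suc j)). poly lb y * poly (Q l) y)) * coeff (G l) i)"
      by (intro arg_cong2[where f = "(+)"] refl sum.cong) (simp only: mom[OF t] lessThan_iff)
    finally show "coeff (uts t j) i = wn j t * coeff la i + wn r t * coeff lb i +
       (\<Sum>l<q. ((\<Sum>k<Suc q. coeff (ut t j) k * (LINT y|LI (x j) (x (Suc j)). y ^ k * poly (Q l) y)) - wn j t * (LINT y|LI (x j) (x (Suc j)). poly la y * poly (Q l) y)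
           - wn r t * (LINT y|LI (x j) (x (Suc j)). poly lb y * poly (Q l) y)) * coeff (G l) i)" .
  qed
qed

section \<open>Continuous piecewise polynomials with Lipschitz coefficients\<close>

definition smooth_approx ::
    "real \<Rightarrow> real \<Rightarrow> (real \<Rightarrow> real) \<Rightarrow> (nat \<Rightarrow> real \<Rightarrow> real) \<Rightarrow> (nat \<Rightarrow> real \<Rightarrow> real) \<Rightarrow> real \<Rightarrow> bool" where
  "smooth_approx T c g P p B \<longleftrightarrow> (\<forall>n. smooth (P n)) \<and> (\<forall>n x. (P n has_real_derivative p n x) (at x)) \<and>
    (\<forall>n. \<forall>t\<in>{0..T}. \<bar>P n t\<bar> \<le> B \<and> \<bar>p n t\<bar> \<le> B) \<and> (\<forall>n. P n 0 = c) \<and>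
    (AE t in LI 0 T. (\<lambda>n. p n t) \<longlonglongrightarrow> g t) \<and> (\<forall>t\<in>{0..T}. (\<lambda>n. P n t) \<longlonglongrightarrow> primitive 0 T c g t)"

text \<open>Finite sums of products of a primitive in time and a primitive in space are approximated factor by factor.\<close>

lemma separable_approximable:
  fixes I :: "'i set"
  assumes I: "finite I" and T: "0 < T"
    and a: "\<And>k. a k \<in> borel_measurable borel" "\<And>k. \<exists>C. \<forall>s. \<bar>a k s\<bar> \<le> C"
    and g: "\<And>k. g k \<in> borel_measurable borel" "\<And>k. \<exists>C. \<forall>s. \<bar>g k s\<bar> \<le> C"
    and m: "Cmeas T V" "Cmeas T Vx" "V 0 \<in> borel_measurable (LI 0 1)"
    and V: "AE y in LI 0 1. \<forall>t\<in>{0..T}. V t y = (\<Sum>k\<in>I. primitive 0 T (a0 k) (a k) t * primitive 0 1 (g0 k) (g k) y)"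
    and Vx: "AE y in LI 0 1. \<forall>t\<in>{0..T}. Vx t y = (\<Sum>k\<in>I. primitive 0 T (a0 k) (a k) t * g k y)"
  shows "approximable T V (\<lambda>t y. \<Sum>k\<in>I. a k t * primitive 0 1 (g0 k) (g k) y) Vx"
proof -
  have "\<exists>P p B. smooth_approx T (a0 k) (a k) P p B" for k
  proof -
    obtain C where "\<forall>s. \<bar>a k s\<bar> \<le> C" using a(2) by blast
    then show ?thesis unfolding smooth_approx_def by (rule primitive_smooth_approximation[OF a(1) _ less_imp_le[OF T]])
  qed
  then obtain P p B where P: "\<And>k. smooth_approx T (a0 k) (a k) (P k) (p k) (B k)" by metis
  have "\<exists>R r D. smooth_approx 1 (g0 k) (g k) R r D" for k
  proof -
    obtain C where "\<forall>s. \<bar>g k s\<bar> \<le> C" using g(2) by blast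
    then show ?thesis unfolding smooth_approx_def by (rule primitive_smooth_approximation[OF g(1) _ zero_le_one])
  qed
  then obtain R r D where R: "\<And>k. smooth_approx 1 (g0 k) (g k) (R k) (r k) (D k)" by metis
  define W where "W = (\<lambda>n t y. \<Sum>k\<in>I. P k n t * R k n y)"
  have Ps: "smooth (P k n)" "smooth (R k n)" for k n using P[of k] R[of k] by (simp_all add: smooth_approx_def)
  have W: "smooth2 (W n)" for n unfolding W_def by (rule smooth2_sum, rule smooth2_tensor) (rule Ps)+
  have DW: "Dt (W n) = (\<lambda>t y. \<Sum>k\<in>I. p k n t * R k n y)" for n
  proof (rule Dt_eqI)
    fix t y
    have "((\<lambda>s. P k n s * R k n y) has_real_derivative p k n t * R k n y) (at t)" for k
      using P[of k] unfolding smooth_approx_def by (intro DERIV_cmult_right) blast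
    then show "((\<lambda>s. W n s y) has_real_derivative (\<Sum>k\<in>I. p k n t * R k n y)) (at t)"
      unfolding W_def by (rule DERIV_sum)
  qed
  have XW: "Dx (W n) = (\<lambda>t y. \<Sum>k\<in>I. P k n t * r k n y)" for n
  proof (rule Dx_eqI)
    fix t y
    have "((\<lambda>y. P k n t * R k n y) has_real_derivative P k n t * r k n y) (at y)" for k
      using R[of k] unfolding smooth_approx_def by (intro DERIV_cmult) blast
    then show "(W n t has_real_derivative (\<Sum>k\<in>I. P k n t * r k n y)) (at y)"
      unfolding W_def by (rule DERIV_sum)
  qed
  have b: "\<bar>P k n t\<bar> \<le> B k" "\<bar>p k n t\<bar> \<le> B k" "\<bar>R k n y\<bar> \<le> D k" "\<bar>r k n y\<bar> \<le> D k"
    if "t \<in> {0..T}" "y \<in> {0..1}" for k n t y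
    using P[of k] R[of k] that unfolding smooth_approx_def by blast+
  have bsum: "\<bar>\<Sum>k\<in>I. f k * h k\<bar> \<le> (\<Sum>k\<in>I. B k * D k)" if "\<And>k. \<bar>f k\<bar> \<le> B k" "\<And>k. \<bar>h k\<bar> \<le> D k" for f h :: "'i \<Rightarrow> real"
  proof (rule order_trans[OF sum_abs sum_mono])
    fix k
    have "0 \<le> B k" using that(1)[of k] by linarith
    then show "\<bar>f k * h k\<bar> \<le> B k * D k" unfolding abs_mult using that by (intro mult_mono) auto
  qed
  have Rl: "(\<lambda>n. R k n y) \<longlonglongrightarrow> primitive 0 1 (g0 k) (g k) y" if "y \<in> {0..1}" for k y
    using R[of k] that by (simp add: smooth_approx_def)
  have Pl: "(\<lambda>n. P k n t) \<longlonglongrightarrow> primitive 0 T (a0 k) (a k) t" if "t \<in> {0..T}" for k t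
    using P[of k] that by (simp add: smooth_approx_def)
  have box: "AE z in LC T. fst z \<in> {0..T} \<and> snd z \<in> {0..1}" by (rule AE_LC_I) simp
  have pl: "AE z in LC T. \<forall>k\<in>I. (\<lambda>n. p k n (fst z)) \<longlonglongrightarrow> a k (fst z)"
  proof (rule AE_finite_allI[OF I])
    fix k show "AE z in LC T. (\<lambda>n. p k n (fst z)) \<longlonglongrightarrow> a k (fst z)"
      by (rule AE_LC_time) (use P[of k] in \<open>simp add: smooth_approx_def\<close>)
  qed
  have rl: "AE z in LC T. \<forall>k\<in>I. (\<lambda>n. r k n (snd z)) \<longlonglongrightarrow> g k (snd z)"
  proof (rule AE_finite_allI[OF I])
    fix k show "AE z in LC T. (\<lambda>n. r k n (snd z)) \<longlonglongrightarrow> g k (snd z)"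
      by (rule AE_LC_space) (use R[of k] in \<open>simp add: smooth_approx_def\<close>)
  qed
  have Vtm: "Cmeas T (\<lambda>t y. \<Sum>k\<in>I. a k t * primitive 0 1 (g0 k) (g k) y)"
  proof (intro borel_measurable_sum borel_measurable_times)
    fix k
    show "(\<lambda>z. a k (fst z)) \<in> borel_measurable (LC T)" by (rule Cmeas_time[OF borel_LI[OF a(1)]])
    obtain C where "\<forall>s. \<bar>g k s\<bar> \<le> C" using g(2) by blast
    then have "integrable (LI 0 1) (g k)" by (intro LI.integrable_const_bound[where B = C] borel_LI g(1)) simp
    then show "(\<lambda>z. primitive 0 1 (g0 k) (g k) (snd z)) \<in> borel_measurable (LC T)"
      by (intro Cmeas_space borel_LI borel_measurable_continuous_onI primitive_continuous)
  qed
  show ?thesis unfolding approximable_def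
  proof (intro conjI m Vtm exI[of _ W] exI[of _ "\<Sum>k\<in>I. B k * D k"] allI ballI W)
    fix n :: nat and t y :: real assume ty: "t \<in> {0..T}" "y \<in> {0..1}"
    show "\<bar>W n t y\<bar> \<le> (\<Sum>k\<in>I. B k * D k)" unfolding W_def by (rule bsum) (rule b[OF ty])+
    show "\<bar>Dt (W n) t y\<bar> \<le> (\<Sum>k\<in>I. B k * D k)" unfolding DW by (rule bsum) (rule b[OF ty])+
    show "\<bar>Dx (W n) t y\<bar> \<le> (\<Sum>k\<in>I. B k * D k)" unfolding XW by (rule bsum) (rule b[OF ty])+
  next
    show "AE z in LC T. (\<lambda>n. W n (fst z) (snd z)) \<longlonglongrightarrow> V (fst z) (snd z)"
      using box AE_LC_space[OF V, where T = T]
    proof eventually_elim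
      case (elim z)
      have "V (fst z) (snd z) = (\<Sum>k\<in>I. primitive 0 T (a0 k) (a k) (fst z) * primitive 0 1 (g0 k) (g k) (snd z))"
        using elim by blast
      then show ?case unfolding W_def using elim by (simp only:) (intro tendsto_sum tendsto_mult Pl Rl; simp)
    qed
    show "AE z in LC T. (\<lambda>n. Dt (W n) (fst z) (snd z)) \<longlonglongrightarrow> (\<Sum>k\<in>I. a k (fst z) * primitive 0 1 (g0 k) (g k) (snd z))"
      using box pl
    proof eventually_elim
      case (elim z)
      then show ?case unfolding DW by (intro tendsto_sum tendsto_mult Rl) simp_all
    qed
    show "AE z in LC T. (\<lambda>n. Dx (W n) (fst z) (snd z)) \<longlonglongrightarrow> Vx (fst z) (snd z)"
      using box rl AE_LC_space[OF Vx, where T = T]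
    proof eventually_elim
      case (elim z)
      have "Vx (fst z) (snd z) = (\<Sum>k\<in>I. primitive 0 T (a0 k) (a k) (fst z) * g k (snd z))"
        using elim by blast
      then show ?case unfolding XW using elim by (simp only:) (intro tendsto_sum tendsto_mult Pl; simp)
    qed
    have "AE y in LI 0 1. y \<in> {0..1}" by (rule AE_LI_I) simp
    then show "AE y in LI 0 1. (\<lambda>n. W n 0 y) \<longlonglongrightarrow> V 0 y"
      using V
    proof eventually_elim
      case (elim y)
      have "0 \<in> {0..T}" using T by simp
      then have "V 0 y = (\<Sum>k\<in>I. primitive 0 T (a0 k) (a k) 0 * primitive 0 1 (g0 k) (g k) y)"
        using elim by blast
      then show ?case unfolding W_def using elim \<open>0 \<in> {0..T}\<close> by (simp only:) (intro tendsto_sum tendsto_mult Pl Rl; simp)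
    qed
  qed
qed

lemma dg_fun_expand:
  assumes d: "\<And>j. j < M \<Longrightarrow> degree (v j) \<le> d"
  shows "dg_fun M x v y = (\<Sum>j<M. \<Sum>i\<le>d. coeff (v j) i * (indicator {x j<..<x (Suc j)} y * y ^ i))"
  unfolding dg_fun_def
proof (rule sum.cong[OF refl])
  fix j assume "j \<in> {..<M}"
  then have "poly (v j) y = (\<Sum>i<Suc d. coeff (v j) i * y ^ i)" using d by (intro pspace_poly) (simp add: pspace_degree)
  then show "indicator {x j<..<x (Suc j)} y * poly (v j) y = (\<Sum>i\<le>d. coeff (v j) i * (indicator {x j<..<x (Suc j)} y * y ^ i))"
    unfolding lessThan_Suc_atMost by (simp add: sum_distrib_left mult_ac)
qed

text \<open>A piecewise polynomial without jumps at the interior nodes is the primitive of its elementwise derivative;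
  the increments over the cells telescope.\<close>

lemma dg_fun_primitive_cell:
  assumes m: "is_mesh M x" and c: "\<And>k. \<lbrakk>0 < k; k < M\<rbrakk> \<Longrightarrow> poly (v (k - 1)) (x k) = poly (v k) (x k)"
    and J: "J < M" "Y \<in> {x J<..<x (Suc J)}"
  shows "dg_fun M x v Y = primitive 0 1 (poly (v 0) 0) (dg_fun M x (dg_deriv v)) Y"
proof -
  note mf = mesh_facts[OF m]
  define G where "G = dg_fun M x (dg_deriv v)"
  define P where "P = primitive 0 1 (poly (v 0) 0) G"
  have Gi: "integrable (LI 0 1) G" unfolding G_def by (rule LI.sqint_integrable[OF dg_fun_sqint])
  have inc: "P y - P (x j) = poly (v j) y - poly (v j) (x j)" if j: "j < M" and y: "x j \<le> y" "y \<le> x (Suc j)" for j y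
  proof -
    have "P y - P (x j) = (LINT s|LI 0 1. indicator {x j..<y} s * G s)"
      unfolding P_def by (rule primitive_diff[OF Gi y(1)])
    also have "\<dots> = (LINT s|LI (x j) y. poly (pderiv (v j)) s)"
      unfolding set_integral_LI[symmetric] set_lebesgue_integral_def
    proof (rule integral_cong_AE)
      show "(\<lambda>s. indicator Omega s *\<^sub>R (indicator {x j..<y} s * G s)) \<in> borel_measurable lborel"
        unfolding G_def using dg_fun_borel[of M x "dg_deriv v"] by measurable
      have "poly (pderiv (v j)) \<in> borel_measurable borel" by (intro borel_measurable_continuous_onI continuous_intros)
      then show "(\<lambda>s. indicator {x j<..<y} s *\<^sub>R poly (pderiv (v j)) s) \<in> borel_measurable lborel" by measurable
      show "AE s in lborel. indicator Omega s *\<^sub>R (indicator {x j..<y} s * G s) = indicator {x j<..<y} s *\<^sub>R poly (pderiv (v j)) s"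
        using AE_lborel_singleton[of "x j"]
      proof eventually_elim
        case (elim s)
        show ?case
        proof (cases "s \<in> {x j<..<y}")
          case True
          then have "s \<in> {x j<..<x (Suc j)}" "s \<in> Omega" using y mf(6)[of j] mf(6)[of "Suc j"] j by auto
          then show ?thesis using True dg_fun_cell[OF m j, of s "dg_deriv v"] by (simp add: G_def dg_deriv_def)
        next
          case False
          then have "s \<notin> {x j..<y}" using elim by auto
          then show ?thesis using False by simp
        qed
      qed
    qed
    also have "\<dots> = poly (v j) y - poly (v j) (x j)"
      by (rule FTC_LI(2)[OF poly_DERIV poly_isCont y(1)])
    finally show ?thesis .
  qed
  have node: "j < M \<Longrightarrow> P (x j) = poly (v j) (x j)" for j
  proof (induction j)
    case 0 then show ?case using mf(2) by (simp add: P_def primitive_left)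
  next
    case (Suc j)
    then have "P (x (Suc j)) = poly (v j) (x (Suc j))" using inc[of j "x (Suc j)"] mf(4)[of j] by simp
    then show ?case using c[of "Suc j"] Suc.prems by simp
  qed
  have "dg_fun M x v Y = P Y"
    using inc[OF J(1), of Y] node[OF J(1)] dg_fun_cell[OF m J] J(2) by simp
  then show ?thesis by (simp add: P_def G_def)
qed

lemma dg_fun_primitive:
  assumes m: "is_mesh M x" and c: "\<And>k. \<lbrakk>0 < k; k < M\<rbrakk> \<Longrightarrow> poly (v (k - 1)) (x k) = poly (v k) (x k)"
  shows "AE y in LI 0 1. dg_fun M x v y = primitive 0 1 (poly (v 0) 0) (dg_fun M x (dg_deriv v)) y"
  using AE_in_cell[OF m]
proof eventually_elim
  case (elim y)
  then obtain j where j: "j < M" "y \<in> {x j<..<x (Suc j)}" by blast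
  show ?case by (rule dg_fun_primitive_cell[OF m c j])
qed

lemma dg_fun_weak_deriv:
  assumes m: "is_mesh M x" and c: "\<And>k. \<lbrakk>0 < k; k < M\<rbrakk> \<Longrightarrow> poly (v (k - 1)) (x k) = poly (v k) (x k)"
  shows "has_weak_deriv 0 1 (dg_fun M x v) (dg_fun M x (dg_deriv v))"
proof -
  have i: "integrable (LI 0 1) (dg_fun M x v)" "integrable (LI 0 1) (dg_fun M x (dg_deriv v))"
    by (rule LI.sqint_integrable[OF dg_fun_sqint])+
  have w: "has_weak_deriv 0 1 (primitive 0 1 (poly (v 0) 0) (dg_fun M x (dg_deriv v))) (dg_fun M x (dg_deriv v))"
    by (rule primitive_weak_deriv[OF i(2)]) simp
  have ae: "AE y in LI 0 1. dg_fun M x v y = primitive 0 1 (poly (v 0) 0) (dg_fun M x (dg_deriv v)) y"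
    by (rule dg_fun_primitive[OF m c])
  show ?thesis unfolding has_weak_deriv_LI
  proof (intro conjI allI impI integrable_L1_loc i)
    fix \<psi> assume \<psi>: "test1 Omega \<psi>"
    have "(LINT y|LI 0 1. dg_fun M x v y * deriv \<psi> y) =
      (LINT y|LI 0 1. primitive 0 1 (poly (v 0) 0) (dg_fun M x (dg_deriv v)) y * deriv \<psi> y)"
    proof (rule integral_cong_AE)
      have s: "deriv \<psi> \<in> borel_measurable (LI 0 1)" by (rule borel_LI[OF borel_measurable_continuous_onI[OF smooth_continuous[OF smooth_deriv[OF test1_smooth[OF \<psi>]]]]])
      show "(\<lambda>y. dg_fun M x v y * deriv \<psi> y) \<in> borel_measurable (LI 0 1)"
        by (rule borel_measurable_times[OF borel_LI[OF dg_fun_borel] s])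
      show "(\<lambda>y. primitive 0 1 (poly (v 0) 0) (dg_fun M x (dg_deriv v)) y * deriv \<psi> y) \<in> borel_measurable (LI 0 1)"
        by (rule borel_measurable_times[OF borel_LI[OF borel_measurable_continuous_onI[OF primitive_continuous[OF i(2)]]] s])
      show "AE y in LI 0 1. dg_fun M x v y * deriv \<psi> y = primitive 0 1 (poly (v 0) 0) (dg_fun M x (dg_deriv v)) y * deriv \<psi> y"
        using ae by eventually_elim simp
    qed
    then show "(LINT y|LI 0 1. dg_fun M x v y * deriv \<psi> y) = - (LINT y|LI 0 1. dg_fun M x (dg_deriv v) y * \<psi> y)"
      using w \<psi> by (simp add: has_weak_deriv_LI)
  qed
qed

lemma dg_fun_Cmeas:
  assumes c: "\<And>j i. j < M \<Longrightarrow> Lip T (\<lambda>t. coeff (v t j) i)"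
    and d: "\<And>j t. \<lbrakk>j < M; t \<in> {0..T}\<rbrakk> \<Longrightarrow> degree (v t j) \<le> d"
  shows "Cmeas T (\<lambda>t. dg_fun M x (v t))"
proof -
  have "(\<lambda>z. \<Sum>j<M. \<Sum>i\<le>d. coeff (v (fst z) j) i * (indicator {x j<..<x (Suc j)} (snd z) * snd z ^ i)) \<in> borel_measurable (LC T)"
  proof (intro borel_measurable_sum borel_measurable_times borel_measurable_power snd_LC)
    fix j i assume "j \<in> {..<M}"
    then show "(\<lambda>z. coeff (v (fst z) j) i) \<in> borel_measurable (LC T)" by (intro Cmeas_time Lip_measurable c) simp
    show "(\<lambda>z. indicator {x j<..<x (Suc j)} (snd z) :: real) \<in> borel_measurable (LC T)"
      by (rule measurable_compose[OF snd_LC]) simp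
  qed
  moreover have "dg_fun M x (v (fst z)) (snd z) = (\<Sum>j<M. \<Sum>i\<le>d. coeff (v (fst z) j) i * (indicator {x j<..<x (Suc j)} (snd z) * snd z ^ i))"
    if "z \<in> space (LC T)" for z
    by (rule dg_fun_expand) (use that d in \<open>auto simp: space_LC\<close>)
  ultimately show ?thesis using measurable_cong[of "LC T" "\<lambda>z. dg_fun M x (v (fst z)) (snd z)"] by (simp only:)
qed

text \<open>With the monomials on the cells as space factors, the derivative in space is a separable sum with Lipschitz
  coefficients. Integration in space, together with the value at \<open>0\<close>, gives the same form for the function itself;
  the index \<open>None\<close> stands for that boundary value.\<close>

lemma dg_fun_approximable:
  assumes m: "is_mesh M x" and T: "0 < T"
    and c: "\<And>j i. j < M \<Longrightarrow> Lip T (\<lambda>t. coeff (v t j) i)"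
    and d: "\<And>j t. \<lbrakk>j < M; t \<in> {0..T}\<rbrakk> \<Longrightarrow> degree (v t j) \<le> d"
    and cont: "\<And>k t. \<lbrakk>0 < k; k < M; t \<in> {0..T}\<rbrakk> \<Longrightarrow> poly (v t (k - 1)) (x k) = poly (v t k) (x k)"
  shows "\<exists>Vt. approximable T (\<lambda>t. dg_fun M x (v t)) Vt (\<lambda>t. dg_fun M x (dg_deriv (v t)))"
proof -
  note mf = mesh_facts[OF m]
  have c': "Lip T (\<lambda>t. coeff (dg_deriv (v t) j) i)" if "j < M" for j i
    unfolding dg_deriv_def coeff_pderiv by (rule Lip_cmult[OF c[OF that]])
  have d': "degree (dg_deriv (v t) j) \<le> d" if "j < M" "t \<in> {0..T}" for j t
    using d[OF that] by (simp add: dg_deriv_def degree_pderiv)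
  define al where "al = (\<lambda>k t. case k of None \<Rightarrow> coeff (v t 0) 0 | Some (j, i) \<Rightarrow> if j < M then coeff (dg_deriv (v t) j) i else 0)"
  have alL: "Lip T (al k)" for k
  proof (cases k)
    case None
    then show ?thesis using c[OF mf(1), of 0] by (simp add: al_def)
  next
    case (Some ji)
    obtain j i where ji: "ji = (j, i)" by force
    show ?thesis using c'[of j i] Lip_const[of T 0] by (cases "j < M") (simp_all add: al_def Some ji)
  qed
  define g where "g = (\<lambda>k (s :: real). case k of None \<Rightarrow> 0 | Some (j, i) \<Rightarrow> if j < M then indicator {x j<..<x (Suc j)} s * s ^ i else (0 :: real))"
  define g0 where "g0 = (\<lambda>k :: (nat \<times> nat) option. if k = None then 1 else 0 :: real)"
  have gm: "g k \<in> borel_measurable borel" for k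
    unfolding g_def by (cases k) (auto split: prod.split)
  have gb: "\<bar>g k s\<bar> \<le> 1" for k s
  proof (cases k)
    case (Some ji)
    obtain j i where ji: "ji = (j, i)" by force
    show ?thesis
    proof (cases "j < M \<and> s \<in> {x j<..<x (Suc j)}")
      case True
      then have "0 \<le> s" "s \<le> 1" using mf(6)[of j] mf(6)[of "Suc j"] by auto
      then show ?thesis using True by (simp add: g_def Some ji power_le_one)
    qed (auto simp: g_def Some ji)
  qed (simp add: g_def)
  have gi: "integrable (LI 0 1) (g k)" for k
    by (rule LI.integrable_const_bound[where B = 1]) (simp_all add: gb borel_LI gm)
  have "\<exists>a C. a \<in> borel_measurable borel \<and> (\<forall>s. \<bar>a s\<bar> \<le> C) \<and> (\<forall>t\<in>{0..T}. al k t = primitive 0 T (al k 0) a t)" for k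
  proof -
    obtain L where "L-lipschitz_on {0..T} (al k)" using alL[of k] unfolding Lip_def by blast
    then show ?thesis by (rule lipschitz_primitive[OF _ less_imp_le[OF T]])
  qed
  then obtain a C where a: "\<And>k. a k \<in> borel_measurable borel" "\<And>k. \<forall>s. \<bar>a k s\<bar> \<le> C k"
    "\<And>k. \<forall>t\<in>{0..T}. al k t = primitive 0 T (al k 0) (a k) t" by metis
  define I where "I = insert None (Some ` ({..<M} \<times> {..d}))"
  have sumI: "(\<Sum>k\<in>I. f k) = f None + (\<Sum>j<M. \<Sum>i\<le>d. f (Some (j, i)))" for f :: "(nat \<times> nat) option \<Rightarrow> real"
  proof -
    have "(\<Sum>k\<in>I. f k) = f None + (\<Sum>k\<in>Some ` ({..<M} \<times> {..d}). f k)"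
      unfolding I_def by (rule sum.insert) auto
    also have "(\<Sum>k\<in>Some ` ({..<M} \<times> {..d}). f k) = (\<Sum>k\<in>{..<M} \<times> {..d}. f (Some k))"
      by (subst sum.reindex) auto
    also have "\<dots> = (\<Sum>j<M. \<Sum>i\<le>d. f (Some (j, i)))" by (simp add: sum.cartesian_product)
    finally show ?thesis .
  qed
  have Vx: "dg_fun M x (dg_deriv (v t)) y = (\<Sum>k\<in>I. al k t * g k y)" if "t \<in> {0..T}" for t y
  proof -
    have "dg_fun M x (dg_deriv (v t)) y = (\<Sum>j<M. \<Sum>i\<le>d. coeff (dg_deriv (v t) j) i * (indicator {x j<..<x (Suc j)} y * y ^ i))"
      by (rule dg_fun_expand) (rule d'[OF _ that])
    also have "\<dots> = (\<Sum>j<M. \<Sum>i\<le>d. al (Some (j, i)) t * g (Some (j, i)) y)"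
      by (intro sum.cong refl) (simp add: al_def g_def)
    finally show ?thesis unfolding sumI by (simp add: g_def)
  qed
  have V: "primitive 0 1 (poly (v t 0) 0) (dg_fun M x (dg_deriv (v t))) y = (\<Sum>k\<in>I. al k t * primitive 0 1 (g0 k) (g k) y)"
    if t: "t \<in> {0..T}" for t y
  proof -
    have "(\<Sum>k\<in>I. al k t * primitive 0 1 (g0 k) (g k) y) = (\<Sum>k\<in>I. al k t * g0 k) + (\<Sum>k\<in>I. al k t * (LINT s|LI 0 1. (if s < y then g k s else 0)))"
      by (simp add: primitive_def distrib_left sum.distrib)
    also have "(\<Sum>k\<in>I. al k t * g0 k) = poly (v t 0) 0" unfolding sumI by (simp add: g0_def al_def poly_0_coeff_0)
    also have "(\<Sum>k\<in>I. al k t * (LINT s|LI 0 1. (if s < y then g k s else 0))) = (LINT s|LI 0 1. (\<Sum>k\<in>I. al k t * (if s < y then g k s else 0)))"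
      by (subst Bochner_Integration.integral_sum) (auto intro: cut_integrable gi)
    also have "\<dots> = (LINT s|LI 0 1. (if s < y then dg_fun M x (dg_deriv (v t)) s else 0))"
      by (rule Bochner_Integration.integral_cong) (auto simp: Vx[OF t])
    finally show ?thesis by (simp add: primitive_def)
  qed
  have pa: "primitive 0 T (al k 0) (a k) t = al k t" if "t \<in> {0..T}" for k t
    by (rule sym, rule bspec[OF a(3) that])
  have ap: "approximable T (\<lambda>t. dg_fun M x (v t)) (\<lambda>t y. \<Sum>k\<in>I. a k t * primitive 0 1 (g0 k) (g k) y) (\<lambda>t. dg_fun M x (dg_deriv (v t)))"
  proof (rule separable_approximable[where ?a0.0 = "\<lambda>k. al k 0"])
    show "finite I" by (simp add: I_def)
    show "0 < T" by (rule T)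
    show "a k \<in> borel_measurable borel" "g k \<in> borel_measurable borel" for k by (rule a gm)+
    show "\<exists>C. \<forall>s. \<bar>a k s\<bar> \<le> C" "\<exists>C. \<forall>s. \<bar>g k s\<bar> \<le> C" for k using a(2) gb by blast+
    show "Cmeas T (\<lambda>t. dg_fun M x (v t))" by (rule dg_fun_Cmeas[OF c d])
    show "Cmeas T (\<lambda>t. dg_fun M x (dg_deriv (v t)))" by (rule dg_fun_Cmeas[OF c' d'])
    show "dg_fun M x (v 0) \<in> borel_measurable (LI 0 1)" by (rule borel_LI[OF dg_fun_borel])
    show "AE y in LI 0 1. \<forall>t\<in>{0..T}. dg_fun M x (dg_deriv (v t)) y = (\<Sum>k\<in>I. primitive 0 T (al k 0) (a k) t * g k y)"
      by (rule AE_I2) (simp add: Vx pa)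
    show "AE y in LI 0 1. \<forall>t\<in>{0..T}. dg_fun M x (v t) y = (\<Sum>k\<in>I. primitive 0 T (al k 0) (a k) t * primitive 0 1 (g0 k) (g k) y)"
      using AE_in_cell[OF m]
    proof eventually_elim
      case (elim y)
      then obtain j where j: "j < M" "y \<in> {x j<..<x (Suc j)}" by blast
      show ?case
      proof
        fix t assume t: "t \<in> {0..T}"
        have "dg_fun M x (v t) y = primitive 0 1 (poly (v t 0) 0) (dg_fun M x (dg_deriv (v t))) y"
          by (rule dg_fun_primitive_cell[OF m cont[OF _ _ t] j])
        then show "dg_fun M x (v t) y = (\<Sum>k\<in>I. primitive 0 T (al k 0) (a k) t * primitive 0 1 (g0 k) (g k) y)"
          using V[OF t] t by (simp only: pa)
      qed
    qed
  qed
  then show ?thesis by blast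
qed

lemma weakly_continuous_minus_dg:
  assumes u: "weakly_continuous_L2 T u"
    and c: "\<And>j i. j < M \<Longrightarrow> Lip T (\<lambda>t. coeff (v t j) i)"
    and d: "\<And>j t. \<lbrakk>j < M; t \<in> {0..T}\<rbrakk> \<Longrightarrow> degree (v t j) \<le> d"
  shows "weakly_continuous_L2 T (\<lambda>t y. u t y - dg_fun M x (v t) y)"
  unfolding weakly_continuous_L2_def
proof (intro conjI ballI allI impI)
  have uq: "sqint (LI 0 1) (u t)" if "t \<in> {0..T}" for t
    using u that by (auto simp: weakly_continuous_L2_def L2_on_LI sqint_def)
  show "L2_on Omega (\<lambda>y. u t y - dg_fun M x (v t) y)" if "t \<in> {0..T}" for t
    using sqint_diff[OF uq[OF that] dg_fun_sqint[of 0 1 M x "v t"]] by (simp add: L2_on_LI sqint_def)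
  fix \<psi> assume \<psi>: "L2_on Omega \<psi>"
  then have \<psi>q: "sqint (LI 0 1) \<psi>" by (simp add: L2_on_LI sqint_def)
  define k where "k = (\<lambda>j i. LINT y|LI 0 1. (indicator {x j<..<x (Suc j)} y * y ^ i) * \<psi> y)"
  have ki: "integrable (LI 0 1) (\<lambda>y. (indicator {x j<..<x (Suc j)} y * y ^ i) * \<psi> y)" for j i
  proof (rule integrable_bounded_mult[OF LI.sqint_integrable[OF \<psi>q], where C = 1])
    show "(\<lambda>y. indicator {x j<..<x (Suc j)} y * y ^ i :: real) \<in> borel_measurable (LI 0 1)" by (rule borel_LI) simp
    show "AE y in LI 0 1. \<bar>indicator {x j<..<x (Suc j)} y * y ^ i :: real\<bar> \<le> 1"
      by (rule AE_LI_I) (simp add: indicator_def power_le_one)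
  qed
  have e: "(LINT y:Omega|lborel. ((u t y - dg_fun M x (v t) y) * \<psi> y)) =
      (LINT y:Omega|lborel. u t y * \<psi> y) - (\<Sum>j<M. \<Sum>i\<le>d. coeff (v t j) i * k j i)" if t: "t \<in> {0..T}" for t
  proof -
    have "(LINT y|LI 0 1. dg_fun M x (v t) y * \<psi> y) =
      (LINT y|LI 0 1. (\<Sum>j<M. \<Sum>i\<le>d. coeff (v t j) i * ((indicator {x j<..<x (Suc j)} y * y ^ i) * \<psi> y)))"
    proof (rule Bochner_Integration.integral_cong[OF refl])
      fix y
      have "dg_fun M x (v t) y = (\<Sum>j<M. \<Sum>i\<le>d. coeff (v t j) i * (indicator {x j<..<x (Suc j)} y * y ^ i))"
        by (rule dg_fun_expand) (rule d[OF _ t])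
      then show "dg_fun M x (v t) y * \<psi> y = (\<Sum>j<M. \<Sum>i\<le>d. coeff (v t j) i * ((indicator {x j<..<x (Suc j)} y * y ^ i) * \<psi> y))"
        by (simp only: sum_distrib_right mult.assoc)
    qed
    also have "\<dots> = (\<Sum>j<M. \<Sum>i\<le>d. coeff (v t j) i * k j i)"
      unfolding k_def using ki by (simp add: Bochner_Integration.integral_sum)
    finally show ?thesis
      using sqint_mult[OF uq[OF t] \<psi>q] sqint_mult[OF dg_fun_sqint[of 0 1 M x "v t"] \<psi>q]
      by (simp add: set_integral_LI left_diff_distrib)
  qed
  have "continuous_on {0..T} (\<lambda>t. (LINT y:Omega|lborel. u t y * \<psi> y) - (\<Sum>j<M. \<Sum>i\<le>d. coeff (v t j) i * k j i))"
  proof (intro continuous_on_diff continuous_on_sum continuous_on_mult continuous_on_const)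
    show "continuous_on {0..T} (\<lambda>t. LINT y:Omega|lborel. u t y * \<psi> y)"
      using u \<psi> unfolding weakly_continuous_L2_def by blast
    show "continuous_on {0..T} (\<lambda>t. coeff (v t j) i)" if "j \<in> {..<M}" for j i
      by (rule Lip_continuous[OF c]) (use that in simp)
  qed
  then show "continuous_on {0..T} (\<lambda>t. LINT y:Omega|lborel. (u t y - dg_fun M x (v t) y) * \<psi> y)"
    by (rule continuous_on_eq) (simp add: e)
qed

section \<open>The temporal reconstruction\<close>

lemma time_step_exists:
  fixes tt :: "nat \<Rightarrow> real"
  assumes tt: "tt 0 = 0" "\<forall>n<N. tt n < tt (Suc n)" and t: "0 \<le> t" "t \<le> tt N" and N: "0 < N"
  shows "\<exists>n<N. t \<in> {tt n..tt (Suc n)}"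
proof -
  have "\<lbrakk>0 < m; m \<le> N; t \<le> tt m\<rbrakk> \<Longrightarrow> \<exists>n<N. t \<in> {tt n..tt (Suc n)}" for m
  proof (induction m)
    case (Suc m)
    show ?case
    proof (cases "m = 0 \<or> tt m \<le> t")
      case True
      then have "tt m \<le> t" using tt(1) t(1) by auto
      then show ?thesis using Suc.prems by (intro exI[of _ m]) simp
    next
      case False
      then have "0 < m" "m \<le> N" "t \<le> tt m" using Suc.prems False by auto
      then show ?thesis by (rule Suc.IH)
    qed
  qed simp
  then show ?thesis using N t(2) by blast
qed

lemma temporal_reconstruction_coefficients:
  assumes tr: "temporal_reconstruction M x q rhs N tt uh ut"
    and tt: "tt 0 = 0" "\<forall>n<N. tt n < tt (Suc n)" and N: "0 < N"
  shows "Lip (tt N) (\<lambda>t. coeff (ut t j) i)" "\<lbrakk>j < M; t \<in> {0..tt N}\<rbrakk> \<Longrightarrow> degree (ut t j) \<le> q"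
proof -
  have c: "\<exists>c :: nat \<Rightarrow> dg. (\<forall>m\<le>3. c m \<in> DG M q) \<and>
           (\<forall>t\<in>{tt n..tt (Suc n)}. \<forall>j. ut t j = (\<Sum>m\<le>3. smult (t ^ m) (c m j)))" if "n < N" for n
    using tr that unfolding temporal_reconstruction_def by blast
  show "Lip (tt N) (\<lambda>t. coeff (ut t j) i)"
  proof (rule piecewise_poly_Lip[OF tt], intro allI impI)
    fix n assume "n < N"
    then obtain c :: "nat \<Rightarrow> dg" where c: "\<forall>t\<in>{tt n..tt (Suc n)}. \<forall>j. ut t j = (\<Sum>m\<le>3. smult (t ^ m) (c m j))" using c by blast
    show "\<exists>p. \<forall>t\<in>{tt n..tt (Suc n)}. coeff (ut t j) i = poly p t"
    proof (intro exI ballI)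
      fix t assume "t \<in> {tt n..tt (Suc n)}"
      then have "ut t j = (\<Sum>m\<le>3. smult (t ^ m) (c m j))" using c by blast
      then show "coeff (ut t j) i = poly (\<Sum>m\<le>3. monom (coeff (c m j) i) m) t"
        by (simp only: coeff_sum coeff_smult poly_sum poly_monom mult.commute)
    qed
  qed
  show "degree (ut t j) \<le> q" if "j < M" "t \<in> {0..tt N}"
  proof -
    obtain n where n: "n < N" "t \<in> {tt n..tt (Suc n)}" using time_step_exists[OF tt _ _ N, of t] \<open>t \<in> {0..tt N}\<close> by auto
    then obtain c :: "nat \<Rightarrow> dg" where c: "\<forall>m\<le>3. c m \<in> DG M q" "ut t j = (\<Sum>m\<le>3. smult (t ^ m) (c m j))" using c by blast
    have "degree (\<Sum>m\<le>3. smult (t ^ m) (c m j)) \<le> q"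
      by (rule degree_sum_le) (use c(1) \<open>j < M\<close> in \<open>auto simp: DG_def intro: order_trans[OF degree_smult_le]\<close>)
    then show ?thesis using c(2) by simp
  qed
qed

section \<open>Norms\<close>

lemma ennsqrt_sq: "(ennsqrt a)\<^sup>2 = a"
proof (cases a)
  case (real r)
  then show ?thesis by (simp add: ennsqrt_def ennreal_power)
qed (simp add: ennsqrt_def power2_eq_square ennreal_mult_eq_top_iff)

lemma L2_norm_sq: "(L2_norm f)\<^sup>2 = (\<integral>\<^sup>+x. ennreal ((f x)\<^sup>2) \<partial>LI 0 1)"
  by (simp add: L2_norm_def ennsqrt_sq nn_integral_LI)

lemma nn_integral_sq: "sqint M f \<Longrightarrow> (\<integral>\<^sup>+x. ennreal ((f x)\<^sup>2) \<partial>M) = ennreal (LINT x|M. (f x)\<^sup>2)"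
  unfolding sqint_def by (intro nn_integral_eq_integral) auto

lemma L2_norm_sqint: "sqint (LI 0 1) f \<Longrightarrow> L2_norm f = ennreal (sqrt (LINT x|LI 0 1. (f x)\<^sup>2))"
  by (simp add: L2_norm_def nn_integral_LI nn_integral_sq ennsqrt_def)

lemma L2_norm_sq_sqint: "sqint (LI 0 1) f \<Longrightarrow> (L2_norm f)\<^sup>2 = ennreal (LINT x|LI 0 1. (f x)\<^sup>2)"
  by (simp add: L2_norm_sq nn_integral_sq)

lemma sum_square_le: "(a + c)\<^sup>2 \<le> 2 * a\<^sup>2 + 2 * c\<^sup>2" for a c :: real
  using sum_squares_bound[of a c] by (simp add: power2_sum)

lemma L2_norm_triangle_sq:
  assumes "sqint (LI 0 1) f" "sqint (LI 0 1) g" "sqint (LI 0 1) h"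
  shows "(L2_norm (\<lambda>x. f x - h x))\<^sup>2 \<le> 2 * (L2_norm (\<lambda>x. f x - g x))\<^sup>2 + 2 * (L2_norm (\<lambda>x. g x - h x))\<^sup>2"
proof -
  have i: "sqint (LI 0 1) (\<lambda>x. f x - g x)" "sqint (LI 0 1) (\<lambda>x. g x - h x)" "sqint (LI 0 1) (\<lambda>x. f x - h x)"
    using assms by (auto intro: sqint_diff)
  have "(LINT x|LI 0 1. (f x - h x)\<^sup>2) \<le> (LINT x|LI 0 1. 2 * (f x - g x)\<^sup>2 + 2 * (g x - h x)\<^sup>2)"
  proof (rule integral_mono)
    show "(f x - h x)\<^sup>2 \<le> 2 * (f x - g x)\<^sup>2 + 2 * (g x - h x)\<^sup>2" for x
      using sum_square_le[of "f x - g x" "g x - h x"] by simp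
  qed (use i in \<open>auto simp: sqint_def\<close>)
  also have "\<dots> = 2 * (LINT x|LI 0 1. (f x - g x)\<^sup>2) + 2 * (LINT x|LI 0 1. (g x - h x)\<^sup>2)"
    using i by (simp add: sqint_def)
  finally have "ennreal (LINT x|LI 0 1. (f x - h x)\<^sup>2) \<le> ennreal (2 * (LINT x|LI 0 1. (f x - g x)\<^sup>2) + 2 * (LINT x|LI 0 1. (g x - h x)\<^sup>2))"
    by (rule ennreal_leI)
  then show ?thesis unfolding L2_norm_sq_sqint[OF i(1)] L2_norm_sq_sqint[OF i(2)] L2_norm_sq_sqint[OF i(3)]
    by (simp add: ennreal_plus ennreal_mult)
qed

text \<open>
  The extended integral of a function without measurability is a supremum over simple minorants, so
  it is only superadditive; subadditivity survives if one summand is measurable.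
\<close>

lemma nn_integral_add_mult_le:
  fixes c :: real
  assumes a: "a \<in> borel_measurable M" "\<And>x. a x \<noteq> \<infinity>" and c: "0 < c" and le: "AE x in M. f x \<le> a x + ennreal c * g x"
  shows "integral\<^sup>N M f \<le> integral\<^sup>N M a + ennreal c * integral\<^sup>N M g"
proof -
  define F where "F = (\<lambda>x. a x + ennreal c * g x)"
  have "integral\<^sup>N M f \<le> integral\<^sup>N M F" unfolding F_def by (rule nn_integral_mono_AE[OF le])
  also have "integral\<^sup>N M F \<le> integral\<^sup>N M a + ennreal c * integral\<^sup>N M g"
    unfolding nn_integral_def[of M F]
  proof (rule SUP_least)
    fix s assume "s \<in> {s. simple_function M s \<and> s \<le> F}"
    then have s: "simple_function M s" "\<And>x. s x \<le> F x" by (auto simp: le_fun_def)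
    have sm: "s \<in> borel_measurable M" using s(1) by (rule borel_measurable_simple_function)
    define d where "d = (\<lambda>x. ennreal (1 / c) * (s x - a x))"
    have dm: "d \<in> borel_measurable M" unfolding d_def using sm a(1) by measurable
    have cc: "ennreal c * (ennreal (1 / c) * z) = z" for z
      using c by (simp add: mult.assoc[symmetric] ennreal_mult[symmetric])
    have cc': "ennreal (1 / c) * (ennreal c * z) = z" for z
      using c by (simp add: mult.assoc[symmetric] ennreal_mult[symmetric])
    have "d x \<le> g x" for x
    proof -
      have "s x - a x \<le> ennreal c * g x"
        using s(2)[of x] a(2)[of x] unfolding F_def by (auto simp: ennreal_minus_le_iff)
      then have "d x \<le> ennreal (1 / c) * (ennreal c * g x)" unfolding d_def by (rule mult_left_mono) simp
      then show ?thesis unfolding cc' .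
    qed
    then have dg: "integral\<^sup>N M d \<le> integral\<^sup>N M g" by (intro nn_integral_mono) simp
    have "s x \<le> a x + ennreal c * d x" for x
      unfolding d_def cc by (metis ennreal_minus_le_iff order_refl a(2))
    then have "integral\<^sup>N M s \<le> (\<integral>\<^sup>+x. a x + ennreal c * d x \<partial>M)" by (intro nn_integral_mono) simp
    also have "\<dots> = integral\<^sup>N M a + ennreal c * integral\<^sup>N M d"
      using a(1) dm by (simp add: nn_integral_add nn_integral_cmult)
    also have "\<dots> \<le> integral\<^sup>N M a + ennreal c * integral\<^sup>N M g" using dg by (intro add_left_mono mult_left_mono) auto
    finally show "integral\<^sup>S M s \<le> integral\<^sup>N M a + ennreal c * integral\<^sup>N M g"
      using nn_integral_eq_simple_integral[OF s(1)] by simp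
  qed
  finally show ?thesis .
qed

text \<open>For a bound by a function \<open>k\<close> that may fail to be measurable; this is the situation of the dual norm of
  the second residual as a function of time.\<close>

lemma integral_le_nn_integral_bound:
  fixes G :: "'a \<Rightarrow> real"
  assumes G: "integrable M G" and k: "AE t in M. ennreal (G t) \<le> k t" and K: "integral\<^sup>N M k \<le> ennreal K" "0 \<le> K"
  shows "integral\<^sup>L M G \<le> K"
proof -
  have "(\<integral>\<^sup>+t. ennreal (G t) \<partial>M) \<le> ennreal K" using nn_integral_mono_AE[OF k] K(1) by (rule order_trans)
  then have "enn2real (\<integral>\<^sup>+t. ennreal (G t) \<partial>M) \<le> K" using K(2) by (metis enn2real_leI)
  moreover have "integral\<^sup>L M G \<le> enn2real (\<integral>\<^sup>+t. ennreal (G t) \<partial>M)"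
    using real_lebesgue_integral_def[OF G] enn2real_nonneg[of "\<integral>\<^sup>+t. ennreal (- G t) \<partial>M"] by linarith
  ultimately show ?thesis by linarith
qed

section \<open>The dual norm of the residual\<close>

lemma L1_loc_measurable:
  assumes "L1_loc {a<..<b} f"
  shows "f \<in> borel_measurable (LI a b)"
proof (rule borel_measurable_LIMSEQ_real)
  define K where "K = (\<lambda>n. {a + 1 / real (Suc n)..b - 1 / real (Suc n)})"
  show "(\<lambda>x. indicator (K n) x * f x) \<in> borel_measurable (LI a b)" for n
  proof (rule borel_LI)
    have "K n \<subseteq> {a<..<b}"
    proof
      fix x assume "x \<in> K n"
      moreover have "0 < 1 / real (Suc n)" by simp
      ultimately show "x \<in> {a<..<b}" unfolding K_def atLeastAtMost_iff greaterThanLessThan_iff by linarith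
    qed
    then have "set_integrable lborel (K n) f" using assms unfolding L1_loc_def by (simp add: K_def)
    then have "(\<lambda>x. indicator (K n) x *\<^sub>R f x) \<in> borel_measurable lborel" unfolding set_integrable_def by (rule borel_measurable_integrable)
    then show "(\<lambda>x. indicator (K n) x * f x) \<in> borel_measurable borel" by simp
  qed
  fix x assume "x \<in> space (LI a b)"
  then have x: "0 < x - a" "0 < b - x" by simp_all
  have "eventually (\<lambda>n. 1 / real (Suc n) < min (x - a) (b - x)) sequentially"
    using inv_Suc_lim x by (intro order_tendstoD(2)) auto
  then have "eventually (\<lambda>n. indicator (K n) x * f x = f x) sequentially"
    by eventually_elim (simp add: K_def)
  then show "(\<lambda>n. indicator (K n) x * f x) \<longlonglongrightarrow> f x" by (rule tendsto_eventually)
qed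

lemma wderiv_measurable: "has_weak_deriv a b f g \<Longrightarrow> wderiv a b f \<in> borel_measurable (LI a b)"
  using someI[of "has_weak_deriv a b f" g] L1_loc_measurable unfolding wderiv_def has_weak_deriv_def by blast

lemma primitive_minus: "primitive a b 0 (\<lambda>s. - g s) y = - primitive a b 0 g y"
proof -
  have "(LINT s|LI a b. (if s < y then - g s else 0)) = (LINT s|LI a b. - (if s < y then g s else 0))"
    by (rule Bochner_Integration.integral_cong) auto
  then show ?thesis by (simp add: primitive_def)
qed

text \<open>The dual norm is tested with \<open>-e\<close>, whose continuous representative vanishes at both end points. If \<open>l\<close> is the value
  of the functional there and \<open>X\<close> the square of the seminorm of \<open>e\<close>, the left-hand side is \<open>2 l - X\<close>, which is at most \<open>l\<^sup>2 / X\<close>.\<close>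

lemma dual_norm_bound:
  assumes ex: "sqint (LI 0 1) ex" and ex1: "primitive 0 1 0 ex 1 = 0"
    and e: "AE y in LI 0 1. e y = primitive 0 1 0 ex y" "e \<in> borel_measurable (LI 0 1)"
    and a: "sqint (LI 0 1) a" and c: "sqint (LI 0 1) c"
  shows "ennreal (- 2 * ((LINT y|LI 0 1. a y * e y) + (LINT y|LI 0 1. c y * ex y)) - (LINT y|LI 0 1. (ex y)\<^sup>2))
    \<le> (Hm1_norm (\<lambda>\<phi>. (LINT y:Omega|lborel. a y * \<phi> y) - (- (LINT y:Omega|lborel. c y * wderiv 0 1 \<phi> y))))\<^sup>2"
    (is "ennreal (- 2 * (?A + ?C) - ?X) \<le> (Hm1_norm ?l)\<^sup>2")
proof -
  define \<phi> where "\<phi> = primitive 0 1 0 (\<lambda>s. - ex s)"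
  have mex: "sqint (LI 0 1) (\<lambda>s. - ex s)" using ex by (simp add: sqint_def)
  have iex: "integrable (LI 0 1) (\<lambda>s. - ex s)" by (rule LI.sqint_integrable[OF mex])
  have wd: "has_weak_deriv 0 1 \<phi> (\<lambda>s. - ex s)" unfolding \<phi>_def by (rule primitive_weak_deriv[OF iex]) simp
  have cont: "continuous_on A \<phi>" for A unfolding \<phi>_def by (rule primitive_continuous[OF iex])
  have \<phi>m: "\<phi> \<in> borel_measurable (LI 0 1)" by (rule borel_LI[OF borel_measurable_continuous_onI[OF cont]])
  have \<phi>e: "\<phi> y = - primitive 0 1 0 ex y" for y unfolding \<phi>_def by (rule primitive_minus)
  have "sqint (LI 0 1) \<phi>"
    by (rule LI.sqint_bounded[OF \<phi>m, where C = "\<bar>0\<bar> + (LINT s|LI 0 1. \<bar>- ex s\<bar>)"], rule AE_I2)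
       (unfold \<phi>_def, rule primitive_bound[OF iex])
  then have h10: "H10 \<phi>"
    unfolding H10_def H1_def using wd mex cont ex1 \<phi>e
    by (auto simp: L2_on_LI sqint_def primitive_left intro!: exI[of _ "\<lambda>s. - ex s"])
  have wdae: "AE y in LI 0 1. wderiv 0 1 \<phi> y = - ex y" by (rule wderiv_AE[OF wd]) simp
  have exm: "ex \<in> borel_measurable (LI 0 1)" using ex by (simp add: sqint_def)
  have lA: "(LINT y|LI 0 1. a y * \<phi> y) = - ?A"
  proof -
    have "(LINT y|LI 0 1. a y * \<phi> y) = (LINT y|LI 0 1. - (a y * e y))"
    proof (rule integral_cong_AE)
      show "(\<lambda>y. a y * \<phi> y) \<in> borel_measurable (LI 0 1)" using a \<phi>m by (intro borel_measurable_times) (auto simp: sqint_def)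
      show "(\<lambda>y. - (a y * e y)) \<in> borel_measurable (LI 0 1)" using a e(2) by (intro borel_measurable_uminus borel_measurable_times) (auto simp: sqint_def)
      show "AE y in LI 0 1. a y * \<phi> y = - (a y * e y)" using e(1) by eventually_elim (simp add: \<phi>e)
    qed
    then show ?thesis by simp
  qed
  show ?thesis
  proof (cases "wderiv 0 1 \<phi> \<in> borel_measurable (LI 0 1)")
    case True
    have lC: "(LINT y|LI 0 1. c y * wderiv 0 1 \<phi> y) = - ?C"
    proof -
      have "(LINT y|LI 0 1. c y * wderiv 0 1 \<phi> y) = (LINT y|LI 0 1. - (c y * ex y))"
      proof (rule integral_cong_AE)
        show "(\<lambda>y. c y * wderiv 0 1 \<phi> y) \<in> borel_measurable (LI 0 1)" using c True by (intro borel_measurable_times) (auto simp: sqint_def)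
        show "(\<lambda>y. - (c y * ex y)) \<in> borel_measurable (LI 0 1)" using c exm by (intro borel_measurable_uminus borel_measurable_times) (auto simp: sqint_def)
        show "AE y in LI 0 1. c y * wderiv 0 1 \<phi> y = - (c y * ex y)" using wdae by eventually_elim simp
      qed
      then show ?thesis by simp
    qed
    have l: "?l \<phi> = - (?A + ?C)" unfolding set_integral_LI lA lC by simp
    have n: "L2_norm (wderiv 0 1 \<phi>) = ennreal (sqrt ?X)"
    proof -
      have "(\<integral>\<^sup>+y. ennreal ((wderiv 0 1 \<phi> y)\<^sup>2) \<partial>LI 0 1) = (\<integral>\<^sup>+y. ennreal ((ex y)\<^sup>2) \<partial>LI 0 1)"
        by (rule nn_integral_cong_AE) (use wdae in \<open>eventually_elim, simp\<close>)
      then show ?thesis using L2_norm_sqint[OF ex] by (simp add: L2_norm_def nn_integral_LI)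
    qed
    show ?thesis
    proof (cases "?X = 0")
      case True
      have "\<bar>?A + ?C\<bar> = 0"
      proof -
        have "AE y in LI 0 1. (ex y)\<^sup>2 = 0"
          using True ex by (subst (asm) integral_nonneg_eq_0_iff_AE) (auto simp: sqint_def)
        then have z: "AE y in LI 0 1. ex y = 0" by eventually_elim simp
        have pz: "primitive 0 1 0 ex y = 0" for y
        proof -
          have "(LINT s|LI 0 1. (if s < y then ex s else 0)) = 0"
            by (rule integral_eq_zero_AE) (use z in \<open>eventually_elim, simp\<close>)
          then show ?thesis by (simp add: primitive_def)
        qed
        have "AE y in LI 0 1. a y * e y = 0" using e(1) by eventually_elim (simp add: pz)
        then have "?A = 0" by (rule integral_eq_zero_AE)
        moreover have "?C = 0" by (rule integral_eq_zero_AE) (use z in \<open>eventually_elim, simp\<close>)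
        ultimately show ?thesis by simp
      qed
      then have "- 2 * (?A + ?C) - ?X = 0" using True by simp
      then show ?thesis by (simp only: ennreal_0 zero_le)
    next
      case False
      moreover have "0 \<le> ?X" by simp
      ultimately have X: "0 < ?X" by linarith
      have nz: "\<exists>y\<in>Omega. \<phi> y \<noteq> 0"
      proof (rule ccontr)
        assume "\<not> (\<exists>y\<in>Omega. \<phi> y \<noteq> 0)"
        then have "AE y in LI 0 1. \<phi> y = 0" by (intro AE_LI_I) simp
        moreover have "has_weak_deriv 0 1 (\<lambda>_. 0) (\<lambda>_. 0)"
          by (simp add: has_weak_deriv_LI integrable_L1_loc)
        ultimately have "AE y in LI 0 1. - ex y = 0" using weak_deriv_unique[OF wd _ zero_less_one] by blast
        then have "AE y in LI 0 1. (ex y)\<^sup>2 = 0" by eventually_elim simp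
        then have "?X = 0" by (rule integral_eq_zero_AE)
        then show False using X by simp
      qed
      define L where "L = - (?A + ?C)"
      have "ennreal L / ennreal (sqrt ?X) \<le> Hm1_norm ?l"
        unfolding Hm1_norm_def
        by (rule SUP_upper2[of \<phi>]) (use h10 nz in \<open>auto simp only: mem_Collect_eq l n L_def order_refl\<close>)
      show ?thesis
      proof (cases "0 < L")
        case True
        then have "ennreal (L / sqrt ?X) \<le> Hm1_norm ?l"
          using \<open>ennreal L / ennreal (sqrt ?X) \<le> Hm1_norm ?l\<close> X by (simp add: divide_ennreal)
        then have "(ennreal (L / sqrt ?X))\<^sup>2 \<le> (Hm1_norm ?l)\<^sup>2" by (rule power_mono) simp
        also have "(ennreal (L / sqrt ?X))\<^sup>2 = ennreal (L\<^sup>2 / ?X)"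
          using True X by (simp add: ennreal_power power_divide)
        finally have up: "ennreal (L\<^sup>2 / ?X) \<le> (Hm1_norm ?l)\<^sup>2" .
        have lo: "2 * L - ?X \<le> L\<^sup>2 / ?X"
        proof -
          have "0 \<le> (L - ?X)\<^sup>2" by simp
          then have "(2 * L - ?X) * ?X \<le> L\<^sup>2" by (simp add: power2_eq_square algebra_simps)
          then show ?thesis using X by (simp add: pos_le_divide_eq)
        qed
        have "- 2 * (?A + ?C) - ?X = 2 * L - ?X" by (simp add: L_def)
        then show ?thesis using order_trans[OF ennreal_leI[OF lo] up] by (simp only:)
      next
        case False
        then have "2 * L - ?X \<le> 0" using X by linarith
        moreover have "- 2 * (?A + ?C) - ?X = 2 * L - ?X" by (simp add: L_def)
        ultimately show ?thesis by (simp only: ennreal_neg zero_le)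
      qed
    qed
  qed (use wderiv_measurable[OF wd] in blast)
qed

section \<open>One-sided limits and the elementwise energy\<close>

lemma LI_subinterval:
  assumes "{c<..<d} \<subseteq> {a<..<b}"
  shows "f \<in> borel_measurable (LI a b) \<Longrightarrow> f \<in> borel_measurable (LI c d)"
    "(AE x in LI a b. P x) \<Longrightarrow> AE x in LI c d. P x"
proof -
  show "f \<in> borel_measurable (LI a b) \<Longrightarrow> f \<in> borel_measurable (LI c d)"
    unfolding LI_def by (rule measurable_restrict_mono[OF _ assms])
  assume "AE x in LI a b. P x"
  then show "AE x in LI c d. P x" unfolding AE_LI by eventually_elim (use assms in blast)
qed

lemma interval_average:
  fixes f :: "real \<Rightarrow> real"
  assumes f: "f \<in> borel_measurable (LI p r)" and pr: "p < r" and \<eta>: "AE y in LI p r. \<bar>f y - v\<bar> \<le> \<eta>"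
  shows "\<bar>(LINT y:{p<..<r}|lborel. f y) / (r - p) - v\<bar> \<le> \<eta>"
proof -
  have vol: "measure (LI p r) (space (LI p r)) = r - p"
    using pr by (simp add: LI_def measure_restrict_space)
  have i: "integrable (LI p r) (\<lambda>y. f y - v)"
    by (rule LI.integrable_const_bound[where B = \<eta>]) (use f \<eta> in auto)
  have "integrable (LI p r) (\<lambda>y. (f y - v) + v)" by (intro Bochner_Integration.integrable_add i) simp
  then have fi: "integrable (LI p r) f" by simp
  have "\<bar>LINT y|LI p r. f y - v\<bar> \<le> (LINT y|LI p r. \<bar>f y - v\<bar>)" by (rule integral_abs_bound)
  also have "\<dots> \<le> (LINT y|LI p r. \<eta>)" by (rule integral_mono_AE) (use i \<eta> in auto)
  also have "\<dots> = (r - p) * \<eta>" using vol by simp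
  finally have "\<bar>(LINT y|LI p r. f y) - (r - p) * v\<bar> \<le> (r - p) * \<eta>" using fi vol by simp
  moreover have "(LINT y|LI p r. f y) / (r - p) - v = ((LINT y|LI p r. f y) - (r - p) * v) / (r - p)"
    using pr by (simp add: field_simps)
  ultimately show ?thesis using pr by (simp add: set_integral_LI abs_divide pos_divide_le_eq mult.commute)
qed

text \<open>Averages of a function over shrinking intervals converge to the value of a continuous representative.\<close>

lemma left_trace_eq:
  assumes ac: "a < c" and f: "f \<in> borel_measurable (LI a c)" "AE y in LI a c. f y = h y" and h: "isCont h c"
  shows "left_trace f c = h c"
  unfolding left_trace_def
proof (rule tendsto_Lim)
  show "((\<lambda>\<delta>. (LINT y:{c - \<delta><..<c}|lborel. f y) / \<delta>) \<longlongrightarrow> h c) (at_right 0)"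
  proof (rule tendstoI)
    fix \<eta> :: real assume "0 < \<eta>"
    then obtain \<rho> where \<rho>: "0 < \<rho>" "\<And>y. dist y c < \<rho> \<Longrightarrow> dist (h y) (h c) < \<eta> / 2"
      using h[unfolded continuous_at_eps_delta] half_gt_zero by blast
    have "eventually (\<lambda>\<delta>. \<delta> < min \<rho> (c - a)) (at_right 0)"
      by (rule order_tendstoD(2)[OF tendsto_ident_at]) (use \<rho>(1) ac in simp)
    moreover have "eventually (\<lambda>\<delta>. (0 :: real) < \<delta>) (at_right 0)" by (rule eventually_at_right_less)
    ultimately show "eventually (\<lambda>\<delta>. dist ((LINT y:{c - \<delta><..<c}|lborel. f y) / \<delta>) (h c) < \<eta>) (at_right 0)"
    proof eventually_elim
      case (elim \<delta>)
      then have sub: "{c - \<delta><..<c} \<subseteq> {a<..<c}" by auto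
      have "AE y in LI (c - \<delta>) c. y \<in> {c - \<delta><..<c}" by (rule AE_LI_I) simp
      then have "AE y in LI (c - \<delta>) c. \<bar>f y - h c\<bar> \<le> \<eta> / 2"
        using LI_subinterval(2)[OF sub f(2)]
      proof eventually_elim
        case (elim y)
        then have "dist y c < \<rho>" using \<open>\<delta> < min \<rho> (c - a)\<close> by (simp add: dist_real_def)
        then show ?case using \<rho>(2)[of y] elim by (simp add: dist_real_def)
      qed
      then show ?case using interval_average[OF LI_subinterval(1)[OF sub f(1)], of "h c" "\<eta> / 2"] elim(2) \<open>0 < \<eta>\<close>
        by (simp add: dist_real_def)
    qed
  qed
qed simp

lemma right_trace_eq:
  assumes cd: "c < d" and f: "f \<in> borel_measurable (LI c d)" "AE y in LI c d. f y = h y" and h: "isCont h c"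
  shows "right_trace f c = h c"
  unfolding right_trace_def
proof (rule tendsto_Lim)
  show "((\<lambda>\<delta>. (LINT y:{c<..<c + \<delta>}|lborel. f y) / \<delta>) \<longlongrightarrow> h c) (at_right 0)"
  proof (rule tendstoI)
    fix \<eta> :: real assume "0 < \<eta>"
    then obtain \<rho> where \<rho>: "0 < \<rho>" "\<And>y. dist y c < \<rho> \<Longrightarrow> dist (h y) (h c) < \<eta> / 2"
      using h[unfolded continuous_at_eps_delta] half_gt_zero by blast
    have "eventually (\<lambda>\<delta>. \<delta> < min \<rho> (d - c)) (at_right 0)"
      by (rule order_tendstoD(2)[OF tendsto_ident_at]) (use \<rho>(1) cd in simp)
    moreover have "eventually (\<lambda>\<delta>. (0 :: real) < \<delta>) (at_right 0)" by (rule eventually_at_right_less)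
    ultimately show "eventually (\<lambda>\<delta>. dist ((LINT y:{c<..<c + \<delta>}|lborel. f y) / \<delta>) (h c) < \<eta>) (at_right 0)"
    proof eventually_elim
      case (elim \<delta>)
      then have sub: "{c<..<c + \<delta>} \<subseteq> {c<..<d}" by auto
      have "AE y in LI c (c + \<delta>). y \<in> {c<..<c + \<delta>}" by (rule AE_LI_I) simp
      then have "AE y in LI c (c + \<delta>). \<bar>f y - h c\<bar> \<le> \<eta> / 2"
        using LI_subinterval(2)[OF sub f(2)]
      proof eventually_elim
        case (elim y)
        then have "dist y c < \<rho>" using \<open>\<delta> < min \<rho> (d - c)\<close> by (simp add: dist_real_def)
        then show ?case using \<rho>(2)[of y] elim by (simp add: dist_real_def)
      qed
      then show ?case using interval_average[OF LI_subinterval(1)[OF sub f(1)], of "h c" "\<eta> / 2"] elim(2) \<open>0 < \<eta>\<close>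
        by (simp add: dist_real_def)
    qed
  qed
qed simp

lemma has_weak_deriv_cong:
  assumes "has_weak_deriv a b f g" and e: "\<And>y. y \<in> {a<..<b} \<Longrightarrow> f' y = f y" "\<And>y. y \<in> {a<..<b} \<Longrightarrow> g' y = g y"
  shows "has_weak_deriv a b f' g'"
proof -
  have l: "L1_loc {a<..<b} h'" if h: "L1_loc {a<..<b} h" and "\<And>y. y \<in> {a<..<b} \<Longrightarrow> h' y = h y" for h h'
    unfolding L1_loc_def
  proof (intro allI impI)
    fix K assume K: "compact K \<and> K \<subseteq> {a<..<b}"
    have "set_integrable lborel K h' = set_integrable lborel K h"
      by (rule set_integrable_cong) (use that K in auto)
    then show "set_integrable lborel K h'" using h K by (simp add: L1_loc_def)
  qed
  show ?thesis unfolding has_weak_deriv_LI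
  proof (intro conjI allI impI)
    show "L1_loc {a<..<b} f'" "L1_loc {a<..<b} g'"
      using assms(1) e l unfolding has_weak_deriv_def by blast+
    fix \<psi> assume \<psi>: "test1 {a<..<b} \<psi>"
    have "(LINT x|LI a b. f' x * deriv \<psi> x) = (LINT x|LI a b. f x * deriv \<psi> x)"
      "(LINT x|LI a b. g' x * \<psi> x) = (LINT x|LI a b. g x * \<psi> x)"
      by (rule Bochner_Integration.integral_cong; simp add: e)+
    then show "(LINT x|LI a b. f' x * deriv \<psi> x) = - (LINT x|LI a b. g' x * \<psi> x)"
      using assms(1) \<psi> by (simp add: has_weak_deriv_LI)
  qed
qed

lemma dg_fun_cell_weak_deriv:
  assumes m: "is_mesh M x" and j: "j < M"
  shows "has_weak_deriv (x j) (x (Suc j)) (dg_fun M x v) (dg_fun M x (dg_deriv v))"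
proof (rule has_weak_deriv_cong)
  note mf = mesh_facts[OF m]
  show "has_weak_deriv (x j) (x (Suc j)) (dg_fun M x (\<lambda>_. v j)) (dg_fun M x (dg_deriv (\<lambda>_. v j)))"
    by (rule weak_deriv_subinterval[OF dg_fun_weak_deriv[OF m]]) (use mf(4)[OF j] mf(6)[of j] mf(6)[of "Suc j"] j in auto)
qed (simp_all add: dg_fun_cell[OF m j] dg_deriv_def)

text \<open>
  Adding to a discontinuous function an error that vanishes at both end points leaves its jumps
  unchanged, so the elementwise energy grows by at most the energy of the error.
\<close>

lemma jump_of_difference:
  assumes m: "is_mesh M x" and j: "j < M" and f: "f \<in> borel_measurable (LI 0 1)"
    and P: "AE y in LI 0 1. f y - dg_fun M x v y = P y" "continuous_on UNIV P" "P 0 = 0" "P 1 = 0"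
  shows "jump M x (\<lambda>y. f y - dg_fun M x z y) j = jump M x (\<lambda>y. dg_fun M x v y - dg_fun M x z y) j"
proof -
  note mf = mesh_facts[OF m]
  have Pc: "isCont P c" for c using P(2) by (simp add: continuous_on_eq_continuous_at)
  have cell: "{x i<..<x (Suc i)} \<subseteq> {0<..<1}" if "i < M" for i
    using mf(6)[of i] mf(6)[of "Suc i"] that by auto
  have dm: "(\<lambda>y. f y - dg_fun M x z y) \<in> borel_measurable (LI 0 1)" "(\<lambda>y. dg_fun M x v y - dg_fun M x z y) \<in> borel_measurable (LI 0 1)"
    by (intro borel_measurable_diff f borel_LI[OF dg_fun_borel])+
  define h where "h = (\<lambda>i y. poly (v i - z i) y)"
  have hc: "isCont (h i) c" for i c unfolding h_def by (rule poly_isCont)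
  have incell: "AE y in LI (x i) (x (Suc i)). y \<in> {x i<..<x (Suc i)}" for i by (rule AE_LI_I) simp
  have d2: "AE y in LI (x i) (x (Suc i)). dg_fun M x v y - dg_fun M x z y = h i y" if i: "i < M" for i
    using incell by eventually_elim (simp add: dg_fun_cell[OF m i] h_def)
  have d1: "AE y in LI (x i) (x (Suc i)). f y - dg_fun M x z y = P y + h i y" if i: "i < M" for i
    using d2[OF i] LI_subinterval(2)[OF cell[OF i] P(1)] by eventually_elim simp
  have Phc: "isCont (\<lambda>y. P y + h i y) c" for i c by (intro continuous_intros Pc hc)
  have L: "left_trace (\<lambda>y. f y - dg_fun M x z y) (x (Suc i)) = P (x (Suc i)) + h i (x (Suc i))"
     "left_trace (\<lambda>y. dg_fun M x v y - dg_fun M x z y) (x (Suc i)) = h i (x (Suc i))" if i: "i < M" for i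
    by (rule left_trace_eq[OF mf(4)[OF i] LI_subinterval(1)[OF cell[OF i] dm(1)] d1[OF i] Phc]
          left_trace_eq[OF mf(4)[OF i] LI_subinterval(1)[OF cell[OF i] dm(2)] d2[OF i] hc])+
  have R: "right_trace (\<lambda>y. f y - dg_fun M x z y) (x i) = P (x i) + h i (x i)"
     "right_trace (\<lambda>y. dg_fun M x v y - dg_fun M x z y) (x i) = h i (x i)" if i: "i < M" for i
    by (rule right_trace_eq[OF mf(4)[OF i] LI_subinterval(1)[OF cell[OF i] dm(1)] d1[OF i] Phc]
          right_trace_eq[OF mf(4)[OF i] LI_subinterval(1)[OF cell[OF i] dm(2)] d2[OF i] hc])+
  show ?thesis
  proof (cases j)
    case 0
    obtain i where i: "M = Suc i" using mf(1) by (cases M) auto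
    then show ?thesis using L[of i] R[OF j] P(3,4) mf(2,3) 0 by (simp add: jump_def)
  next
    case (Suc i)
    then show ?thesis using L[of i] R[OF j] j by (simp add: jump_def)
  qed
qed

abbreviation elementwise_energy :: "nat \<Rightarrow> (nat \<Rightarrow> real) \<Rightarrow> (real \<Rightarrow> real) \<Rightarrow> ennreal" where
  "elementwise_energy M x f \<equiv>
     (\<Sum>j<M. (\<integral>\<^sup>+y\<in>{x j<..<x (Suc j)}. ennreal ((wderiv (x j) (x (Suc j)) f y)\<^sup>2) \<partial>lborel)
        + ennreal ((jump M x f j)\<^sup>2 / node_h M x j))"

lemma energy_of_difference:
  assumes m: "is_mesh M x" and f: "f \<in> borel_measurable (LI 0 1)" "has_weak_deriv 0 1 f fx"
    and ex: "\<And>y. ex y = fx y - dg_fun M x (dg_deriv v) y" "sqint (LI 0 1) ex"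
    and P: "AE y in LI 0 1. f y - dg_fun M x v y = primitive 0 1 0 ex y" "primitive 0 1 0 ex 1 = 0"
  shows "elementwise_energy M x (\<lambda>y. f y - dg_fun M x z y)
    \<le> 2 * ennreal (LINT y|LI 0 1. (ex y)\<^sup>2)
      + 2 * elementwise_energy M x (\<lambda>y. dg_fun M x v y - dg_fun M x z y)"
proof -
  note mf = mesh_facts[OF m]
  define C where "C = (\<lambda>j. {x j<..<x (Suc j)})"
  have cell: "C j \<subseteq> {0<..<1}" if "j < M" for j
    using mf(6)[of j] mf(6)[of "Suc j"] that by (auto simp: C_def)
  have exm: "ex \<in> borel_measurable (LI 0 1)" using ex(2) by (simp add: sqint_def)
  define W1 where "W1 = (\<lambda>j. \<integral>\<^sup>+y\<in>C j. ennreal ((wderiv (x j) (x (Suc j)) (\<lambda>y. f y - dg_fun M x z y) y)\<^sup>2) \<partial>lborel)"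
  define W2 where "W2 = (\<lambda>j. \<integral>\<^sup>+y\<in>C j. ennreal ((wderiv (x j) (x (Suc j)) (\<lambda>y. dg_fun M x v y - dg_fun M x z y) y)\<^sup>2) \<partial>lborel)"
  define J1 where "J1 = (\<lambda>j. ennreal ((jump M x (\<lambda>y. f y - dg_fun M x z y) j)\<^sup>2 / node_h M x j))"
  define J2 where "J2 = (\<lambda>j. ennreal ((jump M x (\<lambda>y. dg_fun M x v y - dg_fun M x z y) j)\<^sup>2 / node_h M x j))"
  define X where "X = (\<lambda>j. \<integral>\<^sup>+y\<in>C j. ennreal ((ex y)\<^sup>2) \<partial>lborel)"
  have J: "J1 j = J2 j" if "j < M" for j
    unfolding J1_def J2_def
    by (subst jump_of_difference[OF m that f(1) P(1) primitive_continuous[OF LI.sqint_integrable[OF ex(2)]] primitive_left P(2)]) (rule refl)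
  have W: "W1 j \<le> 2 * X j + 2 * W2 j" if j: "j < M" for j
  proof -
    have ab: "x j < x (Suc j)" by (rule mf(4)[OF j])
    have fw: "has_weak_deriv (x j) (x (Suc j)) f fx"
      by (rule weak_deriv_subinterval[OF f(2)]) (use ab mf(6)[of j] mf(6)[of "Suc j"] j in auto)
    note dv = dg_fun_cell_weak_deriv[OF m j]
    have w1: "AE y in LI (x j) (x (Suc j)). wderiv (x j) (x (Suc j)) (\<lambda>y. f y - dg_fun M x z y) y = fx y - dg_fun M x (dg_deriv z) y"
      by (rule wderiv_AE[OF weak_deriv_diff[OF fw dv ab] ab])
    have w2: "AE y in LI (x j) (x (Suc j)). wderiv (x j) (x (Suc j)) (\<lambda>y. dg_fun M x v y - dg_fun M x z y) y = dg_fun M x (dg_deriv v) y - dg_fun M x (dg_deriv z) y"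
      by (rule wderiv_AE[OF weak_deriv_diff[OF dv dv ab] ab])
    have "W1 j \<le> integral\<^sup>N (LI (x j) (x (Suc j))) (\<lambda>y. 2 * ennreal ((ex y)\<^sup>2)) + ennreal 2 * W2 j"
      unfolding W1_def W2_def C_def nn_integral_LI
    proof (rule nn_integral_add_mult_le)
      have "ex \<in> borel_measurable (LI (x j) (x (Suc j)))" by (rule LI_subinterval(1)[OF cell[OF j, unfolded C_def] exm])
      then show "(\<lambda>y. 2 * ennreal ((ex y)\<^sup>2)) \<in> borel_measurable (LI (x j) (x (Suc j)))" by measurable
      show "2 * ennreal ((ex y)\<^sup>2) \<noteq> \<infinity>" for y by (simp add: ennreal_mult_eq_top_iff)
      show "AE y in LI (x j) (x (Suc j)). ennreal ((wderiv (x j) (x (Suc j)) (\<lambda>y. f y - dg_fun M x z y) y)\<^sup>2)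
         \<le> 2 * ennreal ((ex y)\<^sup>2) + ennreal 2 * ennreal ((wderiv (x j) (x (Suc j)) (\<lambda>y. dg_fun M x v y - dg_fun M x z y) y)\<^sup>2)"
        using w1 w2
      proof eventually_elim
        case (elim y)
        have "(wderiv (x j) (x (Suc j)) (\<lambda>y. f y - dg_fun M x z y) y)\<^sup>2 \<le> 2 * (ex y)\<^sup>2 + 2 * (wderiv (x j) (x (Suc j)) (\<lambda>y. dg_fun M x v y - dg_fun M x z y) y)\<^sup>2"
          using sum_square_le[of "ex y" "dg_fun M x (dg_deriv v) y - dg_fun M x (dg_deriv z) y"] unfolding elim ex(1) by simp
        from ennreal_leI[OF this] show ?case by (simp add: ennreal_plus ennreal_mult)
      qed
    qed simp
    also have "integral\<^sup>N (LI (x j) (x (Suc j))) (\<lambda>y. 2 * ennreal ((ex y)\<^sup>2)) = 2 * X j"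
    proof -
      have "ex \<in> borel_measurable (LI (x j) (x (Suc j)))" by (rule LI_subinterval(1)[OF cell[OF j, unfolded C_def] exm])
      then have "(\<lambda>y. ennreal ((ex y)\<^sup>2)) \<in> borel_measurable (LI (x j) (x (Suc j)))" by measurable
      then show ?thesis unfolding X_def C_def nn_integral_LI by (rule nn_integral_cmult)
    qed
    finally show ?thesis by simp
  qed
  have X: "(\<Sum>j<M. X j) \<le> ennreal (LINT y|LI 0 1. (ex y)\<^sup>2)"
  proof -
    have "X j = (\<integral>\<^sup>+y. ennreal ((ex y)\<^sup>2) * indicator (C j) y \<partial>LI 0 1)" if "j < M" for j
      unfolding X_def nn_integral_LI[symmetric] by (rule nn_integral_cong) (use cell[OF that] in \<open>auto simp: indicator_def\<close>)
    then have "(\<Sum>j<M. X j) = (\<Sum>j<M. \<integral>\<^sup>+y. ennreal ((ex y)\<^sup>2) * indicator (C j) y \<partial>LI 0 1)" by simp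
    also have "\<dots> = (\<integral>\<^sup>+y. (\<Sum>j<M. ennreal ((ex y)\<^sup>2) * indicator (C j) y) \<partial>LI 0 1)"
    proof (rule nn_integral_sum[symmetric])
      fix j
      have "(\<lambda>y. indicator (C j) y :: ennreal) \<in> borel_measurable (LI 0 1)"
        unfolding LI_def by (intro measurable_restrict_space1) (simp add: C_def)
      then show "(\<lambda>y. ennreal ((ex y)\<^sup>2) * indicator (C j) y) \<in> borel_measurable (LI 0 1)"
        using exm by measurable
    qed
    also have "\<dots> \<le> (\<integral>\<^sup>+y. ennreal ((ex y)\<^sup>2) \<partial>LI 0 1)"
    proof (rule nn_integral_mono)
      fix y
      have "(\<Sum>j<M. indicator (C j) y :: ennreal) \<le> 1"
      proof (cases "\<exists>i<M. y \<in> C i")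
        case True
        then obtain i where i: "i < M" "y \<in> C i" by blast
        have "indicator (C j) y = (0 :: ennreal)" if "j < M" "j \<noteq> i" for j
        proof -
          have "y \<notin> C j"
          proof (cases "j < i")
            case True
            then show ?thesis using i mf(5)[of "Suc j" i] by (auto simp: C_def)
          next
            case False
            then show ?thesis using i that mf(5)[of "Suc i" j] by (auto simp: C_def)
          qed
          then show ?thesis by simp
        qed
        then have "(\<Sum>j<M. indicator (C j) y :: ennreal) = (\<Sum>j<M. if j = i then 1 else 0)"
          using i(2) by (intro sum.cong) auto
        then show ?thesis using i(1) by (simp only: sum.delta finite_lessThan) simp
      next
        case False
        then have "(\<Sum>j<M. indicator (C j) y :: ennreal) = 0" by (intro sum.neutral) auto
        then show ?thesis by simp
      qed
      then have "ennreal ((ex y)\<^sup>2) * (\<Sum>j<M. indicator (C j) y) \<le> ennreal ((ex y)\<^sup>2) * 1" by (rule mult_left_mono) simp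
      then show "(\<Sum>j<M. ennreal ((ex y)\<^sup>2) * indicator (C j) y) \<le> ennreal ((ex y)\<^sup>2)" by (simp add: sum_distrib_left)
    qed
    finally show ?thesis unfolding nn_integral_sq[OF ex(2)] .
  qed
  have "(\<Sum>j<M. W1 j + J1 j) \<le> (\<Sum>j<M. 2 * X j + 2 * (W2 j + J2 j))"
  proof (rule sum_mono)
    fix j assume "j \<in> {..<M}"
    then have "W1 j + J1 j \<le> (2 * X j + 2 * W2 j) + 2 * J2 j"
      using W[of j] J[of j] mult_right_mono[of 1 2 "J2 j"] by (intro add_mono) simp_all
    then show "W1 j + J1 j \<le> 2 * X j + 2 * (W2 j + J2 j)" by (simp add: distrib_left add.assoc)
  qed
  also have "\<dots> = 2 * (\<Sum>j<M. X j) + 2 * (\<Sum>j<M. W2 j + J2 j)" by (simp add: sum.distrib sum_distrib_left)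
  also have "\<dots> \<le> 2 * ennreal (LINT y|LI 0 1. (ex y)\<^sup>2) + 2 * (\<Sum>j<M. W2 j + J2 j)"
    by (intro add_right_mono mult_left_mono X) simp
  finally show ?thesis unfolding W1_def W2_def J1_def J2_def C_def .
qed

section \<open>The error estimate\<close>

context viscous_solution
begin

text \<open>  The energy inequality is combined with bounds for the production term by the residuals. The bounds for the
  residuals enter through \<open>R\<close>, \<open>k\<close> and \<open>K\<close>. The second residual uses half of the dissipation; the first one
  is paired with the error in \<open>L\<^sup>1(L\<^sup>2)\<close>-\<open>L\<^sup>\<infinity>(L\<^sup>2)\<close> duality, which makes the supremum \<open>m\<close> of the error appear on the right.\<close>

lemma energy_estimate:
  fixes a r :: "real \<Rightarrow> real \<Rightarrow> real" and k :: "real \<Rightarrow> ennreal" and R K :: real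
  assumes V: "approximable T V Vt Vx" and \<tau>: "0 < \<tau>" "\<tau> \<le> T"
    and bc: "\<And>\<theta>. \<lbrakk>smooth \<theta>; \<forall>t. 0 \<le> \<theta> t \<and> \<theta> t \<le> 1\<rbrakk> \<Longrightarrow> no_boundary_gain V \<theta>"
    and wc: "weakly_continuous_L2 T (\<lambda>t x. u t x - V t x)"
    and a: "AE t in LI 0 T. t < \<tau> \<longrightarrow> sqint (LI 0 1) (a t)"
    and r: "Cmeas T r" "AE t in LI 0 T. t < \<tau> \<longrightarrow> (AE x in LI 0 1. Vt t x + b * Vx t x = r t x + \<epsilon> * a t x)"
    and R: "(\<integral>\<^sup>+t. ennreal (if t < \<tau> then sqrt (LINT x|LI 0 1. (r t x)\<^sup>2) else 0) \<partial>LI 0 T) \<le> ennreal R" "0 \<le> R"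
    and k: "0 < \<epsilon> \<Longrightarrow> AE t in LI 0 T. t < \<tau> \<longrightarrow>
        ennreal (- 2 * ((LINT x|LI 0 1. a t x * (u t x - V t x)) + (LINT x|LI 0 1. Vx t x * (ux t x - Vx t x)))
           - (LINT x|LI 0 1. (ux t x - Vx t x)\<^sup>2)) \<le> k t"
    and K: "0 < \<epsilon> \<Longrightarrow> (\<integral>\<^sup>+t. (if t < \<tau> then k t else 0) \<partial>LI 0 T) \<le> ennreal K" "0 \<le> K"
  shows "(LINT x|LI 0 1. (u \<tau> x - V \<tau> x)\<^sup>2) + \<epsilon> * (LINT t|LI 0 T. (if t < \<tau> then (LINT x|LI 0 1. (ux t x - Vx t x)\<^sup>2) else 0))
    \<le> 2 * (LINT x|LI 0 1. (u0 x - V 0 x)\<^sup>2) + 4 * R\<^sup>2 + 2 * \<epsilon> * K"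
proof -
  define E where "E = (\<lambda>t. LINT x|LI 0 1. (u t x - V t x)\<^sup>2)"
  define E0 where "E0 = (LINT x|LI 0 1. (u0 x - V 0 x)\<^sup>2)"
  define X where "X = (\<lambda>t. LINT x|LI 0 1. (ux t x - Vx t x)\<^sup>2)"
  define J where "J = (\<lambda>t. LINT x|LI 0 1. dissip V Vt Vx t x)"
  define \<rho> where "\<rho> = (\<lambda>t. sqrt (LINT x|LI 0 1. (r t x)\<^sup>2))"
  note J_int = CI_iterated(3)[OF dissip_int[OF V], folded J_def]
  have X_int: "integrable (LI 0 T) X"
    unfolding X_def by (rule CI_iterated(3)) (use err_dx_sq[OF V] in \<open>simp add: sqint_def\<close>)
  have E_nonneg: "0 \<le> E t" and X_nonneg: "0 \<le> X t" and \<rho>_nonneg: "0 \<le> \<rho> t" and E0_nonneg: "0 \<le> E0" for t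
    by (simp_all add: E_def X_def \<rho>_def E0_def)
  have cut_lt: "(\<lambda>t. if t < s then f t else (0 :: real)) \<in> borel_measurable (LI 0 T)"
    if "f \<in> borel_measurable (LI 0 T)" for f s
  proof -
    have "(\<lambda>t. indicator {..<s} t * f t) \<in> borel_measurable (LI 0 T)"
      by (rule borel_measurable_times[OF borel_LI that]) simp
    moreover have "(\<lambda>t. indicator {..<s} t * f t) = (\<lambda>t. if t < s then f t else (0 :: real))" by auto
    ultimately show ?thesis by simp
  qed
  have cut_int: "integrable (LI 0 T) (\<lambda>t. if t < s then f t else (0 :: real))" if "integrable (LI 0 T) f" for f s
    by (rule Bochner_Integration.integrable_bound[OF that]) (use that in \<open>auto intro: cut_lt\<close>)
  have CI_cut: "CI T (\<lambda>t x. if t < s then dissip V Vt Vx t x else 0) = (LINT t|LI 0 T. (if t < s then J t else 0))" for s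
  proof -
    have dm: "(\<lambda>z. dissip V Vt Vx (fst z) (snd z)) \<in> borel_measurable (LC T)"
      using dissip_int[OF V] by (rule borel_measurable_integrable)
    have "Cmeas T (\<lambda>t x. indicator {..<s} t * dissip V Vt Vx t x)"
      by (rule borel_measurable_times[OF Cmeas_time[OF borel_LI] dm]) simp
    moreover have "indicator {..<s} t * dissip V Vt Vx t x = (if t < s then dissip V Vt Vx t x else 0)" for t x by simp
    ultimately have m: "Cmeas T (\<lambda>t x. if t < s then dissip V Vt Vx t x else 0)" by simp
    have i: "Cint T (\<lambda>t x. if t < s then dissip V Vt Vx t x else 0)"
      by (rule Bochner_Integration.integrable_bound[OF dissip_int[OF V] m]) simp
    show ?thesis unfolding CI_iterated(1)[OF i] J_def
      by (rule Bochner_Integration.integral_cong) auto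
  qed
  have energy: "E s / 2 \<le> E0 / 2 - (LINT t|LI 0 T. (if t < s then J t else 0))" if s: "0 < s" "s \<le> T" for s
    unfolding E_def E0_def CI_cut[symmetric]
  proof (rule energy_inequality[OF V s])
    show "\<forall>\<eta>>0. \<exists>\<rho>>0. \<forall>t\<in>{0..T}. s - \<rho> \<le> t \<and> t \<le> s \<longrightarrow>
      (LINT x|LI 0 1. (u s x - V s x)\<^sup>2) - \<eta> \<le> (LINT x|LI 0 1. (u t x - V t x)\<^sup>2)"
      by (rule weakly_continuous_lsc[OF wc]) (use s in simp)
  qed (rule bc)
  have E_bound: "E s \<le> E0 + 2 * (LINT t|LI 0 T. \<bar>J t\<bar>)" if s: "0 < s" "s \<le> T" for s
  proof -
    have "- (LINT t|LI 0 T. (if t < s then J t else 0)) = (LINT t|LI 0 T. - (if t < s then J t else 0))" by simp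
    also have "\<dots> \<le> (LINT t|LI 0 T. \<bar>J t\<bar>)"
      by (rule integral_mono) (use cut_int[OF J_int, of s] J_int in auto)
    finally show ?thesis using energy[OF s] by linarith
  qed
  define m where "m = sqrt (SUP s\<in>{0<..\<tau>}. E s)"
  have bdd: "bdd_above (E ` {0<..\<tau>})" by (rule bdd_aboveI2[OF E_bound]) (use \<tau>(2) in auto)
  have ne: "{0<..\<tau>} \<noteq> {}" using \<tau>(1) by simp
  have E_le_m: "E s \<le> m\<^sup>2" if "0 < s" "s \<le> \<tau>" for s
  proof -
    have "E s \<le> (SUP s\<in>{0<..\<tau>}. E s)" by (rule cSUP_upper[OF _ bdd]) (use that in simp)
    then show ?thesis using E_nonneg[of s] by (simp add: m_def)
  qed
  have "0 \<le> (SUP s\<in>{0<..\<tau>}. E s)" by (rule cSUP_upper2[OF bdd, of \<tau>]) (use \<tau>(1) E_nonneg in auto)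
  then have m0: "0 \<le> m" and m_sq: "m\<^sup>2 = (SUP s\<in>{0<..\<tau>}. E s)" by (simp_all add: m_def)
  have \<rho>_meas: "\<rho> \<in> borel_measurable (LI 0 T)"
  proof -
    have "(\<lambda>z. (r (fst z) (snd z))\<^sup>2) \<in> borel_measurable (LI 0 T \<Otimes>\<^sub>M LI 0 1)" using r(1) unfolding LC_def by measurable
    then have "(\<lambda>t. LINT x|LI 0 1. (r t x)\<^sup>2) \<in> borel_measurable (LI 0 T)"
      by (intro LI.borel_measurable_lebesgue_integral) (simp add: case_prod_beta')
    then show ?thesis unfolding \<rho>_def by measurable
  qed
  have R_int: "integrable (LI 0 T) (\<lambda>t. if t < s then \<rho> t else 0)"
    and R_le: "(LINT t|LI 0 T. (if t < s then \<rho> t else 0)) \<le> R" if s: "s \<le> \<tau>" for s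
  proof -
    have "(\<integral>\<^sup>+t. ennreal (if t < s then \<rho> t else 0) \<partial>LI 0 T) \<le> (\<integral>\<^sup>+t. ennreal (if t < \<tau> then \<rho> t else 0) \<partial>LI 0 T)"
      by (rule nn_integral_mono) (use s \<rho>_nonneg in auto)
    also have "\<dots> \<le> ennreal R" using R(1) unfolding \<rho>_def .
    finally have le: "(\<integral>\<^sup>+t. ennreal (if t < s then \<rho> t else 0) \<partial>LI 0 T) \<le> ennreal R" .
    show i: "integrable (LI 0 T) (\<lambda>t. if t < s then \<rho> t else 0)"
    proof (rule integrableI_nonneg[OF cut_lt[OF \<rho>_meas]])
      show "AE t in LI 0 T. 0 \<le> (if t < s then \<rho> t else 0)" using \<rho>_nonneg by auto
      show "(\<integral>\<^sup>+t. ennreal (if t < s then \<rho> t else 0) \<partial>LI 0 T) < \<infinity>" using le by (rule le_less_trans) simp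
    qed
    show "(LINT t|LI 0 T. (if t < s then \<rho> t else 0)) \<le> R"
      by (rule integral_le_nn_integral_bound[OF i _ le R(2)]) (rule AE_I2, rule order_refl)
  qed
  \<comment> \<open>At almost every time: the first residual is paired with the error and bounded by the Cauchy-Schwarz
    inequality, the rest is the functional \<open>Q\<close> that the dual norm controls, and half of the dissipation remains.\<close>
  define Q where "Q = (\<lambda>t. - 2 * ((LINT x|LI 0 1. a t x * (u t x - V t x)) + (LINT x|LI 0 1. Vx t x * (ux t x - Vx t x))) - X t)"
  have J_le: "AE t in LI 0 T. t < \<tau> \<longrightarrow> - J t + \<epsilon> / 2 * X t - m * \<rho> t \<le> \<epsilon> / 2 * Q t"
  proof -
    have Vm: "Cmeas T Vt" "Cmeas T Vx" using V by (auto simp: approximable_def)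
    obtain C where C: "AE z in LC T. \<bar>Vt (fst z) (snd z)\<bar> \<le> C" "AE z in LC T. \<bar>Vx (fst z) (snd z)\<bar> \<le> C"
      using approximable_bounds[OF V T] by blast
    have "AE t in LI 0 T. t \<in> {0<..<T}" by (rule AE_LI_I) simp
    then show ?thesis
      using a r(2) sqint_sections[OF LC.sqint_bounded[OF Vm(1) C(1)]] sqint_sections[OF LC.sqint_bounded[OF Vm(2) C(2)]]
        sqint_sections[where f = "\<lambda>t x. u t x - V t x", OF err_sq[OF V]] sqint_sections[where f = "\<lambda>t x. ux t x - Vx t x", OF err_dx_sq[OF V]]
    proof eventually_elim
      case (elim t)
      show ?case
      proof
        assume lt: "t < \<tau>"
        define e where "e = (\<lambda>x. u t x - V t x)"
        define ex where "ex = (\<lambda>x. ux t x - Vx t x)"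
        have eq: "sqint (LI 0 1) e" and exq: "sqint (LI 0 1) ex" and vt: "sqint (LI 0 1) (Vt t)" and vx: "sqint (LI 0 1) (Vx t)"
          and at: "sqint (LI 0 1) (a t)" and ae: "AE x in LI 0 1. Vt t x + b * Vx t x = r t x + \<epsilon> * a t x"
          using elim lt by (simp_all add: e_def ex_def)
        have rm: "r t \<in> borel_measurable (LI 0 1)" by (rule Cmeas_section[OF r(1)]) (use elim in simp)
        have scale: "sqint (LI 0 1) (\<lambda>x. c * f x)" if "sqint (LI 0 1) f" for c f
          by (rule sqint_bounded_mult[OF that, where C = "\<bar>c\<bar>"]) simp_all
        have "sqint (LI 0 1) (\<lambda>x. (Vt t x + b * Vx t x) - \<epsilon> * a t x)"
          by (rule sqint_diff[OF sqint_add[OF vt scale[OF vx]] scale[OF at]])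
        then have "integrable (LI 0 1) (\<lambda>x. ((Vt t x + b * Vx t x) - \<epsilon> * a t x)\<^sup>2)" by (simp add: sqint_def)
        moreover have "(\<lambda>x. (r t x)\<^sup>2) \<in> borel_measurable (LI 0 1)" by (rule borel_measurable_power[OF rm])
        moreover have "AE x in LI 0 1. ((Vt t x + b * Vx t x) - \<epsilon> * a t x)\<^sup>2 = (r t x)\<^sup>2"
          using ae by eventually_elim simp
        ultimately have rq: "sqint (LI 0 1) (r t)"
          using rm integrable_cong_AE_imp unfolding sqint_def by blast
        note i = sqint_mult[OF eq rq] sqint_mult[OF at eq] sqint_mult[OF vx exq]
        have ix: "integrable (LI 0 1) (\<lambda>x. (ex x)\<^sup>2)" using exq by (simp add: sqint_def)
        have "J t = (LINT x|LI 0 1. e x * r t x + \<epsilon> * (a t x * e x) + \<epsilon> * (Vx t x * ex x) + \<epsilon> * (ex x)\<^sup>2)"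
          unfolding J_def
        proof (rule integral_cong_AE)
          show "AE x in LI 0 1. dissip V Vt Vx t x = e x * r t x + \<epsilon> * (a t x * e x) + \<epsilon> * (Vx t x * ex x) + \<epsilon> * (ex x)\<^sup>2"
            using ae
          proof eventually_elim
            case (elim x)
            have "ux t x = ex x + Vx t x" by (simp add: ex_def)
            then have "dissip V Vt Vx t x = e x * (Vt t x + b * Vx t x) + \<epsilon> * ex x * (ex x + Vx t x)"
              by (simp add: dissip_def e_def ex_def)
            then show ?case unfolding elim by (simp add: algebra_simps power2_eq_square)
          qed
          show "(\<lambda>x. e x * r t x + \<epsilon> * (a t x * e x) + \<epsilon> * (Vx t x * ex x) + \<epsilon> * (ex x)\<^sup>2) \<in> borel_measurable (LI 0 1)"
            by (intro borel_measurable_integrable Bochner_Integration.integrable_add integrable_mult_right i ix)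
          have "Cmeas T (dissip V Vt Vx)" using dissip_int[OF V] by (rule borel_measurable_integrable)
          then show "dissip V Vt Vx t \<in> borel_measurable (LI 0 1)" by (rule Cmeas_section) (use elim in simp)
        qed
        also have "\<dots> = (LINT x|LI 0 1. e x * r t x) + \<epsilon> * (LINT x|LI 0 1. a t x * e x) + \<epsilon> * (LINT x|LI 0 1. Vx t x * ex x) + \<epsilon> * X t"
          using i ix by (simp add: X_def ex_def)
        finally have Jt: "J t = (LINT x|LI 0 1. e x * r t x) + \<epsilon> * (LINT x|LI 0 1. a t x * e x) + \<epsilon> * (LINT x|LI 0 1. Vx t x * ex x) + \<epsilon> * X t" .
        have "\<bar>LINT x|LI 0 1. e x * r t x\<bar> \<le> sqrt (E t) * \<rho> t"
          using sqint_CS[OF eq rq] by (simp add: E_def \<rho>_def e_def)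
        also have "\<dots> \<le> m * \<rho> t"
        proof (rule mult_right_mono[OF _ \<rho>_nonneg])
          have "sqrt (E t) \<le> sqrt (m\<^sup>2)" by (rule real_sqrt_le_mono[OF E_le_m]) (use elim lt in auto)
          then show "sqrt (E t) \<le> m" using m0 by simp
        qed
        finally have "- (LINT x|LI 0 1. e x * r t x) \<le> m * \<rho> t" by linarith
        then show "- J t + \<epsilon> / 2 * X t - m * \<rho> t \<le> \<epsilon> / 2 * Q t"
          unfolding Jt Q_def e_def ex_def by (simp add: algebra_simps)
      qed
    qed
  qed
  define Y where "Y = E0 + 2 * m * R + \<epsilon> * K"
  have step: "E s + \<epsilon> * (LINT t|LI 0 T. (if t < s then X t else 0)) \<le> Y" if s: "0 < s" "s \<le> \<tau>" for s
  proof -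
    define G where "G = (\<lambda>t. - (if t < s then J t else 0) + \<epsilon> / 2 * (if t < s then X t else 0) - m * (if t < s then \<rho> t else 0))"
    have iG: "integrable (LI 0 T) G" unfolding G_def
      by (intro Bochner_Integration.integrable_diff Bochner_Integration.integrable_add Bochner_Integration.integrable_minus
          integrable_mult_right cut_int J_int X_int R_int s)
    have "integral\<^sup>L (LI 0 T) G \<le> \<epsilon> / 2 * K"
    proof (cases "0 < \<epsilon>")
      case True
      have "(LINT t|LI 0 T. 2 / \<epsilon> * G t) \<le> K"
      proof (rule integral_le_nn_integral_bound[OF _ _ K(1)[OF True] K(2)])
        show "integrable (LI 0 T) (\<lambda>t. 2 / \<epsilon> * G t)" using iG by simp
        show "AE t in LI 0 T. ennreal (2 / \<epsilon> * G t) \<le> (if t < \<tau> then k t else 0)"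
          using J_le k[OF True]
        proof eventually_elim
          case (elim t)
          show ?case
          proof (cases "t < s")
            case lt: True
            then have "G t \<le> \<epsilon> / 2 * Q t" using elim(1) s(2) by (simp add: G_def)
            then have "2 / \<epsilon> * G t \<le> 2 / \<epsilon> * (\<epsilon> / 2 * Q t)" using True by (intro mult_left_mono) auto
            also have "\<dots> = Q t" using True by simp
            finally have "ennreal (2 / \<epsilon> * G t) \<le> ennreal (Q t)" by (rule ennreal_leI)
            also have "\<dots> \<le> k t" using elim(2) lt s(2) by (simp add: Q_def X_def)
            finally show ?thesis using lt s(2) by simp
          qed (simp add: G_def)
        qed
      qed
      then show ?thesis using True by (simp add: field_simps)
    next
      case False
      then have e0: "\<epsilon> = 0" using eps by simp
      have "integral\<^sup>L (LI 0 T) G \<le> (LINT t|LI 0 T. 0)"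
      proof (rule integral_mono_AE[OF iG integrable_zero])
        show "AE t in LI 0 T. G t \<le> 0" using J_le
        proof eventually_elim
          case (elim t)
          then show ?case using s(2) by (cases "t < s") (simp_all add: G_def e0)
        qed
      qed
      then show ?thesis by (simp add: e0)
    qed
    moreover have "integral\<^sup>L (LI 0 T) G = - (LINT t|LI 0 T. (if t < s then J t else 0)) + \<epsilon> / 2 * (LINT t|LI 0 T. (if t < s then X t else 0))
        - m * (LINT t|LI 0 T. (if t < s then \<rho> t else 0))"
      unfolding G_def using cut_int[OF J_int, of s] cut_int[OF X_int, of s] R_int[OF s(2)] by simp
    moreover have "m * (LINT t|LI 0 T. (if t < s then \<rho> t else 0)) \<le> m * R" by (rule mult_left_mono[OF R_le[OF s(2)] m0])
    moreover have "E s / 2 \<le> E0 / 2 - (LINT t|LI 0 T. (if t < s then J t else 0))" using energy s \<tau>(2) by simp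
    ultimately have "E s / 2 + \<epsilon> / 2 * (LINT t|LI 0 T. (if t < s then X t else 0)) \<le> E0 / 2 + m * R + \<epsilon> / 2 * K" by linarith
    then show ?thesis unfolding Y_def by (simp add: field_simps)
  qed
  \<comment> \<open>Taking the supremum over \<open>s\<close> gives \<open>m\<^sup>2 \<le> B + 2 m R\<close>, and the inequality \<open>2 m R \<le> m\<^sup>2 / 2 + 2 R\<^sup>2\<close> absorbs \<open>m\<close>.\<close>
  have "m\<^sup>2 \<le> Y" unfolding m_sq
  proof (rule cSUP_least[OF ne])
    fix s assume "s \<in> {0<..\<tau>}"
    then have "E s + \<epsilon> * (LINT t|LI 0 T. (if t < s then X t else 0)) \<le> Y" using step by simp
    moreover have "0 \<le> \<epsilon> * (LINT t|LI 0 T. (if t < s then X t else 0))"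
      using eps X_nonneg by (intro mult_nonneg_nonneg integral_nonneg) auto
    ultimately show "E s \<le> Y" by linarith
  qed
  moreover have "2 * (m * R) \<le> m\<^sup>2 / 2 + 2 * R\<^sup>2"
  proof -
    have "0 \<le> (m - 2 * R)\<^sup>2" by simp
    then show ?thesis by (simp add: power2_diff field_simps power_mult_distrib)
  qed
  ultimately have "Y \<le> 2 * E0 + 4 * R\<^sup>2 + 2 * (\<epsilon> * K)" unfolding Y_def by linarith
  then show ?thesis using step[OF \<tau>(1) order_refl] unfolding E_def E0_def X_def by simp
qed

end

section \<open>Residuals and boundary data in time\<close>

lemma nn_integral_cut:
  assumes "\<tau> \<le> T"
  shows "(\<integral>\<^sup>+t. (if t < \<tau> then k t else 0) \<partial>LI 0 T) = integral\<^sup>N (LI 0 \<tau>) k"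
  unfolding nn_integral_LI[symmetric] by (rule nn_integral_cong) (use assms in \<open>auto simp: indicator_def\<close>)

lemma AE_cut: "\<tau> \<le> T \<Longrightarrow> (AE t in LI 0 T. t < \<tau> \<longrightarrow> P t) \<Longrightarrow> AE t in LI 0 \<tau>. P t"
  unfolding AE_LI by (erule eventually_mono) auto

lemma sqrt_integral_le_L2_norm:
  assumes "f \<in> borel_measurable (LI 0 1)"
  shows "ennreal (sqrt (LINT x|LI 0 1. (f x)\<^sup>2)) \<le> L2_norm f"
proof (cases "integrable (LI 0 1) (\<lambda>x. (f x)\<^sup>2)")
  case True
  then show ?thesis using assms L2_norm_sqint[of f] by (simp add: sqint_def)
next
  case False
  then show ?thesis by (simp add: not_integrable_integral_eq)
qed

lemma L2_norm_cong_AE: "AE x in LI 0 1. f x = g x \<Longrightarrow> L2_norm f = L2_norm g"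
  unfolding L2_norm_def nn_integral_LI
  by (rule arg_cong[where f = ennsqrt], rule nn_integral_cong_AE) (erule eventually_mono, simp)

text \<open>The norm of the first residual is defined with Lebesgue measurability, whereas Fubini and the energy
  estimate are formulated for Borel functions.\<close>

lemma lebesgue_borel_version:
  assumes r: "set_borel_measurable lebesgue (Cyl \<tau>) (\<lambda>(s, x). r s x)" and \<tau>: "\<tau> \<le> T"
  shows "\<exists>r'. Cmeas T r' \<and> (AE t in LI 0 T. t < \<tau> \<longrightarrow> (AE x in LI 0 1. r' t x = r t x))"
proof -
  define f :: "real \<times> real \<Rightarrow> real" where "f = (\<lambda>z. indicator (Cyl \<tau>) z *\<^sub>R (case z of (s, x) \<Rightarrow> r s x))"
  have "f \<in> borel_measurable (completion lborel)" using r by (simp add: f_def set_borel_measurable_def)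
  then obtain g where g: "g \<in> borel_measurable lborel" "AE z in lborel. f z = g z"
    using completion_ex_borel_measurable_real by blast
  have "AE z in LC T. f z = g z" unfolding AE_LC using g(2) by eventually_elim simp
  then have s: "AE t in LI 0 T. AE x in LI 0 1. f (t, x) = g (t, x)" by (rule AE_LC_sections)
  have pos: "AE t in LI 0 T. 0 < t" by (rule AE_LI_I) simp
  have om: "AE x in LI 0 1. x \<in> Omega" by (rule AE_LI_I) simp
  show ?thesis
  proof (intro exI conjI)
    have "g \<in> borel_measurable (LC T)" unfolding LC_eq by (rule measurable_restrict_space1[OF g(1)])
    then show "Cmeas T (\<lambda>t x. g (t, x))" by simp
    show "AE t in LI 0 T. t < \<tau> \<longrightarrow> (AE x in LI 0 1. g (t, x) = r t x)"
      using s pos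
    proof eventually_elim
      case (elim t)
      show ?case
      proof
        assume lt: "t < \<tau>"
        show "AE x in LI 0 1. g (t, x) = r t x" using elim(1) om
          by eventually_elim (use lt elim(2) in \<open>simp add: f_def\<close>)
      qed
    qed
  qed
qed

lemma L1_L2_norm_bound:
  assumes fin: "L1_L2_norm \<tau> r \<noteq> \<infinity>" and \<tau>: "\<tau> \<le> T"
  shows "\<exists>r'. Cmeas T r' \<and> (AE t in LI 0 T. t < \<tau> \<longrightarrow> (AE x in LI 0 1. r' t x = r t x)) \<and>
    (\<integral>\<^sup>+t. ennreal (if t < \<tau> then sqrt (LINT x|LI 0 1. (r' t x)\<^sup>2) else 0) \<partial>LI 0 T) \<le> L1_L2_norm \<tau> r"
proof -
  have m: "set_borel_measurable lebesgue (Cyl \<tau>) (\<lambda>(s, x). r s x)"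
    using fin unfolding L1_L2_norm_def by (auto split: if_splits)
  obtain r' where r': "Cmeas T r'" "AE t in LI 0 T. t < \<tau> \<longrightarrow> (AE x in LI 0 1. r' t x = r t x)"
    using lebesgue_borel_version[OF m \<tau>] by blast
  have "AE t in LI 0 T. t \<in> {0<..<T}" by (rule AE_LI_I) simp
  then have "AE t in LI 0 T. ennreal (if t < \<tau> then sqrt (LINT x|LI 0 1. (r' t x)\<^sup>2) else 0) \<le> (if t < \<tau> then L2_norm (r t) else 0)"
    using r'(2)
  proof eventually_elim
    case (elim t)
    show ?case
    proof (cases "t < \<tau>")
      case True
      then have "L2_norm (r' t) = L2_norm (r t)" using elim(2) by (intro L2_norm_cong_AE) simp
      then show ?thesis using True sqrt_integral_le_L2_norm[OF Cmeas_section[OF r'(1) elim(1)]] by simp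
    qed simp
  qed
  then have "(\<integral>\<^sup>+t. ennreal (if t < \<tau> then sqrt (LINT x|LI 0 1. (r' t x)\<^sup>2) else 0) \<partial>LI 0 T)
      \<le> (\<integral>\<^sup>+t. (if t < \<tau> then L2_norm (r t) else 0) \<partial>LI 0 T)"
    by (rule nn_integral_mono_AE)
  also have "\<dots> = L1_L2_norm \<tau> r" unfolding nn_integral_cut[OF \<tau>] L1_L2_norm_def using m by (simp add: nn_integral_LI)
  finally show ?thesis using r' by blast
qed

lemma L2_Hm1_norm_sq:
  assumes "L2_Hm1_norm \<tau> l \<noteq> \<infinity>"
  shows "(L2_Hm1_norm \<tau> l)\<^sup>2 = integral\<^sup>N (LI 0 \<tau>) (\<lambda>s. (Hm1_norm (l s))\<^sup>2)"
  using assms unfolding L2_Hm1_norm_def by (auto simp: ennsqrt_sq nn_integral_LI split: if_splits)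

lemma W1inf_measurable: "W1inf 0 T h \<Longrightarrow> h \<in> borel_measurable (LI 0 T)"
  unfolding W1inf_def Linf_on_def set_borel_LI by blast

lemma lipschitz_measurable:
  assumes "L-lipschitz_on {0<..<T} h"
  shows "h \<in> borel_measurable (LI 0 T)"
proof -
  have "continuous_on {0<..<T} h" using assms by (rule lipschitz_on_continuous_on)
  then have "h \<in> borel_measurable (restrict_space borel {0<..<T})" by (rule borel_measurable_continuous_on_restrict)
  then show ?thesis by (simp add: measurable_cong_sets[OF sets_LI refl])
qed

text \<open>  The error of the space-time reconstruction, with \<open>X\<close> the square of the \<open>L\<^sup>2(0,\<tau>;L\<^sup>2)\<close>-norm of \<open>\<partial>\<^sub>x(u - uts)\<close>. For \<open>\<epsilon> > 0\<close>
  equal boundary data make \<open>u - uts\<close> an element of \<open>H\<^sub>0\<^sup>1(\<Omega>)\<close> at almost every time, which serves three purposes: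
  no boundary term remains, \<open>uts - u\<close> is admissible in the dual norm, and \<open>u - uts\<close> adds no jumps to the elementwise energy.\<close>

lemma reconstruction_error:
  assumes T: "0 < T" and eps: "0 \<le> \<epsilon>" and es: "entropy_solution T b \<epsilon> u u0" and wu: "weakly_continuous_L2 T u"
    and u0: "L2_on Omega u0" and h1: "0 < \<epsilon> \<Longrightarrow> L2_H1 T u"
    and g: "\<forall>c\<in>dirichlet_boundary b \<epsilon>. g c \<in> borel_measurable (LI 0 T)"
    and tru: "\<forall>c\<in>dirichlet_boundary b \<epsilon>. has_trace T u c (g c)"
    and trV: "\<forall>c\<in>dirichlet_boundary b \<epsilon>. has_trace T (\<lambda>t. dg_fun M x (uts t)) c (g c)"
    and m: "is_mesh M x" and V: "approximable T (\<lambda>t. dg_fun M x (uts t)) Vt (\<lambda>t. dg_fun M x (dg_deriv (uts t)))"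
    and cont: "\<And>t k. \<lbrakk>t \<in> {0..T}; 0 < k; k < M\<rbrakk> \<Longrightarrow> poly (uts t (k - 1)) (x k) = poly (uts t k) (x k)"
    and wc: "weakly_continuous_L2 T (\<lambda>t y. u t y - dg_fun M x (uts t) y)"
    and \<tau>: "0 < \<tau>" "\<tau> \<le> T"
  shows "\<exists>X. 0 \<le> X \<and>
    ennreal ((LINT y|LI 0 1. (u \<tau> y - dg_fun M x (uts \<tau>) y)\<^sup>2) + \<epsilon> * X)
      \<le> 2 * (L2_norm (\<lambda>y. u 0 y - dg_fun M x (uts 0) y))\<^sup>2 + 4 * (L1_L2_norm \<tau> (residual1 M x b \<epsilon> A T ut uts))\<^sup>2
        + 2 * (ennreal \<epsilon> * (L2_Hm1_norm \<tau> (residual2 M x A ut uts))\<^sup>2) \<and>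
    (0 < \<epsilon> \<longrightarrow> (\<forall>z. dg_energy_sq M x \<tau> (\<lambda>t y. u t y - dg_fun M x (z t) y)
        \<le> 2 * ennreal X + 2 * dg_energy_sq M x \<tau> (\<lambda>t y. dg_fun M x (uts t) y - dg_fun M x (z t) y)))"
proof -
  define V where "V = (\<lambda>t. dg_fun M x (uts t))"
  define Vx where "Vx = (\<lambda>t. dg_fun M x (dg_deriv (uts t)))"
  define a where "a = (\<lambda>t. dg_fun M x (A (ut t)))"
  note Vap = V[folded V_def Vx_def]
  obtain ux where vs: "viscous_solution T b \<epsilon> u ux u0" and uxw: "0 < \<epsilon> \<Longrightarrow> AE t in LI 0 T. has_weak_deriv 0 1 (u t) (ux t)"
    using entropy_solution_viscous[OF T eps es u0 h1] by blast
  interpret viscous_solution T b \<epsilon> u ux u0 by (rule vs)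
  define e where "e = (\<lambda>t x. u t x - V t x)"
  define ex where "ex = (\<lambda>t x. ux t x - Vx t x)"
  have em: "Cmeas T e" unfolding e_def using err_sq[OF Vap] by (simp add: sqint_def)
  have exq: "sqint (LC T) (\<lambda>z. ex (fst z) (snd z))" unfolding ex_def by (rule err_dx_sq[OF Vap])
  have in_T: "AE t in LI 0 T. t \<in> {0<..<T}" by (rule AE_LI_I) simp
  have Vm: "Cmeas T V" using Vap by (simp add: approximable_def)
  have rep: "AE t in LI 0 T. sqint (LI 0 1) (ex t) \<and> primitive 0 1 0 (ex t) 1 = 0 \<and> (AE y in LI 0 1. e t y = primitive 0 1 0 (ex t) y)"
    if pos: "0 < \<epsilon>"
  proof (rule zero_trace_representative[OF em exq])
    show "AE t in LI 0 T. has_weak_deriv 0 1 (e t) (ex t)"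
      using uxw[OF pos] in_T
    proof eventually_elim
      case (elim t)
      have "has_weak_deriv 0 1 (V t) (Vx t)" unfolding V_def Vx_def
        by (rule dg_fun_weak_deriv[OF m cont]) (use elim(2) in auto)
      then show ?case unfolding e_def ex_def by (rule weak_deriv_diff[OF elim(1)]) simp
    qed
    fix c :: real assume "c \<in> {0, 1}"
    then have c: "c \<in> dirichlet_boundary b \<epsilon>" using pos by (auto simp: dirichlet_boundary_def)
    show "(\<lambda>n. (\<integral>\<^sup>+z. ennreal \<bar>e (fst z) (snd z)\<bar> * indicator (strip c (1 / real (Suc n))) (snd z) \<partial>LC T) / ennreal (1 / real (Suc n))) \<longlonglongrightarrow> 0"
      unfolding e_def
    proof (rule trace_difference[where \<delta> = "\<lambda>n. 1 / real (Suc n)"])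
      show "has_trace T u c (g c)" "has_trace T V c (g c)" "g c \<in> borel_measurable (LI 0 T)"
        using tru trV g c by (auto simp: V_def)
      show "(\<lambda>n. 1 / real (Suc n)) \<longlonglongrightarrow> 0" using inv_Suc_lim[of 1] by (simp only: mult_1)
    qed (use um Vm in simp_all)
  qed
  have bc: "no_boundary_gain V \<theta>"
    if \<theta>: "smooth \<theta>" "\<forall>t. 0 \<le> \<theta> t \<and> \<theta> t \<le> 1" for \<theta>
  proof (cases "0 < \<epsilon>")
    case True
    show ?thesis by (rule boundary_diffusion[OF Vap rep[OF True, unfolded e_def ex_def] \<theta>])
  next
    case False
    then have e0: "\<epsilon> = 0" using eps by simp
    obtain B where "AE z in lborel. z \<in> Cyl T \<longrightarrow> \<bar>case z of (t, y) \<Rightarrow> u t y\<bar> \<le> B"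
      using es unfolding entropy_solution_def Linf_on_def by blast
    then have B: "AE z in LC T. \<bar>u (fst z) (snd z)\<bar> \<le> B" unfolding AE_LC by (simp add: case_prod_beta)
    have "\<forall>c\<in>inflow_boundary b. has_trace T u c (g c) \<and> has_trace T V c (g c) \<and> g c \<in> borel_measurable (LI 0 T)"
      using tru trV g e0 by (simp add: dirichlet_boundary_def V_def)
    from boundary_transport[OF Vap e0 B this \<theta>] show ?thesis .
  qed
  define X where "X = (\<lambda>t. LINT y|LI 0 1. (ex t y)\<^sup>2)"
  have X_int: "integrable (LI 0 T) X"
    unfolding X_def by (rule CI_iterated(3)) (use exq in \<open>simp add: sqint_def\<close>)
  have X0: "0 \<le> X t" for t by (simp add: X_def)
  define Xb where "Xb = (LINT t|LI 0 T. (if t < \<tau> then X t else 0))"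
  have Xb0: "0 \<le> Xb" unfolding Xb_def by (rule integral_nonneg_AE) (use X0 in auto)
  have iv: "(LINT y|LI 0 1. (u0 y - V 0 y)\<^sup>2) = (LINT y|LI 0 1. (u 0 y - V 0 y)\<^sup>2)"
  proof (rule integral_cong_AE)
    have uu: "u0 \<in> borel_measurable (LI 0 1)" "u 0 \<in> borel_measurable (LI 0 1)"
      using u0 wu T by (auto simp: weakly_continuous_L2_def L2_on_LI sqint_def)
    have V0: "V 0 \<in> borel_measurable (LI 0 1)" unfolding V_def by (rule borel_LI[OF dg_fun_borel])
    show "(\<lambda>y. (u0 y - V 0 y)\<^sup>2) \<in> borel_measurable (LI 0 1)" "(\<lambda>y. (u 0 y - V 0 y)\<^sup>2) \<in> borel_measurable (LI 0 1)"
      by (intro borel_measurable_power borel_measurable_diff uu V0)+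
    show "AE y in LI 0 1. (u0 y - V 0 y)\<^sup>2 = (u 0 y - V 0 y)\<^sup>2" using initial_value[OF wu] by eventually_elim simp
  qed
  have E0q: "sqint (LI 0 1) (\<lambda>y. u 0 y - V 0 y)"
    using wc T unfolding weakly_continuous_L2_def V_def by (auto simp: L2_on_LI sqint_def)
  let ?r1 = "residual1 M x b \<epsilon> A T ut uts" and ?r2 = "residual2 M x A ut uts"
  have est: "ennreal ((LINT y|LI 0 1. (u \<tau> y - V \<tau> y)\<^sup>2) + \<epsilon> * Xb)
      \<le> 2 * (L2_norm (\<lambda>y. u 0 y - V 0 y))\<^sup>2 + 4 * (L1_L2_norm \<tau> ?r1)\<^sup>2 + 2 * (ennreal \<epsilon> * (L2_Hm1_norm \<tau> ?r2)\<^sup>2)"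
  proof (cases "L1_L2_norm \<tau> ?r1 = \<infinity> \<or> 0 < \<epsilon> \<and> L2_Hm1_norm \<tau> ?r2 = \<infinity>")
    case True
    then have rhs: "2 * (L2_norm (\<lambda>y. u 0 y - V 0 y))\<^sup>2 + 4 * (L1_L2_norm \<tau> ?r1)\<^sup>2 + 2 * (ennreal \<epsilon> * (L2_Hm1_norm \<tau> ?r2)\<^sup>2) = \<infinity>"
      by (auto simp: power2_eq_square ennreal_mult_top ennreal_mult_eq_top_iff ennreal_top_mult)
    show ?thesis unfolding rhs by simp
  next
    case False
    then have fin1: "L1_L2_norm \<tau> ?r1 \<noteq> \<infinity>" and fin2: "0 < \<epsilon> \<Longrightarrow> L2_Hm1_norm \<tau> ?r2 \<noteq> \<infinity>" by auto
    obtain r where r: "Cmeas T r" "AE t in LI 0 T. t < \<tau> \<longrightarrow> (AE y in LI 0 1. r t y = ?r1 t y)"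
      "(\<integral>\<^sup>+t. ennreal (if t < \<tau> then sqrt (LINT x|LI 0 1. (r t x)\<^sup>2) else 0) \<partial>LI 0 T) \<le> L1_L2_norm \<tau> ?r1"
      using L1_L2_norm_bound[OF fin1 \<tau>(2)] by blast
    define R where "R = enn2real (L1_L2_norm \<tau> ?r1)"
    have Req: "L1_L2_norm \<tau> ?r1 = ennreal R" using fin1 by (simp add: R_def less_top)
    define K where "K = (if 0 < \<epsilon> then enn2real ((L2_Hm1_norm \<tau> ?r2)\<^sup>2) else 0)"
    have Keq: "(L2_Hm1_norm \<tau> ?r2)\<^sup>2 = ennreal K" if "0 < \<epsilon>"
    proof -
      have "(L2_Hm1_norm \<tau> ?r2)\<^sup>2 \<noteq> top"
        using fin2[OF that] by (simp add: power2_eq_square ennreal_mult_eq_top_iff)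
      then show ?thesis using that by (simp add: K_def less_top)
    qed
    have wdt: "AE t in LI 0 T. AE y in LI 0 1. weak_dt T V t y = Vt t y"
      using AE_LC_sections[OF weak_dt_AE[OF approximable_weak_dt[OF Vap T]]] by simp
    have "(LINT y|LI 0 1. (u \<tau> y - V \<tau> y)\<^sup>2) + \<epsilon> * (LINT t|LI 0 T. (if t < \<tau> then (LINT y|LI 0 1. (ux t y - Vx t y)\<^sup>2) else 0))
      \<le> 2 * (LINT y|LI 0 1. (u0 y - V 0 y)\<^sup>2) + 4 * R\<^sup>2 + 2 * \<epsilon> * K"
    proof (rule energy_estimate[OF Vap \<tau>, where a = a and r = r and k = "\<lambda>t. (Hm1_norm (?r2 t))\<^sup>2"])
      show "no_boundary_gain V \<theta>"
        if "smooth \<theta>" "\<forall>t. 0 \<le> \<theta> t \<and> \<theta> t \<le> 1" for \<theta>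
        by (rule bc[OF that])
      show "weakly_continuous_L2 T (\<lambda>t y. u t y - V t y)" unfolding V_def by (rule wc)
      show "AE t in LI 0 T. t < \<tau> \<longrightarrow> sqint (LI 0 1) (a t)" unfolding a_def by (simp add: dg_fun_sqint)
      show "Cmeas T r" by (rule r(1))
      show "AE t in LI 0 T. t < \<tau> \<longrightarrow> (AE y in LI 0 1. Vt t y + b * Vx t y = r t y + \<epsilon> * a t y)"
        using r(2) wdt
      proof eventually_elim
        case (elim t)
        show ?case
        proof
          assume "t < \<tau>"
          with elim(1) have "AE y in LI 0 1. r t y = ?r1 t y" by simp
          then show "AE y in LI 0 1. Vt t y + b * Vx t y = r t y + \<epsilon> * a t y"
            using elim(2) by eventually_elim (simp add: residual1_def V_def Vx_def a_def)
        qed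
      qed
      show "(\<integral>\<^sup>+t. ennreal (if t < \<tau> then sqrt (LINT x|LI 0 1. (r t x)\<^sup>2) else 0) \<partial>LI 0 T) \<le> ennreal R"
        using r(3) unfolding Req .
      show "0 \<le> R" "0 \<le> K" by (simp_all add: R_def K_def)
      assume pos: "0 < \<epsilon>"
      show "(\<integral>\<^sup>+t. (if t < \<tau> then (Hm1_norm (?r2 t))\<^sup>2 else 0) \<partial>LI 0 T) \<le> ennreal K"
        unfolding nn_integral_cut[OF \<tau>(2)] L2_Hm1_norm_sq[OF fin2[OF pos], symmetric] Keq[OF pos] by (rule order_refl)
      show "AE t in LI 0 T. t < \<tau> \<longrightarrow>
        ennreal (- 2 * ((LINT x|LI 0 1. a t x * (u t x - V t x)) + (LINT x|LI 0 1. Vx t x * (ux t x - Vx t x)))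
           - (LINT x|LI 0 1. (ux t x - Vx t x)\<^sup>2)) \<le> (Hm1_norm (?r2 t))\<^sup>2"
        using rep[OF pos] in_T
      proof eventually_elim
        case (elim t)
        have r2: "?r2 t = (\<lambda>\<phi>. (LINT y:Omega|lborel. a t y * \<phi> y) - (- (LINT y:Omega|lborel. Vx t y * wderiv 0 1 \<phi> y)))"
          by (rule ext) (simp add: residual2_def a_def Vx_def)
        have "e t \<in> borel_measurable (LI 0 1)" by (rule Cmeas_section[OF em elim(2)])
        moreover have "sqint (LI 0 1) (a t)" "sqint (LI 0 1) (Vx t)" by (simp_all add: a_def Vx_def dg_fun_sqint)
        ultimately show ?case
          using dual_norm_bound[of "ex t" "e t" "a t" "Vx t"] elim(1) unfolding r2 e_def ex_def by blast
      qed
    qed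
    then have "(LINT y|LI 0 1. (u \<tau> y - V \<tau> y)\<^sup>2) + \<epsilon> * Xb
      \<le> 2 * (LINT y|LI 0 1. (u 0 y - V 0 y)\<^sup>2) + 4 * R\<^sup>2 + 2 * (\<epsilon> * K)"
      unfolding iv Xb_def X_def ex_def by (simp only: mult.assoc)
    then have "ennreal ((LINT y|LI 0 1. (u \<tau> y - V \<tau> y)\<^sup>2) + \<epsilon> * Xb)
      \<le> ennreal (2 * (LINT y|LI 0 1. (u 0 y - V 0 y)\<^sup>2) + 4 * R\<^sup>2 + 2 * (\<epsilon> * K))" by (rule ennreal_leI)
    also have "\<dots> = 2 * (L2_norm (\<lambda>y. u 0 y - V 0 y))\<^sup>2 + 4 * (L1_L2_norm \<tau> ?r1)\<^sup>2 + 2 * (ennreal \<epsilon> * ennreal K)"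
    proof -
      have "0 \<le> R" "0 \<le> K" by (simp_all add: R_def K_def)
      then show ?thesis unfolding L2_norm_sq_sqint[OF E0q] Req using eps
        by (simp add: ennreal_plus ennreal_mult ennreal_power)
    qed
    also have "ennreal \<epsilon> * ennreal K = ennreal \<epsilon> * (L2_Hm1_norm \<tau> ?r2)\<^sup>2"
    proof (cases "0 < \<epsilon>")
      case True then show ?thesis by (simp add: Keq)
    next
      case False then show ?thesis using eps by (simp add: ennreal_neg)
    qed
    finally show ?thesis .
  qed
  have en: "dg_energy_sq M x \<tau> (\<lambda>t y. u t y - dg_fun M x (z t) y)
        \<le> 2 * ennreal Xb + 2 * dg_energy_sq M x \<tau> (\<lambda>t y. V t y - dg_fun M x (z t) y)" if pos: "0 < \<epsilon>" for z
  proof -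
    have Xm: "X \<in> borel_measurable (LI 0 \<tau>)"
      by (rule LI_subinterval(1)[OF _ borel_measurable_integrable[OF X_int]]) (use \<tau>(2) in auto)
    have "dg_energy_sq M x \<tau> (\<lambda>t y. u t y - dg_fun M x (z t) y)
       \<le> integral\<^sup>N (LI 0 \<tau>) (\<lambda>s. 2 * ennreal (X s)) + ennreal 2 * dg_energy_sq M x \<tau> (\<lambda>t y. V t y - dg_fun M x (z t) y)"
      unfolding dg_energy_sq_def nn_integral_LI[where a = 0 and b = \<tau>]
    proof (rule nn_integral_add_mult_le)
      show "(\<lambda>s. 2 * ennreal (X s)) \<in> borel_measurable (LI 0 \<tau>)" using Xm by measurable
      show "2 * ennreal (X s) \<noteq> \<infinity>" for s by (simp add: ennreal_mult_eq_top_iff)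
      show "AE s in LI 0 \<tau>. elementwise_energy M x (\<lambda>y. u s y - dg_fun M x (z s) y)
         \<le> 2 * ennreal (X s) + ennreal 2 * elementwise_energy M x (\<lambda>y. V s y - dg_fun M x (z s) y)"
      proof (rule AE_cut[OF \<tau>(2)], use uxw[OF pos] rep[OF pos] in_T in eventually_elim, rule impI)
        fix s assume s: "has_weak_deriv 0 1 (u s) (ux s)" "s \<in> {0<..<T}"
          and rp: "sqint (LI 0 1) (ex s) \<and> primitive 0 1 0 (ex s) 1 = 0 \<and> (AE y in LI 0 1. e s y = primitive 0 1 0 (ex s) y)"
        have us: "u s \<in> borel_measurable (LI 0 1)" by (rule Cmeas_section[OF um s(2)])
        show "elementwise_energy M x (\<lambda>y. u s y - dg_fun M x (z s) y)
         \<le> 2 * ennreal (X s) + ennreal 2 * elementwise_energy M x (\<lambda>y. V s y - dg_fun M x (z s) y)"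
          unfolding V_def X_def ennreal_numeral
        proof (rule energy_of_difference[OF m us s(1)])
          show "ex s y = ux s y - dg_fun M x (dg_deriv (uts s)) y" for y by (simp add: ex_def Vx_def)
          show "sqint (LI 0 1) (ex s)" "primitive 0 1 0 (ex s) 1 = 0" using rp by blast+
          show "AE y in LI 0 1. u s y - dg_fun M x (uts s) y = primitive 0 1 0 (ex s) y"
            using rp unfolding e_def V_def by blast
        qed
      qed
    qed simp
    also have "integral\<^sup>N (LI 0 \<tau>) (\<lambda>s. 2 * ennreal (X s)) = 2 * ennreal Xb"
    proof -
      have i: "integrable (LI 0 T) (\<lambda>t. if t < \<tau> then X t else 0)"
      proof (rule Bochner_Integration.integrable_bound[OF X_int])
        have "(\<lambda>t. indicator {..<\<tau>} t * X t) \<in> borel_measurable (LI 0 T)"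
          by (rule borel_measurable_times[OF borel_LI borel_measurable_integrable[OF X_int]]) simp
        moreover have "(\<lambda>t. indicator {..<\<tau>} t * X t) = (\<lambda>t. if t < \<tau> then X t else 0)" by auto
        ultimately show "(\<lambda>t. if t < \<tau> then X t else 0) \<in> borel_measurable (LI 0 T)" by simp
      qed auto
      have "integral\<^sup>N (LI 0 \<tau>) (\<lambda>s. ennreal (X s)) = (\<integral>\<^sup>+t. ennreal (if t < \<tau> then X t else 0) \<partial>LI 0 T)"
        unfolding nn_integral_cut[OF \<tau>(2), symmetric] by (rule nn_integral_cong) simp
      also have "\<dots> = ennreal Xb" unfolding Xb_def by (rule nn_integral_eq_integral[OF i]) (use X0 in auto)
      finally show ?thesis using Xm by (subst nn_integral_cmult) auto
    qed
    finally show ?thesis by simp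
  qed
  show ?thesis using Xb0 est en unfolding V_def by blast
qed

section \<open>The a posteriori estimate\<close>

text \<open>
  What remains is the triangle inequality: \<open>u - u_h = (u - uts) + (uts - u_h)\<close>. The numbers \<open>8\<close> and \<open>2\<close> come from \<open>(a + c)\<^sup>2 \<le> 2 a\<^sup>2 + 2 c\<^sup>2\<close>,
  which gives \<open>\<epsilon> X\<close> the factor \<open>4\<close>, and from the factor \<open>2\<close> in the bound for the error of the reconstruction.
\<close>

theorem corollary4p8:
  fixes T b \<epsilon> :: real
    and u g :: "real \<Rightarrow> real \<Rightarrow> real" and u0 :: "real \<Rightarrow> real"
    and M q :: nat and x :: "nat \<Rightarrow> real"
    and w F :: "real \<Rightarrow> real \<Rightarrow> real" and A :: "dg \<Rightarrow> dg"
    and s p N :: nat and a :: "bool \<Rightarrow> nat \<Rightarrow> nat \<Rightarrow> real" and \<beta> :: "bool \<Rightarrow> nat \<Rightarrow> real"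
    and tt :: "nat \<Rightarrow> real" and uh :: "nat \<Rightarrow> dg" and ut uts :: "real \<Rightarrow> dg"
  assumes "T > 0" and "\<epsilon> \<ge> 0"
    and "entropy_solution T b \<epsilon> u u0"
    and "weakly_continuous_L2 T u"
    and "\<epsilon> > 0 \<Longrightarrow> L2_H1 T u \<and> H1 u0 \<and> (\<forall>c\<in>{0, 1}. W1inf 0 T (\<lambda>t. g t c))"
    and "\<epsilon> = 0 \<Longrightarrow> Linf_on (Cyl T) (\<lambda>(t, y). u t y) \<and> Linf_on Omega u0 \<and>
           (\<forall>c\<in>inflow_boundary b. \<exists>L. L-lipschitz_on {0<..<T} (\<lambda>t. g t c))"
    and "\<forall>c\<in>dirichlet_boundary b \<epsilon>. has_trace T u c (\<lambda>t. g t c)"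
    and "is_mesh M x" and "q \<ge> 1"
    and "numerical_flux b (mesh_size M x) w F"
    and "discrete_laplacian M x q b \<epsilon> F A"
    and "tt 0 = 0" and "tt N = T" and "\<forall>n<N. tt n < tt (Suc n)"
    and "rk_order s a \<beta> p" and "p \<le> 3"
    and "rkdg_approximation M x q b \<epsilon> F A s a \<beta> N tt (u 0) uh"
    and "temporal_reconstruction M x q (semi_rhs M x q b \<epsilon> F A) N tt uh ut"
    and "space_time_reconstruction M x q w T ut uts"
    and "\<forall>c\<in>dirichlet_boundary b \<epsilon>. has_trace T (\<lambda>t. dg_fun M x (uts t)) c (\<lambda>t. g t c)"
  shows "\<forall>i\<le>N.
    (L2_norm (\<lambda>y. u (tt i) y - dg_fun M x (uh i) y))\<^sup>2
      + 2 * ennreal \<epsilon> * dg_energy_sq M x (tt i) (\<lambda>t y. u t y - dg_fun M x (ut t) y)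
    \<le> 8 * ((L2_norm (\<lambda>y. u 0 y - dg_fun M x (uts 0) y))\<^sup>2
           + 4 * (L1_L2_norm (tt i) (residual1 M x b \<epsilon> A T ut uts))\<^sup>2
           + ennreal \<epsilon> * (L2_Hm1_norm (tt i) (residual2 M x A ut uts))\<^sup>2)
      + 2 * ((L2_norm (\<lambda>y. dg_fun M x (uts (tt i)) y - dg_fun M x (uh i) y))\<^sup>2
             + 2 * ennreal \<epsilon> * dg_energy_sq M x (tt i)
                 (\<lambda>t y. dg_fun M x (uts t) y - dg_fun M x (ut t) y))"
proof (intro allI impI)
  fix i assume i: "i \<le> N"
  note mesh = \<open>is_mesh M x\<close> and wu = \<open>weakly_continuous_L2 T u\<close>
  note mf = mesh_facts[OF mesh]
  have N: "0 < N" using \<open>T > 0\<close> \<open>tt 0 = 0\<close> \<open>tt N = T\<close> by (cases N) auto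
  have le: "l \<le> m \<Longrightarrow> m \<le> N \<Longrightarrow> tt l \<le> tt m" for l m
  proof (induction m)
    case (Suc m)
    have "tt m < tt (Suc m)" using \<open>\<forall>n<N. tt n < tt (Suc n)\<close> Suc.prems by simp
    moreover have "tt l \<le> tt m" if "l \<noteq> Suc m" using Suc that by simp
    ultimately show ?case by (cases "l = Suc m") auto
  qed simp
  have t_in: "0 \<le> tt i" "tt i \<le> T" using le[of 0 i] le[of i N] i \<open>tt 0 = 0\<close> \<open>tt N = T\<close> by simp_all
  note st = \<open>space_time_reconstruction M x q w T ut uts\<close>
  have utL: "Lip T (\<lambda>t. coeff (ut t j) l)" for j l
    using temporal_reconstruction_coefficients(1)[OF \<open>temporal_reconstruction M x q (semi_rhs M x q b \<epsilon> F A) N tt uh ut\<close> \<open>tt 0 = 0\<close> \<open>\<forall>n<N. tt n < tt (Suc n)\<close> N]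
    unfolding \<open>tt N = T\<close> .
  have utd: "degree (ut t j) \<le> q" if "j < M" "t \<in> {0..T}" for j t
    using temporal_reconstruction_coefficients(2)[OF \<open>temporal_reconstruction M x q (semi_rhs M x q b \<epsilon> F A) N tt uh ut\<close> \<open>tt 0 = 0\<close> \<open>\<forall>n<N. tt n < tt (Suc n)\<close> N that(1), unfolded \<open>tt N = T\<close>, OF that(2)] .
  have wL: "\<forall>p. \<exists>\<delta>>0. \<exists>L. L-lipschitz_on (ball p \<delta>) (\<lambda>(a, c). w a c)"
  proof -
    have "flux_base w" using \<open>numerical_flux b (mesh_size M x) w F\<close> unfolding numerical_flux_def by (rule conjunct1)
    then show ?thesis unfolding flux_base_def by (rule conjunct1)
  qed
  have utsL: "Lip T (\<lambda>t. coeff (uts t j) l)" if "j < M" for j l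
    by (rule space_time_coefficients_Lip[OF mesh \<open>q \<ge> 1\<close> wL st utL utd that])
  have utsd: "degree (uts t j) \<le> q + 1" if "j < M" "t \<in> {0..T}" for j t
    using st that unfolding space_time_reconstruction_def DG_def by blast
  have cont: "poly (uts t (k - 1)) (x k) = poly (uts t k) (x k)" if "t \<in> {0..T}" "0 < k" "k < M" for t k
  proof -
    have "left_val M x (uts t) k = right_val x (uts t) k"
      using st that unfolding space_time_reconstruction_def by metis
    then show ?thesis using that(2) by (simp add: left_val_def right_val_def)
  qed
  obtain Vt where V: "approximable T (\<lambda>t. dg_fun M x (uts t)) Vt (\<lambda>t. dg_fun M x (dg_deriv (uts t)))"
    using dg_fun_approximable[OF mesh \<open>T > 0\<close> utsL utsd cont] by blast
  have wc: "weakly_continuous_L2 T (\<lambda>t y. u t y - dg_fun M x (uts t) y)"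
    by (rule weakly_continuous_minus_dg[OF wu utsL utsd])
  have uq: "sqint (LI 0 1) (u t)" if "t \<in> {0..T}" for t
    using wu that by (auto simp: weakly_continuous_L2_def L2_on_LI sqint_def)
  let ?V = "\<lambda>t. dg_fun M x (uts t)"
  let ?r1 = "L1_L2_norm (tt i) (residual1 M x b \<epsilon> A T ut uts)"
  let ?r2 = "L2_Hm1_norm (tt i) (residual2 M x A ut uts)"
  let ?E0 = "(L2_norm (\<lambda>y. u 0 y - ?V 0 y))\<^sup>2"
  let ?c = "(L2_norm (\<lambda>y. ?V (tt i) y - dg_fun M x (uh i) y))\<^sup>2"
  let ?D = "dg_energy_sq M x (tt i) (\<lambda>t y. ?V t y - dg_fun M x (ut t) y)"
  have tri: "(L2_norm (\<lambda>y. u (tt i) y - dg_fun M x (uh i) y))\<^sup>2 \<le> 2 * (L2_norm (\<lambda>y. u (tt i) y - ?V (tt i) y))\<^sup>2 + 2 * ?c"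
    by (rule L2_norm_triangle_sq) (use uq t_in dg_fun_sqint in auto)
  show "(L2_norm (\<lambda>y. u (tt i) y - dg_fun M x (uh i) y))\<^sup>2
      + 2 * ennreal \<epsilon> * dg_energy_sq M x (tt i) (\<lambda>t y. u t y - dg_fun M x (ut t) y)
    \<le> 8 * (?E0 + 4 * ?r1\<^sup>2 + ennreal \<epsilon> * ?r2\<^sup>2) + 2 * (?c + 2 * ennreal \<epsilon> * ?D)"
  proof (cases "tt i = 0")
    case True
    have "(L2_norm (\<lambda>y. u (tt i) y - dg_fun M x (uh i) y))\<^sup>2 \<le> 2 * ?E0 + 2 * ?c" using tri by (simp add: True)
    also have "\<dots> \<le> 8 * (?E0 + 4 * ?r1\<^sup>2 + ennreal \<epsilon> * ?r2\<^sup>2) + 2 * (?c + 2 * ennreal \<epsilon> * ?D)"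
      by (intro add_mono mult_mono) auto
    finally show ?thesis by (simp add: True dg_energy_sq_def)
  next
    case False
    then have pos: "0 < tt i" using t_in by simp
    have u0: "L2_on Omega u0"
    proof (cases "0 < \<epsilon>")
      case True
      then show ?thesis using assms(5) by (simp add: H1_def)
    next
      case False
      then have "Linf_on Omega u0" using assms(2,6) by simp
      then obtain B where "u0 \<in> borel_measurable (LI 0 1)" "AE y in LI 0 1. \<bar>u0 y\<bar> \<le> B"
        unfolding Linf_on_def set_borel_LI AE_LI by blast
      then have "sqint (LI 0 1) u0" by (rule LI.sqint_bounded)
      then show ?thesis by (simp add: L2_on_LI sqint_def)
    qed
    have g: "\<forall>c\<in>dirichlet_boundary b \<epsilon>. (\<lambda>t. g t c) \<in> borel_measurable (LI 0 T)"
    proof (cases "0 < \<epsilon>")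
      case True
      then show ?thesis using assms(5) by (auto simp: dirichlet_boundary_def intro: W1inf_measurable)
    next
      case False
      then have "\<forall>c\<in>inflow_boundary b. \<exists>L. L-lipschitz_on {0<..<T} (\<lambda>t. g t c)" using assms(2,6) by simp
      then show ?thesis using False lipschitz_measurable unfolding dirichlet_boundary_def by auto
    qed
    have h1: "L2_H1 T u" if "0 < \<epsilon>" using assms(5) that by blast
    obtain X where X: "0 \<le> X"
      "ennreal ((LINT y|LI 0 1. (u (tt i) y - ?V (tt i) y)\<^sup>2) + \<epsilon> * X) \<le> 2 * ?E0 + 4 * ?r1\<^sup>2 + 2 * (ennreal \<epsilon> * ?r2\<^sup>2)"
      "0 < \<epsilon> \<longrightarrow> (\<forall>z. dg_energy_sq M x (tt i) (\<lambda>t y. u t y - dg_fun M x (z t) y)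
        \<le> 2 * ennreal X + 2 * dg_energy_sq M x (tt i) (\<lambda>t y. ?V t y - dg_fun M x (z t) y))"
      using reconstruction_error[OF \<open>T > 0\<close> \<open>\<epsilon> \<ge> 0\<close> \<open>entropy_solution T b \<epsilon> u u0\<close> wu u0 h1 g
          \<open>\<forall>c\<in>dirichlet_boundary b \<epsilon>. has_trace T u c (\<lambda>t. g t c)\<close>
          \<open>\<forall>c\<in>dirichlet_boundary b \<epsilon>. has_trace T (\<lambda>t. dg_fun M x (uts t)) c (\<lambda>t. g t c)\<close> mesh V cont wc pos t_in(2), of A ut]
      by blast
    define e where "e = (L2_norm (\<lambda>y. u (tt i) y - ?V (tt i) y))\<^sup>2"
    have eX: "e + ennreal \<epsilon> * ennreal X \<le> 2 * ?E0 + 4 * ?r1\<^sup>2 + 2 * (ennreal \<epsilon> * ?r2\<^sup>2)"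
    proof -
      have "sqint (LI 0 1) (\<lambda>y. u (tt i) y - ?V (tt i) y)" using uq t_in by (intro sqint_diff dg_fun_sqint) auto
      then have "e + ennreal \<epsilon> * ennreal X = ennreal ((LINT y|LI 0 1. (u (tt i) y - ?V (tt i) y)\<^sup>2) + \<epsilon> * X)"
        using X(1) \<open>\<epsilon> \<ge> 0\<close> by (simp add: e_def L2_norm_sq_sqint ennreal_plus ennreal_mult)
      then show ?thesis using X(2) by simp
    qed
    have D: "ennreal \<epsilon> * dg_energy_sq M x (tt i) (\<lambda>t y. u t y - dg_fun M x (ut t) y) \<le> ennreal \<epsilon> * (2 * ennreal X + 2 * ?D)"
    proof (cases "0 < \<epsilon>")
      case True
      then show ?thesis using X(3) by (intro mult_left_mono) auto
    next
      case False
      then show ?thesis by (simp add: ennreal_neg)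
    qed
    have "(L2_norm (\<lambda>y. u (tt i) y - dg_fun M x (uh i) y))\<^sup>2
      + 2 * ennreal \<epsilon> * dg_energy_sq M x (tt i) (\<lambda>t y. u t y - dg_fun M x (ut t) y)
      \<le> (2 * e + 2 * ?c) + 2 * (ennreal \<epsilon> * (2 * ennreal X + 2 * ?D))"
      using tri mult_left_mono[OF D, of 2] unfolding e_def mult.assoc by (intro add_mono) auto
    also have "\<dots> \<le> (4 * e + 2 * ?c) + 2 * (ennreal \<epsilon> * (2 * ennreal X + 2 * ?D))"
      by (intro add_mono mult_mono) auto
    also have "\<dots> = 4 * (e + ennreal \<epsilon> * ennreal X) + 2 * (?c + 2 * ennreal \<epsilon> * ?D)"
      by (simp add: algebra_simps)
    also have "\<dots> \<le> 4 * (2 * ?E0 + 4 * ?r1\<^sup>2 + 2 * (ennreal \<epsilon> * ?r2\<^sup>2)) + 2 * (?c + 2 * ennreal \<epsilon> * ?D)"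
      by (intro add_right_mono mult_left_mono eX) simp
    also have "4 * (2 * ?E0 + 4 * ?r1\<^sup>2 + 2 * (ennreal \<epsilon> * ?r2\<^sup>2)) = 8 * ?E0 + 16 * ?r1\<^sup>2 + 8 * (ennreal \<epsilon> * ?r2\<^sup>2)"
      by (simp add: distrib_left mult.assoc[symmetric])
    also have "\<dots> \<le> 8 * ?E0 + 32 * ?r1\<^sup>2 + 8 * (ennreal \<epsilon> * ?r2\<^sup>2)"
      by (intro add_mono mult_right_mono) auto
    also have "\<dots> = 8 * (?E0 + 4 * ?r1\<^sup>2 + ennreal \<epsilon> * ?r2\<^sup>2)"
      by (simp add: distrib_left mult.assoc[symmetric])
    finally show ?thesis by (simp only: add_right_mono)
  qed
qed

end
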